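(* Let $(\mathbf{P},m,\Delta)$ be a twisted bialgebra with a compatible contraction-extraction coproduct (in the sense of the context). Then $\mathcal{F}_\bullet[\mathbf{P}]$ is a functor from the category of commutative, not necessarily unitary, bialgebras to the category of double bialgebras: it sends $(V,\cdot,\delta_V)$ to the double bialgebra $(\mathcal{F}_V[\mathbf{P}],m,\Delta,\delta)$, and a bialgebra morphism $f:V\to W$ to the map $\overline{v_1\ldots v_n\otimes p}\mapsto\overline{f(v_1)\ldots f(v_n)\otimes p}$.
   Context: $\mathbb{K}$ is a field. A species $\mathbf{P}$ is a functor from the category of finite sets with bijections to $\mathbb{K}$-vector spaces, written $X\mapsto\mathbf{P}[X]$, $\sigma\mapsto\mathbf{P}[\sigma]$; $[n]=\{1,\ldots,n\}$ and $\mathbf{P}[n]=\mathbf{P}[\{1,\ldots,n\}]$. $\sqcup$ is disjoint union, $c$ is the flip, $m_{1,3,24}(a\otimes b\otimes a'\otimes b')=a\otimes a'\otimes m(b\otimes b')$. A not necessarily unitary bialgebra $(V,\cdot,\delta_V)$ is an associative algebra (possibly without unit) with a coassociative coproduct $\delta_V$ with counit $\epsilon_V$, both $\delta_V$ and $\epsilon_V$ being multiplicative; morphisms are linear maps compatible with products, coproducts and counits. Twisted algebra $(\mathbf{P},m)$: linear maps $m_{X,Y}:\mathbf{P}[X]\otimes\mathbf{P}[Y]\to\mathbf{P}[X\sqcup Y]$, natural in bijections, associative, with unit $1_{\mathbf{P}}\in\mathbf{P}[\emptyset]$. Twisted coalgebra $(\mathbf{P},\Delta)$: linear maps $\Delta_{X,Y}:\mathbf{P}[X\sqcup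 Y]\to\mathbf{P}[X]\otimes\mathbf{P}[Y]$, natural in bijections, with $(\Delta_{X,Y}\otimes\mathrm{Id})\circ\Delta_{X\sqcup Y,Z}=(\mathrm{Id}\otimes\Delta_{Y,Z})\circ\Delta_{X,Y\sqcup Z}$ and a counit $\varepsilon_\Delta:\mathbf{P}[\emptyset]\to\mathbb{K}$. Twisted bialgebra: both, such that whenever $I\sqcup J=I'\sqcup J'$, $\Delta_{I,J}\circ m_{I',J'}=(m_{I'\cap I,J'\cap I}\otimes m_{I'\cap J,J'\cap J})\circ(\mathrm{Id}\otimes c\otimes\mathrm{Id})\circ(\Delta_{I'\cap I,I'\cap J}\otimes\Delta_{J'\cap I,J'\cap J})$, $\Delta_{\emptyset,\emptyset}(1_{\mathbf{P}})=1_{\mathbf{P}}\otimes1_{\mathbf{P}}$, and $\varepsilon_\Delta$ is multiplicative and unital on $\mathbf{P}[\emptyset]$. Equivalences. $\mathcal{E}[X]$ is the set of equivalence relations on $X$, ordered by: $\sim\leq\sim'$ iff ($x\sim'y\Rightarrow x\sim y$). One identifies $\mathcal{E}[X/\sim']$ with $\{\sim\in\mathcal{E}[X]:\sim\leq\sim'\}$ and $(X/\sim')/\sim$ with $X/\sim$. For a bijection $\sigma:X\to Y$, $\sim_\sigma$ is the transported equivalence and $\sigma/\sim:X/\sim\to Y/\sim_\sigma$ the induced bijection. $\sim_X\sqcup\sim_Y$ is the equivalence on $X\sqcup Y$ whose classes are those of $\sim_X$ and those of $\sim_Y$. Contraction-extraction coproduct $\delta$ on $\mathbf{P}$: linear maps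 $\delta_\sim:\mathbf{P}[X]\to\mathbf{P}[X/\sim]\otimes\mathbf{P}[X]$ for every finite $X$ and $\sim\in\mathcal{E}[X]$, with: (i) $\delta_{\sim_\sigma}\circ\mathbf{P}[\sigma]=(\mathbf{P}[\sigma/\sim]\otimes\mathbf{P}[\sigma])\circ\delta_\sim$ for bijections $\sigma:X\to Y$; (ii) if $\sim\leq\sim'$, $(\delta_\sim\otimes\mathrm{Id})\circ\delta_{\sim'}=(\mathrm{Id}\otimes\delta_{\sim'})\circ\delta_\sim$ (on the left $\delta_\sim$ is applied to $\mathbf{P}[X/\sim']$), and if $\sim\leq\sim'$ fails, $(\mathrm{Id}\otimes\delta_{\sim'})\circ\delta_\sim=0$; (iii) there are linear maps $\epsilon_\delta[X]:\mathbf{P}[X]\to\mathbb{K}$, invariant under bijections, such that $(\mathrm{Id}\otimes\epsilon_\delta[X])\circ\delta_\sim$ is $\mathrm{Id}$ if $\sim$ is the equality and $0$ otherwise, and $\sum_{\sim\in\mathcal{E}[X]}(\epsilon_\delta[X/\sim]\otimes\mathrm{Id})\circ\delta_\sim=\mathrm{Id}_{\mathbf{P}[X]}$. It is compatible with $(m,\Delta)$ if for all finite $X,Y$ and $\sim\in\mathcal{E}[X\sqcup Y]$, with $\sim_X=\sim\cap X^2$, $\sim_Y=\sim\cap Y^2$: $\delta_\sim\circ m_{X,Y}$ equals $(m_{X/\sim_X,Y/\sim_Y}\otimes m_{X,Y})\circ(\mathrm{Id}\otimes c\otimes\mathrm{Id})\circ(\delta_{\sim_X}\otimes\delta_{\sim_Y})$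 if $\sim=\sim_X\sqcup\sim_Y$ and $0$ otherwise; $(\Delta_{X/\sim_X,Y/\sim_Y}\otimes\mathrm{Id})\circ\delta_\sim=m_{1,3,24}\circ(\delta_{\sim_X}\otimes\delta_{\sim_Y})\circ\Delta_{X,Y}$ if $\sim=\sim_X\sqcup\sim_Y$; and, $\sim_\emptyset$ being the equivalence on $\emptyset$, $\delta_{\sim_\emptyset}(1_{\mathbf{P}})=1_{\mathbf{P}}\otimes1_{\mathbf{P}}$ and $(\varepsilon_\Delta\otimes\mathrm{Id})\circ\delta_{\sim_\emptyset}(x)=\varepsilon_\Delta(x)1_{\mathbf{P}}$ for $x\in\mathbf{P}[\emptyset]$. The structure on $\mathcal{F}_V[\mathbf{P}]$: $\mathcal{F}_V[\mathbf{P}]=\bigoplus_{n\geq0}V^{\otimes n}\otimes_{\mathfrak{S}_n}\mathbf{P}[n]$, the quotient of $\bigoplus_nV^{\otimes n}\otimes\mathbf{P}[n]$ by the relations $v_1\ldots v_n\otimes\mathbf{P}[\sigma](p)=v_{\sigma(1)}\ldots v_{\sigma(n)}\otimes p$, $\sigma\in\mathfrak{S}_n$; classes are denoted by a bar and $v_1\ldots v_n$ means $v_1\otimes\cdots\otimes v_n$. Product: $\overline{v_1\ldots v_k\otimes p}\cdot\overline{v_{k+1}\ldots v_{k+l}\otimes q}=\overline{v_1\ldots v_{k+l}\otimes\mathbf{P}[\sigma_{k,l}]\circ m_{[k],[l]}(p\otimes q)}$, where $\sigma_{k,l}:[k]\sqcup[l]\to[k+l]$ is $i\in[k]\mapsto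 i$, $j\in[l]\mapsto k+j$. First coproduct: $\Delta(\overline{v_1\ldots v_n\otimes p})=\sum_{A\sqcup B=[n]}\overline{v_A\otimes\mathbf{P}[\sigma_A](p^{(1)})}\otimes\overline{v_B\otimes\mathbf{P}[\sigma_B](p^{(2)})}$, where $\Delta_{A,B}(p)=p^{(1)}\otimes p^{(2)}$, $\sigma_A:A\to[|A|]$ is the increasing bijection and $v_A$ is the tensor of the $v_i$, $i\in A$, in increasing order. Second coproduct: writing $\delta_\sim(p)=p^{(1)_\sim}\otimes p^{(2)_\sim}$, $\delta_V(v)=v'\otimes v''$, and choosing for each $\sim\in\mathcal{E}[[n]]$ a bijection $\sigma_\sim:[n]/\sim\to[k_\sim]$, $\delta(\overline{v_1\ldots v_n\otimes p})=\sum_{\sim\in\mathcal{E}[[n]]}\overline{w_1^\sim\ldots w_{k_\sim}^\sim\otimes\mathbf{P}[\sigma_\sim](p^{(1)_\sim})}\otimes\overline{v''_1\ldots v''_n\otimes p^{(2)_\sim}}$, with $w_j^\sim=\prod_{i\in\sigma_\sim^{-1}(j)}v'_i$ (product in $V$). Double bialgebra $(A,m,\Delta,\delta)$: $(A,m,\Delta)$ is a bialgebra with unit $1$ and counit $\varepsilon_\Delta$, $\delta:A\to A\otimes A$ is coassociative with a counit $\epsilon_\delta$, $\delta$ is a unital algebra morphism, and $(\Delta\otimes\mathrm{Id})\circ\delta=m_{1,3,24}\circ(\delta\otimes\delta)\circ\Delta$, $(\varepsilon_\Delta\otimes\mathrm{Id})\circ\delta(x)=\varepsilon_\Delta(x)1$.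 Morphisms of double bialgebras are linear maps compatible with products, units, both coproducts and both counits. *)

theory Defs
  imports "HOL-Algebra.Module" "HOL-Algebra.AbelCoset" "HOL-Library.Nat_Bijection" "HOL.Hull"
begin

section \<open>Vector spaces given by generators and relations, tensor products\<close>

text \<open>
  Vector spaces over a field \<open>K\<close> are the modules of \<^theory>\<open>HOL-Algebra.Module\<close>. The record type
  of modules extends that of rings; its fields for product and unit carry no
  meaning unless the space is explicitly treated as an algebra.
\<close>

definition linear_map :: "('k, 'r) ring_scheme \<Rightarrow> ('k, 'a, 'm) module_scheme \<Rightarrow>
    ('k, 'b, 'n) module_scheme \<Rightarrow> ('a \<Rightarrow> 'b) \<Rightarrow> bool" where
  "linear_map K M N f \<longleftrightarrow>
     f \<in> carrier M \<rightarrow> carrier N \<and>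
     (\<forall>x\<in>carrier M. \<forall>y\<in>carrier M. f (x \<oplus>\<^bsub>M\<^esub> y) = f x \<oplus>\<^bsub>N\<^esub> f y) \<and>
     (\<forall>c\<in>carrier K. \<forall>x\<in>carrier M. f (c \<odot>\<^bsub>M\<^esub> x) = c \<odot>\<^bsub>N\<^esub> f x)"

text \<open>The ground field, as a vector space over itself.\<close>

definition self_module :: "('k, 'r) ring_scheme \<Rightarrow> ('k, 'k) module" where
  "self_module K = \<lparr>carrier = carrier K, mult = mult K, one = \<one>\<^bsub>K\<^esub>, zero = \<zero>\<^bsub>K\<^esub>,
     add = add K, smult = mult K\<rparr>"

definition free_module :: "('k, 'r) ring_scheme \<Rightarrow> 'g set \<Rightarrow> ('k, 'g \<Rightarrow> 'k) module" where
  "free_module K G = \<lparr>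
     carrier = {x. x ` G \<subseteq> carrier K \<and> (\<forall>g. g \<notin> G \<longrightarrow> x g = \<zero>\<^bsub>K\<^esub>) \<and> finite {g. x g \<noteq> \<zero>\<^bsub>K\<^esub>}},
     mult = undefined, one = undefined,
     zero = (\<lambda>g. \<zero>\<^bsub>K\<^esub>),
     add = (\<lambda>x y g. x g \<oplus>\<^bsub>K\<^esub> y g),
     smult = (\<lambda>c x g. c \<otimes>\<^bsub>K\<^esub> x g)\<rparr>"

definition free_gen :: "('k, 'r) ring_scheme \<Rightarrow> 'g \<Rightarrow> 'g \<Rightarrow> 'k" where
  "free_gen K g = (\<lambda>h. if h = g then \<one>\<^bsub>K\<^esub> else \<zero>\<^bsub>K\<^esub>)"

text \<open>The quotient of \<open>M\<close> by a subspace \<open>N\<close>; its elements are the cosets of \<open>N\<close>.\<close>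

definition quotient_module :: "('k, 'a, 'm) module_scheme \<Rightarrow> 'a set \<Rightarrow> ('k, 'a set) module" where
  "quotient_module M N = \<lparr>carrier = a_rcosets\<^bsub>M\<^esub> N, mult = undefined, one = undefined,
     zero = N, add = set_add M, smult = (\<lambda>c C. \<Union>x\<in>C. N +>\<^bsub>M\<^esub> (c \<odot>\<^bsub>M\<^esub> x))\<rparr>"

definition relation_span :: "('k, 'r) ring_scheme \<Rightarrow> 'g set \<Rightarrow> ('g \<Rightarrow> 'k) set \<Rightarrow> ('g \<Rightarrow> 'k) set" where
  "relation_span K G R = (\<lambda>N. submodule N K (free_module K G)) hull R"

definition presented :: "('k, 'r) ring_scheme \<Rightarrow> 'g set \<Rightarrow> ('g \<Rightarrow> 'k) set \<Rightarrow>
    ('k, ('g \<Rightarrow> 'k) set) module" where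
  "presented K G R = quotient_module (free_module K G) (relation_span K G R)"

definition presented_gen :: "('k, 'r) ring_scheme \<Rightarrow> 'g set \<Rightarrow> ('g \<Rightarrow> 'k) set \<Rightarrow> 'g \<Rightarrow> ('g \<Rightarrow> 'k) set" where
  "presented_gen K G R g = relation_span K G R +>\<^bsub>free_module K G\<^esub> free_gen K g"

text \<open>
  The linear map from a presented space to \<open>U\<close> sending the class of a generator \<open>g\<close> to \<open>\<beta> g\<close>,
  computed on an element (a coset) from its representatives. It is meaningful when \<open>\<beta>\<close> respects
  the relations: all representatives then yield the same vector.
\<close>

definition lift :: "('k, 'r) ring_scheme \<Rightarrow> ('k, 'u, 'm) module_scheme \<Rightarrow> ('g \<Rightarrow> 'u) \<Rightarrow>
    ('g \<Rightarrow> 'k) set \<Rightarrow> 'u" where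
  "lift K U \<beta> C =
     the_elem ((\<lambda>x. finsum U (\<lambda>g. x g \<odot>\<^bsub>U\<^esub> \<beta> g) {g. x g \<noteq> \<zero>\<^bsub>K\<^esub>}) ` C)"

type_synonym ('k, 'a, 'b) tensor = "('a \<times> 'b \<Rightarrow> 'k) set"

definition tensor_rels :: "('k, 'r) ring_scheme \<Rightarrow> ('k, 'a, 'm) module_scheme \<Rightarrow>
    ('k, 'b, 'n) module_scheme \<Rightarrow> ('a \<times> 'b \<Rightarrow> 'k) set" where
  "tensor_rels K A B = (let F = free_module K (carrier A \<times> carrier B); e = free_gen K in
     {e (a \<oplus>\<^bsub>A\<^esub> a', b) \<ominus>\<^bsub>F\<^esub> (e (a, b) \<oplus>\<^bsub>F\<^esub> e (a', b)) | a a' b.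
        a \<in> carrier A \<and> a' \<in> carrier A \<and> b \<in> carrier B} \<union>
     {e (a, b \<oplus>\<^bsub>B\<^esub> b') \<ominus>\<^bsub>F\<^esub> (e (a, b) \<oplus>\<^bsub>F\<^esub> e (a, b')) | a b b'.
        a \<in> carrier A \<and> b \<in> carrier B \<and> b' \<in> carrier B} \<union>
     {e (c \<odot>\<^bsub>A\<^esub> a, b) \<ominus>\<^bsub>F\<^esub> (c \<odot>\<^bsub>F\<^esub> e (a, b)) | c a b.
        c \<in> carrier K \<and> a \<in> carrier A \<and> b \<in> carrier B} \<union>
     {e (a, c \<odot>\<^bsub>B\<^esub> b) \<ominus>\<^bsub>F\<^esub> (c \<odot>\<^bsub>F\<^esub> e (a, b)) | c a b.
        c \<in> carrier K \<and> a \<in> carrier A \<and> b \<in> carrier B})"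

definition tensor_space :: "('k, 'r) ring_scheme \<Rightarrow> ('k, 'a, 'm) module_scheme \<Rightarrow>
    ('k, 'b, 'n) module_scheme \<Rightarrow> ('k, ('k, 'a, 'b) tensor) module" where
  "tensor_space K A B = presented K (carrier A \<times> carrier B) (tensor_rels K A B)"

text \<open>The pure tensor \<open>a \<otimes> b\<close> in the tensor product of \<open>A\<close> and \<open>B\<close>.\<close>

definition tens :: "('k, 'r) ring_scheme \<Rightarrow> ('k, 'a, 'm) module_scheme \<Rightarrow>
    ('k, 'b, 'n) module_scheme \<Rightarrow> 'a \<Rightarrow> 'b \<Rightarrow> ('k, 'a, 'b) tensor" where
  "tens K A B a b = presented_gen K (carrier A \<times> carrier B) (tensor_rels K A B) (a, b)"

text \<open>
  The tensor product, equipped with the product \<open>(a \<otimes> b) (c \<otimes> d) = ac \<otimes> bd\<close> and unit \<open>1 \<otimes> 1\<close>.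
  These two fields are only used when \<open>A\<close> and \<open>B\<close> are (unital) algebras.
\<close>

definition tensor :: "('k, 'r) ring_scheme \<Rightarrow> ('k, 'a, 'm) module_scheme \<Rightarrow>
    ('k, 'b, 'n) module_scheme \<Rightarrow> ('k, ('k, 'a, 'b) tensor) module" where
  "tensor K A B = (tensor_space K A B)\<lparr>
     mult := (\<lambda>s t. lift K (tensor_space K A B) (\<lambda>(a, b).
               lift K (tensor_space K A B) (\<lambda>(c, d). tens K A B (a \<otimes>\<^bsub>A\<^esub> c) (b \<otimes>\<^bsub>B\<^esub> d)) t) s),
     one := tens K A B \<one>\<^bsub>A\<^esub> \<one>\<^bsub>B\<^esub>\<rparr>"

text \<open>The map \<open>f \<otimes> g\<close>, for linear maps \<open>f\<close> into \<open>A\<close> and \<open>g\<close> into \<open>B\<close>.\<close>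

definition tmap :: "('k, 'r) ring_scheme \<Rightarrow> ('k, 'a, 'm) module_scheme \<Rightarrow>
    ('k, 'b, 'n) module_scheme \<Rightarrow> ('c \<Rightarrow> 'a) \<Rightarrow> ('d \<Rightarrow> 'b) \<Rightarrow>
    ('k, 'c, 'd) tensor \<Rightarrow> ('k, 'a, 'b) tensor" where
  "tmap K A B f g = lift K (tensor K A B) (\<lambda>(c, d). tens K A B (f c) (g d))"

text \<open>The identification \<open>(A \<otimes> B) \<otimes> C \<rightarrow> A \<otimes> (B \<otimes> C)\<close>.\<close>

definition tassoc :: "('k, 'r) ring_scheme \<Rightarrow> ('k, 'a, 'm) module_scheme \<Rightarrow>
    ('k, 'b, 'n) module_scheme \<Rightarrow> ('k, 'c, 'q) module_scheme \<Rightarrow>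
    ('k, ('k, 'a, 'b) tensor, 'c) tensor \<Rightarrow> ('k, 'a, ('k, 'b, 'c) tensor) tensor" where
  "tassoc K A B C = (let T = tensor K A (tensor K B C) in
     lift K T (\<lambda>(s, c). lift K T (\<lambda>(a, b). tens K A (tensor K B C) a (tens K B C b c)) s))"

text \<open>The map \<open>Id \<otimes> c \<otimes> Id\<close>, from \<open>(A \<otimes> B) \<otimes> (C \<otimes> D)\<close> to \<open>(A \<otimes> C) \<otimes> (B \<otimes> D)\<close>.\<close>

definition tswap :: "('k, 'r) ring_scheme \<Rightarrow> ('k, 'a, 'm) module_scheme \<Rightarrow>
    ('k, 'b, 'n) module_scheme \<Rightarrow> ('k, 'c, 'q) module_scheme \<Rightarrow> ('k, 'd, 's) module_scheme \<Rightarrow>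
    ('k, ('k, 'a, 'b) tensor, ('k, 'c, 'd) tensor) tensor \<Rightarrow>
    ('k, ('k, 'a, 'c) tensor, ('k, 'b, 'd) tensor) tensor" where
  "tswap K A B C D = (let T = tensor K (tensor K A C) (tensor K B D) in
     lift K T (\<lambda>(s, t). lift K T (\<lambda>(a, b). lift K T (\<lambda>(c, d).
       tens K (tensor K A C) (tensor K B D) (tens K A C a c) (tens K B D b d)) t) s))"

text \<open>The map \<open>m\<^sub>1\<^sub>,\<^sub>3\<^sub>,\<^sub>2\<^sub>4\<close>, from \<open>(A \<otimes> B) \<otimes> (C \<otimes> D)\<close> to \<open>(A \<otimes> C) \<otimes> E\<close>, where \<open>m\<close> goes from \<open>B \<otimes> D\<close> to \<open>E\<close>.\<close>

definition m1324 :: "('k, 'r) ring_scheme \<Rightarrow> ('k, 'a, 'm) module_scheme \<Rightarrow>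
    ('k, 'b, 'n) module_scheme \<Rightarrow> ('k, 'c, 'q) module_scheme \<Rightarrow> ('k, 'd, 's) module_scheme \<Rightarrow>
    ('k, 'e, 't) module_scheme \<Rightarrow> (('k, 'b, 'd) tensor \<Rightarrow> 'e) \<Rightarrow>
    ('k, ('k, 'a, 'b) tensor, ('k, 'c, 'd) tensor) tensor \<Rightarrow>
    ('k, ('k, 'a, 'c) tensor, 'e) tensor" where
  "m1324 K A B C D E m z = tmap K (tensor K A C) E id m (tswap K A B C D z)"

text \<open>The maps \<open>\<epsilon> \<otimes> Id\<close> and \<open>Id \<otimes> \<epsilon>\<close>, followed by the identification of \<open>K \<otimes> M\<close> and \<open>M \<otimes> K\<close> with \<open>M\<close>.\<close>

definition eval_left :: "('k, 'r) ring_scheme \<Rightarrow> ('k, 'b, 'm) module_scheme \<Rightarrow> ('a \<Rightarrow> 'k) \<Rightarrow>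
    ('k, 'a, 'b) tensor \<Rightarrow> 'b" where
  "eval_left K M \<epsilon> = lift K M (\<lambda>(a, b). \<epsilon> a \<odot>\<^bsub>M\<^esub> b)"

definition eval_right :: "('k, 'r) ring_scheme \<Rightarrow> ('k, 'a, 'm) module_scheme \<Rightarrow> ('b \<Rightarrow> 'k) \<Rightarrow>
    ('k, 'a, 'b) tensor \<Rightarrow> 'a" where
  "eval_right K M \<epsilon> = lift K M (\<lambda>(a, b). \<epsilon> b \<odot>\<^bsub>M\<^esub> a)"


section \<open>Bialgebras and double bialgebras\<close>

definition nonunital_algebra :: "('k, 'r) ring_scheme \<Rightarrow> ('k, 'a, 'm) module_scheme \<Rightarrow> bool" where
  "nonunital_algebra K A \<longleftrightarrow>
     module K A \<and>
     (\<forall>x\<in>carrier A. linear_map K A A (\<lambda>y. x \<otimes>\<^bsub>A\<^esub> y)) \<and>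
     (\<forall>y\<in>carrier A. linear_map K A A (\<lambda>x. x \<otimes>\<^bsub>A\<^esub> y)) \<and>
     (\<forall>x\<in>carrier A. \<forall>y\<in>carrier A. \<forall>z\<in>carrier A. (x \<otimes>\<^bsub>A\<^esub> y) \<otimes>\<^bsub>A\<^esub> z = x \<otimes>\<^bsub>A\<^esub> (y \<otimes>\<^bsub>A\<^esub> z))"

definition coalgebra :: "('k, 'r) ring_scheme \<Rightarrow> ('k, 'a, 'm) module_scheme \<Rightarrow>
    ('a \<Rightarrow> ('k, 'a, 'a) tensor) \<Rightarrow> ('a \<Rightarrow> 'k) \<Rightarrow> bool" where
  "coalgebra K C \<Delta> \<epsilon> \<longleftrightarrow>
     module K C \<and> linear_map K C (tensor K C C) \<Delta> \<and> linear_map K C (self_module K) \<epsilon> \<and>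
     (\<forall>x\<in>carrier C. tassoc K C C C (tmap K (tensor K C C) C \<Delta> id (\<Delta> x)) =
                    tmap K C (tensor K C C) id \<Delta> (\<Delta> x)) \<and>
     (\<forall>x\<in>carrier C. eval_left K C \<epsilon> (\<Delta> x) = x \<and> eval_right K C \<epsilon> (\<Delta> x) = x)"

record ('k, 'a) bialgebra = "('k, 'a) module" +
  comult :: "'a \<Rightarrow> ('k, 'a, 'a) tensor"
  counit :: "'a \<Rightarrow> 'k"

record ('k, 'a) double_bialgebra = "('k, 'a) bialgebra" +
  comult2 :: "'a \<Rightarrow> ('k, 'a, 'a) tensor"
  counit2 :: "'a \<Rightarrow> 'k"

definition nonunital_bialgebra :: "('k, 'r) ring_scheme \<Rightarrow> ('k, 'a, 'm) bialgebra_scheme \<Rightarrow> bool" where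
  "nonunital_bialgebra K V \<longleftrightarrow>
     nonunital_algebra K V \<and> coalgebra K V (comult V) (counit V) \<and>
     (\<forall>x\<in>carrier V. \<forall>y\<in>carrier V.
        comult V (x \<otimes>\<^bsub>V\<^esub> y) = comult V x \<otimes>\<^bsub>tensor K V V\<^esub> comult V y \<and>
        counit V (x \<otimes>\<^bsub>V\<^esub> y) = counit V x \<otimes>\<^bsub>K\<^esub> counit V y)"

definition comm_nonunital_bialgebra ::
    "('k, 'r) ring_scheme \<Rightarrow> ('k, 'a, 'm) bialgebra_scheme \<Rightarrow> bool" where
  "comm_nonunital_bialgebra K V \<longleftrightarrow>
     nonunital_bialgebra K V \<and> (\<forall>x\<in>carrier V. \<forall>y\<in>carrier V. x \<otimes>\<^bsub>V\<^esub> y = y \<otimes>\<^bsub>V\<^esub> x)"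

definition nonunital_bialgebra_hom :: "('k, 'r) ring_scheme \<Rightarrow> ('k, 'a, 'm) bialgebra_scheme \<Rightarrow>
    ('k, 'b, 'n) bialgebra_scheme \<Rightarrow> ('a \<Rightarrow> 'b) \<Rightarrow> bool" where
  "nonunital_bialgebra_hom K V W f \<longleftrightarrow>
     linear_map K V W f \<and>
     (\<forall>x\<in>carrier V. \<forall>y\<in>carrier V. f (x \<otimes>\<^bsub>V\<^esub> y) = f x \<otimes>\<^bsub>W\<^esub> f y) \<and>
     (\<forall>x\<in>carrier V. comult W (f x) = tmap K W W f f (comult V x)) \<and>
     (\<forall>x\<in>carrier V. counit W (f x) = counit V x)"

definition unital_bialgebra :: "('k, 'r) ring_scheme \<Rightarrow> ('k, 'a, 'm) bialgebra_scheme \<Rightarrow> bool" where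
  "unital_bialgebra K A \<longleftrightarrow>
     nonunital_bialgebra K A \<and> monoid A \<and>
     comult A \<one>\<^bsub>A\<^esub> = \<one>\<^bsub>tensor K A A\<^esub> \<and> counit A \<one>\<^bsub>A\<^esub> = \<one>\<^bsub>K\<^esub>"

text \<open>
  Note that multiplicativity of the second counit is not among the axioms of a double bialgebra.
\<close>

definition is_double_bialgebra ::
    "('k, 'r) ring_scheme \<Rightarrow> ('k, 'a, 'm) double_bialgebra_scheme \<Rightarrow> bool" where
  "is_double_bialgebra K A \<longleftrightarrow>
     unital_bialgebra K A \<and>
     coalgebra K A (comult2 A) (counit2 A) \<and>
     (\<forall>x\<in>carrier A. \<forall>y\<in>carrier A.
        comult2 A (x \<otimes>\<^bsub>A\<^esub> y) = comult2 A x \<otimes>\<^bsub>tensor K A A\<^esub> comult2 A y) \<and>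
     comult2 A \<one>\<^bsub>A\<^esub> = \<one>\<^bsub>tensor K A A\<^esub> \<and>
     (\<forall>x\<in>carrier A.
        tmap K (tensor K A A) A (comult A) id (comult2 A x) =
        m1324 K A A A A A (lift K A (\<lambda>(a, b). a \<otimes>\<^bsub>A\<^esub> b))
          (tmap K (tensor K A A) (tensor K A A) (comult2 A) (comult2 A) (comult A x)) \<and>
        eval_left K A (counit A) (comult2 A x) = counit A x \<odot>\<^bsub>A\<^esub> \<one>\<^bsub>A\<^esub>)"

definition double_bialgebra_hom :: "('k, 'r) ring_scheme \<Rightarrow> ('k, 'a, 'm) double_bialgebra_scheme \<Rightarrow>
    ('k, 'b, 'n) double_bialgebra_scheme \<Rightarrow> ('a \<Rightarrow> 'b) \<Rightarrow> bool" where
  "double_bialgebra_hom K A B f \<longleftrightarrow>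
     linear_map K A B f \<and>
     (\<forall>x\<in>carrier A. \<forall>y\<in>carrier A. f (x \<otimes>\<^bsub>A\<^esub> y) = f x \<otimes>\<^bsub>B\<^esub> f y) \<and>
     f \<one>\<^bsub>A\<^esub> = \<one>\<^bsub>B\<^esub> \<and>
     (\<forall>x\<in>carrier A.
        comult B (f x) = tmap K B B f f (comult A x) \<and> counit B (f x) = counit A x \<and>
        comult2 B (f x) = tmap K B B f f (comult2 A x) \<and> counit2 B (f x) = counit2 A x)"


section \<open>Equivalences and quotients of finite sets\<close>

text \<open>
  Finite sets are represented by the finite subsets of \<open>\<nat>\<close>. To stay within this universe, a finite
  set of numbers (such as a class of an equivalence) is coded by a number via \<^const>\<open>set_encode\<close>,
  which is a bijection from the finite sets of numbers to \<open>\<nat>\<close> with inverse \<^const>\<open>set_decode\<close>.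
\<close>

definition equivs :: "nat set \<Rightarrow> (nat \<times> nat) set set" where
  "equivs X = {r. equiv X r}"

definition quo :: "nat set \<Rightarrow> (nat \<times> nat) set \<Rightarrow> nat set" where
  "quo X r = set_encode ` (X // r)"

text \<open>The transported equivalence, and the induced bijection between the quotients.\<close>

definition transport :: "(nat \<Rightarrow> nat) \<Rightarrow> (nat \<times> nat) set \<Rightarrow> (nat \<times> nat) set" where
  "transport \<sigma> r = map_prod \<sigma> \<sigma> ` r"

definition quo_map :: "(nat \<Rightarrow> nat) \<Rightarrow> nat \<Rightarrow> nat" where
  "quo_map \<sigma> c = set_encode (\<sigma> ` set_decode c)"

text \<open>For \<open>r' \<subseteq> r\<close>, the equivalence on the quotient by \<open>r'\<close> which is identified with \<open>r\<close>, and the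
  identification of the iterated quotient with the quotient by \<open>r\<close> (a class of classes is sent
  to its union).\<close>

definition quo_equiv :: "(nat \<times> nat) set \<Rightarrow> (nat \<times> nat) set \<Rightarrow> (nat \<times> nat) set" where
  "quo_equiv r r' = transport (\<lambda>x. set_encode (r' `` {x})) r"

definition flatten :: "nat \<Rightarrow> nat" where
  "flatten c = set_encode (\<Union>b\<in>set_decode c. set_decode b)"


section \<open>Species, twisted bialgebras, contraction-extraction coproducts\<close>

text \<open>
  \<open>obj P X\<close> is the space \<open>P[X]\<close>; for \<open>\<sigma>\<close> injective on \<open>X\<close>, \<open>arr P X \<sigma>\<close> is \<open>P[\<sigma>]\<close> for the bijection
  from \<open>X\<close> to \<open>\<sigma> ` X\<close> given by \<open>\<sigma>\<close>.
\<close>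

record ('k, 'p) species =
  obj :: "nat set \<Rightarrow> ('k, 'p) module"
  arr :: "nat set \<Rightarrow> (nat \<Rightarrow> nat) \<Rightarrow> 'p \<Rightarrow> 'p"

record ('k, 'p) twisted = "('k, 'p) species" +
  tw_mult :: "nat set \<Rightarrow> nat set \<Rightarrow> ('k, 'p, 'p) tensor \<Rightarrow> 'p"
  tw_one :: 'p
  tw_comult :: "nat set \<Rightarrow> nat set \<Rightarrow> 'p \<Rightarrow> ('k, 'p, 'p) tensor"
  tw_counit :: "'p \<Rightarrow> 'k"

record ('k, 'p) double_twisted = "('k, 'p) twisted" +
  contr :: "nat set \<Rightarrow> (nat \<times> nat) set \<Rightarrow> 'p \<Rightarrow> ('k, 'p, 'p) tensor"
  contr_counit :: "nat set \<Rightarrow> 'p \<Rightarrow> 'k"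

definition is_species :: "('k, 'r) ring_scheme \<Rightarrow> ('k, 'p, 'z) species_scheme \<Rightarrow> bool" where
  "is_species K P \<longleftrightarrow>
     (\<forall>X. finite X \<longrightarrow> module K (obj P X)) \<and>
     (\<forall>X \<sigma>. finite X \<and> inj_on \<sigma> X \<longrightarrow> linear_map K (obj P X) (obj P (\<sigma> ` X)) (arr P X \<sigma>)) \<and>
     (\<forall>X \<sigma> \<tau>. finite X \<and> inj_on \<sigma> X \<and> (\<forall>x\<in>X. \<sigma> x = \<tau> x) \<longrightarrow>
        (\<forall>p\<in>carrier (obj P X). arr P X \<sigma> p = arr P X \<tau> p)) \<and>
     (\<forall>X. finite X \<longrightarrow> (\<forall>p\<in>carrier (obj P X). arr P X id p = p)) \<and>
     (\<forall>X \<sigma> \<tau>. finite X \<and> inj_on \<sigma> X \<and> inj_on \<tau> (\<sigma> ` X) \<longrightarrow>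
        (\<forall>p\<in>carrier (obj P X). arr P X (\<tau> \<circ> \<sigma>) p = arr P (\<sigma> ` X) \<tau> (arr P X \<sigma> p)))"

text \<open>
  Disjoint unions are internal: \<open>X \<squnion> Y\<close> is \<open>X \<union> Y\<close> for disjoint \<open>X\<close> and \<open>Y\<close>. A bijection
  \<open>\<sigma> \<squnion> \<tau>\<close> between disjoint unions is a single function injective on \<open>X \<union> Y\<close>.
\<close>

definition twisted_algebra :: "('k, 'r) ring_scheme \<Rightarrow> ('k, 'p, 'z) twisted_scheme \<Rightarrow> bool" where
  "twisted_algebra K P \<longleftrightarrow>
     is_species K P \<and>
     (\<forall>X Y. finite X \<and> finite Y \<and> X \<inter> Y = {} \<longrightarrow>
        linear_map K (tensor K (obj P X) (obj P Y)) (obj P (X \<union> Y)) (tw_mult P X Y)) \<and>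
     (\<forall>X Y \<sigma>. finite X \<and> finite Y \<and> X \<inter> Y = {} \<and> inj_on \<sigma> (X \<union> Y) \<longrightarrow>
        (\<forall>t\<in>carrier (tensor K (obj P X) (obj P Y)).
           arr P (X \<union> Y) \<sigma> (tw_mult P X Y t) =
           tw_mult P (\<sigma> ` X) (\<sigma> ` Y)
             (tmap K (obj P (\<sigma> ` X)) (obj P (\<sigma> ` Y)) (arr P X \<sigma>) (arr P Y \<sigma>) t))) \<and>
     (\<forall>X Y Z. finite X \<and> finite Y \<and> finite Z \<and> X \<inter> Y = {} \<and> X \<inter> Z = {} \<and> Y \<inter> Z = {} \<longrightarrow>
        (\<forall>t\<in>carrier (tensor K (tensor K (obj P X) (obj P Y)) (obj P Z)).
           tw_mult P (X \<union> Y) Z (tmap K (obj P (X \<union> Y)) (obj P Z) (tw_mult P X Y) id t) =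
           tw_mult P X (Y \<union> Z) (tmap K (obj P X) (obj P (Y \<union> Z)) id (tw_mult P Y Z)
             (tassoc K (obj P X) (obj P Y) (obj P Z) t)))) \<and>
     tw_one P \<in> carrier (obj P {}) \<and>
     (\<forall>X. finite X \<longrightarrow> (\<forall>p\<in>carrier (obj P X).
        tw_mult P {} X (tens K (obj P {}) (obj P X) (tw_one P) p) = p \<and>
        tw_mult P X {} (tens K (obj P X) (obj P {}) p (tw_one P)) = p))"

definition twisted_coalgebra :: "('k, 'r) ring_scheme \<Rightarrow> ('k, 'p, 'z) twisted_scheme \<Rightarrow> bool" where
  "twisted_coalgebra K P \<longleftrightarrow>
     is_species K P \<and>
     (\<forall>X Y. finite X \<and> finite Y \<and> X \<inter> Y = {} \<longrightarrow>
        linear_map K (obj P (X \<union> Y)) (tensor K (obj P X) (obj P Y)) (tw_comult P X Y)) \<and>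
     (\<forall>X Y \<sigma>. finite X \<and> finite Y \<and> X \<inter> Y = {} \<and> inj_on \<sigma> (X \<union> Y) \<longrightarrow>
        (\<forall>p\<in>carrier (obj P (X \<union> Y)).
           tw_comult P (\<sigma> ` X) (\<sigma> ` Y) (arr P (X \<union> Y) \<sigma> p) =
           tmap K (obj P (\<sigma> ` X)) (obj P (\<sigma> ` Y)) (arr P X \<sigma>) (arr P Y \<sigma>) (tw_comult P X Y p))) \<and>
     (\<forall>X Y Z. finite X \<and> finite Y \<and> finite Z \<and> X \<inter> Y = {} \<and> X \<inter> Z = {} \<and> Y \<inter> Z = {} \<longrightarrow>
        (\<forall>p\<in>carrier (obj P (X \<union> Y \<union> Z)).
           tassoc K (obj P X) (obj P Y) (obj P Z)
             (tmap K (tensor K (obj P X) (obj P Y)) (obj P Z) (tw_comult P X Y) id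
               (tw_comult P (X \<union> Y) Z p)) =
           tmap K (obj P X) (tensor K (obj P Y) (obj P Z)) id (tw_comult P Y Z)
             (tw_comult P X (Y \<union> Z) p))) \<and>
     linear_map K (obj P {}) (self_module K) (tw_counit P) \<and>
     (\<forall>X. finite X \<longrightarrow> (\<forall>p\<in>carrier (obj P X).
        eval_left K (obj P X) (tw_counit P) (tw_comult P {} X p) = p \<and>
        eval_right K (obj P X) (tw_counit P) (tw_comult P X {} p) = p))"

definition twisted_bialgebra :: "('k, 'r) ring_scheme \<Rightarrow> ('k, 'p, 'z) twisted_scheme \<Rightarrow> bool" where
  "twisted_bialgebra K P \<longleftrightarrow>
     twisted_algebra K P \<and> twisted_coalgebra K P \<and>
     (\<forall>I J I' J'. finite I \<and> finite J \<and> finite I' \<and> finite J' \<and>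
        I \<inter> J = {} \<and> I' \<inter> J' = {} \<and> I \<union> J = I' \<union> J' \<longrightarrow>
        (\<forall>t\<in>carrier (tensor K (obj P I') (obj P J')).
           tw_comult P I J (tw_mult P I' J' t) =
           tmap K (obj P I) (obj P J)
             (tw_mult P (I' \<inter> I) (J' \<inter> I)) (tw_mult P (I' \<inter> J) (J' \<inter> J))
             (tswap K (obj P (I' \<inter> I)) (obj P (I' \<inter> J)) (obj P (J' \<inter> I)) (obj P (J' \<inter> J))
               (tmap K (tensor K (obj P (I' \<inter> I)) (obj P (I' \<inter> J)))
                  (tensor K (obj P (J' \<inter> I)) (obj P (J' \<inter> J)))
                  (tw_comult P (I' \<inter> I) (I' \<inter> J)) (tw_comult P (J' \<inter> I) (J' \<inter> J)) t)))) \<and>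
     tw_comult P {} {} (tw_one P) = tens K (obj P {}) (obj P {}) (tw_one P) (tw_one P) \<and>
     (\<forall>p\<in>carrier (obj P {}). \<forall>q\<in>carrier (obj P {}).
        tw_counit P (tw_mult P {} {} (tens K (obj P {}) (obj P {}) p q)) =
        tw_counit P p \<otimes>\<^bsub>K\<^esub> tw_counit P q) \<and>
     tw_counit P (tw_one P) = \<one>\<^bsub>K\<^esub>"

text \<open>
  In the order on equivalences, \<open>r \<le> r'\<close> means \<open>r' \<subseteq> r\<close>. The equality on \<open>X\<close> is \<open>Id_on X\<close>,
  and the quotient by it is identified with \<open>X\<close> via singletons.
\<close>

definition contraction_coproduct ::
    "('k, 'r) ring_scheme \<Rightarrow> ('k, 'p, 'z) double_twisted_scheme \<Rightarrow> bool" where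
  "contraction_coproduct K P \<longleftrightarrow>
     (\<forall>X. finite X \<longrightarrow> (\<forall>r\<in>equivs X.
        linear_map K (obj P X) (tensor K (obj P (quo X r)) (obj P X)) (contr P X r))) \<and>
     (\<forall>X \<sigma>. finite X \<and> inj_on \<sigma> X \<longrightarrow> (\<forall>r\<in>equivs X. \<forall>p\<in>carrier (obj P X).
        contr P (\<sigma> ` X) (transport \<sigma> r) (arr P X \<sigma> p) =
        tmap K (obj P (quo (\<sigma> ` X) (transport \<sigma> r))) (obj P (\<sigma> ` X))
          (arr P (quo X r) (quo_map \<sigma>)) (arr P X \<sigma>) (contr P X r p))) \<and>
     (\<forall>X. finite X \<longrightarrow> (\<forall>r\<in>equivs X. \<forall>r'\<in>equivs X. \<forall>p\<in>carrier (obj P X).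
        tmap K (obj P (quo X r)) (tensor K (obj P (quo X r')) (obj P X)) id (contr P X r')
          (contr P X r p) =
        (if r' \<subseteq> r then
           tassoc K (obj P (quo X r)) (obj P (quo X r')) (obj P X)
             (tmap K (tensor K (obj P (quo X r)) (obj P (quo X r'))) (obj P X)
               (\<lambda>q. tmap K (obj P (quo X r)) (obj P (quo X r'))
                      (arr P (quo (quo X r') (quo_equiv r r')) flatten) id
                      (contr P (quo X r') (quo_equiv r r') q))
               id (contr P X r' p))
         else \<zero>\<^bsub>tensor K (obj P (quo X r)) (tensor K (obj P (quo X r')) (obj P X))\<^esub>))) \<and>
     (\<forall>X. finite X \<longrightarrow> linear_map K (obj P X) (self_module K) (contr_counit P X)) \<and>
     (\<forall>X \<sigma>. finite X \<and> inj_on \<sigma> X \<longrightarrow> (\<forall>p\<in>carrier (obj P X).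
        contr_counit P (\<sigma> ` X) (arr P X \<sigma> p) = contr_counit P X p)) \<and>
     (\<forall>X. finite X \<longrightarrow> (\<forall>r\<in>equivs X. \<forall>p\<in>carrier (obj P X).
        eval_right K (obj P (quo X r)) (contr_counit P X) (contr P X r p) =
        (if r = Id_on X then arr P X (\<lambda>x. set_encode {x}) p else \<zero>\<^bsub>obj P (quo X r)\<^esub>))) \<and>
     (\<forall>X. finite X \<longrightarrow> (\<forall>p\<in>carrier (obj P X).
        finsum (obj P X)
          (\<lambda>r. eval_left K (obj P X) (contr_counit P (quo X r)) (contr P X r p)) (equivs X) = p))"

definition contraction_compatible ::
    "('k, 'r) ring_scheme \<Rightarrow> ('k, 'p, 'z) double_twisted_scheme \<Rightarrow> bool" where
  "contraction_compatible K P \<longleftrightarrow>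
     (\<forall>X Y. finite X \<and> finite Y \<and> X \<inter> Y = {} \<longrightarrow> (\<forall>r\<in>equivs (X \<union> Y).
        let rX = r \<inter> X \<times> X; rY = r \<inter> Y \<times> Y in
        (\<forall>t\<in>carrier (tensor K (obj P X) (obj P Y)).
           contr P (X \<union> Y) r (tw_mult P X Y t) =
           (if r = rX \<union> rY then
              tmap K (obj P (quo (X \<union> Y) r)) (obj P (X \<union> Y))
                (tw_mult P (quo X rX) (quo Y rY)) (tw_mult P X Y)
                (tswap K (obj P (quo X rX)) (obj P X) (obj P (quo Y rY)) (obj P Y)
                  (tmap K (tensor K (obj P (quo X rX)) (obj P X)) (tensor K (obj P (quo Y rY)) (obj P Y))
                    (contr P X rX) (contr P Y rY) t))
            else \<zero>\<^bsub>tensor K (obj P (quo (X \<union> Y) r)) (obj P (X \<union> Y))\<^esub>)) \<and>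
        (r = rX \<union> rY \<longrightarrow> (\<forall>p\<in>carrier (obj P (X \<union> Y)).
           tmap K (tensor K (obj P (quo X rX)) (obj P (quo Y rY))) (obj P (X \<union> Y))
             (tw_comult P (quo X rX) (quo Y rY)) id (contr P (X \<union> Y) r p) =
           m1324 K (obj P (quo X rX)) (obj P X) (obj P (quo Y rY)) (obj P Y) (obj P (X \<union> Y))
             (tw_mult P X Y)
             (tmap K (tensor K (obj P (quo X rX)) (obj P X)) (tensor K (obj P (quo Y rY)) (obj P Y))
               (contr P X rX) (contr P Y rY) (tw_comult P X Y p)))))) \<and>
     contr P {} {} (tw_one P) = tens K (obj P {}) (obj P {}) (tw_one P) (tw_one P) \<and>
     (\<forall>p\<in>carrier (obj P {}).
        eval_left K (obj P {}) (tw_counit P) (contr P {} {} p) =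
        tw_counit P p \<odot>\<^bsub>obj P {}\<^esub> tw_one P)"


section \<open>The coloured Fock functor\<close>

text \<open>
  The space \<open>\<Oplus>\<^sub>n V\<^sup>\<otimes>\<^sup>n \<otimes>\<^bsub>S\<^sub>n\<^esub> P[n]\<close>, by generators and relations: a generator \<open>(vs, p)\<close>
  stands for \<open>v\<^sub>1 \<dots> v\<^sub>n \<otimes> p\<close> with \<open>vs = [v\<^sub>1, \<dots>, v\<^sub>n]\<close>. The first four families of relations
  (multilinearity) present \<open>\<Oplus>\<^sub>n V\<^sup>\<otimes>\<^sup>n \<otimes> P[n]\<close>, the fifth identifies \<open>v\<^sub>1 \<dots> v\<^sub>n \<otimes> P[\<sigma>](p)\<close> with
  \<open>v\<^bsub>\<sigma>(1)\<^esub> \<dots> v\<^bsub>\<sigma>(n)\<^esub> \<otimes> p\<close>. Positions in a list are numbered from \<open>0\<close>, elements of \<open>[n]\<close> from \<open>1\<close>.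
\<close>

definition fock_gens :: "('k, 'p, 'z) species_scheme \<Rightarrow> ('k, 'v, 'm) module_scheme \<Rightarrow>
    ('v list \<times> 'p) set" where
  "fock_gens P V = {(vs, p). set vs \<subseteq> carrier V \<and> p \<in> carrier (obj P {1..length vs})}"

definition fock_rels :: "('k, 'r) ring_scheme \<Rightarrow> ('k, 'p, 'z) species_scheme \<Rightarrow>
    ('k, 'v, 'm) module_scheme \<Rightarrow> ('v list \<times> 'p \<Rightarrow> 'k) set" where
  "fock_rels K P V = (let F = free_module K (fock_gens P V); e = free_gen K in
     {e (vs[i := v \<oplus>\<^bsub>V\<^esub> w], p) \<ominus>\<^bsub>F\<^esub> (e (vs[i := v], p) \<oplus>\<^bsub>F\<^esub> e (vs[i := w], p)) | vs i v w p.
        (vs, p) \<in> fock_gens P V \<and> i < length vs \<and> v \<in> carrier V \<and> w \<in> carrier V} \<union>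
     {e (vs[i := c \<odot>\<^bsub>V\<^esub> v], p) \<ominus>\<^bsub>F\<^esub> (c \<odot>\<^bsub>F\<^esub> e (vs[i := v], p)) | vs i c v p.
        (vs, p) \<in> fock_gens P V \<and> i < length vs \<and> c \<in> carrier K \<and> v \<in> carrier V} \<union>
     {e (vs, p \<oplus>\<^bsub>obj P {1..length vs}\<^esub> q) \<ominus>\<^bsub>F\<^esub> (e (vs, p) \<oplus>\<^bsub>F\<^esub> e (vs, q)) | vs p q.
        (vs, p) \<in> fock_gens P V \<and> (vs, q) \<in> fock_gens P V} \<union>
     {e (vs, c \<odot>\<^bsub>obj P {1..length vs}\<^esub> p) \<ominus>\<^bsub>F\<^esub> (c \<odot>\<^bsub>F\<^esub> e (vs, p)) | vs c p.
        (vs, p) \<in> fock_gens P V \<and> c \<in> carrier K} \<union>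
     {e (vs, arr P {1..length vs} \<sigma> p) \<ominus>\<^bsub>F\<^esub>
        e (map (\<lambda>i. vs ! (\<sigma> i - 1)) [1..<Suc (length vs)], p) | vs \<sigma> p.
        (vs, p) \<in> fock_gens P V \<and> bij_betw \<sigma> {1..length vs} {1..length vs}})"

definition fock_space :: "('k, 'r) ring_scheme \<Rightarrow> ('k, 'p, 'z) species_scheme \<Rightarrow>
    ('k, 'v, 'm) module_scheme \<Rightarrow> ('k, ('v list \<times> 'p \<Rightarrow> 'k) set) module" where
  "fock_space K P V = presented K (fock_gens P V) (fock_rels K P V)"

text \<open>The class of \<open>v\<^sub>1 \<dots> v\<^sub>n \<otimes> p\<close>.\<close>

definition fock_cls :: "('k, 'r) ring_scheme \<Rightarrow> ('k, 'p, 'z) species_scheme \<Rightarrow>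
    ('k, 'v, 'm) module_scheme \<Rightarrow> 'v list \<Rightarrow> 'p \<Rightarrow> ('v list \<times> 'p \<Rightarrow> 'k) set" where
  "fock_cls K P V vs p = presented_gen K (fock_gens P V) (fock_rels K P V) (vs, p)"

text \<open>
  Values of the structure maps on generators. In the product, \<open>P[\<sigma>\<^bsub>k,l\<^esub>] \<circ> m\<^bsub>[k],[l]\<^esub>\<close> (with an external
  disjoint union \<open>[k] \<squnion> [l]\<close>) is read through naturality: \<open>[l]\<close> is first shifted to \<open>{k+1..k+l}\<close>.
\<close>

definition fock_mult_gen :: "('k, 'r) ring_scheme \<Rightarrow> ('k, 'p, 'z) twisted_scheme \<Rightarrow>
    ('k, 'v, 'm) module_scheme \<Rightarrow> 'v list \<Rightarrow> 'p \<Rightarrow> 'v list \<Rightarrow> 'p \<Rightarrow> ('v list \<times> 'p \<Rightarrow> 'k) set" where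
  "fock_mult_gen K P V vs p ws q = (let k = length vs; l = length ws in
     fock_cls K P V (vs @ ws)
       (tw_mult P {1..k} {k+1..k+l}
         (tens K (obj P {1..k}) (obj P {k+1..k+l}) p (arr P {1..l} (\<lambda>j. k + j) q))))"

text \<open>\<open>restr vs A\<close> is the word \<open>v\<^sub>A\<close>, and \<open>rank_in A\<close> is the increasing bijection from \<open>A\<close> to \<open>{1..card A}\<close>.\<close>

definition restr :: "'v list \<Rightarrow> nat set \<Rightarrow> 'v list" where
  "restr vs A = nths vs {i. Suc i \<in> A}"

definition rank_in :: "nat set \<Rightarrow> nat \<Rightarrow> nat" where
  "rank_in A i = card {j\<in>A. j \<le> i}"

definition fock_comult_gen :: "('k, 'r) ring_scheme \<Rightarrow> ('k, 'p, 'z) twisted_scheme \<Rightarrow>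
    ('k, 'v, 'm) module_scheme \<Rightarrow> 'v list \<Rightarrow> 'p \<Rightarrow>
    ('k, ('v list \<times> 'p \<Rightarrow> 'k) set, ('v list \<times> 'p \<Rightarrow> 'k) set) tensor" where
  "fock_comult_gen K P V vs p = (let F = fock_space K P V in
     finsum (tensor K F F)
       (\<lambda>A. let B = {1..length vs} - A in
          lift K (tensor K F F)
            (\<lambda>(p1, p2). tens K F F (fock_cls K P V (restr vs A) (arr P A (rank_in A) p1))
                                   (fock_cls K P V (restr vs B) (arr P B (rank_in B) p2)))
            (tw_comult P A B p))
       (Pow {1..length vs}))"

text \<open>
  Multilinear expansion of a list of tensors: if \<open>t\<^sub>i = a\<^sub>i \<otimes> b\<^sub>i\<close>, the value is
  \<open>\<beta> [(a\<^sub>1, b\<^sub>1), \<dots>, (a\<^sub>n, b\<^sub>n)]\<close>; in general it is the corresponding sum.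
\<close>

primrec lift_list :: "('k, 'r) ring_scheme \<Rightarrow> ('k, 'u, 'm) module_scheme \<Rightarrow>
    ('k, 'a, 'b) tensor list \<Rightarrow> (('a \<times> 'b) list \<Rightarrow> 'u) \<Rightarrow> 'u" where
  "lift_list K U [] \<beta> = \<beta> []"
| "lift_list K U (t # ts) \<beta> = lift K U (\<lambda>x. lift_list K U ts (\<lambda>xs. \<beta> (x # xs))) t"

text \<open>Product of a nonempty word in an algebra without unit.\<close>

definition word_prod :: "('v, 'm) monoid_scheme \<Rightarrow> 'v list \<Rightarrow> 'v" where
  "word_prod V vs = foldl (mult V) (hd vs) (tl vs)"

text \<open>A choice, for each \<open>n\<close> and each equivalence on \<open>[n]\<close>, of a numbering of its classes.\<close>

definition block_numbering :: "((nat \<times> nat) set \<Rightarrow> nat \<Rightarrow> nat) \<Rightarrow> bool" where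
  "block_numbering \<sigma> \<longleftrightarrow>
     (\<forall>n. \<forall>r\<in>equivs {1..n}. bij_betw (\<sigma> r) (quo {1..n} r) {1..card (quo {1..n} r)})"

text \<open>For \<open>vs = [v'\<^sub>1, \<dots>, v'\<^sub>n]\<close>, the word \<open>w\<^sub>1 \<dots> w\<^sub>k\<close> where \<open>w\<^sub>j\<close> is the product of the letters of
  \<open>vs\<close> in the \<open>j\<close>-th class of \<open>r\<close>.\<close>

definition block_word :: "('v, 'm) monoid_scheme \<Rightarrow> ((nat \<times> nat) set \<Rightarrow> nat \<Rightarrow> nat) \<Rightarrow>
    (nat \<times> nat) set \<Rightarrow> 'v list \<Rightarrow> 'v list" where
  "block_word V \<sigma> r vs = (let Q = quo {1..length vs} r in
     map (\<lambda>j. word_prod V (restr vs (set_decode (inv_into Q (\<sigma> r) j)))) [1..<Suc (card Q)])"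

definition fock_comult2_gen :: "('k, 'r) ring_scheme \<Rightarrow> ('k, 'p, 'z) double_twisted_scheme \<Rightarrow>
    ('k, 'v, 'm) bialgebra_scheme \<Rightarrow> ((nat \<times> nat) set \<Rightarrow> nat \<Rightarrow> nat) \<Rightarrow> 'v list \<Rightarrow> 'p \<Rightarrow>
    ('k, ('v list \<times> 'p \<Rightarrow> 'k) set, ('v list \<times> 'p \<Rightarrow> 'k) set) tensor" where
  "fock_comult2_gen K P V \<sigma> vs p = (let n = length vs; F = fock_space K P V; T = tensor K F F in
     finsum T
       (\<lambda>r. lift K T
          (\<lambda>(p1, p2). lift_list K T (map (comult V) vs)
            (\<lambda>xs. tens K F F
               (fock_cls K P V (block_word V \<sigma> r (map fst xs)) (arr P (quo {1..n} r) (\<sigma> r) p1))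
               (fock_cls K P V (map snd xs) p2)))
          (contr P {1..n} r p))
       (equivs {1..n}))"

definition fock_counit_gen :: "('k, 'r) ring_scheme \<Rightarrow> ('k, 'p, 'z) twisted_scheme \<Rightarrow>
    'v list \<Rightarrow> 'p \<Rightarrow> 'k" where
  "fock_counit_gen K P vs p = (if vs = [] then tw_counit P p else \<zero>\<^bsub>K\<^esub>)"

definition fock_counit2_gen :: "('k, 'r) ring_scheme \<Rightarrow> ('k, 'p, 'z) double_twisted_scheme \<Rightarrow>
    ('k, 'v, 'm) bialgebra_scheme \<Rightarrow> 'v list \<Rightarrow> 'p \<Rightarrow> 'k" where
  "fock_counit2_gen K P V vs p =
     foldr (\<lambda>v c. counit V v \<otimes>\<^bsub>K\<^esub> c) vs (contr_counit P {1..length vs} p)"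

text \<open>The image of \<open>V\<close> under the functor. The numbering used to define the second coproduct is immaterial.\<close>

definition fock :: "('k, 'r) ring_scheme \<Rightarrow> ('k, 'p, 'z) double_twisted_scheme \<Rightarrow>
    ('k, 'v, 'm) bialgebra_scheme \<Rightarrow> ('k, ('v list \<times> 'p \<Rightarrow> 'k) set) double_bialgebra" where
  "fock K P V = (let F = fock_space K P V in \<lparr>
     carrier = carrier F,
     mult = (\<lambda>s t. lift K F (\<lambda>(vs, p). lift K F (\<lambda>(ws, q). fock_mult_gen K P V vs p ws q) t) s),
     one = fock_cls K P V [] (tw_one P),
     zero = zero F, add = add F, smult = smult F,
     comult = lift K (tensor K F F) (\<lambda>(vs, p). fock_comult_gen K P V vs p),
     counit = lift K (self_module K) (\<lambda>(vs, p). fock_counit_gen K P vs p),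
     comult2 = lift K (tensor K F F)
       (\<lambda>(vs, p). fock_comult2_gen K P V (SOME \<sigma>. block_numbering \<sigma>) vs p),
     counit2 = lift K (self_module K) (\<lambda>(vs, p). fock_counit2_gen K P V vs p)\<rparr>)"

definition fock_map :: "('k, 'r) ring_scheme \<Rightarrow> ('k, 'p, 'z) double_twisted_scheme \<Rightarrow>
    ('k, 'w, 'm) bialgebra_scheme \<Rightarrow> ('v \<Rightarrow> 'w) \<Rightarrow>
    ('v list \<times> 'p \<Rightarrow> 'k) set \<Rightarrow> ('w list \<times> 'p \<Rightarrow> 'k) set" where
  "fock_map K P W f = lift K (fock_space K P W) (\<lambda>(vs, p). fock_cls K P W (map f vs) p)"

end

(*
  A class in the Fock space can be written with letters v_x indexed by an arbitrary finite set X and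
  p in P[X]: renumbering X does not matter. In this form the product is a disjoint union, the first
  coproduct is a sum over the subsets of X, and the axioms of (m, Delta) hold term by term because
  they hold in P.

  The second coproduct is the composition of F(delta_V) : F_V -> F_{V (x) V} with a "splitting"
  F_{A (x) B} -> F_A (x) F_B, which exists for every commutative algebra A and every space B and is
  natural in both. Each axiom of the second coproduct thus becomes the same axiom of delta_V, carried
  by functoriality, together with an identity for splittings. The latter only has to be checked on
  letters that are pure tensors, so that no sums over the coproduct of the letters appear. There it
  follows from the axiom of P and a bijection of index sets: pairs of equivalences with r' contained
  in r correspond to pairs (r', equivalence on X/r') for coassociativity, and pairs (r, subset of X/r)
  correspond to triples (Y, equivalence on Y, equivalence on X - Y) for the cointeraction.
*)

theory Submission
  imports Defs
begin

section \<open>Linear maps\<close>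

text \<open>The obstacle in the second coproduct is that \<delta>_V(v) is a sum, so that a word
  expands into a product of sums about which the axioms of \<open>P\<close> say nothing. A splitting
  takes tensors a_i \<otimes> b_i as letters, multiplies the a_i inside each class and copies the
  b_i. This explains its asymmetry: a class has no order, so \<open>A\<close> must be a commutative
  algebra, while \<open>B\<close> is any module; it is natural for multiplicative maps on the left
  and for linear maps on the right. The axioms of \<open>V\<close> enter accordingly:
  multiplicativity of \<delta>_V lets it pass through the left factor in coassociativity, and
  multiplicativity of \<epsilon>_V turns the left counit into a product over all letters, the same
  for every equivalence. Classes are never empty, so their products exist although \<open>V\<close>
  may lack a unit. Since letters range over modules such as V \<otimes> V, the structure is built on
  \<open>fock_alg\<close> and \<open>fock_lin\<close>, which ask for no bialgebra, and is
  transferred to \<open>fock\<close> at the end.\<close>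

definition lin :: "('k, 'r) ring_scheme \<Rightarrow> ('k, 'a, 'm) module_scheme \<Rightarrow>
    ('k, 'b, 'n) module_scheme \<Rightarrow> ('a \<Rightarrow> 'b) \<Rightarrow> bool" where
  "lin K M N f \<longleftrightarrow> module K M \<and> module K N \<and> linear_map K M N f"

lemma linI:
  assumes "module K M" "module K N" "\<And>x. x \<in> carrier M ==> f x \<in> carrier N"
    "\<And>x y. x \<in> carrier M ==> y \<in> carrier M ==> f (x \<oplus>\<^bsub>M\<^esub> y) = f x \<oplus>\<^bsub>N\<^esub> f y"
    "\<And>c x. c \<in> carrier K ==> x \<in> carrier M ==> f (c \<odot>\<^bsub>M\<^esub> x) = c \<odot>\<^bsub>N\<^esub> f x"
  shows "lin K M N f"
  using assms unfolding lin_def linear_map_def by auto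

lemma lin_dom: "lin K M N f ==> module K M"
  and lin_cod: "lin K M N f ==> module K N"
  and lin_closed: "lin K M N f ==> x \<in> carrier M ==> f x \<in> carrier N"
  and lin_add: "lin K M N f ==> x \<in> carrier M ==> y \<in> carrier M ==> f (x \<oplus>\<^bsub>M\<^esub> y) = f x \<oplus>\<^bsub>N\<^esub> f y"
  and lin_smult: "lin K M N f ==> c \<in> carrier K ==> x \<in> carrier M ==> f (c \<odot>\<^bsub>M\<^esub> x) = c \<odot>\<^bsub>N\<^esub> f x"
  unfolding lin_def linear_map_def by auto

lemma lin_zero: assumes "lin K M N f" shows "f \<zero>\<^bsub>M\<^esub> = \<zero>\<^bsub>N\<^esub>"
proof -
  interpret M: module K M by (rule lin_dom[OF assms])
  interpret N: module K N by (rule lin_cod[OF assms])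
  have "f (\<zero>\<^bsub>K\<^esub> \<odot>\<^bsub>M\<^esub> \<zero>\<^bsub>M\<^esub>) = \<zero>\<^bsub>K\<^esub> \<odot>\<^bsub>N\<^esub> f \<zero>\<^bsub>M\<^esub>"
    by (rule lin_smult[OF assms]) auto
  then show ?thesis by (simp add: lin_closed[OF assms])
qed

lemma lin_minus:
  assumes "lin K M N f" "x \<in> carrier M" "y \<in> carrier M"
  shows "f (x \<ominus>\<^bsub>M\<^esub> y) = f x \<ominus>\<^bsub>N\<^esub> f y"
proof -
  interpret M: module K M by (rule lin_dom[OF assms(1)])
  interpret N: module K N by (rule lin_cod[OF assms(1)])
  have "\<ominus>\<^bsub>M\<^esub> y = (\<ominus>\<^bsub>K\<^esub> \<one>\<^bsub>K\<^esub>) \<odot>\<^bsub>M\<^esub> y" using assms by (simp add: M.smult_l_minus)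
  moreover have "\<ominus>\<^bsub>N\<^esub> f y = (\<ominus>\<^bsub>K\<^esub> \<one>\<^bsub>K\<^esub>) \<odot>\<^bsub>N\<^esub> f y"
    using assms by (simp add: N.smult_l_minus lin_closed)
  ultimately have "f (\<ominus>\<^bsub>M\<^esub> y) = \<ominus>\<^bsub>N\<^esub> f y"
    by (simp add: lin_smult[OF assms(1)] assms(3))
  then show ?thesis by (simp add: a_minus_def lin_add[OF assms(1)] assms)
qed

lemma lin_finsum:
  assumes "lin K M N f" "g \<in> S \<rightarrow> carrier M"
  shows "f (finsum M g S) = finsum N (\<lambda>i. f (g i)) S"
proof -
  interpret M: module K M by (rule lin_dom[OF assms(1)])
  interpret N: module K N by (rule lin_cod[OF assms(1)])
  from assms(2) show ?thesis
  proof (induction S rule: infinite_finite_induct)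
    case (insert i S)
    then show ?case
      by (subst M.finsum_insert; simp add: lin_add[OF assms(1)] lin_closed[OF assms(1)] Pi_def)
  qed (auto simp: lin_zero[OF assms(1)])
qed

lemma lin_cong:
  assumes "lin K M N f" "\<And>x. x \<in> carrier M ==> f x = g x"
  shows "lin K M N g"
proof -
  interpret M: module K M by (rule lin_dom[OF assms(1)])
  have g: "g x = f x" if "x \<in> carrier M" for x using assms(2) that by simp
  show ?thesis
    by (rule linI[OF lin_dom[OF assms(1)] lin_cod[OF assms(1)]])
       (simp_all add: g lin_closed[OF assms(1)] lin_add[OF assms(1)] lin_smult[OF assms(1)])
qed

lemma lin_id: "module K M ==> lin K M M (\<lambda>x. x)"
  by (rule linI) simp_all

lemma lin_comp: "lin K M N f ==> lin K N L g ==> lin K M L (\<lambda>x. g (f x))"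
  by (rule linI) (auto simp: lin_dom lin_cod lin_closed lin_add lin_smult)

lemma lin_0: assumes "module K M" "module K N" shows "lin K M N (\<lambda>x. \<zero>\<^bsub>N\<^esub>)"
proof -
  interpret N: module K N by fact
  show ?thesis using assms by (intro linI) auto
qed

lemma lin_sum:
  assumes "module K M" "module K N" "\<And>i. i \<in> S ==> lin K M N (f i)"
  shows "lin K M N (\<lambda>x. finsum N (\<lambda>i. f i x) S)"
proof -
  interpret M: module K M by fact
  interpret N: module K N by fact
  have cl: "(\<lambda>i. f i x) \<in> S \<rightarrow> carrier N" if "x \<in> carrier M" for x
    using assms(3) lin_closed that by fastforce
  show ?thesis
  proof (cases "finite S")
    case True
    show ?thesis
    proof (rule linI[OF assms(1,2)])
      fix x y assume xy: "x \<in> carrier M" "y \<in> carrier M"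
      show "finsum N (\<lambda>i. f i (x \<oplus>\<^bsub>M\<^esub> y)) S = finsum N (\<lambda>i. f i x) S \<oplus>\<^bsub>N\<^esub> finsum N (\<lambda>i. f i y) S"
        unfolding N.finsum_addf[OF cl[OF xy(1)] cl[OF xy(2)], symmetric]
        using xy cl by (intro N.finsum_cong') (auto simp: lin_add[OF assms(3)] Pi_def)
    next
      fix c x assume cx: "c \<in> carrier K" "x \<in> carrier M"
      show "finsum N (\<lambda>i. f i (c \<odot>\<^bsub>M\<^esub> x)) S = c \<odot>\<^bsub>N\<^esub> finsum N (\<lambda>i. f i x) S"
        using cx cl True by (subst N.finsum_smult_ldistr)
          (auto intro!: N.finsum_cong' simp: lin_smult[OF assms(3)] Pi_def)
    qed (use cl in auto)
  next
    case False
    \<comment> \<open>Over an infinite index set \<open>finsum\<close> takes its default value zero,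
      and the zero map is linear.\<close>
    then show ?thesis using lin_0[OF assms(1,2)] by simp
  qed
qed

lemma lin_scale:
  assumes "lin K M N f" "c \<in> carrier K"
  shows "lin K M N (\<lambda>x. c \<odot>\<^bsub>N\<^esub> f x)"
proof -
  interpret M: module K M by (rule lin_dom[OF assms(1)])
  interpret N: module K N by (rule lin_cod[OF assms(1)])
  show ?thesis
  proof (rule linI)
    fix d x assume "d \<in> carrier K" "x \<in> carrier M"
    then show "c \<odot>\<^bsub>N\<^esub> f (d \<odot>\<^bsub>M\<^esub> x) = d \<odot>\<^bsub>N\<^esub> (c \<odot>\<^bsub>N\<^esub> f x)"
      using assms by (simp add: lin_smult lin_closed N.smult_assoc1[symmetric] M.R.m_comm)
  qed (use assms in \<open>auto simp: lin_closed lin_add N.smult_r_distr intro: lin_dom lin_cod\<close>)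
qed

lemma self_module_simps [simp]:
  "carrier (self_module K) = carrier K" "zero (self_module K) = \<zero>\<^bsub>K\<^esub>"
  "add (self_module K) = add K" "smult (self_module K) = mult K"
  by (simp_all add: self_module_def)

lemma module_self: assumes "cring K" shows "module K (self_module K)"
proof -
  interpret cring K by fact
  show ?thesis
    by (intro moduleI abelian_groupI assms)
       (auto simp: l_distr r_distr m_assoc a_assoc intro: a_comm l_neg r_neg a_inv_closed
         intro: bexI[where x = "\<ominus>\<^bsub>K\<^esub> x" for x])
qed

lemma lin_scale_right:
  assumes "lin K M (self_module K) f" "module K N" "n \<in> carrier N"
  shows "lin K M N (\<lambda>x. f x \<odot>\<^bsub>N\<^esub> n)"
proof -
  interpret M: module K M by (rule lin_dom[OF assms(1)])
  interpret N: module K N by fact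
  show ?thesis
    using assms lin_closed[OF assms(1)]
    by (intro linI) (auto simp: lin_add lin_smult N.smult_l_distr N.smult_assoc1 intro: lin_dom)
qed

lemma (in abelian_monoid) finsum_Sigma:
  assumes "finite A" "\<And>a. a \<in> A ==> finite (B a)"
    "\<And>a b. a \<in> A ==> b \<in> B a ==> f a b \<in> carrier G"
  shows "finsum G (\<lambda>a. finsum G (f a) (B a)) A = finsum G (\<lambda>(a, b). f a b) (Sigma A B)"
  using assms
proof (induction A rule: finite_induct)
  case (insert a A)
  have eq: "Sigma (insert a A) B = Pair a ` B a \<union> Sigma A B" by auto
  have "finsum G (\<lambda>(a, b). f a b) (Sigma (insert a A) B) =
      finsum G (\<lambda>(a, b). f a b) (Pair a ` B a) \<oplus> finsum G (\<lambda>(a, b). f a b) (Sigma A B)"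
    unfolding eq using insert by (intro finsum_Un_disjoint) auto
  also have "finsum G (\<lambda>(a, b). f a b) (Pair a ` B a) = finsum G (f a) (B a)"
    using insert by (subst finsum_reindex) (auto simp: inj_on_def Pi_def)
  finally show ?case using insert by (subst finsum_insert) (auto simp: Pi_def)
qed simp

text \<open>Reindexing in the form in which bijections of index sets, between families of subsets or
  of equivalences, later compare two sums.\<close>

lemma (in abelian_monoid) finsum_bij:
  assumes "bij_betw h A B" "g \<in> B \<rightarrow> carrier G" "\<And>a. a \<in> A ==> f a = g (h a)"
  shows "finsum G f A = finsum G g B"
proof -
  have "finsum G g B = finsum G (\<lambda>x. g (h x)) A"
    using assms(1,2) finsum_reindex[of g h A] by (auto simp: bij_betw_def)
  also have "\<dots> = finsum G f A"
    using assms by (intro finsum_cong') (auto simp: bij_betw_def)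
  finally show ?thesis ..
qed

section \<open>Spaces given by generators and relations\<close>

lemma free_module_simps [simp]:
  "zero (free_module K G) = (\<lambda>g. \<zero>\<^bsub>K\<^esub>)"
  "add (free_module K G) = (\<lambda>x y g. x g \<oplus>\<^bsub>K\<^esub> y g)"
  "smult (free_module K G) = (\<lambda>c x g. c \<otimes>\<^bsub>K\<^esub> x g)"
  by (simp_all add: free_module_def)

lemma carrier_free_module:
  "x \<in> carrier (free_module K G) \<longleftrightarrow>
     x ` G \<subseteq> carrier K \<and> (\<forall>g. g \<notin> G \<longrightarrow> x g = \<zero>\<^bsub>K\<^esub>) \<and> finite {g. x g \<noteq> \<zero>\<^bsub>K\<^esub>}"
  by (simp add: free_module_def)

lemma free_module_val:
  assumes "cring K" "x \<in> carrier (free_module K G)" shows "x g \<in> carrier K"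
proof -
  interpret cring K by fact
  show ?thesis using assms(2) by (cases "g \<in> G") (auto simp: carrier_free_module)
qed

lemma module_free_module: assumes "cring K" shows "module K (free_module K G)"
proof -
  interpret cring K by fact
  note val [simp] = free_module_val[OF assms]
  have add: "(\<lambda>g. x g \<oplus>\<^bsub>K\<^esub> y g) \<in> carrier (free_module K G)"
    if xy: "x \<in> carrier (free_module K G)" "y \<in> carrier (free_module K G)" for x y
  proof -
    have "{g. x g \<oplus>\<^bsub>K\<^esub> y g \<noteq> \<zero>\<^bsub>K\<^esub>} \<subseteq> {g. x g \<noteq> \<zero>\<^bsub>K\<^esub>} \<union> {g. y g \<noteq> \<zero>\<^bsub>K\<^esub>}" by auto
    then show ?thesis using xy finite_subset
      unfolding carrier_free_module by (auto simp: image_subset_iff)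
  qed
  have smult: "(\<lambda>g. c \<otimes>\<^bsub>K\<^esub> x g) \<in> carrier (free_module K G)"
    if cx: "c \<in> carrier K" "x \<in> carrier (free_module K G)" for c x
  proof -
    have "{g. c \<otimes>\<^bsub>K\<^esub> x g \<noteq> \<zero>\<^bsub>K\<^esub>} \<subseteq> {g. x g \<noteq> \<zero>\<^bsub>K\<^esub>}" using cx by auto
    then show ?thesis using cx finite_subset
      unfolding carrier_free_module by (auto simp: image_subset_iff)
  qed
  have zero: "(\<lambda>g. \<zero>\<^bsub>K\<^esub>) \<in> carrier (free_module K G)"
    by (auto simp: carrier_free_module)
  have "abelian_group (free_module K G)"
  proof (rule abelian_groupI; simp add: add zero)
    fix x assume x: "x \<in> carrier (free_module K G)"
    have "(\<lambda>g. (\<ominus>\<^bsub>K\<^esub> \<one>\<^bsub>K\<^esub>) \<otimes>\<^bsub>K\<^esub> x g) \<in> carrier (free_module K G)"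
      using x by (intro smult) auto
    then show "\<exists>y\<in>carrier (free_module K G). (\<lambda>g. y g \<oplus>\<^bsub>K\<^esub> x g) = (\<lambda>g. \<zero>\<^bsub>K\<^esub>)"
      using x by (rule_tac bexI) (auto simp: l_minus l_neg)
  qed (auto simp: fun_eq_iff a_assoc intro: a_comm)
  then show ?thesis
    by (intro moduleI assms) (auto simp: smult l_distr r_distr m_assoc)
qed

lemma free_gen_closed:
  assumes "cring K" "g \<in> G" shows "free_gen K g \<in> carrier (free_module K G)"
proof -
  interpret cring K by fact
  have "{h. h = g \<and> \<one>\<^bsub>K\<^esub> \<noteq> \<zero>\<^bsub>K\<^esub>} \<subseteq> {g}" by auto
  then have "finite {h. h = g \<and> \<one>\<^bsub>K\<^esub> \<noteq> \<zero>\<^bsub>K\<^esub>}" by (rule finite_subset) auto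
  then show ?thesis using assms by (auto simp: carrier_free_module free_gen_def)
qed

text \<open>Vectors have finite support. The induction runs over a finite set that contains the
  support: erasing the coefficient at one of its elements leaves a vector supported on a smaller
  set, and the erased part is a multiple of a generator.\<close>

lemma free_module_induct [consumes 2, case_names zero add smult gen]:
  assumes "cring K" "x \<in> carrier (free_module K G)"
    and zero: "P \<zero>\<^bsub>free_module K G\<^esub>"
    and add: "\<And>x y. x \<in> carrier (free_module K G) ==> y \<in> carrier (free_module K G) ==>
        P x ==> P y ==> P (x \<oplus>\<^bsub>free_module K G\<^esub> y)"
    and smult: "\<And>c x. c \<in> carrier K ==> x \<in> carrier (free_module K G) ==> P x ==>
        P (c \<odot>\<^bsub>free_module K G\<^esub> x)"
    and gen: "\<And>g. g \<in> G ==> P (free_gen K g)"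
  shows "P x"
proof -
  interpret cring K by fact
  interpret F: module K "free_module K G" by (rule module_free_module) fact
  note val [simp] = free_module_val[OF assms(1)]
  have "\<forall>x\<in>carrier (free_module K G). {g. x g \<noteq> \<zero>\<^bsub>K\<^esub>} \<subseteq> S \<longrightarrow> P x" if "finite S" for S
    using that
  proof (induction S)
    case empty
    show ?case using zero by (auto simp: fun_eq_iff[symmetric])
  next
    case (insert s S)
    show ?case
    proof (intro ballI impI)
      fix x assume x: "x \<in> carrier (free_module K G)" and sub: "{g. x g \<noteq> \<zero>\<^bsub>K\<^esub>} \<subseteq> insert s S"
      show "P x"
      proof (cases "x s = \<zero>\<^bsub>K\<^esub>")
        case True
        then show ?thesis using x sub insert by auto
      next
        case False
        let ?y = "x(s := \<zero>\<^bsub>K\<^esub>)"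
        have s: "s \<in> G" using False x by (auto simp: carrier_free_module)
        have ss: "{g. ?y g \<noteq> \<zero>\<^bsub>K\<^esub>} \<subseteq> {g. x g \<noteq> \<zero>\<^bsub>K\<^esub>}" by auto
        then have y: "?y \<in> carrier (free_module K G)"
          using x finite_subset[OF ss] by (auto simp: carrier_free_module simp del: fun_upd_apply)
             (auto simp: image_subset_iff)
        have "{g. ?y g \<noteq> \<zero>\<^bsub>K\<^esub>} \<subseteq> S" using sub by auto
        with y insert.IH have "P ?y" by blast
        moreover have "P (x s \<odot>\<^bsub>free_module K G\<^esub> free_gen K s)"
          using x s by (intro smult gen free_gen_closed assms) auto
        moreover have "x = (x s \<odot>\<^bsub>free_module K G\<^esub> free_gen K s) \<oplus>\<^bsub>free_module K G\<^esub> ?y"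
          using x by (auto simp: fun_eq_iff free_gen_def)
        moreover have "(x s \<odot>\<^bsub>free_module K G\<^esub> free_gen K s) \<in> carrier (free_module K G)"
          using x s by (intro F.smult_closed free_gen_closed assms) auto
        ultimately show ?thesis using add y by metis
      qed
    qed
  qed
  then show ?thesis using assms(2) by (auto simp: carrier_free_module)
qed

text \<open>The expression inside \<open>lift\<close>, evaluated at a single representative;
  \<open>lift\<close> collects its values over a whole coset.\<close>

definition free_lift :: "('k, 'r) ring_scheme \<Rightarrow> ('k, 'u, 'm) module_scheme \<Rightarrow> ('g \<Rightarrow> 'u) \<Rightarrow>
    ('g \<Rightarrow> 'k) \<Rightarrow> 'u" where
  "free_lift K U \<beta> x = finsum U (\<lambda>g. x g \<odot>\<^bsub>U\<^esub> \<beta> g) {g. x g \<noteq> \<zero>\<^bsub>K\<^esub>}"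

lemma lin_free_lift:
  assumes "module K U" "\<beta> \<in> G \<rightarrow> carrier U"
  shows "lin K (free_module K G) U (free_lift K U \<beta>)"
proof -
  interpret U: module K U by fact
  let ?F = "free_module K G"
  interpret F: module K ?F by (rule module_free_module) (rule U.R.is_cring)
  note val [simp] = free_module_val[OF U.R.is_cring]
  have cl: "x g \<odot>\<^bsub>U\<^esub> \<beta> g \<in> carrier U" if "x \<in> carrier ?F" "x g \<noteq> \<zero>\<^bsub>K\<^esub>" for x g
    using that assms(2) by (intro U.smult_closed) (auto simp: carrier_free_module)
  \<comment> \<open>The supports of two vectors and of their sum differ. Enlarging the summation set
    to a common finite one only adds zero terms, and then the sums can be compared.\<close>
  have S: "free_lift K U \<beta> x = finsum U (\<lambda>g. x g \<odot>\<^bsub>U\<^esub> \<beta> g) S"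
    if x: "x \<in> carrier ?F" "finite S" "S \<subseteq> G" "{g. x g \<noteq> \<zero>\<^bsub>K\<^esub>} \<subseteq> S" for x S
    unfolding free_lift_def
    using that assms(2) by (intro U.add.finprod_mono_neutral_cong_left) (auto simp: Pi_def subset_iff)
  show ?thesis
  proof (rule linI)
    fix x y assume xy: "x \<in> carrier ?F" "y \<in> carrier ?F"
    let ?S = "{g. x g \<noteq> \<zero>\<^bsub>K\<^esub>} \<union> {g. y g \<noteq> \<zero>\<^bsub>K\<^esub>}"
    have fin: "finite ?S" "?S \<subseteq> G" using xy by (auto simp: carrier_free_module)
    then have b: "\<And>g. g \<in> ?S ==> \<beta> g \<in> carrier U" using assms(2) by blast
    have "free_lift K U \<beta> (x \<oplus>\<^bsub>?F\<^esub> y) = finsum U (\<lambda>g. (x \<oplus>\<^bsub>?F\<^esub> y) g \<odot>\<^bsub>U\<^esub> \<beta> g) ?S"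
      using xy fin by (intro S F.a_closed) auto
    also have "\<dots> = finsum U (\<lambda>g. x g \<odot>\<^bsub>U\<^esub> \<beta> g \<oplus>\<^bsub>U\<^esub> y g \<odot>\<^bsub>U\<^esub> \<beta> g) ?S"
      using xy b by (intro U.finsum_cong') (auto simp: U.smult_l_distr)
    also have "\<dots> = free_lift K U \<beta> x \<oplus>\<^bsub>U\<^esub> free_lift K U \<beta> y"
      using xy b fin by (subst U.finsum_addf) (auto simp: S[where S = ?S])
    finally show "free_lift K U \<beta> (x \<oplus>\<^bsub>?F\<^esub> y) = free_lift K U \<beta> x \<oplus>\<^bsub>U\<^esub> free_lift K U \<beta> y" .
  next
    fix c x assume cx: "c \<in> carrier K" "x \<in> carrier ?F"
    let ?S = "{g. x g \<noteq> \<zero>\<^bsub>K\<^esub>}"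
    have fin: "finite ?S" "?S \<subseteq> G" using cx by (auto simp: carrier_free_module)
    then have b: "\<And>g. g \<in> ?S ==> \<beta> g \<in> carrier U" using assms(2) by blast
    have "free_lift K U \<beta> (c \<odot>\<^bsub>?F\<^esub> x) = finsum U (\<lambda>g. (c \<odot>\<^bsub>?F\<^esub> x) g \<odot>\<^bsub>U\<^esub> \<beta> g) ?S"
      using cx fin by (intro S F.smult_closed) auto
    also have "\<dots> = finsum U (\<lambda>g. c \<odot>\<^bsub>U\<^esub> (x g \<odot>\<^bsub>U\<^esub> \<beta> g)) ?S"
      using cx b by (intro U.finsum_cong') (auto simp: U.smult_assoc1)
    also have "\<dots> = c \<odot>\<^bsub>U\<^esub> free_lift K U \<beta> x"
      unfolding free_lift_def using cx b fin by (subst U.finsum_smult_ldistr) auto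
    finally show "free_lift K U \<beta> (c \<odot>\<^bsub>?F\<^esub> x) = c \<odot>\<^bsub>U\<^esub> free_lift K U \<beta> x" .
  next
    fix x assume "x \<in> carrier ?F"
    then show "free_lift K U \<beta> x \<in> carrier U"
      unfolding free_lift_def by (intro U.finsum_closed) (auto intro: cl)
  qed (intro F.module_axioms assms module_free_module U.R.is_cring)+
qed

lemma free_lift_gen:
  assumes "module K U" "\<beta> g \<in> carrier U"
  shows "free_lift K U \<beta> (free_gen K g) = \<beta> g"
proof -
  interpret U: module K U by fact
  show ?thesis
  \<comment> \<open>In the zero ring a generator has empty support; there every module is zero as
    well.\<close>
  proof (cases "\<one>\<^bsub>K\<^esub> = \<zero>\<^bsub>K\<^esub>")
    case True
    then have "\<beta> g = \<zero>\<^bsub>U\<^esub>" using assms U.smult_one U.smult_l_null by metis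
    then show ?thesis using True by (simp add: free_lift_def free_gen_def)
  next
    case False
    then have "{h. free_gen K g h \<noteq> \<zero>\<^bsub>K\<^esub>} = {g}" by (auto simp: free_gen_def)
    then show ?thesis using assms by (simp add: free_lift_def) (simp add: free_gen_def)
  qed
qed

lemma lin_plus:
  assumes "lin K M N f" "lin K M N g"
  shows "lin K M N (\<lambda>x. f x \<oplus>\<^bsub>N\<^esub> g x)"
proof -
  interpret M: module K M by (rule lin_dom[OF assms(1)])
  interpret N: module K N by (rule lin_cod[OF assms(1)])
  show ?thesis
    using assms(2)
    by (intro linI lin_dom[OF assms(1)] lin_cod[OF assms(1)])
       (simp_all add: lin_closed[OF assms(1)] lin_closed[OF assms(2)] lin_add[OF assms(1)]
         lin_add[OF assms(2)] lin_smult[OF assms(1)] lin_smult[OF assms(2)] N.smult_r_distr N.a_ac)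
qed

lemma (in abelian_group) eq_if_minus_zero:
  assumes "a \<ominus> b = \<zero>" "a \<in> carrier G" "b \<in> carrier G"
  shows "a = b"
  using assms minus_equality[of a "\<ominus> b"] by (simp add: a_minus_def)

text \<open>\<open>quotient_module\<close> forms the scalar multiple of a coset as a union over all
  representatives. The submodule is closed under scalars, so every representative contributes the
  same coset and the union collapses to it.\<close>

lemma (in module) quotient_smult:
  assumes "submodule N R M" "c \<in> carrier R" "x \<in> carrier M"
  shows "c \<odot>\<^bsub>quotient_module M N\<^esub> (N +>\<^bsub>M\<^esub> x) = N +>\<^bsub>M\<^esub> (c \<odot>\<^bsub>M\<^esub> x)"
proof -
  interpret N: submodule N R M by fact
  have sg: "subgroup N (add_monoid M)" by (rule N.subgroup_axioms)
  have sub: "N \<subseteq> carrier M" using submoduleE(1)[OF assms(1)] .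
  have eq: "N +>\<^bsub>M\<^esub> (c \<odot>\<^bsub>M\<^esub> z) = N +>\<^bsub>M\<^esub> (c \<odot>\<^bsub>M\<^esub> x)" if "z \<in> N +>\<^bsub>M\<^esub> x" for z
  proof -
    from that obtain n where n: "n \<in> N" "z = n \<oplus>\<^bsub>M\<^esub> x" by (auto simp: a_r_coset_def')
    have "n \<in> carrier M" using n sub by blast
    then have "c \<odot>\<^bsub>M\<^esub> z = c \<odot>\<^bsub>M\<^esub> n \<oplus>\<^bsub>M\<^esub> c \<odot>\<^bsub>M\<^esub> x"
      unfolding n(2) using assms(2,3) by (rule_tac smult_r_distr)
    moreover have "c \<odot>\<^bsub>M\<^esub> n \<in> N" using n assms by auto
    ultimately have "c \<odot>\<^bsub>M\<^esub> z \<in> N +>\<^bsub>M\<^esub> (c \<odot>\<^bsub>M\<^esub> x)" by (auto simp: a_r_coset_def')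
    then show ?thesis
      using M.a_repr_independence[of "c \<odot>\<^bsub>M\<^esub> z" N "c \<odot>\<^bsub>M\<^esub> x"] smult_closed[OF assms(2,3)] sg by simp
  qed
  have "x \<in> N +>\<^bsub>M\<^esub> x"
    using N.one_closed assms(3) by (auto simp: a_r_coset_def' intro: bexI[where x = "\<zero>\<^bsub>M\<^esub>"])
  then have "(\<Union>z\<in>N +>\<^bsub>M\<^esub> x. N +>\<^bsub>M\<^esub> (c \<odot>\<^bsub>M\<^esub> z)) = N +>\<^bsub>M\<^esub> (c \<odot>\<^bsub>M\<^esub> x)"
    using SUP_eq_const[of "N +>\<^bsub>M\<^esub> x" "\<lambda>z. N +>\<^bsub>M\<^esub> (c \<odot>\<^bsub>M\<^esub> z)"] eq by blast
  then show ?thesis by (simp add: quotient_module_def)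
qed

lemma (in module) module_quotient:
  assumes "submodule N R M"
  shows "module R (quotient_module M N)" and "lin R M (quotient_module M N) (\<lambda>x. N +>\<^bsub>M\<^esub> x)"
    and "carrier (quotient_module M N) = (\<lambda>x. N +>\<^bsub>M\<^esub> x) ` carrier M"
proof -
  let ?Q = "quotient_module M N"
  interpret N: submodule N R M by fact
  interpret abelian_subgroup N M
    by (intro abelian_subgroupI3 additive_subgroupI N.subgroup_axioms abelian_group_axioms)
  show car: "carrier ?Q = (\<lambda>x. N +>\<^bsub>M\<^esub> x) ` carrier M"
    by (auto simp: quotient_module_def A_RCOSETS_def')
  have add: "(N +>\<^bsub>M\<^esub> x) \<oplus>\<^bsub>?Q\<^esub> (N +>\<^bsub>M\<^esub> y) = N +>\<^bsub>M\<^esub> (x \<oplus>\<^bsub>M\<^esub> y)" if "x \<in> carrier M" "y \<in> carrier M" for x y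
    using that by (simp add: quotient_module_def a_rcos_sum)
  have zero: "\<zero>\<^bsub>?Q\<^esub> = N +>\<^bsub>M\<^esub> \<zero>\<^bsub>M\<^esub>" by (simp add: quotient_module_def a_subset)
  have smult: "c \<odot>\<^bsub>?Q\<^esub> (N +>\<^bsub>M\<^esub> x) = N +>\<^bsub>M\<^esub> (c \<odot>\<^bsub>M\<^esub> x)" if "c \<in> carrier R" "x \<in> carrier M" for c x
    using quotient_smult[OF assms that] .
  have "abelian_group ?Q"
  proof (rule abelian_groupI)
    fix X assume "X \<in> carrier ?Q"
    then obtain x where x: "x \<in> carrier M" "X = N +>\<^bsub>M\<^esub> x" by (auto simp: car)
    then have "(N +>\<^bsub>M\<^esub> (\<ominus>\<^bsub>M\<^esub> x)) \<oplus>\<^bsub>?Q\<^esub> X = \<zero>\<^bsub>?Q\<^esub>" by (simp add: add zero l_neg)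
    then show "\<exists>Y\<in>carrier ?Q. Y \<oplus>\<^bsub>?Q\<^esub> X = \<zero>\<^bsub>?Q\<^esub>" using x by (auto simp: car)
  next
    fix X Y assume "X \<in> carrier ?Q" "Y \<in> carrier ?Q"
    then show "X \<oplus>\<^bsub>?Q\<^esub> Y = Y \<oplus>\<^bsub>?Q\<^esub> X" by (auto simp: car add M.a_comm)
  qed (auto simp: car add zero M.a_assoc)
  then show Q: "module R ?Q"
    by (intro moduleI R.is_cring)
       (auto simp: car add smult smult_l_distr smult_r_distr smult_assoc1)
  show "lin R M ?Q (\<lambda>x. N +>\<^bsub>M\<^esub> x)"
    by (intro linI Q module_axioms) (auto simp: car add smult)
qed

context
  fixes K :: "('k, 'r) ring_scheme" and G :: "'g set" and R :: "('g \<Rightarrow> 'k) set"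
  assumes K: "cring K" and R: "R \<subseteq> carrier (free_module K G)"
begin

interpretation F: module K "free_module K G"
  by (rule module_free_module[OF K])

text \<open>\<open>hull\<close> intersects all submodules that contain \<open>R\<close>. The whole
  free module is among them, which keeps the intersection inside the carrier, and the closure
  properties pass to intersections.\<close>

lemma submodule_relation_span: "submodule (relation_span K G R) K (free_module K G)"
  unfolding relation_span_def
proof (rule F.submoduleI)
  let ?H = "(\<lambda>N. submodule N K (free_module K G)) hull R"
  have F: "submodule (carrier (free_module K G)) K (free_module K G)"
    by (rule F.submoduleI) (auto simp del: free_module_simps)
  show "?H \<subseteq> carrier (free_module K G)" by (rule hull_minimal) (use R F in auto)
  note * = F.submoduleE
  show "\<zero>\<^bsub>free_module K G\<^esub> \<in> ?H"
    unfolding hull_def using subgroup.one_closed[OF submodule.axioms(1)] by fastforce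
  show "\<ominus>\<^bsub>free_module K G\<^esub> a \<in> ?H" if "a \<in> ?H" for a
    using that *(3) unfolding hull_def by blast
  show "a \<oplus>\<^bsub>free_module K G\<^esub> b \<in> ?H" if "a \<in> ?H" "b \<in> ?H" for a b
    using that *(5) unfolding hull_def by blast
  show "a \<odot>\<^bsub>free_module K G\<^esub> b \<in> ?H" if "a \<in> carrier K" "b \<in> ?H" for a b
    using that *(4) unfolding hull_def by blast
qed

lemma module_presented: "module K (presented K G R)"
  unfolding presented_def by (rule F.module_quotient(1)[OF submodule_relation_span])

lemma lin_presented_proj:
  "lin K (free_module K G) (presented K G R) (\<lambda>x. relation_span K G R +>\<^bsub>free_module K G\<^esub> x)"
  unfolding presented_def by (rule F.module_quotient(2)[OF submodule_relation_span])

lemma presented_gen_closed: "g \<in> G ==> presented_gen K G R g \<in> carrier (presented K G R)"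
  unfolding presented_gen_def by (intro lin_closed[OF lin_presented_proj] free_gen_closed K)

lemma presented_eqI:
  assumes "lin K (presented K G R) U f" "lin K (presented K G R) U f'"
    "\<And>g. g \<in> G ==> f (presented_gen K G R g) = f' (presented_gen K G R g)"
    "x \<in> carrier (presented K G R)"
  shows "f x = f' x"
proof -
  let ?p = "\<lambda>x. relation_span K G R +>\<^bsub>free_module K G\<^esub> x"
  obtain y where y: "y \<in> carrier (free_module K G)" "x = ?p y"
    using assms(4) F.module_quotient(3)[OF submodule_relation_span] unfolding presented_def by auto
  note l = lin_comp[OF lin_presented_proj assms(1)] and l' = lin_comp[OF lin_presented_proj assms(2)]
  have "f (?p y) = f' (?p y)" using K y(1)
  proof (induction rule: free_module_induct)
    case (gen g)
    then show ?case using assms(3) by (simp add: presented_gen_def)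
  next
    case zero
    show ?case using lin_zero[OF l] lin_zero[OF l'] by simp
  next
    case (add x y)
    then show ?case using lin_add[OF l] lin_add[OF l'] by simp
  next
    case (smult c x)
    then show ?case using lin_smult[OF l] lin_smult[OF l'] by simp
  qed
  then show ?thesis using y by simp
qed

lemma presented_rel: "x \<in> R ==> relation_span K G R +>\<^bsub>free_module K G\<^esub> x = \<zero>\<^bsub>presented K G R\<^esub>"
  using R hull_inc[of x R] submodule_relation_span F.a_coset_join2
  unfolding presented_def quotient_module_def relation_span_def
  by (auto simp: submodule_def subset_iff)

lemma presented_rel_add:
  assumes "free_gen K g \<ominus>\<^bsub>free_module K G\<^esub> (free_gen K g1 \<oplus>\<^bsub>free_module K G\<^esub> free_gen K g2) \<in> R"
    "g \<in> G" "g1 \<in> G" "g2 \<in> G"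
  shows "presented_gen K G R g =
    presented_gen K G R g1 \<oplus>\<^bsub>presented K G R\<^esub> presented_gen K G R g2"
proof -
  interpret Q: module K "presented K G R" by (rule module_presented)
  note cl = assms(2-)[THEN free_gen_closed[OF K]]
  show ?thesis
  proof (rule Q.eq_if_minus_zero)
    show "presented_gen K G R g \<ominus>\<^bsub>presented K G R\<^esub> (presented_gen K G R g1 \<oplus>\<^bsub>presented K G R\<^esub> presented_gen K G R g2) = \<zero>\<^bsub>presented K G R\<^esub>"
      using presented_rel[OF assms(1)] cl assms(2-)
      by (simp add: lin_minus[OF lin_presented_proj] lin_add[OF lin_presented_proj]
        presented_gen_def[symmetric] del: free_module_simps)
  qed (use assms(2-) presented_gen_closed Q.a_closed Q.smult_closed in auto)
qed

lemma presented_rel_smult: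
  assumes "free_gen K g \<ominus>\<^bsub>free_module K G\<^esub> (c \<odot>\<^bsub>free_module K G\<^esub> free_gen K g1) \<in> R"
    "g \<in> G" "g1 \<in> G" "c \<in> carrier K"
  shows "presented_gen K G R g = c \<odot>\<^bsub>presented K G R\<^esub> presented_gen K G R g1"
proof -
  interpret Q: module K "presented K G R" by (rule module_presented)
  note cl = assms(2,3)[THEN free_gen_closed[OF K]]
  show ?thesis
  proof (rule Q.eq_if_minus_zero)
    show "presented_gen K G R g \<ominus>\<^bsub>presented K G R\<^esub> (c \<odot>\<^bsub>presented K G R\<^esub> presented_gen K G R g1) = \<zero>\<^bsub>presented K G R\<^esub>"
      using presented_rel[OF assms(1)] cl assms(2-)
      by (simp add: lin_minus[OF lin_presented_proj] lin_smult[OF lin_presented_proj]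
        presented_gen_def[symmetric] del: free_module_simps)
  qed (use assms(2-) presented_gen_closed Q.a_closed Q.smult_closed in auto)
qed

lemma presented_rel_eq:
  assumes "free_gen K g \<ominus>\<^bsub>free_module K G\<^esub> free_gen K g1 \<in> R" "g \<in> G" "g1 \<in> G"
  shows "presented_gen K G R g = presented_gen K G R g1"
proof -
  interpret Q: module K "presented K G R" by (rule module_presented)
  note cl = assms(2,3)[THEN free_gen_closed[OF K]]
  show ?thesis
  proof (rule Q.eq_if_minus_zero)
    show "presented_gen K G R g \<ominus>\<^bsub>presented K G R\<^esub> (presented_gen K G R g1) = \<zero>\<^bsub>presented K G R\<^esub>"
      using presented_rel[OF assms(1)] cl assms(2-)
      by (simp add: lin_minus[OF lin_presented_proj]
        presented_gen_def[symmetric] del: free_module_simps)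
  qed (use assms(2-) presented_gen_closed Q.a_closed Q.smult_closed in auto)
qed

context
  fixes U :: "('k, 'u, 'm) module_scheme" and \<beta> :: "'g \<Rightarrow> 'u"
  assumes U: "module K U" and \<beta>: "\<And>g. g \<in> G ==> \<beta> g \<in> carrier U"
    and rel: "\<And>x. x \<in> R ==> free_lift K U \<beta> x = \<zero>\<^bsub>U\<^esub>"
begin

interpretation U: module K U by (rule U)

lemma lin_fl: "lin K (free_module K G) U (free_lift K U \<beta>)"
  by (rule lin_free_lift) (use U \<beta> in auto)

text \<open>The vectors on which \<open>free_lift\<close> vanishes form a submodule that contains
  \<open>R\<close>, hence also its span. So \<open>free_lift\<close> is constant on each coset, the
  image in the definition of \<open>lift\<close> is a singleton, and \<open>the_elem\<close> returns
  its element.\<close>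

lemma lift_proj:
  assumes "x \<in> carrier (free_module K G)"
  shows "lift K U \<beta> (relation_span K G R +>\<^bsub>free_module K G\<^esub> x) = free_lift K U \<beta> x"
proof -
  let ?N = "relation_span K G R"
  let ?Z = "{x \<in> carrier (free_module K G). free_lift K U \<beta> x = \<zero>\<^bsub>U\<^esub>}"
  interpret N: submodule ?N K "free_module K G" by (rule submodule_relation_span)
  have neg: "free_lift K U \<beta> (\<ominus>\<^bsub>free_module K G\<^esub> a) = \<zero>\<^bsub>U\<^esub>"
    if "a \<in> carrier (free_module K G)" "free_lift K U \<beta> a = \<zero>\<^bsub>U\<^esub>" for a
    using lin_minus[OF lin_fl F.zero_closed that(1)] that lin_zero[OF lin_fl]
    by (simp add: a_minus_def del: free_module_simps)
  have "submodule ?Z K (free_module K G)"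
    by (rule F.submoduleI)
       (auto simp: lin_zero[OF lin_fl] lin_add[OF lin_fl] lin_smult[OF lin_fl] neg
         simp del: free_module_simps)
  then have NZ: "?N \<subseteq> ?Z"
    unfolding relation_span_def by (rule hull_minimal[rotated]) (use R rel in auto)
  have "free_lift K U \<beta> (n \<oplus>\<^bsub>free_module K G\<^esub> x) = free_lift K U \<beta> x" if "n \<in> ?N" for n
    using that NZ assms by (auto simp: lin_add[OF lin_fl] lin_closed[OF lin_fl] subset_iff
        simp del: free_module_simps)
  moreover have "\<zero>\<^bsub>free_module K G\<^esub> \<in> ?N" using N.one_closed by simp
  ultimately have "free_lift K U \<beta> ` (?N +>\<^bsub>free_module K G\<^esub> x) = {free_lift K U \<beta> x}"
    unfolding a_r_coset_def' image_UN by (auto simp del: free_module_simps intro!: bexI)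
  then show ?thesis by (simp add: lift_def free_lift_def[abs_def])
qed

lemma lin_presented_lift: "lin K (presented K G R) U (lift K U \<beta>)"
proof -
  let ?p = "\<lambda>x. relation_span K G R +>\<^bsub>free_module K G\<^esub> x"
  have ex: "\<exists>y. y \<in> carrier (free_module K G) \<and> x = ?p y" if "x \<in> carrier (presented K G R)" for x
    using that F.module_quotient(3)[OF submodule_relation_span] unfolding presented_def by auto
  show ?thesis
  proof (rule linI[OF module_presented U])
    fix x assume "x \<in> carrier (presented K G R)"
    then show "lift K U \<beta> x \<in> carrier U" using ex lift_proj lin_closed[OF lin_fl] by metis
  next
    fix x y assume "x \<in> carrier (presented K G R)" "y \<in> carrier (presented K G R)"
    then obtain x' y' where "x' \<in> carrier (free_module K G)" "x = ?p x'"
      "y' \<in> carrier (free_module K G)" "y = ?p y'" using ex by metis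
    then show "lift K U \<beta> (x \<oplus>\<^bsub>presented K G R\<^esub> y) = lift K U \<beta> x \<oplus>\<^bsub>U\<^esub> lift K U \<beta> y"
      by (simp add: lin_add[OF lin_presented_proj, symmetric] lift_proj lin_add[OF lin_fl]
          F.a_closed del: free_module_simps)
  next
    fix c x assume "c \<in> carrier K" "x \<in> carrier (presented K G R)"
    moreover then obtain x' where "x' \<in> carrier (free_module K G)" "x = ?p x'" using ex by metis
    ultimately show "lift K U \<beta> (c \<odot>\<^bsub>presented K G R\<^esub> x) = c \<odot>\<^bsub>U\<^esub> lift K U \<beta> x"
      by (simp add: lin_smult[OF lin_presented_proj, symmetric] lift_proj lin_smult[OF lin_fl]
          F.smult_closed del: free_module_simps)
  qed
qed

lemma presented_lift_gen: "g \<in> G ==> lift K U \<beta> (presented_gen K G R g) = \<beta> g"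
  unfolding presented_gen_def
  by (simp add: lift_proj free_gen_closed K free_lift_gen U \<beta>)

end

text \<open>With the next two lemmas this covers the shapes of relations that occur for tensor
  products and Fock spaces: additivity and homogeneity in a slot, and identification of two
  generators.\<close>

lemma free_lift_rel_add:
  assumes U: "module K U" and \<beta>: "\<And>g. g \<in> G ==> \<beta> g \<in> carrier U"
    and g: "g \<in> G" "g1 \<in> G" "g2 \<in> G" and eq: "\<beta> g = \<beta> g1 \<oplus>\<^bsub>U\<^esub> \<beta> g2"
  shows "free_lift K U \<beta> (free_gen K g \<ominus>\<^bsub>free_module K G\<^esub>
    (free_gen K g1 \<oplus>\<^bsub>free_module K G\<^esub> free_gen K g2)) = \<zero>\<^bsub>U\<^esub>"
proof -
  interpret U: module K U by fact
  have l: "lin K (free_module K G) U (free_lift K U \<beta>)" by (rule lin_free_lift) (use U \<beta> in auto)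
  show ?thesis
    using g eq \<beta> by (simp add: lin_minus[OF l] lin_add[OF l] free_gen_closed K free_lift_gen U
        U.r_neg U.minus_eq del: free_module_simps)
qed

lemma free_lift_rel_smult:
  assumes U: "module K U" and \<beta>: "\<And>g. g \<in> G ==> \<beta> g \<in> carrier U"
    and g: "g \<in> G" "g1 \<in> G" "c \<in> carrier K" and eq: "\<beta> g = c \<odot>\<^bsub>U\<^esub> \<beta> g1"
  shows "free_lift K U \<beta> (free_gen K g \<ominus>\<^bsub>free_module K G\<^esub>
    (c \<odot>\<^bsub>free_module K G\<^esub> free_gen K g1)) = \<zero>\<^bsub>U\<^esub>"
proof -
  interpret U: module K U by fact
  have l: "lin K (free_module K G) U (free_lift K U \<beta>)" by (rule lin_free_lift) (use U \<beta> in auto)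
  show ?thesis
    using g eq \<beta> by (simp add: lin_minus[OF l] lin_smult[OF l] free_gen_closed K free_lift_gen U
        U.r_neg U.minus_eq del: free_module_simps)
qed

lemma free_lift_rel_eq:
  assumes U: "module K U" and \<beta>: "\<And>g. g \<in> G ==> \<beta> g \<in> carrier U"
    and g: "g \<in> G" "g1 \<in> G" and eq: "\<beta> g = \<beta> g1"
  shows "free_lift K U \<beta> (free_gen K g \<ominus>\<^bsub>free_module K G\<^esub> free_gen K g1) = \<zero>\<^bsub>U\<^esub>"
proof -
  interpret U: module K U by fact
  have l: "lin K (free_module K G) U (free_lift K U \<beta>)" by (rule lin_free_lift) (use U \<beta> in auto)
  show ?thesis
    using g eq \<beta> by (simp add: lin_minus[OF l] free_gen_closed K free_lift_gen U
        U.r_neg U.minus_eq del: free_module_simps)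
qed

end

section \<open>Tensor products\<close>

definition bilin :: "('k, 'r) ring_scheme \<Rightarrow> ('k, 'a, 'm) module_scheme \<Rightarrow>
    ('k, 'b, 'n) module_scheme \<Rightarrow> ('k, 'u, 'q) module_scheme \<Rightarrow> ('a \<Rightarrow> 'b \<Rightarrow> 'u) \<Rightarrow> bool" where
  "bilin K A B U \<beta> \<longleftrightarrow> module K A \<and> module K B \<and> module K U \<and>
     (\<forall>a\<in>carrier A. lin K B U (\<beta> a)) \<and> (\<forall>b\<in>carrier B. lin K A U (\<lambda>a. \<beta> a b))"

lemma bilinI:
  assumes "module K A" "module K B" "module K U"
    "\<And>a. a \<in> carrier A ==> lin K B U (\<beta> a)"
    "\<And>b. b \<in> carrier B ==> lin K A U (\<lambda>a. \<beta> a b)"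
  shows "bilin K A B U \<beta>"
  using assms by (simp add: bilin_def)

lemma bilin_left: "bilin K A B U \<beta> ==> b \<in> carrier B ==> lin K A U (\<lambda>a. \<beta> a b)"
  and bilin_right: "bilin K A B U \<beta> ==> a \<in> carrier A ==> lin K B U (\<beta> a)"
  and bilin_closed: "bilin K A B U \<beta> ==> a \<in> carrier A ==> b \<in> carrier B ==> \<beta> a b \<in> carrier U"
  by (auto simp: bilin_def intro: lin_closed)

lemma bilin_comp:
  assumes "bilin K A B U \<beta>" "lin K C A f" "lin K D B g" "lin K U W h"
  shows "bilin K C D W (\<lambda>c d. h (\<beta> (f c) (g d)))"
proof (rule bilinI)
  fix c assume "c \<in> carrier C"
  then show "lin K D W (\<lambda>d. h (\<beta> (f c) (g d)))"
    using assms lin_closed[OF assms(2)]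
    by (intro lin_comp[OF _ assms(4)] lin_comp[OF assms(3)] bilin_right)
next
  fix d assume "d \<in> carrier D"
  then show "lin K C W (\<lambda>c. h (\<beta> (f c) (g d)))"
    using assms lin_closed[OF assms(3)]
    by (intro lin_comp[OF _ assms(4)] lin_comp[OF assms(2), where g = "\<lambda>a. \<beta> a (g d)" for d] bilin_left)
qed (use assms lin_dom lin_cod in auto)

text \<open>The records \<open>tensor_space\<close> and \<open>tensor\<close>, and likewise
  \<open>fock_space\<close> and \<open>fock_alg\<close>, agree as vector spaces and differ only in
  product and unit. This lemma and the next two carry facts from one record to another.\<close>

lemma module_fields_cong:
  assumes "module K M" "carrier N = carrier M" "zero N = zero M" "add N = add M" "smult N = smult M"
  shows "module K N"
proof -
  interpret M: module K M by fact
  have "abelian_group N"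
  proof (rule abelian_groupI)
    fix x assume "x \<in> carrier N"
    then show "\<exists>y\<in>carrier N. y \<oplus>\<^bsub>N\<^esub> x = \<zero>\<^bsub>N\<^esub>"
      using M.l_neg[of x] M.a_inv_closed[of x] unfolding assms(2-) by blast
  qed (auto simp: assms(2-) M.a_assoc intro: M.a_comm)
  then show ?thesis
    by (intro moduleI M.R.is_cring)
       (simp_all add: assms(2-) M.smult_l_distr M.smult_r_distr M.smult_assoc1)
qed

lemma lin_fields_cong:
  assumes "lin K M N f" "carrier N' = carrier N" "zero N' = zero N" "add N' = add N" "smult N' = smult N"
    "carrier M' = carrier M" "zero M' = zero M" "add M' = add M" "smult M' = smult M"
  shows "lin K M' N' f"
  using module_fields_cong[OF lin_cod[OF assms(1)] assms(2-5)]
    module_fields_cong[OF lin_dom[OF assms(1)] assms(6-)] assms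
  unfolding lin_def linear_map_def by simp

lemma lift_fields_cong:
  assumes "carrier N = carrier M" "zero N = zero M" "add N = add M" "smult N = smult M"
  shows "lift K N = lift K M"
  by (simp add: fun_eq_iff lift_def finsum_def finprod_def assms)

lemma tensor_fields:
  "carrier (tensor K A B) = carrier (tensor_space K A B)"
  "zero (tensor K A B) = zero (tensor_space K A B)"
  "add (tensor K A B) = add (tensor_space K A B)"
  "smult (tensor K A B) = smult (tensor_space K A B)"
  by (simp_all add: tensor_def)

lemma tensor_rels_closed:
  assumes "module K A" "module K B"
  shows "tensor_rels K A B \<subseteq> carrier (free_module K (carrier A \<times> carrier B))"
proof -
  interpret A: module K A by fact
  interpret B: module K B by fact
  interpret F: module K "free_module K (carrier A \<times> carrier B)"
    by (rule module_free_module) (rule A.R.is_cring)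
  note [simp] = free_gen_closed[OF A.R.is_cring]
  show ?thesis unfolding tensor_rels_def Let_def
    by (intro Un_least subsetI) (auto simp del: free_module_simps intro!: F.minus_closed F.a_closed)
qed

context
  fixes K :: "('k, 'r) ring_scheme" and A :: "('k, 'a, 'm) module_scheme"
    and B :: "('k, 'b, 'n) module_scheme"
  assumes A: "module K A" and B: "module K B"
begin

interpretation A: module K A by (rule A)
interpretation B: module K B by (rule B)

lemma module_tensor: "module K (tensor K A B)"
proof -
  have "module K (tensor_space K A B)" unfolding tensor_space_def
    by (intro module_presented A.R.is_cring tensor_rels_closed A B)
  then show ?thesis by (rule module_fields_cong) (simp_all add: tensor_fields)
qed

lemma tens_closed: "a \<in> carrier A ==> b \<in> carrier B ==> tens K A B a b \<in> carrier (tensor K A B)"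
  unfolding tens_def tensor_fields tensor_space_def
  by (intro presented_gen_closed A.R.is_cring tensor_rels_closed A B) auto

lemma bilin_tens: "bilin K A B (tensor K A B) (tens K A B)"
proof (intro bilinI linI A B module_tensor tens_closed)
  note * = A.R.is_cring tensor_rels_closed[OF A B]
  fix a b assume ab: "a \<in> carrier A" "b \<in> carrier B"
  {
    fix b' assume "b' \<in> carrier B"
    then show "tens K A B a (b \<oplus>\<^bsub>B\<^esub> b') = tens K A B a b \<oplus>\<^bsub>tensor K A B\<^esub> tens K A B a b'"
      unfolding tens_def tensor_fields tensor_space_def using ab
      by (intro presented_rel_add *) (auto simp: tensor_rels_def Let_def)
  next
    fix a' assume "a' \<in> carrier A"
    then show "tens K A B (a \<oplus>\<^bsub>A\<^esub> a') b = tens K A B a b \<oplus>\<^bsub>tensor K A B\<^esub> tens K A B a' b"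
      unfolding tens_def tensor_fields tensor_space_def using ab
      by (intro presented_rel_add *) (auto simp: tensor_rels_def Let_def)
  next
    fix c assume "c \<in> carrier K"
    then show "tens K A B a (c \<odot>\<^bsub>B\<^esub> b) = c \<odot>\<^bsub>tensor K A B\<^esub> tens K A B a b"
      unfolding tens_def tensor_fields tensor_space_def using ab
      by (intro presented_rel_smult *) (auto simp: tensor_rels_def Let_def)
  next
    fix c assume "c \<in> carrier K"
    then show "tens K A B (c \<odot>\<^bsub>A\<^esub> a) b = c \<odot>\<^bsub>tensor K A B\<^esub> tens K A B a b"
      unfolding tens_def tensor_fields tensor_space_def using ab
      by (intro presented_rel_smult *) (auto simp: tensor_rels_def Let_def)
  }
qed

lemma tensor_eqI:
  assumes f: "lin K (tensor K A B) U f" and f': "lin K (tensor K A B) U f'"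
    and eq: "\<And>a b. a \<in> carrier A ==> b \<in> carrier B ==> f (tens K A B a b) = f' (tens K A B a b)"
    and t: "t \<in> carrier (tensor K A B)"
  shows "f t = f' t"
proof -
  have "lin K (tensor_space K A B) U f" "lin K (tensor_space K A B) U f'"
    using f f' by (auto elim!: lin_fields_cong simp: tensor_fields)
  then show ?thesis
    using t eq unfolding tens_def tensor_fields tensor_space_def
    by (intro presented_eqI[OF A.R.is_cring tensor_rels_closed[OF A B], where x = t and f = f and f' = f'])
       auto
qed

context
  fixes U :: "('k, 'u, 'q) module_scheme" and \<beta> :: "'a \<Rightarrow> 'b \<Rightarrow> 'u"
  assumes \<beta>: "bilin K A B U \<beta>"
begin

lemma tensor_rels_lift:
  assumes "x \<in> tensor_rels K A B"
  shows "free_lift K U (\<lambda>(a, b). \<beta> a b) x = \<zero>\<^bsub>U\<^esub>"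
proof -
  note * = A.R.is_cring tensor_rels_closed[OF A B]
  have U: "module K U" using \<beta> by (simp add: bilin_def)
  have cl: "(case g of (a, b) \<Rightarrow> \<beta> a b) \<in> carrier U" if "g \<in> carrier A \<times> carrier B" for g
    using that bilin_closed[OF \<beta>] by auto
  note l = lin_add[OF bilin_left[OF \<beta>]] lin_add[OF bilin_right[OF \<beta>]]
    lin_smult[OF bilin_left[OF \<beta>]] lin_smult[OF bilin_right[OF \<beta>]]
  show ?thesis using assms unfolding tensor_rels_def Let_def
    by (elim UnE CollectE exE conjE; hypsubst)
       ((intro free_lift_rel_add[OF * U] cl; simp add: l), (intro free_lift_rel_add[OF * U] cl; simp add: l),
        (intro free_lift_rel_smult[OF * U] cl; simp add: l), (intro free_lift_rel_smult[OF * U] cl; simp add: l))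
qed

lemma lin_tensor_lift: "lin K (tensor K A B) U (lift K U (\<lambda>(a, b). \<beta> a b))"
proof -
  have U: "module K U" using \<beta> by (simp add: bilin_def)
  have "lin K (tensor_space K A B) U (lift K U (\<lambda>(a, b). \<beta> a b))"
    unfolding tensor_space_def
    by (rule lin_presented_lift[OF A.R.is_cring tensor_rels_closed[OF A B] U _ tensor_rels_lift])
       (auto intro: bilin_closed[OF \<beta>])
  then show ?thesis by (auto elim!: lin_fields_cong simp: tensor_fields)
qed

lemma tensor_lift_tens:
  "a \<in> carrier A ==> b \<in> carrier B ==> lift K U (\<lambda>(a, b). \<beta> a b) (tens K A B a b) = \<beta> a b"
proof -
  have U: "module K U" using \<beta> by (simp add: bilin_def)
  assume "a \<in> carrier A" "b \<in> carrier B"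
  then show ?thesis
    unfolding tens_def
    by (subst presented_lift_gen[OF A.R.is_cring tensor_rels_closed[OF A B] U _ tensor_rels_lift])
       (auto intro: bilin_closed[OF \<beta>])
qed

end

end

lemma lin_tens_left: "module K A ==> module K B ==> b \<in> carrier B ==>
    lin K A (tensor K A B) (\<lambda>a. tens K A B a b)"
  and lin_tens_right: "module K A ==> module K B ==> a \<in> carrier A ==>
    lin K B (tensor K A B) (tens K A B a)"
  using bilin_tens by (auto intro: bilin_left bilin_right)

text \<open>The rule behind nested lifts, where the inner lift depends on the variables of the outer
  one. The identities to be shown compare linear maps out of the tensor product, and those only have
  to be checked on pure tensors, where they are the assumed linearity in the parameter.\<close>

lemma lin_tensor_lift_param:
  assumes "module K A" "module K B" "module K M"
    and "\<And>m. m \<in> carrier M ==> bilin K A B U (\<beta> m)"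
    and "\<And>a b. a \<in> carrier A ==> b \<in> carrier B ==> lin K M U (\<lambda>m. \<beta> m a b)"
    and t: "t \<in> carrier (tensor K A B)"
  shows "lin K M U (\<lambda>m. lift K U (\<lambda>(a, b). \<beta> m a b) t)"
proof -
  interpret M: module K M by fact
  have U: "module K U" using assms(4)[OF M.zero_closed] by (simp add: bilin_def)
  interpret U: module K U by (rule U)
  note l = lin_tensor_lift[OF assms(1,2,4)] and v = tensor_lift_tens[OF assms(1,2,4)]
  show ?thesis
  proof (rule linI[OF assms(3) U])
    fix m assume "m \<in> carrier M"
    then show "lift K U (\<lambda>(a, b). \<beta> m a b) t \<in> carrier U" by (intro lin_closed[OF l] t)
  next
    fix x y assume xy: "x \<in> carrier M" "y \<in> carrier M"
    show "lift K U (\<lambda>(a, b). \<beta> (x \<oplus>\<^bsub>M\<^esub> y) a b) t =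
      lift K U (\<lambda>(a, b). \<beta> x a b) t \<oplus>\<^bsub>U\<^esub> lift K U (\<lambda>(a, b). \<beta> y a b) t"
      by (rule tensor_eqI[OF assms(1,2) _ _ _ t, where f = "lift K U (\<lambda>(a, b). \<beta> (x \<oplus>\<^bsub>M\<^esub> y) a b)"])
         (use xy in \<open>auto intro!: lin_plus l simp: v lin_add[OF assms(5)]\<close>)
  next
    fix c x assume cx: "c \<in> carrier K" "x \<in> carrier M"
    show "lift K U (\<lambda>(a, b). \<beta> (c \<odot>\<^bsub>M\<^esub> x) a b) t = c \<odot>\<^bsub>U\<^esub> lift K U (\<lambda>(a, b). \<beta> x a b) t"
      by (rule tensor_eqI[OF assms(1,2) _ _ _ t, where f = "lift K U (\<lambda>(a, b). \<beta> (c \<odot>\<^bsub>M\<^esub> x) a b)"])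
         (use cx in \<open>auto intro!: lin_scale l simp: v lin_smult[OF assms(5)]\<close>)
  qed
qed

lemma tensor_eqI3_left:
  assumes "module K A" "module K B" "module K C"
    and f: "lin K (tensor K (tensor K A B) C) U f" and f': "lin K (tensor K (tensor K A B) C) U f'"
    and eq: "\<And>a b c. a \<in> carrier A ==> b \<in> carrier B ==> c \<in> carrier C ==>
      f (tens K (tensor K A B) C (tens K A B a b) c) = f' (tens K (tensor K A B) C (tens K A B a b) c)"
    and t: "t \<in> carrier (tensor K (tensor K A B) C)"
  shows "f t = f' t"
proof (rule tensor_eqI[OF module_tensor[OF assms(1,2)] assms(3) f f' _ t])
  fix s c assume s: "s \<in> carrier (tensor K A B)" and c: "c \<in> carrier C"
  note l = lin_comp[OF lin_tens_left[OF module_tensor[OF assms(1,2)] assms(3) c]]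
  show "f (tens K (tensor K A B) C s c) = f' (tens K (tensor K A B) C s c)"
    by (rule tensor_eqI[OF assms(1,2) l[OF f] l[OF f'] _ s]) (rule eq[OF _ _ c])
qed

lemma tensor_eqI4:
  assumes "module K A" "module K B" "module K C" "module K D"
    and f: "lin K (tensor K (tensor K A B) (tensor K C D)) U f"
    and f': "lin K (tensor K (tensor K A B) (tensor K C D)) U f'"
    and eq: "\<And>a b c d. a \<in> carrier A ==> b \<in> carrier B ==> c \<in> carrier C ==> d \<in> carrier D ==>
      f (tens K (tensor K A B) (tensor K C D) (tens K A B a b) (tens K C D c d)) =
      f' (tens K (tensor K A B) (tensor K C D) (tens K A B a b) (tens K C D c d))"
    and t: "t \<in> carrier (tensor K (tensor K A B) (tensor K C D))"
  shows "f t = f' t"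
proof (rule tensor_eqI3_left[OF assms(1,2) module_tensor[OF assms(3,4)] f f' _ t])
  fix a b s assume ab: "a \<in> carrier A" "b \<in> carrier B" and s: "s \<in> carrier (tensor K C D)"
  note l = lin_comp[OF lin_tens_right[OF module_tensor[OF assms(1,2)] module_tensor[OF assms(3,4)]
      tens_closed[OF assms(1,2) ab]]]
  show "f (tens K (tensor K A B) (tensor K C D) (tens K A B a b) s) =
      f' (tens K (tensor K A B) (tensor K C D) (tens K A B a b) s)"
    by (rule tensor_eqI[OF assms(3,4) l[OF f] l[OF f'] _ s]) (rule eq[OF ab])
qed

lemma lin_tmap:
  assumes "lin K C A f" "lin K D B g"
  shows "lin K (tensor K C D) (tensor K A B) (tmap K A B f g)"
  unfolding tmap_def
  by (intro lin_tensor_lift bilin_comp[OF bilin_tens, where h = "\<lambda>x. x"] assms lin_id module_tensor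
      lin_dom[OF assms(1)] lin_dom[OF assms(2)] lin_cod[OF assms(1)] lin_cod[OF assms(2)])

lemma tmap_tens:
  assumes "lin K C A f" "lin K D B g" "c \<in> carrier C" "d \<in> carrier D"
  shows "tmap K A B f g (tens K C D c d) = tens K A B (f c) (g d)"
  unfolding tmap_def
  by (rule tensor_lift_tens, intro lin_dom[OF assms(1)], intro lin_dom[OF assms(2)])
     (intro bilin_comp[OF bilin_tens, where h = "\<lambda>x. x"] assms lin_id module_tensor
      lin_cod[OF assms(1)] lin_cod[OF assms(2)])+

lemma tmap_comp:
  assumes "lin K C A f" "lin K D B g" "lin K A A' f'" "lin K B B' g'" "t \<in> carrier (tensor K C D)"
  shows "tmap K A' B' f' g' (tmap K A B f g t) = tmap K A' B' (\<lambda>x. f' (f x)) (\<lambda>x. g' (g x)) t"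
proof (rule tensor_eqI[OF lin_dom[OF assms(1)] lin_dom[OF assms(2)] _ _ _ assms(5)])
  fix c d assume "c \<in> carrier C" "d \<in> carrier D"
  then show "tmap K A' B' f' g' (tmap K A B f g (tens K C D c d)) =
      tmap K A' B' (\<lambda>x. f' (f x)) (\<lambda>x. g' (g x)) (tens K C D c d)"
    by (simp add: tmap_tens[OF assms(1,2)] tmap_tens[OF assms(3,4)] lin_closed[OF assms(1)]
        lin_closed[OF assms(2)] tmap_tens[OF lin_comp[OF assms(1,3)] lin_comp[OF assms(2,4)]])
qed (rule lin_comp[OF lin_tmap[OF assms(1,2)] lin_tmap[OF assms(3,4)]],
    rule lin_tmap[OF lin_comp[OF assms(1,3)] lin_comp[OF assms(2,4)]])

lemma tmap_cong:
  assumes "lin K C A f" "lin K D B g" "t \<in> carrier (tensor K C D)"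
    "\<And>c. c \<in> carrier C ==> f c = f' c" "\<And>d. d \<in> carrier D ==> g d = g' d"
  shows "tmap K A B f g t = tmap K A B f' g' t"
proof -
  have l: "lin K C A f'" "lin K D B g'" using assms lin_cong by metis+
  show ?thesis
    by (rule tensor_eqI[OF lin_dom[OF assms(1)] lin_dom[OF assms(2)] _ _ _ assms(3)])
       (auto intro!: lin_tmap assms(1,2) l simp: tmap_tens[OF assms(1,2)] tmap_tens[OF l] assms(4,5))
qed

lemma tmap_id:
  assumes "module K A" "module K B" "t \<in> carrier (tensor K A B)"
    "\<And>a. a \<in> carrier A ==> f a = a" "\<And>b. b \<in> carrier B ==> g b = b"
  shows "tmap K A B f g t = t"
proof -
  have "lin K A A f" "lin K B B g"
    using assms by (auto intro: lin_cong[OF lin_id])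
  then show ?thesis
    by (intro tensor_eqI[OF assms(1,2) _ _ _ assms(3), where f' = "\<lambda>x. x"])
       (auto intro!: lin_tmap lin_id module_tensor assms(1,2) simp: tmap_tens assms)
qed

lemma tmap_sum_left:
  assumes "\<And>i. i \<in> S ==> lin K C A (f i)" "module K C" "module K A" "lin K D B g"
    "t \<in> carrier (tensor K C D)"
  shows "tmap K A B (\<lambda>x. finsum A (\<lambda>i. f i x) S) g t =
    finsum (tensor K A B) (\<lambda>i. tmap K A B (f i) g t) S"
proof -
  note D = lin_dom[OF assms(4)] and B = lin_cod[OF assms(4)]
  have s: "lin K C A (\<lambda>x. finsum A (\<lambda>i. f i x) S)" by (intro lin_sum assms)
  show ?thesis
  proof (rule tensor_eqI[OF assms(2) D _ _ _ assms(5)])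
    fix c d assume cd: "c \<in> carrier C" "d \<in> carrier D"
    interpret T: module K "tensor K A B" by (rule module_tensor[OF assms(3) B])
    have "tens K A B (finsum A (\<lambda>i. f i c) S) (g d) =
        finsum (tensor K A B) (\<lambda>i. tens K A B (f i c) (g d)) S"
      using cd lin_closed[OF assms(1)]
      by (intro lin_finsum[OF lin_tens_left[OF assms(3) B]] lin_closed[OF assms(4)]) auto
    also have "\<dots> = finsum (tensor K A B) (\<lambda>i. tmap K A B (f i) g (tens K C D c d)) S"
      using cd lin_closed[OF assms(1)] lin_closed[OF assms(4)] lin_closed[OF lin_tmap[OF assms(1,4)]]
        tens_closed[OF assms(2) D]
      by (intro T.finsum_cong') (auto simp: tmap_tens[OF assms(1,4)] intro!: tens_closed B assms)
    finally show "tmap K A B (\<lambda>x. finsum A (\<lambda>i. f i x) S) g (tens K C D c d) =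
        finsum (tensor K A B) (\<lambda>i. tmap K A B (f i) g (tens K C D c d)) S"
      using cd by (simp add: tmap_tens[OF s assms(4)])
  qed (rule lin_tmap[OF s assms(4)],
      rule lin_sum[OF module_tensor[OF assms(2) D] module_tensor[OF assms(3) B] lin_tmap[OF assms(1,4)]])
qed

lemma tmap_sum_right:
  assumes "\<And>i. i \<in> S ==> lin K D B (g i)" "module K D" "module K B" "lin K C A f"
    "t \<in> carrier (tensor K C D)"
  shows "tmap K A B f (\<lambda>x. finsum B (\<lambda>i. g i x) S) t =
    finsum (tensor K A B) (\<lambda>i. tmap K A B f (g i) t) S"
proof -
  note C = lin_dom[OF assms(4)] and A = lin_cod[OF assms(4)]
  have s: "lin K D B (\<lambda>x. finsum B (\<lambda>i. g i x) S)" by (intro lin_sum assms)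
  show ?thesis
  proof (rule tensor_eqI[OF C assms(2) _ _ _ assms(5)])
    fix c d assume cd: "c \<in> carrier C" "d \<in> carrier D"
    interpret T: module K "tensor K A B" by (rule module_tensor[OF A assms(3)])
    have "tens K A B (f c) (finsum B (\<lambda>i. g i d) S) =
        finsum (tensor K A B) (\<lambda>i. tens K A B (f c) (g i d)) S"
      using cd lin_closed[OF assms(1)]
      by (intro lin_finsum[OF lin_tens_right[OF A assms(3)]] lin_closed[OF assms(4)]) auto
    also have "\<dots> = finsum (tensor K A B) (\<lambda>i. tmap K A B f (g i) (tens K C D c d)) S"
      using cd lin_closed[OF assms(1)] lin_closed[OF assms(4)] lin_closed[OF lin_tmap[OF assms(4,1)]]
        tens_closed[OF C assms(2)]
      by (intro T.finsum_cong') (auto simp: tmap_tens[OF assms(4,1)] intro!: tens_closed A assms)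
    finally show "tmap K A B f (\<lambda>x. finsum B (\<lambda>i. g i x) S) (tens K C D c d) =
        finsum (tensor K A B) (\<lambda>i. tmap K A B f (g i) (tens K C D c d)) S"
      using cd by (simp add: tmap_tens[OF assms(4) s])
  qed (rule lin_tmap[OF assms(4) s],
      rule lin_sum[OF module_tensor[OF C assms(2)] module_tensor[OF A assms(3)] lin_tmap[OF assms(4,1)]])
qed

lemma lin_tmap_param_left:
  assumes "\<And>m. m \<in> carrier M ==> lin K C A (f m)" "\<And>c. c \<in> carrier C ==> lin K M A (\<lambda>m. f m c)"
    "module K M" "module K C" "module K A" "lin K D B g" "t \<in> carrier (tensor K C D)"
  shows "lin K M (tensor K A B) (\<lambda>m. tmap K A B (f m) g t)"
  unfolding tmap_def
proof (rule lin_tensor_lift_param[OF assms(4) lin_dom[OF assms(6)] assms(3) _ _ assms(7)])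
  fix m assume "m \<in> carrier M"
  then show "bilin K C D (tensor K A B) (\<lambda>c d. tens K A B (f m c) (g d))"
    by (intro bilin_comp[OF bilin_tens, where h = "\<lambda>x. x"] assms lin_id module_tensor lin_cod[OF assms(6)])
next
  fix c d assume "c \<in> carrier C" "d \<in> carrier D"
  then show "lin K M (tensor K A B) (\<lambda>m. tens K A B (f m c) (g d))"
    by (intro lin_comp[OF assms(2)] lin_tens_left lin_closed[OF assms(6)] lin_cod[OF assms(6)] assms)
qed

lemma lin_tmap_param_right:
  assumes "\<And>m. m \<in> carrier M ==> lin K D B (g m)" "\<And>d. d \<in> carrier D ==> lin K M B (\<lambda>m. g m d)"
    "module K M" "module K D" "module K B" "lin K C A f" "t \<in> carrier (tensor K C D)"
  shows "lin K M (tensor K A B) (\<lambda>m. tmap K A B f (g m) t)"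
  unfolding tmap_def
proof (rule lin_tensor_lift_param[OF lin_dom[OF assms(6)] assms(4) assms(3) _ _ assms(7)])
  fix m assume "m \<in> carrier M"
  then show "bilin K C D (tensor K A B) (\<lambda>c d. tens K A B (f c) (g m d))"
    by (intro bilin_comp[OF bilin_tens, where h = "\<lambda>x. x"] assms lin_id module_tensor lin_cod[OF assms(6)])
next
  fix c d assume "c \<in> carrier C" "d \<in> carrier D"
  then show "lin K M (tensor K A B) (\<lambda>m. tens K A B (f c) (g m d))"
    by (intro lin_comp[OF assms(2)] lin_tens_right lin_closed[OF assms(6)] lin_cod[OF assms(6)] assms)
qed

text \<open>In \<open>tassoc\<close>, in \<open>tswap\<close> and in the product on
  \<open>tensor\<close> one tensor is expanded inside the expansion of another; bilinearity is
  passed outward through this rule.\<close>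

lemma bilin_lift:
  assumes "module K A" "module K B" "module K M"
    "\<And>m. m \<in> carrier M ==> bilin K A B U (\<beta> m)"
    "\<And>a b. a \<in> carrier A ==> b \<in> carrier B ==> lin K M U (\<lambda>m. \<beta> m a b)"
  shows "bilin K (tensor K A B) M U (\<lambda>s m. lift K U (\<lambda>(a, b). \<beta> m a b) s)"
proof -
  interpret M: module K M by fact
  have U: "module K U" using assms(4)[OF M.zero_closed] by (simp add: bilin_def)
  show ?thesis
    by (rule bilinI[OF module_tensor[OF assms(1,2)] assms(3) U])
       (auto intro!: lin_tensor_lift lin_tensor_lift_param assms)
qed

lemma bilin_flip: "bilin K A B U \<beta> ==> bilin K B A U (\<lambda>b a. \<beta> a b)"
  by (auto simp: bilin_def)

context
  fixes K :: "('k, 'r) ring_scheme" and A :: "('k, 'a, 'm) module_scheme"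
    and B :: "('k, 'b, 'n) module_scheme" and C :: "('k, 'c, 'q) module_scheme"
  assumes A: "module K A" and B: "module K B" and C: "module K C"
begin

lemma tassoc_bilin1: "c \<in> carrier C ==>
    bilin K A B (tensor K A (tensor K B C)) (\<lambda>a b. tens K A (tensor K B C) a (tens K B C b c))"
  by (intro bilin_comp[OF bilin_tens, where h = "\<lambda>x. x" and f = "\<lambda>x. x"] lin_id module_tensor
      lin_tens_left A B C)

lemma tassoc_bilin: "bilin K (tensor K A B) C (tensor K A (tensor K B C))
    (\<lambda>s c. lift K (tensor K A (tensor K B C)) (\<lambda>(a, b). tens K A (tensor K B C) a (tens K B C b c)) s)"
  by (intro bilin_lift[OF A B C] tassoc_bilin1 lin_comp[OF lin_tens_right[OF B C]] lin_tens_right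
      module_tensor A B C)

lemma lin_tassoc: "lin K (tensor K (tensor K A B) C) (tensor K A (tensor K B C)) (tassoc K A B C)"
  unfolding tassoc_def Let_def by (intro lin_tensor_lift module_tensor A B C tassoc_bilin)

lemma tassoc_tens:
  assumes "a \<in> carrier A" "b \<in> carrier B" "c \<in> carrier C"
  shows "tassoc K A B C (tens K (tensor K A B) C (tens K A B a b) c) =
    tens K A (tensor K B C) a (tens K B C b c)"
  unfolding tassoc_def Let_def
  by (simp add: tensor_lift_tens[OF module_tensor[OF A B] C tassoc_bilin] assms tens_closed A B
      tensor_lift_tens[OF A B tassoc_bilin1])

end

lemma tassoc_tmap:
  assumes "lin K A A' f" "lin K B B' g" "lin K C C' h" "t \<in> carrier (tensor K (tensor K A B) C)"
  shows "tassoc K A' B' C' (tmap K (tensor K A' B') C' (tmap K A' B' f g) h t) =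
    tmap K A' (tensor K B' C') f (tmap K B' C' g h) (tassoc K A B C t)"
proof -
  note m = lin_dom[OF assms(1)] lin_dom[OF assms(2)] lin_dom[OF assms(3)]
  note m' = lin_cod[OF assms(1)] lin_cod[OF assms(2)] lin_cod[OF assms(3)]
  note l1 = lin_tmap[OF assms(1,2)] and l2 = lin_tmap[OF assms(2,3)]
  show ?thesis
    by (rule tensor_eqI3_left[OF m _ _ _ assms(4)],
        rule lin_comp[OF lin_tmap[OF l1 assms(3)] lin_tassoc[OF m']],
        rule lin_comp[OF lin_tassoc[OF m] lin_tmap[OF assms(1) l2]])
       (simp add: tmap_tens[OF l1 assms(3)] tmap_tens[OF assms(1,2)] tassoc_tens[OF m']
         tassoc_tens[OF m] tmap_tens[OF assms(1) l2] tmap_tens[OF assms(2,3)] tens_closed m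
         lin_closed[OF assms(1)] lin_closed[OF assms(2)] lin_closed[OF assms(3)])
qed

context
  fixes K :: "('k, 'r) ring_scheme" and A :: "('k, 'a, 'm) module_scheme"
    and B :: "('k, 'b, 'n) module_scheme" and C :: "('k, 'c, 'q) module_scheme"
    and D :: "('k, 'd, 's) module_scheme"
  assumes A: "module K A" and B: "module K B" and C: "module K C" and D: "module K D"
begin

abbreviation (input) "sw_target \<equiv> tensor K (tensor K A C) (tensor K B D)"
abbreviation (input) "sw_tens a b c d \<equiv>
  tens K (tensor K A C) (tensor K B D) (tens K A C a c) (tens K B D b d)"

lemma sw_bilin1: "a \<in> carrier A ==> b \<in> carrier B ==> bilin K C D sw_target (\<lambda>c d. sw_tens a b c d)"
  by (intro bilin_comp[OF bilin_tens, where h = "\<lambda>x. x"] lin_id module_tensor lin_tens_right A B C D)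

lemma sw_bilin2: "c \<in> carrier C ==> d \<in> carrier D ==> bilin K A B sw_target (\<lambda>a b. sw_tens a b c d)"
  by (intro bilin_comp[OF bilin_tens, where h = "\<lambda>x. x"] lin_id module_tensor lin_tens_left A B C D)

lemma sw_bilin3:
  assumes "t \<in> carrier (tensor K C D)"
  shows "bilin K A B sw_target (\<lambda>a b. lift K sw_target (\<lambda>(c, d). sw_tens a b c d) t)"
  by (rule bilinI[OF A B])
     (auto intro!: module_tensor A B C D lin_tensor_lift_param[OF C D _ _ _ assms] sw_bilin1
       bilin_left[OF sw_bilin2] bilin_right[OF sw_bilin2])

lemma sw_bilin4: "bilin K (tensor K A B) (tensor K C D) sw_target
  (\<lambda>s t. lift K sw_target (\<lambda>(a, b). lift K sw_target (\<lambda>(c, d). sw_tens a b c d) t) s)"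
  by (intro bilin_lift sw_bilin3 lin_tensor_lift sw_bilin1 A B C D module_tensor)

lemma lin_tswap: "lin K (tensor K (tensor K A B) (tensor K C D)) sw_target (tswap K A B C D)"
  unfolding tswap_def Let_def by (intro lin_tensor_lift module_tensor A B C D sw_bilin4)

lemma tswap_tens:
  assumes "a \<in> carrier A" "b \<in> carrier B" "c \<in> carrier C" "d \<in> carrier D"
  shows "tswap K A B C D (tens K (tensor K A B) (tensor K C D) (tens K A B a b) (tens K C D c d)) =
    sw_tens a b c d"
  unfolding tswap_def Let_def
  by (simp add: tensor_lift_tens[OF module_tensor[OF A B] module_tensor[OF C D] sw_bilin4] assms
      tens_closed A B C D tensor_lift_tens[OF A B sw_bilin3] tensor_lift_tens[OF C D sw_bilin1])

end

lemma lin_m1324: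
  assumes "module K A" "module K B" "module K C" "module K D" "lin K (tensor K B D) E m"
  shows "lin K (tensor K (tensor K A B) (tensor K C D)) (tensor K (tensor K A C) E) (m1324 K A B C D E m)"
  unfolding m1324_def
  using assms by (intro lin_comp[OF lin_tswap] lin_tmap) (auto simp: id_def intro: lin_id module_tensor)

lemma m1324_tens:
  assumes "module K A" "module K B" "module K C" "module K D" "lin K (tensor K B D) E m"
    "a \<in> carrier A" "b \<in> carrier B" "c \<in> carrier C" "d \<in> carrier D"
  shows "m1324 K A B C D E m (tens K (tensor K A B) (tensor K C D) (tens K A B a b) (tens K C D c d)) =
    tens K (tensor K A C) E (tens K A C a c) (m (tens K B D b d))"
proof -
  have i: "lin K (tensor K A C) (tensor K A C) id"
    using assms by (auto simp: id_def intro: lin_id module_tensor)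
  show ?thesis unfolding m1324_def
    by (simp add: tswap_tens assms tmap_tens[OF i assms(5)] tens_closed)
qed

context
  fixes K :: "('k, 'r) ring_scheme" and A :: "('k, 'a, 'm) module_scheme"
    and M :: "('k, 'b, 'n) module_scheme" and \<epsilon>
  assumes M: "module K M" and \<epsilon>: "lin K A (self_module K) \<epsilon>"
begin

interpretation M: module K M by (rule M)

lemma eval_bilin: "bilin K A M M (\<lambda>a b. \<epsilon> a \<odot>\<^bsub>M\<^esub> b)"
proof (rule bilinI[OF lin_dom[OF \<epsilon>] M M])
  fix a assume "a \<in> carrier A"
  then have "\<epsilon> a \<in> carrier K" using lin_closed[OF \<epsilon>] by simp
  then show "lin K M M (\<lambda>b. \<epsilon> a \<odot>\<^bsub>M\<^esub> b)" by (intro lin_scale lin_id M)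
qed (rule lin_scale_right[OF \<epsilon> M])

lemma lin_eval_left: "lin K (tensor K A M) M (eval_left K M \<epsilon>)"
  unfolding eval_left_def by (rule lin_tensor_lift[OF lin_dom[OF \<epsilon>] M eval_bilin])

lemma lin_eval_right: "lin K (tensor K M A) M (eval_right K M \<epsilon>)"
  unfolding eval_right_def by (rule lin_tensor_lift[OF M lin_dom[OF \<epsilon>] bilin_flip[OF eval_bilin]])

lemma eval_left_tens: "a \<in> carrier A ==> b \<in> carrier M ==>
    eval_left K M \<epsilon> (tens K A M a b) = \<epsilon> a \<odot>\<^bsub>M\<^esub> b"
  unfolding eval_left_def by (rule tensor_lift_tens[OF lin_dom[OF \<epsilon>] M eval_bilin])

lemma eval_right_tens: "a \<in> carrier A ==> b \<in> carrier M ==>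
    eval_right K M \<epsilon> (tens K M A b a) = \<epsilon> a \<odot>\<^bsub>M\<^esub> b"
  unfolding eval_right_def by (rule tensor_lift_tens[OF M lin_dom[OF \<epsilon>] bilin_flip[OF eval_bilin]])

end

lemma eval_left_tmap:
  assumes "lin K A (self_module K) \<epsilon>" "lin K C A f" "lin K N M g" "t \<in> carrier (tensor K C N)"
  shows "eval_left K M \<epsilon> (tmap K A M f g t) = g (eval_left K N (\<lambda>x. \<epsilon> (f x)) t)"
proof -
  note l = lin_comp[OF assms(2,1)]
  have c: "\<epsilon> (f x) \<in> carrier K" if "x \<in> carrier C" for x using lin_closed[OF l that] by simp
  show ?thesis
    by (rule tensor_eqI[OF lin_dom[OF assms(2)] lin_dom[OF assms(3)] _ _ _ assms(4)],
        rule lin_comp[OF lin_tmap[OF assms(2,3)] lin_eval_left[OF lin_cod[OF assms(3)] assms(1)]],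
        rule lin_comp[OF lin_eval_left[OF lin_dom[OF assms(3)] l] assms(3)])
       (simp add: tmap_tens[OF assms(2,3)] eval_left_tens[OF lin_cod[OF assms(3)] assms(1)]
         eval_left_tens[OF lin_dom[OF assms(3)] l] lin_closed[OF assms(2)] lin_closed[OF assms(3)]
         lin_smult[OF assms(3)] c)
qed

lemma eval_right_tmap:
  assumes "lin K A (self_module K) \<epsilon>" "lin K C A f" "lin K N M g" "t \<in> carrier (tensor K N C)"
  shows "eval_right K M \<epsilon> (tmap K M A g f t) = g (eval_right K N (\<lambda>x. \<epsilon> (f x)) t)"
proof -
  note l = lin_comp[OF assms(2,1)]
  have c: "\<epsilon> (f x) \<in> carrier K" if "x \<in> carrier C" for x using lin_closed[OF l that] by simp
  show ?thesis
    by (rule tensor_eqI[OF lin_dom[OF assms(3)] lin_dom[OF assms(2)] _ _ _ assms(4)],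
        rule lin_comp[OF lin_tmap[OF assms(3,2)] lin_eval_right[OF lin_cod[OF assms(3)] assms(1)]],
        rule lin_comp[OF lin_eval_right[OF lin_dom[OF assms(3)] l] assms(3)])
       (simp add: tmap_tens[OF assms(3,2)] eval_right_tens[OF lin_cod[OF assms(3)] assms(1)]
         eval_right_tens[OF lin_dom[OF assms(3)] l] lin_closed[OF assms(2)] lin_closed[OF assms(3)]
         lin_smult[OF assms(3)] c)
qed

section \<open>Algebras and their tensor products\<close>

definition comm_alg :: "('k, 'r) ring_scheme \<Rightarrow> ('k, 'a, 'm) module_scheme \<Rightarrow> bool" where
  "comm_alg K A \<longleftrightarrow> nonunital_algebra K A \<and>
     (\<forall>x\<in>carrier A. \<forall>y\<in>carrier A. x \<otimes>\<^bsub>A\<^esub> y = y \<otimes>\<^bsub>A\<^esub> x)"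

lemma nonunital_algebra_iff:
  "nonunital_algebra K A \<longleftrightarrow> bilin K A A A (mult A) \<and>
     (\<forall>x\<in>carrier A. \<forall>y\<in>carrier A. \<forall>z\<in>carrier A. (x \<otimes>\<^bsub>A\<^esub> y) \<otimes>\<^bsub>A\<^esub> z = x \<otimes>\<^bsub>A\<^esub> (y \<otimes>\<^bsub>A\<^esub> z))"
  by (auto simp: nonunital_algebra_def bilin_def lin_def)

context
  fixes K :: "('k, 'r) ring_scheme" and A :: "('k, 'a, 'm) module_scheme"
    and B :: "('k, 'b, 'n) module_scheme"
  assumes A: "bilin K A A A (mult A)" and B: "bilin K B B B (mult B)"
begin

private lemma mA: "module K A" and mB: "module K B" using A B by (auto simp: bilin_def)

private lemma bil1: "a \<in> carrier A ==> b \<in> carrier B ==>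
    bilin K A B (tensor K A B) (\<lambda>c d. tens K A B (a \<otimes>\<^bsub>A\<^esub> c) (b \<otimes>\<^bsub>B\<^esub> d))"
  by (intro bilin_comp[OF bilin_tens, where h = "\<lambda>x. x"] lin_id module_tensor mA mB
      bilin_right[OF A] bilin_right[OF B])

private lemma bil2: "c \<in> carrier A ==> d \<in> carrier B ==>
    bilin K A B (tensor K A B) (\<lambda>a b. tens K A B (a \<otimes>\<^bsub>A\<^esub> c) (b \<otimes>\<^bsub>B\<^esub> d))"
  by (intro bilin_comp[OF bilin_tens, where h = "\<lambda>x. x"] lin_id module_tensor mA mB
      bilin_left[OF A] bilin_left[OF B])

private lemma bil3: "t \<in> carrier (tensor K A B) ==>
    bilin K A B (tensor K A B) (\<lambda>a b. lift K (tensor K A B)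
      (\<lambda>(c, d). tens K A B (a \<otimes>\<^bsub>A\<^esub> c) (b \<otimes>\<^bsub>B\<^esub> d)) t)"
  by (rule bilinI[OF mA mB])
     (auto intro!: module_tensor mA mB lin_tensor_lift_param bil1
       bilin_left[OF bil2] bilin_right[OF bil2])

private lemma bil4: "bilin K (tensor K A B) (tensor K A B) (tensor K A B) (\<lambda>s t.
    lift K (tensor K A B) (\<lambda>(a, b). lift K (tensor K A B)
      (\<lambda>(c, d). tens K A B (a \<otimes>\<^bsub>A\<^esub> c) (b \<otimes>\<^bsub>B\<^esub> d)) t) s)"
  by (intro bilin_lift bil3 lin_tensor_lift bil1 mA mB module_tensor)

text \<open>The product on \<open>tensor\<close> is defined by lifts into
  \<open>tensor_space\<close>; the target is exchanged for the full record, to which the bilinearity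
  lemmas refer.\<close>

private lemma mult_eq: "mult (tensor K A B) = (\<lambda>s t.
    lift K (tensor K A B) (\<lambda>(a, b). lift K (tensor K A B)
      (\<lambda>(c, d). tens K A B (a \<otimes>\<^bsub>A\<^esub> c) (b \<otimes>\<^bsub>B\<^esub> d)) t) s)"
  by (simp add: tensor_def lift_fields_cong[OF tensor_fields, unfolded tensor_def])

lemma bilin_tensor_mult: "bilin K (tensor K A B) (tensor K A B) (tensor K A B) (mult (tensor K A B))"
  using bil4 by (simp add: mult_eq)

lemma tensor_mult_tens:
  assumes "a \<in> carrier A" "b \<in> carrier B" "c \<in> carrier A" "d \<in> carrier B"
  shows "tens K A B a b \<otimes>\<^bsub>tensor K A B\<^esub> tens K A B c d = tens K A B (a \<otimes>\<^bsub>A\<^esub> c) (b \<otimes>\<^bsub>B\<^esub> d)"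
  unfolding mult_eq
  by (simp add: tensor_lift_tens[OF mA mB bil3] tensor_lift_tens[OF mA mB bil1] assms tens_closed mA mB)

end

lemma one_tensor: "\<one>\<^bsub>tensor K A B\<^esub> = tens K A B \<one>\<^bsub>A\<^esub> \<one>\<^bsub>B\<^esub>"
  by (simp add: tensor_def)

lemma bilin_eqI_tensor:
  assumes "module K A" "module K B" "module K C" "module K D"
    and f: "bilin K (tensor K A B) (tensor K C D) U f" and g: "bilin K (tensor K A B) (tensor K C D) U g"
    and eq: "\<And>a b c d. a \<in> carrier A ==> b \<in> carrier B ==> c \<in> carrier C ==> d \<in> carrier D ==>
      f (tens K A B a b) (tens K C D c d) = g (tens K A B a b) (tens K C D c d)"
    and st: "s \<in> carrier (tensor K A B)" "t \<in> carrier (tensor K C D)"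
  shows "f s t = g s t"
proof (rule tensor_eqI[OF assms(1,2) bilin_left[OF f st(2)] bilin_left[OF g st(2)] _ st(1)])
  fix a b assume ab: "a \<in> carrier A" "b \<in> carrier B"
  note cl = tens_closed[OF assms(1,2) ab]
  show "f (tens K A B a b) t = g (tens K A B a b) t"
    by (rule tensor_eqI[OF assms(3,4) bilin_right[OF f cl] bilin_right[OF g cl] eq[OF ab] st(2)])
qed

lemma nonunital_algebra_tensor:
  assumes "nonunital_algebra K A" "nonunital_algebra K B"
  shows "nonunital_algebra K (tensor K A B)"
proof -
  let ?T = "tensor K A B"
  have A: "bilin K A A A (mult A)" and B: "bilin K B B B (mult B)"
    using assms by (simp_all add: nonunital_algebra_iff)
  have mA: "module K A" and mB: "module K B" using A B by (auto simp: bilin_def)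
  note T = bilin_tensor_mult[OF A B] and v = tensor_mult_tens[OF A B]
  note mT = module_tensor[OF mA mB]
  note c = bilin_closed[OF A] bilin_closed[OF B] tens_closed[OF mA mB] bilin_closed[OF T]
  have "(x \<otimes>\<^bsub>?T\<^esub> y) \<otimes>\<^bsub>?T\<^esub> z = x \<otimes>\<^bsub>?T\<^esub> (y \<otimes>\<^bsub>?T\<^esub> z)"
    if x: "x \<in> carrier ?T" and y: "y \<in> carrier ?T" and z: "z \<in> carrier ?T" for x y z
  proof (rule bilin_eqI_tensor[OF mA mB mA mB _ _ _ x y,
        where f = "\<lambda>x y. (x \<otimes>\<^bsub>?T\<^esub> y) \<otimes>\<^bsub>?T\<^esub> z" and g = "\<lambda>x y. x \<otimes>\<^bsub>?T\<^esub> (y \<otimes>\<^bsub>?T\<^esub> z)"])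
    show "bilin K ?T ?T ?T (\<lambda>x y. (x \<otimes>\<^bsub>?T\<^esub> y) \<otimes>\<^bsub>?T\<^esub> z)"
      by (rule bilin_comp[OF T lin_id lin_id bilin_left[OF T]]) (use mT z in auto)
    show "bilin K ?T ?T ?T (\<lambda>x y. x \<otimes>\<^bsub>?T\<^esub> (y \<otimes>\<^bsub>?T\<^esub> z))"
      by (rule bilin_comp[OF T lin_id bilin_left[OF T] lin_id]) (use mT z in auto)
    fix a b c d assume abcd: "a \<in> carrier A" "b \<in> carrier B" "c \<in> carrier A" "d \<in> carrier B"
    show "(tens K A B a b \<otimes>\<^bsub>?T\<^esub> tens K A B c d) \<otimes>\<^bsub>?T\<^esub> z = tens K A B a b \<otimes>\<^bsub>?T\<^esub> (tens K A B c d \<otimes>\<^bsub>?T\<^esub> z)"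
      by (rule tensor_eqI[OF mA mB _ _ _ z], rule bilin_right[OF T],
          rule_tac [2] lin_comp[OF bilin_right[OF T] bilin_right[OF T]])
         (use abcd assms in \<open>auto simp: v c nonunital_algebra_iff\<close>)
  qed
  then show ?thesis using T by (simp add: nonunital_algebra_iff)
qed

lemma comm_alg_tensor:
  assumes "comm_alg K A" "comm_alg K B"
  shows "comm_alg K (tensor K A B)"
proof -
  let ?T = "tensor K A B"
  have A: "bilin K A A A (mult A)" and B: "bilin K B B B (mult B)"
    using assms by (simp_all add: nonunital_algebra_iff comm_alg_def)
  have mA: "module K A" and mB: "module K B" using A B by (auto simp: bilin_def)
  note T = bilin_tensor_mult[OF A B] and v = tensor_mult_tens[OF A B]
  have "x \<otimes>\<^bsub>?T\<^esub> y = y \<otimes>\<^bsub>?T\<^esub> x" if "x \<in> carrier ?T" "y \<in> carrier ?T" for x y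
    by (rule bilin_eqI_tensor[OF mA mB mA mB T bilin_flip[OF T] _ that])
       (use assms in \<open>auto simp: v comm_alg_def\<close>)
  then show ?thesis
    using assms nonunital_algebra_tensor by (auto simp: comm_alg_def)
qed

declare One_nat_def [simp del]

section \<open>Increasing enumerations\<close>

text \<open>In the sorted list of \<open>X\<close> the elements up to entry \<open>k\<close> are
  exactly the entries 0 to \<open>k\<close>, which makes \<open>Suc k\<close> of them: ranks count
  from 1, list positions from 0.\<close>

lemma rank_in_nth:
  assumes "finite X" "k < card X"
  shows "rank_in X (sorted_list_of_set X ! k) = Suc k"
proof -
  let ?l = "sorted_list_of_set X"
  have len: "length ?l = card X" and set: "set ?l = X" and d: "distinct ?l" and s: "sorted ?l"
    using assms by auto
  have "{j \<in> X. j \<le> ?l ! k} = (!) ?l ` {..k}"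
  proof (intro equalityI subsetI)
    fix j assume "j \<in> {j \<in> X. j \<le> ?l ! k}"
    then obtain i where i: "i < card X" "j = ?l ! i" "?l ! i \<le> ?l ! k"
      using set len by (metis (no_types, lifting) in_set_conv_nth mem_Collect_eq)
    then have "i \<le> k"
      using s d len assms(2) by (metis le_antisym nat_le_linear nth_eq_iff_index_eq sorted_nth_mono)
    then show "j \<in> (!) ?l ` {..k}" using i by auto
  next
    fix j assume "j \<in> (!) ?l ` {..k}"
    then obtain i where i: "i \<le> k" "j = ?l ! i" by auto
    then show "j \<in> {j \<in> X. j \<le> ?l ! k}"
      using s len assms(2) set nth_mem[of i ?l] by (auto intro: sorted_nth_mono)
  qed
  moreover have "inj_on ((!) ?l) {..k}"
    using d len assms(2) by (auto simp: inj_on_def nth_eq_iff_index_eq)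
  ultimately show ?thesis by (simp add: rank_in_def card_image)
qed

lemma nth_rank_in:
  assumes "finite X" "x \<in> X"
  shows "sorted_list_of_set X ! (rank_in X x - 1) = x" "1 \<le> rank_in X x" "rank_in X x \<le> card X"
proof -
  obtain k where k: "k < card X" "x = sorted_list_of_set X ! k"
    using assms by (metis in_set_conv_nth length_sorted_list_of_set set_sorted_list_of_set)
  then show "sorted_list_of_set X ! (rank_in X x - 1) = x" "1 \<le> rank_in X x" "rank_in X x \<le> card X"
    using rank_in_nth[OF assms(1) k(1)] by auto
qed

lemma rank_in_bij: assumes "finite X" shows "bij_betw (rank_in X) X {1..card X}"
proof (rule bij_betw_imageI)
  show "inj_on (rank_in X) X"
    by (rule inj_onI) (metis assms nth_rank_in(1))
  show "rank_in X ` X = {1..card X}"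
  proof (intro equalityI subsetI)
    fix j assume "j \<in> {1..card X}"
    then have "j = rank_in X (sorted_list_of_set X ! (j - 1))" "j - 1 < card X"
      using rank_in_nth[OF assms, of "j - 1"] by auto
    moreover have "sorted_list_of_set X ! (j - 1) \<in> X"
      using \<open>j - 1 < card X\<close> assms by (metis length_sorted_list_of_set nth_mem set_sorted_list_of_set)
    ultimately show "j \<in> rank_in X ` X" by auto
  qed (use nth_rank_in assms in auto)
qed

lemma sorted_list_upto: "sorted_list_of_set {1..n} = [1..<Suc n]"
  using sorted_list_of_set_range[of 1 "Suc n"] by (simp add: atLeastLessThanSuc_atLeastAtMost)

lemma rank_in_upto: "i \<in> {1..n} ==> rank_in {1..n} i = i"
proof -
  assume "i \<in> {1..n}"
  then have "{j \<in> {1..n}. j \<le> i} = {1..i}" by auto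
  then show ?thesis by (simp add: rank_in_def)
qed

lemma map_nth1: "map (\<lambda>i. vs ! (i - 1)) [1..<Suc (length vs)] = vs"
  by (rule nth_equalityI) (auto simp del: upt_Suc)

section \<open>Multilinear maps of words\<close>

definition mlin :: "('k, 'r) ring_scheme \<Rightarrow> ('k, 'a, 'm) module_scheme \<Rightarrow>
    ('k, 'u, 'q) module_scheme \<Rightarrow> nat \<Rightarrow> ('a list \<Rightarrow> 'u) \<Rightarrow> bool" where
  "mlin K A U n \<beta> \<longleftrightarrow> (\<forall>vs. length vs = n \<and> set vs \<subseteq> carrier A \<longrightarrow>
     \<beta> vs \<in> carrier U \<and> (\<forall>i<n. lin K A U (\<lambda>a. \<beta> (vs[i := a]))))"

lemma mlin_closed: "mlin K A U n \<beta> ==> length vs = n ==> set vs \<subseteq> carrier A ==> \<beta> vs \<in> carrier U"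
  and mlin_lin: "mlin K A U n \<beta> ==> length vs = n ==> set vs \<subseteq> carrier A ==> i < n ==>
    lin K A U (\<lambda>a. \<beta> (vs[i := a]))"
  by (auto simp: mlin_def)

text \<open>A substitute for spanning sets that asks only for what is used, uniqueness of linear
  maps into a given target \<open>U\<close>. For pure tensors this is what \<open>tensor_eqI\<close>
  provides.\<close>

definition determining :: "('k, 'r) ring_scheme \<Rightarrow> ('k, 'a, 'm) module_scheme \<Rightarrow>
    ('k, 'u, 'n) module_scheme \<Rightarrow> 'a set \<Rightarrow> bool" where
  "determining K A U S \<longleftrightarrow> S \<subseteq> carrier A \<and> (\<forall>h h'. lin K A U h \<longrightarrow> lin K A U h' \<longrightarrow>
     (\<forall>s\<in>S. h s = h' s) \<longrightarrow> (\<forall>a\<in>carrier A. h a = h' a))"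

lemma determiningD:
  assumes "determining K A U S"
  shows "S \<subseteq> carrier A" "lin K A U h ==> lin K A U h' ==> (\<And>s. s \<in> S ==> h s = h' s) ==>
    a \<in> carrier A ==> h a = h' a"
  using assms by (simp_all add: determining_def)

text \<open>Letters are exchanged one at a time. The induction keeps a prefix \<open>us\<close> of
  arbitrary letters and a suffix \<open>ws\<close> with letters in \<open>S\<close>; the last letter
  of the prefix is moved across by \<open>determining\<close>, all other letters being
  fixed.\<close>

lemma mlin_eqI:
  assumes f: "mlin K A U n f" and g: "mlin K A U n g"
    and det: "determining K A U S"
    and eq: "\<And>vs. length vs = n ==> set vs \<subseteq> S ==> f vs = g vs"
    and vs: "length vs = n" "set vs \<subseteq> carrier A"
  shows "f vs = g vs"
proof -
  note S = determiningD(1)[OF det]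
  have "f (us @ ws) = g (us @ ws)"
    if "length us + length ws = n" "set us \<subseteq> carrier A" "set ws \<subseteq> S" for us ws
    using that
  proof (induction us arbitrary: ws rule: rev_induct)
    case Nil
    then show ?case using eq by auto
  next
    case (snoc u us)
    have upd: "(us @ u # ws)[length us := a] = us @ a # ws" for a by simp
    have w: "set (us @ u # ws) \<subseteq> carrier A" using snoc.prems S by auto
    show ?case
    proof (simp, rule determiningD(2)[OF det, of "\<lambda>a. f (us @ a # ws)" "\<lambda>a. g (us @ a # ws)"])
      show "lin K A U (\<lambda>a. f (us @ a # ws))" "lin K A U (\<lambda>a. g (us @ a # ws))"
        using mlin_lin[OF f _ w, of "length us"] mlin_lin[OF g _ w, of "length us"] snoc.prems(1)
        by (simp_all only: upd) simp_all
      show "f (us @ s # ws) = g (us @ s # ws)" if "s \<in> S" for s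
        using snoc.IH[of "s # ws"] snoc.prems that by simp
    qed (use snoc.prems in auto)
  qed
  from this[of vs "[]"] vs show ?thesis by simp
qed

section \<open>The Fock space over a species\<close>

locale species_over =
  fixes K :: "('k, 'r) ring_scheme" and P :: "('k, 'p, 'z) species_scheme"
  assumes K: "cring K" and sp: "is_species K P"
begin

lemma module_obj: "finite X ==> module K (obj P X)"
  using sp by (auto simp: is_species_def)

lemma lin_arr: "finite X ==> inj_on \<sigma> X ==> Y = \<sigma> ` X ==> lin K (obj P X) (obj P Y) (arr P X \<sigma>)"
  using sp by (auto simp: is_species_def lin_def)

lemma arr_cong: "finite X ==> inj_on \<sigma> X ==> (\<And>x. x \<in> X ==> \<sigma> x = \<tau> x) ==> p \<in> carrier (obj P X) ==>
    arr P X \<sigma> p = arr P X \<tau> p"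
  using sp[unfolded is_species_def, THEN conjunct2, THEN conjunct2, THEN conjunct1] by blast

lemma arr_id: "finite X ==> (\<And>x. x \<in> X ==> \<sigma> x = x) ==> p \<in> carrier (obj P X) ==> arr P X \<sigma> p = p"
  using sp arr_cong[of X id \<sigma> p] by (auto simp: is_species_def)

lemma arr_comp: "finite X ==> inj_on \<sigma> X ==> inj_on \<tau> (\<sigma> ` X) ==> p \<in> carrier (obj P X) ==>
    arr P (\<sigma> ` X) \<tau> (arr P X \<sigma> p) = arr P X (\<tau> \<circ> \<sigma>) p"
  using sp unfolding is_species_def by metis

lemma arr_closed: "finite X ==> inj_on \<sigma> X ==> Y = \<sigma> ` X ==> p \<in> carrier (obj P X) ==>
    arr P X \<sigma> p \<in> carrier (obj P Y)"
  by (rule lin_closed[OF lin_arr])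

context
  fixes V :: "('k, 'v, 'm) module_scheme"
  assumes V: "module K V"
begin

interpretation V: module K V by (rule V)

lemma fock_gens_update:
  "(vs, p) \<in> fock_gens P V ==> v \<in> carrier V ==> (vs[i := v], p) \<in> fock_gens P V"
  using set_update_subset_insert[of vs i v] by (auto simp: fock_gens_def)

lemma fock_gens_perm:
  assumes "(vs, p) \<in> fock_gens P V" "bij_betw \<sigma> {1..length vs} {1..length vs}"
  shows "(vs, arr P {1..length vs} \<sigma> p) \<in> fock_gens P V"
    "(map (\<lambda>i. vs ! (\<sigma> i - 1)) [1..<Suc (length vs)], p) \<in> fock_gens P V"
proof -
  show "(vs, arr P {1..length vs} \<sigma> p) \<in> fock_gens P V"
    using assms arr_closed[of "{1..length vs}" \<sigma> "{1..length vs}" p]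
    by (simp add: fock_gens_def bij_betw_def)
  have "vs ! (\<sigma> i - 1) \<in> set vs" if "i \<in> {1..length vs}" for i
  proof -
    have "\<sigma> i \<in> {1..length vs}" using assms(2) that by (auto simp: bij_betw_def)
    then show ?thesis by (intro nth_mem) auto
  qed
  then show "(map (\<lambda>i. vs ! (\<sigma> i - 1)) [1..<Suc (length vs)], p) \<in> fock_gens P V"
    using assms(1) by (auto simp: fock_gens_def subset_iff simp del: upt_Suc)
qed

lemma fock_rels_closed: "fock_rels K P V \<subseteq> carrier (free_module K (fock_gens P V))"
proof -
  interpret F: module K "free_module K (fock_gens P V)" by (rule module_free_module[OF K])
  note [simp] = free_gen_closed[OF K]
  have obj: "(vs, p \<oplus>\<^bsub>obj P {1..length vs}\<^esub> q) \<in> fock_gens P V"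
    if "(vs, p) \<in> fock_gens P V" "(vs, q) \<in> fock_gens P V" for vs p q
  proof -
    interpret O: module K "obj P {1..length vs}" by (rule module_obj) simp
    show ?thesis using that by (auto simp: fock_gens_def)
  qed
  have obj': "(vs, c \<odot>\<^bsub>obj P {1..length vs}\<^esub> p) \<in> fock_gens P V"
    if "(vs, p) \<in> fock_gens P V" "c \<in> carrier K" for vs p c
  proof -
    interpret O: module K "obj P {1..length vs}" by (rule module_obj) simp
    show ?thesis using that by (auto simp: fock_gens_def)
  qed
  show ?thesis unfolding fock_rels_def Let_def
    by (intro Un_least subsetI; clarify;
        intro F.minus_closed F.a_closed F.smult_closed free_gen_closed K fock_gens_update fock_gens_perm
          obj obj' V.a_closed V.smult_closed; assumption)
qed

lemma module_fock_space: "module K (fock_space K P V)"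
  unfolding fock_space_def by (rule module_presented[OF K fock_rels_closed])

lemma fock_cls_closed: "(vs, p) \<in> fock_gens P V ==> fock_cls K P V vs p \<in> carrier (fock_space K P V)"
  unfolding fock_space_def fock_cls_def by (rule presented_gen_closed[OF K fock_rels_closed])

lemma fock_rels_mem:
  fixes vs :: "'v list"
  defines "F \<equiv> free_module K (fock_gens P V)"
  shows "(vs, p) \<in> fock_gens P V ==> i < length vs ==> v \<in> carrier V ==> w \<in> carrier V ==>
      free_gen K (vs[i := v \<oplus>\<^bsub>V\<^esub> w], p) \<ominus>\<^bsub>F\<^esub> (free_gen K (vs[i := v], p) \<oplus>\<^bsub>F\<^esub> free_gen K (vs[i := w], p))
        \<in> fock_rels K P V"
    and "(vs, p) \<in> fock_gens P V ==> i < length vs ==> c \<in> carrier K ==> v \<in> carrier V ==>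
      free_gen K (vs[i := c \<odot>\<^bsub>V\<^esub> v], p) \<ominus>\<^bsub>F\<^esub> (c \<odot>\<^bsub>F\<^esub> free_gen K (vs[i := v], p)) \<in> fock_rels K P V"
    and "(vs, p) \<in> fock_gens P V ==> (vs, q) \<in> fock_gens P V ==>
      free_gen K (vs, p \<oplus>\<^bsub>obj P {1..length vs}\<^esub> q) \<ominus>\<^bsub>F\<^esub> (free_gen K (vs, p) \<oplus>\<^bsub>F\<^esub> free_gen K (vs, q))
        \<in> fock_rels K P V"
    and "(vs, p) \<in> fock_gens P V ==> c \<in> carrier K ==>
      free_gen K (vs, c \<odot>\<^bsub>obj P {1..length vs}\<^esub> p) \<ominus>\<^bsub>F\<^esub> (c \<odot>\<^bsub>F\<^esub> free_gen K (vs, p)) \<in> fock_rels K P V"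
  unfolding fock_rels_def Let_def F_def by blast+

lemma mlin_fock_cls:
  assumes "p \<in> carrier (obj P {1..n})"
  shows "mlin K V (fock_space K P V) n (\<lambda>vs. fock_cls K P V vs p)"
  unfolding mlin_def
proof (intro allI impI conjI)
  fix vs :: "'v list" assume vs: "length vs = n \<and> set vs \<subseteq> carrier V"
  then have g: "(vs, p) \<in> fock_gens P V" using assms by (auto simp: fock_gens_def)
  show "fock_cls K P V vs p \<in> carrier (fock_space K P V)" by (rule fock_cls_closed[OF g])
  note * = presented_rel_add[OF K fock_rels_closed] presented_rel_smult[OF K fock_rels_closed]
  fix i assume i: "i < n"
  show "lin K V (fock_space K P V) (\<lambda>a. fock_cls K P V (vs[i := a]) p)"
  proof (rule linI[OF V module_fock_space])
    fix x assume "x \<in> carrier V"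
    then show "fock_cls K P V (vs[i := x]) p \<in> carrier (fock_space K P V)"
      by (intro fock_cls_closed fock_gens_update g)
  next
    fix x y assume "x \<in> carrier V" "y \<in> carrier V"
    then show "fock_cls K P V (vs[i := x \<oplus>\<^bsub>V\<^esub> y]) p =
      fock_cls K P V (vs[i := x]) p \<oplus>\<^bsub>fock_space K P V\<^esub> fock_cls K P V (vs[i := y]) p"
      using g i vs unfolding fock_cls_def fock_space_def
      by (intro * fock_gens_update V.a_closed fock_rels_mem) simp_all
  next
    fix c x assume "c \<in> carrier K" "x \<in> carrier V"
    then show "fock_cls K P V (vs[i := c \<odot>\<^bsub>V\<^esub> x]) p = c \<odot>\<^bsub>fock_space K P V\<^esub> fock_cls K P V (vs[i := x]) p"
      using g i vs unfolding fock_cls_def fock_space_def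
      by (intro * fock_gens_update V.smult_closed fock_rels_mem) simp_all
  qed
qed

lemma lin_fock_cls:
  assumes "set vs \<subseteq> carrier V"
  shows "lin K (obj P {1..length vs}) (fock_space K P V) (fock_cls K P V vs)"
proof -
  interpret O: module K "obj P {1..length vs}" by (rule module_obj) simp
  note * = presented_rel_add[OF K fock_rels_closed] presented_rel_smult[OF K fock_rels_closed]
  have g: "(vs, p) \<in> fock_gens P V" if "p \<in> carrier (obj P {1..length vs})" for p
    using that assms by (auto simp: fock_gens_def)
  show ?thesis
  proof (rule linI[OF O.module_axioms module_fock_space])
    fix x assume "x \<in> carrier (obj P {1..length vs})"
    then show "fock_cls K P V vs x \<in> carrier (fock_space K P V)" by (intro fock_cls_closed g)
  next
    fix x y assume "x \<in> carrier (obj P {1..length vs})" "y \<in> carrier (obj P {1..length vs})"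
    then show "fock_cls K P V vs (x \<oplus>\<^bsub>obj P {1..length vs}\<^esub> y) =
      fock_cls K P V vs x \<oplus>\<^bsub>fock_space K P V\<^esub> fock_cls K P V vs y"
      unfolding fock_cls_def fock_space_def
      by (intro * g O.a_closed fock_rels_mem) simp_all
  next
    fix c x assume "c \<in> carrier K" "x \<in> carrier (obj P {1..length vs})"
    then show "fock_cls K P V vs (c \<odot>\<^bsub>obj P {1..length vs}\<^esub> x) = c \<odot>\<^bsub>fock_space K P V\<^esub> fock_cls K P V vs x"
      unfolding fock_cls_def fock_space_def
      by (intro * g O.smult_closed fock_rels_mem) simp_all
  qed
qed

lemma fock_cls_perm:
  assumes "(vs, p) \<in> fock_gens P V" "bij_betw \<sigma> {1..length vs} {1..length vs}"
  shows "fock_cls K P V vs (arr P {1..length vs} \<sigma> p) =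
    fock_cls K P V (map (\<lambda>i. vs ! (\<sigma> i - 1)) [1..<Suc (length vs)]) p"
  unfolding fock_cls_def
proof (rule presented_rel_eq[OF K fock_rels_closed])
  show "free_gen K (vs, arr P {1..length vs} \<sigma> p) \<ominus>\<^bsub>free_module K (fock_gens P V)\<^esub>
    free_gen K (map (\<lambda>i. vs ! (\<sigma> i - 1)) [1..<Suc (length vs)], p) \<in> fock_rels K P V"
    unfolding fock_rels_def Let_def by (rule UnI2) (use assms in blast)
qed (use fock_gens_perm[OF assms] in auto)

lemma fock_eqI_list:
  assumes "lin K (fock_space K P V) U f" "lin K (fock_space K P V) U g"
    "\<And>vs p. (vs, p) \<in> fock_gens P V ==> f (fock_cls K P V vs p) = g (fock_cls K P V vs p)"
    "x \<in> carrier (fock_space K P V)"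
  shows "f x = g x"
proof (rule presented_eqI[OF K fock_rels_closed])
  show "f (presented_gen K (fock_gens P V) (fock_rels K P V) h) =
      g (presented_gen K (fock_gens P V) (fock_rels K P V) h)" if "h \<in> fock_gens P V" for h
    using assms(3)[of "fst h" "snd h"] that by (simp add: fock_cls_def)
qed (use assms in \<open>simp_all add: fock_space_def\<close>)

context
  fixes U :: "('k, 'u, 'q) module_scheme" and \<beta> :: "'v list \<Rightarrow> 'p \<Rightarrow> 'u"
  assumes U: "module K U"
    and lin_vs: "\<And>n p. p \<in> carrier (obj P {1..n}) ==> mlin K V U n (\<lambda>vs. \<beta> vs p)"
    and lin_p: "\<And>vs. set vs \<subseteq> carrier V ==> lin K (obj P {1..length vs}) U (\<beta> vs)"
    and perm: "\<And>vs p \<sigma>. (vs, p) \<in> fock_gens P V ==> bij_betw \<sigma> {1..length vs} {1..length vs} ==>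
      \<beta> vs (arr P {1..length vs} \<sigma> p) = \<beta> (map (\<lambda>i. vs ! (\<sigma> i - 1)) [1..<Suc (length vs)]) p"
begin

lemma fock_rels_lift:
  assumes "x \<in> fock_rels K P V"
  shows "free_lift K U (\<lambda>(vs, p). \<beta> vs p) x = \<zero>\<^bsub>U\<^esub>"
proof -
  have cl: "(case g of (vs, p) \<Rightarrow> \<beta> vs p) \<in> carrier U" if "g \<in> fock_gens P V" for g
    using that lin_closed[OF lin_p] by (auto simp: fock_gens_def)
  have obj: "(vs, p \<oplus>\<^bsub>obj P {1..length vs}\<^esub> q) \<in> fock_gens P V"
    if "(vs, p) \<in> fock_gens P V" "(vs, q) \<in> fock_gens P V" for vs p q
  proof -
    interpret O: module K "obj P {1..length vs}" by (rule module_obj) simp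
    show ?thesis using that by (auto simp: fock_gens_def)
  qed
  have obj': "(vs, c \<odot>\<^bsub>obj P {1..length vs}\<^esub> p) \<in> fock_gens P V"
    if "(vs, p) \<in> fock_gens P V" "c \<in> carrier K" for vs p c
  proof -
    interpret O: module K "obj P {1..length vs}" by (rule module_obj) simp
    show ?thesis using that by (auto simp: fock_gens_def)
  qed
  have l: "lin K V U (\<lambda>a. \<beta> (vs[i := a]) p)" if "(vs, p) \<in> fock_gens P V" "i < length vs" for vs p i
    using that by (intro mlin_lin[OF lin_vs]) (auto simp: fock_gens_def)
  have l': "lin K (obj P {1..length vs}) U (\<beta> vs)" "p \<in> carrier (obj P {1..length vs})"
    if "(vs, p) \<in> fock_gens P V" for vs p
    using that lin_p by (auto simp: fock_gens_def)
  note * = K fock_rels_closed U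
  show ?thesis using assms unfolding fock_rels_def Let_def
  proof (elim UnE CollectE exE conjE; hypsubst)
    fix vs i v w p assume "(vs, p) \<in> fock_gens P V" "i < length vs" "v \<in> carrier V" "w \<in> carrier V"
    then show "free_lift K U (\<lambda>(vs, p). \<beta> vs p) (free_gen K (vs[i := v \<oplus>\<^bsub>V\<^esub> w], p)
       \<ominus>\<^bsub>free_module K (fock_gens P V)\<^esub> (free_gen K (vs[i := v], p)
       \<oplus>\<^bsub>free_module K (fock_gens P V)\<^esub> free_gen K (vs[i := w], p))) = \<zero>\<^bsub>U\<^esub>"
      by (intro free_lift_rel_add[OF *] cl fock_gens_update V.a_closed)
         (auto simp: lin_add[OF l])
  next
    fix vs i c v p assume "(vs, p) \<in> fock_gens P V" "i < length vs" "c \<in> carrier K" "v \<in> carrier V"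
    then show "free_lift K U (\<lambda>(vs, p). \<beta> vs p) (free_gen K (vs[i := c \<odot>\<^bsub>V\<^esub> v], p)
       \<ominus>\<^bsub>free_module K (fock_gens P V)\<^esub> (c \<odot>\<^bsub>free_module K (fock_gens P V)\<^esub> free_gen K (vs[i := v], p))) = \<zero>\<^bsub>U\<^esub>"
      by (intro free_lift_rel_smult[OF *] cl fock_gens_update V.smult_closed)
         (auto simp: lin_smult[OF l])
  next
    fix vs p q assume "(vs, p) \<in> fock_gens P V" "(vs, q) \<in> fock_gens P V"
    then show "free_lift K U (\<lambda>(vs, p). \<beta> vs p) (free_gen K (vs, p \<oplus>\<^bsub>obj P {1..length vs}\<^esub> q)
       \<ominus>\<^bsub>free_module K (fock_gens P V)\<^esub> (free_gen K (vs, p)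
       \<oplus>\<^bsub>free_module K (fock_gens P V)\<^esub> free_gen K (vs, q))) = \<zero>\<^bsub>U\<^esub>"
      by (intro free_lift_rel_add[OF *] cl obj) (auto simp: lin_add[OF l'(1)] l'(2))
  next
    fix vs c p assume "(vs, p) \<in> fock_gens P V" "c \<in> carrier K"
    then show "free_lift K U (\<lambda>(vs, p). \<beta> vs p) (free_gen K (vs, c \<odot>\<^bsub>obj P {1..length vs}\<^esub> p)
       \<ominus>\<^bsub>free_module K (fock_gens P V)\<^esub> (c \<odot>\<^bsub>free_module K (fock_gens P V)\<^esub> free_gen K (vs, p))) = \<zero>\<^bsub>U\<^esub>"
      by (intro free_lift_rel_smult[OF *] cl obj') (auto simp: lin_smult[OF l'(1)] l'(2))
  next
    fix vs \<sigma> p assume "(vs, p) \<in> fock_gens P V" "bij_betw \<sigma> {1..length vs} {1..length vs}"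
    then show "free_lift K U (\<lambda>(vs, p). \<beta> vs p) (free_gen K (vs, arr P {1..length vs} \<sigma> p)
       \<ominus>\<^bsub>free_module K (fock_gens P V)\<^esub>
       free_gen K (map (\<lambda>i. vs ! (\<sigma> i - 1)) [1..<Suc (length vs)], p)) = \<zero>\<^bsub>U\<^esub>"
      by (intro free_lift_rel_eq[OF *] cl fock_gens_perm) (auto simp: perm simp del: upt_Suc)
  qed
qed

lemma fock_lift_list:
  shows "lin K (fock_space K P V) U (lift K U (\<lambda>(vs, p). \<beta> vs p))"
    and "(vs, p) \<in> fock_gens P V ==> lift K U (\<lambda>(vs, p). \<beta> vs p) (fock_cls K P V vs p) = \<beta> vs p"
proof -
  have cl: "(case g of (vs, p) \<Rightarrow> \<beta> vs p) \<in> carrier U" if "g \<in> fock_gens P V" for g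
    using that lin_closed[OF lin_p] by (auto simp: fock_gens_def)
  show "lin K (fock_space K P V) U (lift K U (\<lambda>(vs, p). \<beta> vs p))"
    unfolding fock_space_def
    by (rule lin_presented_lift[OF K fock_rels_closed U cl fock_rels_lift])
  show "(vs, p) \<in> fock_gens P V ==> lift K U (\<lambda>(vs, p). \<beta> vs p) (fock_cls K P V vs p) = \<beta> vs p"
    unfolding fock_cls_def
    by (subst presented_lift_gen[OF K fock_rels_closed U cl fock_rels_lift]) auto
qed

end

end

end

section \<open>Generators indexed by arbitrary finite sets\<close>

text \<open>
  The class of \<open>v \<otimes> p\<close> for a family \<open>v\<close> of letters indexed by a finite set \<open>X\<close> and \<open>p \<in> P[X]\<close>:
  the relations of the Fock space make the choice of a bijection from \<open>X\<close> to \<open>[n]\<close> immaterial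
  (\<open>cls_natural\<close> below), so that the structure maps need no renumbering.
\<close>

context species_over
begin

abbreviation "elts X \<equiv> carrier (obj P X)"

definition cls where
  "cls V X v p = fock_cls K P V (map v (sorted_list_of_set X)) (arr P X (rank_in X) p)"

lemma cls_cong: "finite X ==> (\<And>x. x \<in> X ==> v x = v' x) ==> cls V X v p = cls V X v' p"
  unfolding cls_def by (intro arg_cong2[where f = "\<lambda>vs p. fock_cls K P V vs p"] map_cong) auto

text \<open>The functions \<open>\<Theta>\<close> below present linear maps on the Fock space by their values on generators.\<close>

definition fock_compatible where
  "fock_compatible V U \<Theta> \<longleftrightarrow> module K U \<and> (\<forall>X v. finite X \<and> v \<in> X \<rightarrow> carrier V \<longrightarrow>
     lin K (obj P X) U (\<Theta> X v) \<and>
     (\<forall>p\<in>elts X. (\<forall>i\<in>X. lin K V U (\<lambda>a. \<Theta> X (v(i := a)) p)) \<and>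
       (\<forall>\<sigma> v'. inj_on \<sigma> X \<and> (\<forall>x\<in>X. v' (\<sigma> x) = v x) \<longrightarrow> \<Theta> (\<sigma> ` X) v' (arr P X \<sigma> p) = \<Theta> X v p)))"

lemma cls_gens:
  assumes "finite X" "v \<in> X \<rightarrow> carrier V" "p \<in> elts X"
  shows "(map v (sorted_list_of_set X), arr P X (rank_in X) p) \<in> fock_gens P V"
  using assms rank_in_bij[OF assms(1)] arr_closed[of X "rank_in X" "{1..card X}" p]
  by (auto simp: fock_gens_def bij_betw_def)

lemma cls_upto:
  assumes "(vs, p) \<in> fock_gens P V"
  shows "cls V {1..length vs} (\<lambda>i. vs ! (i - 1)) p = fock_cls K P V vs p"
proof -
  have "arr P {1..length vs} (rank_in {1..length vs}) p = p"
    using assms by (intro arr_id) (auto simp: fock_gens_def rank_in_upto)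
  then show ?thesis
    by (simp add: cls_def sorted_list_upto map_nth1 del: upt_Suc)
qed

lemma letters_upto: "(vs, p) \<in> fock_gens P V ==> (\<lambda>i. vs ! (i - 1)) \<in> {1..length vs} \<rightarrow> carrier V"
  by (auto simp: fock_gens_def subset_iff)

lemma gens_obj: "(vs, p) \<in> fock_gens P V ==> p \<in> carrier (obj P {1..length vs})"
  by (auto simp: fock_gens_def)

context
  fixes V :: "('k, 'v, 'm) module_scheme"
  assumes V: "module K V"
begin

lemma lin_cls_space:
  assumes "finite X" "v \<in> X \<rightarrow> carrier V"
  shows "lin K (obj P X) (fock_space K P V) (cls V X v)"
proof -
  have "set (map v (sorted_list_of_set X)) \<subseteq> carrier V" using assms by auto
  from lin_fock_cls[OF V this]
  have "lin K (obj P {1..card X}) (fock_space K P V) (fock_cls K P V (map v (sorted_list_of_set X)))"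
    by simp
  then show ?thesis
    unfolding cls_def[abs_def] using rank_in_bij[OF assms(1)]
    by (intro lin_comp[OF lin_arr]) (use assms in \<open>auto simp: bij_betw_def\<close>)
qed

lemma lin_cls_letter_space:
  assumes "finite X" "v \<in> X \<rightarrow> carrier V" "i \<in> X" "p \<in> elts X"
  shows "lin K V (fock_space K P V) (\<lambda>a. cls V X (v(i := a)) p)"
proof -
  let ?l = "sorted_list_of_set X" and ?k = "rank_in X i - 1"
  have k: "?l ! ?k = i" "?k < card X"
    using nth_rank_in[OF assms(1,3)] by auto
  \<comment> \<open>The enumeration has no repetitions, so the letter \<open>i\<close> occupies a
    single position, which is its rank less 1.\<close>
  have "map (v(i := a)) ?l = (map v ?l)[?k := a]" for a
    using k by (intro nth_equalityI)
      (auto simp: nth_list_update nth_eq_iff_index_eq[OF distinct_sorted_list_of_set])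
  moreover have "arr P X (rank_in X) p \<in> carrier (obj P {1..card X})"
    using arr_closed[of X "rank_in X" "{1..card X}" p] rank_in_bij[OF assms(1)] assms
    by (auto simp: bij_betw_def)
  note mlin_lin[OF mlin_fock_cls[OF V this], of "map v ?l" ?k]
  ultimately show ?thesis unfolding cls_def using k assms by auto
qed

lemma cls_natural:
  assumes X: "finite X" and inj: "inj_on \<sigma> X" and vv': "\<And>x. x \<in> X ==> v (\<sigma> x) = v' x"
    and v': "v' \<in> X \<rightarrow> carrier V" and p: "p \<in> elts X"
  shows "cls V (\<sigma> ` X) v (arr P X \<sigma> p) = cls V X v' p"
proof -
  let ?n = "card X" and ?Y = "\<sigma> ` X" and ?lX = "sorted_list_of_set X" and ?lY = "sorted_list_of_set (\<sigma> ` X)"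
  have n: "card ?Y = ?n" using inj by (rule card_image)
  have Y: "finite ?Y" using X by simp
  \<comment> \<open>The permutation of positions that \<sigma> induces between the increasing
    enumerations of \<open>X\<close> and of its image. The symmetry relation of the Fock space is
    applied to it.\<close>
  define \<rho> where "\<rho> i = rank_in ?Y (\<sigma> (?lX ! (i - 1)))" for i
  have \<rho>: "\<rho> (rank_in X x) = rank_in ?Y (\<sigma> x)" if "x \<in> X" for x
    using that nth_rank_in[OF X] by (simp add: \<rho>_def)
  have bX: "bij_betw (rank_in X) X {1..?n}" and bY: "bij_betw (rank_in ?Y) ?Y {1..?n}"
    using rank_in_bij[OF X] rank_in_bij[OF Y] n by simp_all
  have b\<sigma>: "bij_betw \<sigma> X ?Y" using inj by (simp add: bij_betw_def)
  have "bij_betw (\<lambda>x. \<rho> (rank_in X x)) X {1..?n}"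
    using bij_betw_trans[OF b\<sigma> bY] by (auto simp: \<rho> comp_def cong: bij_betw_cong)
  then have b\<rho>: "bij_betw \<rho> {1..?n} {1..?n}"
    using bij_betw_comp_iff[OF bX, of \<rho> "{1..?n}"] by (simp add: comp_def)
  let ?q = "arr P X (rank_in X) p"
  have q: "?q \<in> elts {1..?n}"
    using bX by (intro arr_closed[OF X _ _ p]) (auto simp: bij_betw_def)
  have "arr P ?Y (rank_in ?Y) (arr P X \<sigma> p) = arr P X (rank_in ?Y \<circ> \<sigma>) p"
    using bY by (intro arr_comp X inj p) (auto simp: bij_betw_def)
  also have "\<dots> = arr P X (\<rho> \<circ> rank_in X) p"
    using bij_betw_trans[OF b\<sigma> bY] by (intro arr_cong[OF X _ _ p]) (auto simp: \<rho> bij_betw_def)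
  also have "\<dots> = arr P (rank_in X ` X) \<rho> ?q"
    using bX b\<rho> by (intro arr_comp[symmetric] X p) (auto simp: bij_betw_def)
  also have "rank_in X ` X = {1..?n}" using bX by (auto simp: bij_betw_def)
  finally have eq: "arr P ?Y (rank_in ?Y) (arr P X \<sigma> p) = arr P {1..?n} \<rho> ?q" .
  let ?vs = "map v ?lY"
  have len: "length ?vs = ?n" using n by simp
  have "(?vs, ?q) \<in> fock_gens P V"
    using q v' vv' X len by (auto simp: fock_gens_def n)
  then have "fock_cls K P V ?vs (arr P {1..?n} \<rho> ?q) =
      fock_cls K P V (map (\<lambda>i. ?vs ! (\<rho> i - 1)) [1..<Suc ?n]) ?q"
    using fock_cls_perm[OF V, of ?vs ?q \<rho>] b\<rho> len by metis
  also have "map (\<lambda>i. ?vs ! (\<rho> i - 1)) [1..<Suc ?n] = map v' ?lX"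
  proof (rule nth_equalityI)
    fix k assume "k < length (map (\<lambda>i. ?vs ! (\<rho> i - 1)) [1..<Suc ?n])"
    then have k: "k < ?n" by (simp del: upt_Suc)
    then have x: "?lX ! k \<in> X" using X by (metis length_sorted_list_of_set nth_mem set_sorted_list_of_set)
    note r = nth_rank_in[OF Y imageI[OF x, of \<sigma>]]
    have "?vs ! (rank_in ?Y (\<sigma> (?lX ! k)) - 1) = v (\<sigma> (?lX ! k))"
      using r n by (subst nth_map) auto
    then show "map (\<lambda>i. ?vs ! (\<rho> i - 1)) [1..<Suc ?n] ! k = map v' ?lX ! k"
      using k x vv' by (simp add: \<rho>_def del: upt_Suc)
  qed simp
  finally show ?thesis unfolding cls_def eq .
qed

text \<open>Naturality along \<tau>, combined with the fact that on \<open>{1..m}\<close> the rank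
  is the identity: any numbering may replace the increasing one. This is what makes the choice of
  \<open>block_numbering\<close> in the second coproduct immaterial.\<close>

lemma cls_numbered:
  assumes Q: "finite Q" and \<tau>: "bij_betw \<tau> Q {1..m}" and w: "w \<in> Q \<rightarrow> carrier V"
    and q: "q \<in> elts Q"
  shows "fock_cls K P V (map (\<lambda>j. w (inv_into Q \<tau> j)) [1..<Suc m]) (arr P Q \<tau> q) = cls V Q w q"
proof -
  have im: "\<tau> ` Q = {1..m}" and inj: "inj_on \<tau> Q" using \<tau> by (auto simp: bij_betw_def)
  have cl: "arr P Q \<tau> q \<in> elts {1..m}"
    by (rule arr_closed[OF Q inj im[symmetric] q])
  have "arr P {1..m} (rank_in {1..m}) (arr P Q \<tau> q) = arr P Q \<tau> q"
    using cl by (intro arr_id) (auto simp: rank_in_upto)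
  then have "fock_cls K P V (map (\<lambda>j. w (inv_into Q \<tau> j)) [1..<Suc m]) (arr P Q \<tau> q) =
      cls V (\<tau> ` Q) (\<lambda>j. w (inv_into Q \<tau> j)) (arr P Q \<tau> q)"
    by (simp add: cls_def im sorted_list_upto del: upt_Suc)
  also have "\<dots> = cls V Q w q"
    using inj by (intro cls_natural Q w q) auto
  finally show ?thesis .
qed

lemma fock_space_eqI:
  assumes "lin K (fock_space K P V) U f" "lin K (fock_space K P V) U g"
    "\<And>X v p. finite X ==> v \<in> X \<rightarrow> carrier V ==> p \<in> elts X ==>
      f (cls V X v p) = g (cls V X v p)"
    "x \<in> carrier (fock_space K P V)"
  shows "f x = g x"
proof (rule fock_eqI_list[OF V assms(1,2) _ assms(4)])
  fix vs p assume g: "(vs, p) \<in> fock_gens P V"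
  show "f (fock_cls K P V vs p) = g (fock_cls K P V vs p)"
    using assms(3)[OF _ letters_upto[OF g] gens_obj[OF g]] by (simp add: cls_upto[OF g])
qed

lemma fock_compatibleI:
  assumes "module K U"
    "\<And>X v. finite X ==> v \<in> X \<rightarrow> carrier V ==> lin K (obj P X) U (\<Theta> X v)"
    "\<And>X v p i. finite X ==> v \<in> X \<rightarrow> carrier V ==> p \<in> elts X ==> i \<in> X ==>
      lin K V U (\<lambda>a. \<Theta> X (v(i := a)) p)"
    "\<And>X v v' p \<sigma>. finite X ==> v \<in> X \<rightarrow> carrier V ==> p \<in> elts X ==> inj_on \<sigma> X ==>
      (\<And>x. x \<in> X ==> v' (\<sigma> x) = v x) ==> \<Theta> (\<sigma> ` X) v' (arr P X \<sigma> p) = \<Theta> X v p"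
  shows "fock_compatible V U \<Theta>"
  using assms unfolding fock_compatible_def by auto

lemma compatibleD:
  assumes "fock_compatible V U \<Theta>" "finite X" "v \<in> X \<rightarrow> carrier V"
  shows "lin K (obj P X) U (\<Theta> X v)"
    and "p \<in> elts X ==> i \<in> X ==> lin K V U (\<lambda>a. \<Theta> X (v(i := a)) p)"
    and "p \<in> elts X ==> inj_on \<sigma> X ==> (\<And>x. x \<in> X ==> v' (\<sigma> x) = v x) ==>
      \<Theta> (\<sigma> ` X) v' (arr P X \<sigma> p) = \<Theta> X v p"
  using assms by (simp_all add: fock_compatible_def)

context
  fixes U :: "('k, 'u, 'q) module_scheme" and \<Theta> :: "nat set \<Rightarrow> (nat \<Rightarrow> 'v) \<Rightarrow> 'p \<Rightarrow> 'u"
    and \<beta> :: "'v list \<Rightarrow> 'p \<Rightarrow> 'u"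
  assumes comp: "fock_compatible V U \<Theta>"
    and gen: "\<And>vs p. (vs, p) \<in> fock_gens P V ==> \<beta> vs p = \<Theta> {1..length vs} (\<lambda>i. vs ! (i - 1)) p"
begin

text \<open>Naturality along the identity bijection, for two families that agree on
  \<open>X\<close>: outside \<open>X\<close> a family has arbitrary values as a total function, and
  these must not matter.\<close>

lemma compatible_cong:
  assumes "finite X" "v \<in> X \<rightarrow> carrier V" "p \<in> elts X" "\<And>x. x \<in> X ==> v' x = v x"
  shows "\<Theta> X v' p = \<Theta> X v p"
proof -
  have "\<Theta> (id ` X) v' (arr P X id p) = \<Theta> X v p"
    using assms by (intro compatibleD(3)[OF comp]) auto
  then show ?thesis using arr_id[OF assms(1) _ assms(3)] by simp
qed

text \<open>A word has its letters at positions 0 to n - 1, a family at indices 1 to n, so updating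
  position \<open>i\<close> means updating the letter \<open>Suc i\<close>. Invariance under a
  permutation is naturality along it, read as a bijection from \<open>{1..n}\<close> to
  itself.\<close>

lemma fock_lift_hyps:
  shows "p \<in> elts {1..n} ==> mlin K V U n (\<lambda>vs. \<beta> vs p)"
    and "set vs \<subseteq> carrier V ==> lin K (obj P {1..length vs}) U (\<beta> vs)"
    and "(vs, p) \<in> fock_gens P V ==> bij_betw \<sigma> {1..length vs} {1..length vs} ==>
      \<beta> vs (arr P {1..length vs} \<sigma> p) = \<beta> (map (\<lambda>i. vs ! (\<sigma> i - 1)) [1..<Suc (length vs)]) p"
proof -
  show l: "lin K (obj P {1..length vs}) U (\<beta> vs)" if "set vs \<subseteq> carrier V" for vs
  proof (rule lin_cong)
    show "lin K (obj P {1..length vs}) U (\<Theta> {1..length vs} (\<lambda>i. vs ! (i - 1)))"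
    proof -
      have "(\<lambda>i. vs ! (i - 1)) \<in> {1..length vs} \<rightarrow> carrier V" using that by (auto simp: subset_iff)
      then show ?thesis using comp unfolding fock_compatible_def by simp
    qed
    fix x assume "x \<in> carrier (obj P {1..length vs})"
    then show "\<Theta> {1..length vs} (\<lambda>i. vs ! (i - 1)) x = \<beta> vs x"
      using that by (intro gen[symmetric]) (auto simp: fock_gens_def)
  qed
  show "mlin K V U n (\<lambda>vs. \<beta> vs p)" if p: "p \<in> elts {1..n}"
    unfolding mlin_def
  proof (intro allI impI conjI)
    fix vs assume vs: "length vs = n \<and> set vs \<subseteq> carrier V"
    then have g: "(vs, p) \<in> fock_gens P V" using p by (auto simp: fock_gens_def)
    show "\<beta> vs p \<in> carrier U" using lin_closed[OF l] vs p by auto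
    fix i assume i: "i < n"
    show "lin K V U (\<lambda>a. \<beta> (vs[i := a]) p)"
    proof (rule lin_cong)
      show "lin K V U (\<lambda>a. \<Theta> {1..n} ((\<lambda>i. vs ! (i - 1))(Suc i := a)) p)"
        using comp p letters_upto[OF g] i vs unfolding fock_compatible_def by auto
      fix a assume a: "a \<in> carrier V"
      have g': "(vs[i := a], p) \<in> fock_gens P V" by (rule fock_gens_update[OF V g a])
      then have "\<beta> (vs[i := a]) p = \<Theta> {1..n} (\<lambda>j. vs[i := a] ! (j - 1)) p"
        using gen vs by fastforce
      also have "\<dots> = \<Theta> {1..n} ((\<lambda>i. vs ! (i - 1))(Suc i := a)) p"
        using letters_upto[OF g] a vs i p
        by (intro compatible_cong) (auto simp: nth_list_update Pi_def)
      finally show "\<Theta> {1..n} ((\<lambda>i. vs ! (i - 1))(Suc i := a)) p = \<beta> (vs[i := a]) p" ..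
    qed
  qed
  show "\<beta> vs (arr P {1..length vs} \<sigma> p) = \<beta> (map (\<lambda>i. vs ! (\<sigma> i - 1)) [1..<Suc (length vs)]) p"
    if g: "(vs, p) \<in> fock_gens P V" and \<sigma>: "bij_betw \<sigma> {1..length vs} {1..length vs}"
  proof -
    let ?ws = "map (\<lambda>i. vs ! (\<sigma> i - 1)) [1..<Suc (length vs)]"
    note g' = fock_gens_perm[OF V g \<sigma>]
    have "\<beta> vs (arr P {1..length vs} \<sigma> p) =
        \<Theta> (\<sigma> ` {1..length vs}) (\<lambda>i. vs ! (i - 1)) (arr P {1..length vs} \<sigma> p)"
      using gen[OF g'(1)] \<sigma> by (simp add: bij_betw_def)
    also have "\<dots> = \<Theta> {1..length vs} (\<lambda>i. ?ws ! (i - 1)) p"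
    proof -
      have "(\<lambda>i. ?ws ! (i - 1)) \<in> {1..length vs} \<rightarrow> carrier V"
        using letters_upto[OF g'(2)] by (simp del: upt_Suc)
      moreover have "\<forall>i\<in>{1..length vs}. vs ! (\<sigma> i - 1) = ?ws ! (i - 1)"
        by (auto simp del: upt_Suc)
      ultimately show ?thesis
        using \<sigma> by (intro compatibleD(3)[OF comp] gens_obj[OF g]) (auto simp: bij_betw_def simp del: upt_Suc)
    qed
    also have "\<dots> = \<beta> ?ws p" using gen[OF g'(2)] by (simp del: upt_Suc)
    finally show ?thesis .
  qed
qed

lemma lin_fock_space_lift: "lin K (fock_space K P V) U (lift K U (\<lambda>(vs, p). \<beta> vs p))"
  using comp by (intro fock_lift_list V fock_lift_hyps) (auto simp: fock_compatible_def)

lemma fock_lift_gens: "(vs, p) \<in> fock_gens P V ==> lift K U (\<lambda>(vs, p). \<beta> vs p) (fock_cls K P V vs p) = \<beta> vs p"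
  using comp by (intro fock_lift_list V fock_lift_hyps) (auto simp: fock_compatible_def)

lemma fock_lift_cls:
  assumes "finite X" "v \<in> X \<rightarrow> carrier V" "p \<in> elts X"
  shows "lift K U (\<lambda>(vs, p). \<beta> vs p) (cls V X v p) = \<Theta> X v p"
proof -
  let ?l = "sorted_list_of_set X"
  have b: "inj_on (rank_in X) X" "rank_in X ` X = {1..card X}"
    using rank_in_bij[OF assms(1)] by (auto simp: bij_betw_def)
  have "\<forall>x\<in>X. map v ?l ! (rank_in X x - 1) = v x"
  proof
    fix x assume x: "x \<in> X"
    have "rank_in X x - 1 < card X" using nth_rank_in(2,3)[OF assms(1) x] by simp
    then show "map v ?l ! (rank_in X x - 1) = v x" using nth_rank_in(1)[OF assms(1) x] by simp
  qed
  then have "\<Theta> (rank_in X ` X) (\<lambda>i. map v ?l ! (i - 1)) (arr P X (rank_in X) p) = \<Theta> X v p"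
    using b(1) assms by (intro compatibleD(3)[OF comp]) auto
  then show ?thesis
    unfolding cls_def fock_lift_gens[OF cls_gens[OF assms]] gen[OF cls_gens[OF assms]]
    by (simp add: b(2))
qed

end

lemma fock_compatible_cls:
  "fock_compatible V (fock_space K P V) (cls V)"
  using module_fock_space[OF V]
  by (intro fock_compatibleI lin_cls_space lin_cls_letter_space cls_natural) auto

end

text \<open>The counterpart of \<open>lin_tensor_lift_param\<close> for the Fock space, needed
  because the product is a lift inside a lift.\<close>

lemma fock_lift_param:
  assumes V: "module K V" and M: "module K M" and comp: "\<And>m. m \<in> carrier M ==> fock_compatible V U (\<Theta> m)"
    and gen: "\<And>m vs p. m \<in> carrier M ==> (vs, p) \<in> fock_gens P V ==>
      \<beta> m vs p = \<Theta> m {1..length vs} (\<lambda>i. vs ! (i - 1)) p"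
    and l: "\<And>X v p. finite X ==> v \<in> X \<rightarrow> carrier V ==> p \<in> elts X ==>
      lin K M U (\<lambda>m. \<Theta> m X v p)"
    and t: "t \<in> carrier (fock_space K P V)"
  shows "lin K M U (\<lambda>m. lift K U (\<lambda>(vs, p). \<beta> m vs p) t)"
proof -
  interpret M: module K M by fact
  note lin = lin_fock_space_lift[OF V comp gen] and v = fock_lift_cls[OF V comp gen]
  have U: "module K U" using lin_cod[OF lin] M.zero_closed by blast
  interpret U: module K U by (rule U)
  show ?thesis
  proof (rule linI[OF M U])
    fix x assume "x \<in> carrier M"
    then show "lift K U (\<lambda>(vs, p). \<beta> x vs p) t \<in> carrier U" by (intro lin_closed[OF lin t])
  next
    fix x y assume xy: "x \<in> carrier M" "y \<in> carrier M"
    note xy' = M.a_closed[OF xy]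
    show "lift K U (\<lambda>(vs, p). \<beta> (x \<oplus>\<^bsub>M\<^esub> y) vs p) t =
        lift K U (\<lambda>(vs, p). \<beta> x vs p) t \<oplus>\<^bsub>U\<^esub> lift K U (\<lambda>(vs, p). \<beta> y vs p) t"
      by (rule fock_space_eqI[OF V lin[OF xy' xy'] lin_plus[OF lin[OF xy(1) xy(1)] lin[OF xy(2) xy(2)]] _ t])
         (simp_all add: v xy xy' lin_add[OF l])
  next
    fix c x assume c: "c \<in> carrier K" and x: "x \<in> carrier M"
    note cx = M.smult_closed[OF c x]
    show "lift K U (\<lambda>(vs, p). \<beta> (c \<odot>\<^bsub>M\<^esub> x) vs p) t = c \<odot>\<^bsub>U\<^esub> lift K U (\<lambda>(vs, p). \<beta> x vs p) t"
      by (rule fock_space_eqI[OF V lin[OF cx cx] lin_scale[OF lin[OF x x] c] _ t])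
         (simp_all add: v c x cx lin_smult[OF l])
  qed
qed

text \<open>Lifting in the second argument with the first generator fixed gives \<Psi>, which is
  then lifted in the first argument. That \<Psi> is compatible there at an arbitrary vector
  \<open>t\<close> is deduced from the case of a generator \<open>t\<close>, by linearity in
  \<open>t\<close>.\<close>

lemma bilin_fock_lift:
  assumes V: "module K V"
    and comp1: "\<And>Y w q. finite Y ==> w \<in> Y \<rightarrow> carrier V ==> q \<in> elts Y ==>
      fock_compatible V U (\<lambda>X v p. \<Theta> X v p Y w q)"
    and comp2: "\<And>X v p. finite X ==> v \<in> X \<rightarrow> carrier V ==> p \<in> elts X ==>
      fock_compatible V U (\<Theta> X v p)"
    and gen: "\<And>vs p ws q. (vs, p) \<in> fock_gens P V ==> (ws, q) \<in> fock_gens P V ==>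
      \<gamma> vs p ws q = \<Theta> {1..length vs} (\<lambda>i. vs ! (i - 1)) p {1..length ws} (\<lambda>i. ws ! (i - 1)) q"
  defines "\<mu> \<equiv> \<lambda>s t. lift K U (\<lambda>(vs, p). lift K U (\<lambda>(ws, q). \<gamma> vs p ws q) t) s"
  shows "bilin K (fock_space K P V) (fock_space K P V) U \<mu>" (is ?bilin)
    and "finite X ==> v \<in> X \<rightarrow> carrier V ==> p \<in> elts X ==>
      finite Y ==> w \<in> Y \<rightarrow> carrier V ==> q \<in> elts Y ==>
      \<mu> (cls V X v p) (cls V Y w q) = \<Theta> X v p Y w q"
    and "(vs, p) \<in> fock_gens P V ==> (ws, q) \<in> fock_gens P V ==>
      \<mu> (fock_cls K P V vs p) (fock_cls K P V ws q) = \<gamma> vs p ws q"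
proof -
  let ?F = "fock_space K P V"
  define \<Psi> where "\<Psi> t X v p = lift K U (\<lambda>(ws, q). \<Theta> X v p {1..length ws} (\<lambda>i. ws ! (i - 1)) q) t" for t X v p
  have \<Psi>_lin: "lin K ?F U (\<lambda>t. \<Psi> t X v p)"
    if "finite X" "v \<in> X \<rightarrow> carrier V" "p \<in> elts X" for X v p
    unfolding \<Psi>_def by (rule lin_fock_space_lift[OF V comp2[OF that] refl])
  have \<Psi>_cls: "\<Psi> (cls V Y w q) X v p = \<Theta> X v p Y w q"
    if "finite X" "v \<in> X \<rightarrow> carrier V" "p \<in> elts X"
      "finite Y" "w \<in> Y \<rightarrow> carrier V" "q \<in> elts Y" for X v p Y w q
    unfolding \<Psi>_def by (rule fock_lift_cls[OF V comp2[OF that(1-3)] refl that(4-6)])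
  have F: "module K ?F" by (rule module_fock_space[OF V])
  \<comment> \<open>The zero vector of \<open>obj P {}\<close> is always available as a generator
    without letters, and linearity at this generator exhibits \<open>U\<close> as a module.\<close>
  have U: "module K U"
  proof -
    interpret O: module K "obj P {}" by (rule module_obj) simp
    show ?thesis
      using lin_cod[OF \<Psi>_lin[of "{}" "\<lambda>_. undefined" "\<zero>\<^bsub>obj P {}\<^esub>"]] by simp
  qed
  have comp\<Psi>: "fock_compatible V U (\<Psi> t)" if t: "t \<in> carrier ?F" for t
  proof (rule fock_compatibleI[OF V U])
    fix X :: "nat set" and v assume X: "finite X" "v \<in> X \<rightarrow> carrier V"
    show "lin K (obj P X) U (\<Psi> t X v)" unfolding \<Psi>_def[abs_def]
      using comp1 X by (intro fock_lift_param[OF V module_obj _ refl _ t] comp2) (auto simp: fock_compatible_def)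
    fix p i assume p: "p \<in> elts X" and i: "i \<in> X"
    show "lin K V U (\<lambda>a. \<Psi> t X (v(i := a)) p)" unfolding \<Psi>_def[abs_def]
    proof (rule fock_lift_param[OF V V _ refl _ t])
      show "fock_compatible V U (\<Theta> X (v(i := a)) p)" if "a \<in> carrier V" for a
        using X p that by (intro comp2) auto
      show "lin K V U (\<lambda>a. \<Theta> X (v(i := a)) p Y w q)"
        if "finite Y" "w \<in> Y \<rightarrow> carrier V" "q \<in> elts Y" for Y w q
        by (rule compatibleD(2)[OF V comp1[OF that] X p i])
    qed
  next
    fix X :: "nat set" and v and v' and p and \<sigma> :: "nat \<Rightarrow> nat"
    assume X: "finite X" "v \<in> X \<rightarrow> carrier V" and p: "p \<in> elts X" and \<sigma>: "inj_on \<sigma> X"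
      and v': "\<And>x. x \<in> X ==> v' (\<sigma> x) = v x"
    have "v' \<in> \<sigma> ` X \<rightarrow> carrier V" using X v' by auto
    note a = finite_imageI[OF X(1), of \<sigma>] this arr_closed[OF X(1) \<sigma> refl[of "\<sigma> ` X"] p]
    show "\<Psi> t (\<sigma> ` X) v' (arr P X \<sigma> p) = \<Psi> t X v p"
    \<comment> \<open>Invariance in the first argument is known for each generator in the second
      place; linearity in \<open>t\<close> extends it to all vectors.\<close>
    proof (rule fock_space_eqI[OF V \<Psi>_lin[OF a] \<Psi>_lin[OF X p] _ t])
      fix Y w q assume Y: "finite Y" "w \<in> Y \<rightarrow> carrier V" "q \<in> elts Y"
      have "\<Theta> (\<sigma> ` X) v' (arr P X \<sigma> p) Y w q = \<Theta> X v p Y w q"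
        using comp1[OF Y] X p \<sigma> v' by (simp add: fock_compatible_def)
      then show "\<Psi> (cls V Y w q) (\<sigma> ` X) v' (arr P X \<sigma> p) = \<Psi> (cls V Y w q) X v p"
        using \<Psi>_cls[OF a Y] \<Psi>_cls[OF X p Y] by simp
    qed
  qed
  have gen1: "lift K U (\<lambda>(ws, q). \<gamma> vs p ws q) t = \<Psi> t {1..length vs} (\<lambda>i. vs ! (i - 1)) p"
    if g: "(vs, p) \<in> fock_gens P V" and t: "t \<in> carrier ?F" for vs p t
  proof -
    note c = comp2[OF finite_atLeastAtMost letters_upto[OF g] gens_obj[OF g]]
    show ?thesis
      by (rule fock_space_eqI[OF V lin_fock_space_lift[OF V c gen[OF g]] \<Psi>_lin[OF finite_atLeastAtMost letters_upto[OF g] gens_obj[OF g]] _ t])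
         (simp_all add: fock_lift_cls[OF V c gen[OF g]] \<Psi>_cls[OF finite_atLeastAtMost letters_upto[OF g] gens_obj[OF g]])
  qed
  show ?bilin
  proof (rule bilinI[OF F F U])
    fix t assume t: "t \<in> carrier ?F"
    show "lin K ?F U (\<lambda>s. \<mu> s t)" unfolding \<mu>_def by (rule lin_fock_space_lift[OF V comp\<Psi>[OF t] gen1[OF _ t]])
  next
    fix s assume s: "s \<in> carrier ?F"
    show "lin K ?F U (\<mu> s)" unfolding \<mu>_def
      by (rule fock_lift_param[OF V F comp\<Psi> gen1 _ s]) (auto intro: \<Psi>_lin)
  qed
  {
    assume X: "finite X" "v \<in> X \<rightarrow> carrier V" "p \<in> elts X"
      and Y: "finite Y" "w \<in> Y \<rightarrow> carrier V" "q \<in> elts Y"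
    have t: "cls V Y w q \<in> carrier ?F"
      using fock_compatible_cls[OF V] Y by (auto simp: fock_compatible_def dest: lin_closed)
    show "\<mu> (cls V X v p) (cls V Y w q) = \<Theta> X v p Y w q"
      unfolding \<mu>_def
      by (simp add: fock_lift_cls[OF V comp\<Psi>[OF t] gen1[OF _ t] X] \<Psi>_cls[OF X Y])
  }
  {
    assume g: "(vs, p) \<in> fock_gens P V" and g': "(ws, q) \<in> fock_gens P V"
    have t: "fock_cls K P V ws q \<in> carrier ?F" by (rule fock_cls_closed[OF V g'])
    note c = comp2[OF finite_atLeastAtMost letters_upto[OF g] gens_obj[OF g]]
    show "\<mu> (fock_cls K P V vs p) (fock_cls K P V ws q) = \<gamma> vs p ws q"
      unfolding \<mu>_def by (simp add: fock_lift_gens[OF V comp\<Psi>[OF t] gen1[OF _ t] g] fock_lift_gens[OF V c gen[OF g] g'])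
  }
qed

end

section \<open>The Fock space as an algebra\<close>

lemma tensor_space_fields_cong:
  assumes "carrier A' = carrier A" "add A' = add A" "smult A' = smult A"
    "carrier B' = carrier B" "add B' = add B" "smult B' = smult B"
  shows "tensor_space K A' B' = tensor_space K A B" "tens K A' B' = tens K A B"
  by (simp_all add: fun_eq_iff tensor_space_def tens_def tensor_rels_def assms)

lemma finsum_fields_cong:
  assumes "carrier N = carrier M" "zero N = zero M" "add N = add M"
  shows "finsum N = finsum M"
  by (simp add: fun_eq_iff finsum_def finprod_def assms)

text \<open>The Fock space with its product over an arbitrary module of letters. It precedes
  \<open>fock\<close> because its tensor square needs a product before any coproduct is at hand, and
  because it must also exist for letters in V \<otimes> V.\<close>

definition fock_alg :: "('k, 'r) ring_scheme \<Rightarrow> ('k, 'p, 'z) twisted_scheme \<Rightarrow>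
    ('k, 'v, 'm) module_scheme \<Rightarrow> ('k, ('v list \<times> 'p \<Rightarrow> 'k) set) module" where
  "fock_alg K P V = (fock_space K P V)\<lparr>
     mult := (\<lambda>s t. lift K (fock_space K P V) (\<lambda>(vs, p).
       lift K (fock_space K P V) (\<lambda>(ws, q). fock_mult_gen K P V vs p ws q) t) s),
     one := fock_cls K P V [] (tw_one P)\<rparr>"

lemma fock_alg_fields:
  "carrier (fock_alg K P V) = carrier (fock_space K P V)"
  "zero (fock_alg K P V) = zero (fock_space K P V)"
  "add (fock_alg K P V) = add (fock_space K P V)"
  "smult (fock_alg K P V) = smult (fock_space K P V)"
  by (simp_all add: fock_alg_def)

lemma one_fock_alg: "\<one>\<^bsub>fock_alg K P V\<^esub> = fock_cls K P V [] (tw_one P)"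
  by (simp add: fock_alg_def)

locale twisted_over =
  fixes K :: "('k, 'r) ring_scheme" and P :: "('k, 'p, 'z) twisted_scheme"
  assumes K_cring: "cring K" and tw: "twisted_bialgebra K P"

sublocale twisted_over \<subseteq> species_over K P
  by (rule species_over.intro)
     (simp_all only: K_cring tw[unfolded twisted_bialgebra_def twisted_algebra_def])

context twisted_over
begin

abbreviation FA where "FA V \<equiv> fock_alg K P V"

abbreviation FF where "FF A B \<equiv> tensor K (FA A) (FA B)"

abbreviation PP where "PP X Y \<equiv> tensor K (obj P X) (obj P Y)"

abbreviation Fmap where "Fmap A B \<equiv> tmap K (FA A) (FA B)"

lemmas tw_alg = tw[unfolded twisted_bialgebra_def, THEN conjunct1, unfolded twisted_algebra_def, THEN conjunct2]

lemma lin_mul: "finite X ==> finite Y ==> X \<inter> Y = {} ==> Z = X \<union> Y ==>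
    lin K (PP X Y) (obj P Z) (tw_mult P X Y)"
  using tw_alg[THEN conjunct1] by (simp add: lin_def module_tensor module_obj)

lemma mul_natural: "finite X ==> finite Y ==> X \<inter> Y = {} ==> inj_on \<sigma> (X \<union> Y) ==>
    t \<in> carrier (PP X Y) ==>
    arr P (X \<union> Y) \<sigma> (tw_mult P X Y t) = tw_mult P (\<sigma> ` X) (\<sigma> ` Y)
      (tmap K (obj P (\<sigma> ` X)) (obj P (\<sigma> ` Y)) (arr P X \<sigma>) (arr P Y \<sigma>) t)"
  using tw_alg[THEN conjunct2, THEN conjunct1] by simp

lemma mul_assoc: "finite X ==> finite Y ==> finite Z ==> X \<inter> Y = {} ==> X \<inter> Z = {} ==> Y \<inter> Z = {} ==>
    t \<in> carrier (tensor K (PP X Y) (obj P Z)) ==>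
    tw_mult P (X \<union> Y) Z (tmap K (obj P (X \<union> Y)) (obj P Z) (tw_mult P X Y) id t) =
    tw_mult P X (Y \<union> Z) (tmap K (obj P X) (obj P (Y \<union> Z)) id (tw_mult P Y Z)
      (tassoc K (obj P X) (obj P Y) (obj P Z) t))"
  using tw_alg[THEN conjunct2, THEN conjunct2, THEN conjunct1] by simp

lemma tw_one_closed: "tw_one P \<in> elts {}"
  and mul_one_left: "finite X ==> p \<in> elts X ==>
    tw_mult P {} X (tens K (obj P {}) (obj P X) (tw_one P) p) = p"
  and mul_one_right: "finite X ==> p \<in> elts X ==>
    tw_mult P X {} (tens K (obj P X) (obj P {}) p (tw_one P)) = p"
  using tw_alg[THEN conjunct2, THEN conjunct2, THEN conjunct2] by simp_all

lemma mul_tens_closed: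
  assumes "finite X" "finite Y" "X \<inter> Y = {}" "Z = X \<union> Y" "p \<in> elts X" "q \<in> elts Y"
  shows "tw_mult P X Y (tens K (obj P X) (obj P Y) p q) \<in> elts Z"
  by (rule lin_closed[OF lin_mul[OF assms(1-4)] tens_closed[OF module_obj module_obj]]) (use assms in auto)

context
  fixes V :: "('k, 'v, 'm) module_scheme"
  assumes V: "module K V"
begin

lemma module_FA: "module K (FA V)"
  by (rule module_fields_cong[OF module_fock_space[OF V]]) (simp_all add: fock_alg_fields)

lemma lin_FA_dom: "lin K (fock_space K P V) U f ==> lin K (FA V) U f"
  by (erule lin_fields_cong) (simp_all add: fock_alg_fields)

lemma lin_FA_cod: "lin K U (fock_space K P V) f ==> lin K U (FA V) f"
  by (erule lin_fields_cong) (simp_all add: fock_alg_fields)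

lemma lin_FA_domD: "lin K (FA V) U f ==> lin K (fock_space K P V) U f"
  by (erule lin_fields_cong) (simp_all add: fock_alg_fields)

lemma lin_cls: "finite X ==> v \<in> X \<rightarrow> carrier V ==> lin K (obj P X) (FA V) (cls V X v)"
  by (intro lin_FA_cod lin_cls_space V)

lemma lin_cls_letter: "finite X ==> v \<in> X \<rightarrow> carrier V ==> i \<in> X ==> p \<in> elts X ==>
    lin K V (FA V) (\<lambda>a. cls V X (v(i := a)) p)"
  by (intro lin_FA_cod lin_cls_letter_space V)

lemma cls_closed: "finite X ==> v \<in> X \<rightarrow> carrier V ==> p \<in> elts X ==>
    cls V X v p \<in> carrier (FA V)"
  by (rule lin_closed[OF lin_cls])

lemma FA_eqI:
  assumes "lin K (FA V) U f" "lin K (FA V) U g"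
    "\<And>X v p. finite X ==> v \<in> X \<rightarrow> carrier V ==> p \<in> elts X ==>
      f (cls V X v p) = g (cls V X v p)"
    "x \<in> carrier (FA V)"
  shows "f x = g x"
  using fock_space_eqI[OF V lin_FA_domD[OF assms(1)] lin_FA_domD[OF assms(2)] assms(3)] assms(4)
  by (simp add: fock_alg_fields)

lemma cls_empty: "p \<in> elts {} ==> cls V {} v p = fock_cls K P V [] p"
  using arr_id[of "{}" "rank_in {}" p] by (simp add: cls_def)

text \<open>Index sets may be renamed, so the second of two generators can be moved away from the
  index set \<open>S\<close> of the first, and both then read their letters from one family
  \<open>u\<close>. The set \<open>D\<close> is the carrier, or a determining set to which the
  letters have to be confined.\<close>

lemma cls_disjoint:
  assumes "D \<subseteq> carrier V" "finite S" "v \<in> S \<rightarrow> D" "finite Z" "w \<in> Z \<rightarrow> D" "r \<in> elts Z"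
  obtains Z' u r' where "finite Z'" "Z' \<inter> S = {}" "u \<in> (S \<union> Z') \<rightarrow> D" "\<And>x. x \<in> S ==> u x = v x"
    "r' \<in> elts Z'" "cls V Z w r = cls V Z' u r'"
proof -
  \<comment> \<open>A shift beyond every element of \<open>S\<close>; inserting 0 gives the maximum
    a meaning when \<open>S\<close> is empty.\<close>
  define N where "N = Suc (Max (insert 0 S))"
  have N: "x < N" if "x \<in> S" for x using that assms(2) by (simp add: N_def less_Suc_eq_le)
  define u where "u n = (if n \<in> S then v n else w (n - N))" for n
  have inj: "inj_on (\<lambda>n. n + N) Z" by simp
  have disj: "(\<lambda>n. n + N) ` Z \<inter> S = {}" using N by force
  have uw: "u (n + N) = w n" for n using N[of "n + N"] by (auto simp: u_def)
  show thesis
  proof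
    show "u \<in> S \<union> (\<lambda>n. n + N) ` Z \<rightarrow> D" using assms uw by (auto simp: u_def)
    have w: "w \<in> Z \<rightarrow> carrier V" using assms(1,5) by auto
    show "cls V Z w r = cls V ((\<lambda>n. n + N) ` Z) u (arr P Z (\<lambda>n. n + N) r)"
      by (rule cls_natural[OF V assms(4) inj uw w assms(6), symmetric])
  qed (use assms disj inj in \<open>auto simp: u_def intro: arr_closed\<close>)
qed

lemma bilin_FA_eqI:
  assumes f: "bilin K (FA V) (FA V) U f" and g: "bilin K (FA V) (FA V) U g"
    and eq: "\<And>X Y v p q. finite X ==> finite Y ==> X \<inter> Y = {} ==> v \<in> X \<union> Y \<rightarrow> carrier V ==>
      p \<in> elts X ==> q \<in> elts Y ==>
      f (cls V X v p) (cls V Y v q) = g (cls V X v p) (cls V Y v q)"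
    and xy: "x \<in> carrier (FA V)" "y \<in> carrier (FA V)"
  shows "f x y = g x y"
proof (rule FA_eqI[OF bilin_left[OF f xy(2)] bilin_left[OF g xy(2)] _ xy(1)])
  fix X v p assume X: "finite X" "v \<in> X \<rightarrow> carrier V" "p \<in> elts X"
  note c = cls_closed[OF X]
  show "f (cls V X v p) y = g (cls V X v p) y"
  proof (rule FA_eqI[OF bilin_right[OF f c] bilin_right[OF g c] _ xy(2)])
    fix Y w q assume Y: "finite Y" "w \<in> Y \<rightarrow> carrier V" "q \<in> elts Y"
    obtain Z u r where Z: "finite Z" "Z \<inter> X = {}" "u \<in> (X \<union> Z) \<rightarrow> carrier V" "\<And>x. x \<in> X ==> u x = v x"
      "r \<in> elts Z" and e: "cls V Y w q = cls V Z u r"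
      using cls_disjoint[OF subset_refl X(1,2) Y] by blast
    have "cls V X v p = cls V X u p" using Z by (intro cls_cong X) auto
    then show "f (cls V X v p) (cls V Y w q) = g (cls V X v p) (cls V Y w q)"
      using eq[OF X(1) Z(1) _ Z(3) X(3) Z(5)] Z(2) by (auto simp: e)
  qed
qed

text \<open>Two ways of placing \<open>X\<close> and \<open>Y\<close> disjointly differ by a
  bijection \<rho> between the unions, and both the product of \<open>P\<close> and
  \<open>cls\<close> are natural along \<rho>. It is used to compare the placement on even and odd
  numbers with its renamings, with the shift by \<open>k\<close>, and with the identity.\<close>

lemma mult_relabel:
  assumes X: "finite X" "p \<in> elts X" and Y: "finite Y" "q \<in> elts Y"
    and st: "inj_on \<sigma> X" "inj_on \<tau> Y" "\<sigma> ` X \<inter> \<tau> ` Y = {}"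
    and st': "inj_on \<sigma>' X" "inj_on \<tau>' Y" "\<sigma>' ` X \<inter> \<tau>' ` Y = {}"
    and u: "\<And>x. x \<in> X ==> u (\<sigma> x) = u' (\<sigma>' x)" "\<And>y. y \<in> Y ==> u (\<tau> y) = u' (\<tau>' y)"
    and uV: "u' \<in> (\<sigma>' ` X \<union> \<tau>' ` Y) \<rightarrow> carrier V"
  shows "cls V (\<sigma> ` X \<union> \<tau> ` Y) u (tw_mult P (\<sigma> ` X) (\<tau> ` Y)
      (tens K (obj P (\<sigma> ` X)) (obj P (\<tau> ` Y)) (arr P X \<sigma> p) (arr P Y \<tau> q))) =
    cls V (\<sigma>' ` X \<union> \<tau>' ` Y) u' (tw_mult P (\<sigma>' ` X) (\<tau>' ` Y)
      (tens K (obj P (\<sigma>' ` X)) (obj P (\<tau>' ` Y)) (arr P X \<sigma>' p) (arr P Y \<tau>' q)))"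
proof -
  let ?X = "\<sigma>' ` X" and ?Y = "\<tau>' ` Y"
  define \<rho> where "\<rho> n = (if n \<in> ?X then \<sigma> (inv_into X \<sigma>' n) else \<tau> (inv_into Y \<tau>' n))" for n
  have \<rho>X: "\<rho> (\<sigma>' x) = \<sigma> x" if "x \<in> X" for x using that st' by (simp add: \<rho>_def)
  have \<rho>Y: "\<rho> (\<tau>' y) = \<tau> y" if "y \<in> Y" for y
    using that st' by (auto simp: \<rho>_def)
  have inj: "inj_on \<rho> (?X \<union> ?Y)"
  proof (rule inj_onI)
    fix a b assume ab: "a \<in> ?X \<union> ?Y" "b \<in> ?X \<union> ?Y" "\<rho> a = \<rho> b"
    have ne: "\<sigma> x \<noteq> \<tau> y" if "x \<in> X" "y \<in> Y" for x y using st(3) that by blast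
    from ab show "a = b"
      by (elim UnE imageE)
         (simp_all add: \<rho>X \<rho>Y ne ne[symmetric] inj_on_eq_iff[OF st(1)] inj_on_eq_iff[OF st(2)])
  qed
  have im: "\<rho> ` ?X = \<sigma> ` X" "\<rho> ` ?Y = \<tau> ` Y" using \<rho>X \<rho>Y by (auto simp: image_image)
  have injs: "inj_on \<rho> ?X" "inj_on \<rho> ?Y" using inj by (auto intro: inj_on_subset)
  have aX: "arr P ?X \<rho> (arr P X \<sigma>' p) = arr P X \<sigma> p"
    using arr_comp[OF X(1) st'(1) injs(1) X(2)] arr_cong[OF X(1) st(1) _ X(2), of "\<rho> \<circ> \<sigma>'"] \<rho>X by simp
  have aY: "arr P ?Y \<rho> (arr P Y \<tau>' q) = arr P Y \<tau> q"
    using arr_comp[OF Y(1) st'(2) injs(2) Y(2)] arr_cong[OF Y(1) st(2) _ Y(2), of "\<rho> \<circ> \<tau>'"] \<rho>Y by simp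
  have c: "arr P X \<sigma>' p \<in> elts ?X" "arr P Y \<tau>' q \<in> elts ?Y"
    using X Y st' by (auto intro: arr_closed)
  have m: "module K (obj P ?X)" "module K (obj P ?Y)" using X Y by (auto intro: module_obj)
  let ?t = "tens K (obj P ?X) (obj P ?Y) (arr P X \<sigma>' p) (arr P Y \<tau>' q)"
  have t: "?t \<in> carrier (PP ?X ?Y)" by (intro tens_closed m c)
  have "arr P (?X \<union> ?Y) \<rho> (tw_mult P ?X ?Y ?t) =
      tw_mult P (\<sigma> ` X) (\<tau> ` Y) (tens K (obj P (\<sigma> ` X)) (obj P (\<tau> ` Y)) (arr P X \<sigma> p) (arr P Y \<tau> q))"
    using X Y c st'(3) tmap_tens[OF lin_arr[OF _ injs(1) refl] lin_arr[OF _ injs(2) refl]]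
    by (subst mul_natural[OF _ _ _ inj t]) (auto simp: im aX aY)
  moreover have "cls V (\<rho> ` (?X \<union> ?Y)) u (arr P (?X \<union> ?Y) \<rho> (tw_mult P ?X ?Y ?t)) =
      cls V (?X \<union> ?Y) u' (tw_mult P ?X ?Y ?t)"
    using X Y c st' uV u \<rho>X \<rho>Y by (intro cls_natural V inj mul_tens_closed) auto
  ultimately show ?thesis by (simp add: image_Un im)
qed

text \<open>The index sets of two generators may overlap, whereas the product of \<open>P\<close>
  needs disjoint ones. Even and odd numbers provide a disjoint union by one formula for all pairs,
  so that compatibility can be checked in each argument separately. The last two clauses read it
  back as concatenation of words and as a plain union of disjoint sets.\<close>

lemma fock_mult_hyps:
  defines "\<Theta> \<equiv> \<lambda>X v p Y w q. cls V ((\<lambda>n. 2 * n) ` X \<union> (\<lambda>n. 2 * n + 1) ` Y)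
    (\<lambda>n. if even n then v (n div 2) else w (n div 2))
    (tw_mult P ((\<lambda>n. 2 * n) ` X) ((\<lambda>n. 2 * n + 1) ` Y)
      (tens K (obj P ((\<lambda>n. 2 * n) ` X)) (obj P ((\<lambda>n. 2 * n + 1) ` Y))
        (arr P X (\<lambda>n. 2 * n) p) (arr P Y (\<lambda>n. 2 * n + 1) q)))"
  shows "finite Y ==> w \<in> Y \<rightarrow> carrier V ==> q \<in> elts Y ==>
      fock_compatible V (FA V) (\<lambda>X v p. \<Theta> X v p Y w q)"
    and "finite X ==> v \<in> X \<rightarrow> carrier V ==> p \<in> elts X ==>
      fock_compatible V (FA V) (\<Theta> X v p)"
    and "(vs, p) \<in> fock_gens P V ==> (ws, q) \<in> fock_gens P V ==>
      fock_mult_gen K P V vs p ws q = \<Theta> {1..length vs} (\<lambda>i. vs ! (i - 1)) p {1..length ws} (\<lambda>i. ws ! (i - 1)) q"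
    and "finite X ==> finite Y ==> X \<inter> Y = {} ==> v \<in> X \<union> Y \<rightarrow> carrier V ==>
      p \<in> elts X ==> q \<in> elts Y ==>
      \<Theta> X v p Y v q = cls V (X \<union> Y) v (tw_mult P X Y (tens K (obj P X) (obj P Y) p q))"
proof -
  let ?d = "\<lambda>n::nat. 2 * n" and ?o = "\<lambda>n::nat. 2 * n + 1"
  let ?u = "\<lambda>v w n. if even n then v (n div 2) else w (n div 2)"
  have inj: "inj_on ?d X" "inj_on ?o X" for X by (auto simp: inj_on_def)
  have disj: "?d ` X \<inter> ?o ` Y = {}" for X Y by auto presburger
  have uV: "?u v w \<in> ?d ` X \<union> ?o ` Y \<rightarrow> carrier V"
    if "v \<in> X \<rightarrow> carrier V" "w \<in> Y \<rightarrow> carrier V" for X Y v w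
    using that by auto
  have nat: "\<Theta> (\<sigma> ` X) v' (arr P X \<sigma> p) (\<tau> ` Y) w' (arr P Y \<tau> q) = \<Theta> X v p Y w q"
    if X: "finite X" "v \<in> X \<rightarrow> carrier V" "p \<in> elts X"
      and Y: "finite Y" "w \<in> Y \<rightarrow> carrier V" "q \<in> elts Y"
      and \<sigma>: "inj_on \<sigma> X" "\<And>x. x \<in> X ==> v' (\<sigma> x) = v x"
      and \<tau>: "inj_on \<tau> Y" "\<And>y. y \<in> Y ==> w' (\<tau> y) = w y"
    for X Y v w p q v' w' and \<sigma> \<tau> :: "nat \<Rightarrow> nat"
  proof -
    have e: "arr P (\<sigma> ` X) ?d (arr P X \<sigma> p) = arr P X (?d \<circ> \<sigma>) p"
      "arr P (\<tau> ` Y) ?o (arr P Y \<tau> q) = arr P Y (?o \<circ> \<tau>) q"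
      using X Y \<sigma> \<tau> inj by (auto intro!: arr_comp)
    have i: "?d ` \<sigma> ` X = (?d \<circ> \<sigma>) ` X" "?o ` \<tau> ` Y = (?o \<circ> \<tau>) ` Y" by (simp_all add: image_comp)
    have dd: "(?d \<circ> \<sigma>) ` X \<inter> (?o \<circ> \<tau>) ` Y = {}"
      using disj[of "\<sigma> ` X" "\<tau> ` Y"] unfolding i .
    show ?thesis
      unfolding \<Theta>_def e i
    proof (rule mult_relabel[OF X(1,3) Y(1,3)])
      show "inj_on (?d \<circ> \<sigma>) X" "inj_on (?o \<circ> \<tau>) Y"
        using \<sigma>(1) \<tau>(1) by (auto simp: inj_on_def)
      show "?u v' w' ((?d \<circ> \<sigma>) x) = ?u v w (2 * x)" if "x \<in> X" for x
        using \<sigma>(2)[OF that] by simp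
      show "?u v' w' ((?o \<circ> \<tau>) y) = ?u v w (2 * y + 1)" if "y \<in> Y" for y
        using \<tau>(2)[OF that] by simp
    qed (rule dd inj disj uV[OF X(2) Y(2)])+
  qed
  have nat1: "\<Theta> (\<sigma> ` X) v' (arr P X \<sigma> p) Y w q = \<Theta> X v p Y w q"
    if "finite X" "v \<in> X \<rightarrow> carrier V" "p \<in> elts X"
      and Y: "finite Y" "w \<in> Y \<rightarrow> carrier V" "q \<in> elts Y"
      and "inj_on \<sigma> X" "\<And>x. x \<in> X ==> v' (\<sigma> x) = v x"
    for X Y v w p q v' and \<sigma> :: "nat \<Rightarrow> nat"
    using nat[OF that, of id w] arr_id[OF Y(1) _ Y(3), of id] by simp
  have nat2: "\<Theta> X v p (\<tau> ` Y) w' (arr P Y \<tau> q) = \<Theta> X v p Y w q"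
    if X: "finite X" "v \<in> X \<rightarrow> carrier V" "p \<in> elts X"
      and Y: "finite Y" "w \<in> Y \<rightarrow> carrier V" "q \<in> elts Y"
      and \<tau>: "inj_on \<tau> Y" "\<And>y. y \<in> Y ==> w' (\<tau> y) = w y"
    for X Y v w p q w' and \<tau> :: "nat \<Rightarrow> nat"
    using nat[OF X Y inj_on_id _ \<tau>, of v] arr_id[OF X(1) _ X(3), of id] by simp
  have m: "module K (obj P (?d ` X))" "module K (obj P (?o ` X))" if "finite X" for X
    using that by (auto intro: module_obj)
  have lp: "lin K (obj P X) (FA V) (\<lambda>p. \<Theta> X v p Y w q)"
    if X: "finite X" "v \<in> X \<rightarrow> carrier V"
      and Y: "finite Y" "w \<in> Y \<rightarrow> carrier V" "q \<in> elts Y" for X Y v w q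
    unfolding \<Theta>_def using X Y uV[OF X(2) Y(2)] disj
    by (intro lin_comp[OF _ lin_cls] lin_comp[OF _ lin_mul] lin_comp[OF lin_arr[OF _ inj(1) refl]] lin_tens_left
        arr_closed[OF _ inj(2) refl] m) auto
  have lq: "lin K (obj P Y) (FA V) (\<Theta> X v p Y w)"
    if X: "finite X" "v \<in> X \<rightarrow> carrier V" "p \<in> elts X"
      and Y: "finite Y" "w \<in> Y \<rightarrow> carrier V" for X Y v w p
    unfolding \<Theta>_def using X Y uV[OF X(2) Y(2)] disj
    by (intro lin_comp[OF _ lin_cls] lin_comp[OF _ lin_mul] lin_comp[OF lin_arr[OF _ inj(2) refl]] lin_tens_right
        arr_closed[OF _ inj(1) refl] m) auto
  have uv: "?u (v(i := a)) w = (?u v w)(?d i := a)" for v w i a by (auto simp: fun_eq_iff)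
  have uw: "?u v (w(i := a)) = (?u v w)(?o i := a)" for v w i a
    by (rule ext) (auto elim!: oddE)
  have pq: "tw_mult P (?d ` X) (?o ` Y) (tens K (obj P (?d ` X)) (obj P (?o ` Y)) (arr P X ?d p) (arr P Y ?o q))
      \<in> elts (?d ` X \<union> ?o ` Y)"
    if "finite X" "p \<in> elts X" "finite Y" "q \<in> elts Y" for X Y p q
    using that disj by (intro mul_tens_closed arr_closed[OF _ inj(1) refl] arr_closed[OF _ inj(2) refl]) auto
  show "fock_compatible V (FA V) (\<lambda>X v p. \<Theta> X v p Y w q)"
    if Y: "finite Y" "w \<in> Y \<rightarrow> carrier V" "q \<in> elts Y"
  proof (rule fock_compatibleI[OF V module_FA])
    fix X v p i assume X: "finite X" "v \<in> X \<rightarrow> carrier V" "p \<in> elts X" "i \<in> X"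
    show "lin K V (FA V) (\<lambda>a. \<Theta> X (v(i := a)) p Y w q)"
      unfolding \<Theta>_def uv using X Y uV[OF X(2) Y(2)] by (intro lin_cls_letter pq) auto
  qed (rule lp nat1; (rule Y | assumption | blast))+
  show "fock_compatible V (FA V) (\<Theta> X v p)"
    if X: "finite X" "v \<in> X \<rightarrow> carrier V" "p \<in> elts X"
  proof (rule fock_compatibleI[OF V module_FA])
    fix Y w q i assume Y: "finite Y" "w \<in> Y \<rightarrow> carrier V" "q \<in> elts Y" "i \<in> Y"
    show "lin K V (FA V) (\<lambda>a. \<Theta> X v p Y (w(i := a)) q)"
      unfolding \<Theta>_def uw using X Y uV[OF X(2) Y(2)] by (intro lin_cls_letter pq) auto
  qed (rule lq nat2; (rule X | assumption | blast))+
  show "fock_mult_gen K P V vs p ws q =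
      \<Theta> {1..length vs} (\<lambda>i. vs ! (i - 1)) p {1..length ws} (\<lambda>i. ws ! (i - 1)) q"
    if g: "(vs, p) \<in> fock_gens P V" and g': "(ws, q) \<in> fock_gens P V"
  proof -
    let ?k = "length vs" and ?l = "length ws"
    have s: "(\<lambda>j. ?k + j) ` {1..?l} = {?k + 1..?k + ?l}"
      using image_add_atLeastAtMost[of ?k 1 ?l] by simp
    have U: "{1..?k} \<union> {?k + 1..?k + ?l} = {1..length (vs @ ws)}" by auto
    have idp: "arr P {1..?k} (\<lambda>n. n) p = p" using gens_obj[OF g] by (intro arr_id) auto
    have vw: "set (vs @ ws) \<subseteq> carrier V" using g g' by (auto simp: fock_gens_def)
    have c: "tw_mult P {1..?k} {?k + 1..?k + ?l} (tens K (obj P {1..?k}) (obj P {?k + 1..?k + ?l}) p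
        (arr P {1..?l} (\<lambda>j. ?k + j) q)) \<in> carrier (obj P {1..length (vs @ ws)})"
      using gens_obj[OF g] gens_obj[OF g'] s
      by (intro mul_tens_closed arr_closed) (auto simp: U[symmetric])
    have "fock_mult_gen K P V vs p ws q = cls V {1..length (vs @ ws)} (\<lambda>i. (vs @ ws) ! (i - 1))
        (tw_mult P {1..?k} {?k + 1..?k + ?l} (tens K (obj P {1..?k}) (obj P {?k + 1..?k + ?l}) p
          (arr P {1..?l} (\<lambda>j. ?k + j) q)))"
      unfolding fock_mult_gen_def Let_def
      by (rule cls_upto[symmetric]) (use vw c in \<open>auto simp: fock_gens_def\<close>)
    also have "\<dots> = \<Theta> {1..?k} (\<lambda>i. vs ! (i - 1)) p {1..?l} (\<lambda>i. ws ! (i - 1)) q"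
      unfolding \<Theta>_def U[symmetric] s[symmetric]
    proof (rule mult_relabel[OF finite_atLeastAtMost gens_obj[OF g] finite_atLeastAtMost gens_obj[OF g'],
          where \<sigma> = "\<lambda>n. n", unfolded idp image_ident])
      show "(vs @ ws) ! (x - 1) = ?u (\<lambda>i. vs ! (i - 1)) (\<lambda>i. ws ! (i - 1)) (2 * x)" if "x \<in> {1..?k}" for x
        using that by (auto simp: nth_append)
      show "(vs @ ws) ! (?k + y - 1) = ?u (\<lambda>i. vs ! (i - 1)) (\<lambda>i. ws ! (i - 1)) (2 * y + 1)" if "y \<in> {1..?l}" for y
        using that by (auto simp: nth_append)
      show "{1..?k} \<inter> (\<lambda>j. ?k + j) ` {1..?l} = {}" by auto
    qed (use inj disj uV[OF letters_upto[OF g] letters_upto[OF g']] in simp_all)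
    finally show ?thesis .
  qed
  show "\<Theta> X v p Y v q = cls V (X \<union> Y) v (tw_mult P X Y (tens K (obj P X) (obj P Y) p q))"
    if "finite X" "finite Y" "X \<inter> Y = {}" "v \<in> X \<union> Y \<rightarrow> carrier V"
      "p \<in> elts X" "q \<in> elts Y"
    unfolding \<Theta>_def
  proof -
    have e: "arr P X (\<lambda>n. n) p = p" "arr P Y (\<lambda>n. n) q = q" using that by (auto intro: arr_id)
    show "cls V (?d ` X \<union> ?o ` Y) (?u v v) (tw_mult P (?d ` X) (?o ` Y)
        (tens K (obj P (?d ` X)) (obj P (?o ` Y)) (arr P X ?d p) (arr P Y ?o q))) =
      cls V (X \<union> Y) v (tw_mult P X Y (tens K (obj P X) (obj P Y) p q))"
      by (rule mult_relabel[OF that(1,5) that(2,6), where \<sigma>' = "\<lambda>n. n" and \<tau>' = "\<lambda>n. n", unfolded e image_ident])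
         (use that inj disj in simp_all)
  qed
qed

lemma mult_FA: "mult (FA V) = (\<lambda>s t. lift K (FA V) (\<lambda>(vs, p).
    lift K (FA V) (\<lambda>(ws, q). fock_mult_gen K P V vs p ws q) t) s)"
proof -
  have *: "lift K (FA V) = lift K (fock_space K P V)"
    by (rule lift_fields_cong) (simp_all add: fock_alg_fields)
  show ?thesis unfolding * by (simp add: fock_alg_def)
qed

lemma bilin_mult: "bilin K (FA V) (FA V) (FA V) (mult (FA V))"
proof -
  have b: "bilin K (fock_space K P V) (fock_space K P V) (FA V) (mult (FA V))"
    unfolding mult_FA by (rule bilin_fock_lift(1)[OF V fock_mult_hyps(1-3)])
  show ?thesis
    by (rule bilinI[OF module_FA module_FA module_FA])
       (auto intro!: lin_FA_dom bilin_left[OF b] bilin_right[OF b] simp: fock_alg_fields)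
qed

lemma mult_gens: "(vs, p) \<in> fock_gens P V ==> (ws, q) \<in> fock_gens P V ==>
    fock_cls K P V vs p \<otimes>\<^bsub>FA V\<^esub> fock_cls K P V ws q = fock_mult_gen K P V vs p ws q"
  unfolding mult_FA by (rule bilin_fock_lift(3)[OF V fock_mult_hyps(1-3)])

lemma mult_cls:
  assumes "finite X" "finite Y" "X \<inter> Y = {}" "v \<in> X \<union> Y \<rightarrow> carrier V"
    "p \<in> elts X" "q \<in> elts Y"
  shows "cls V X v p \<otimes>\<^bsub>FA V\<^esub> cls V Y v q =
    cls V (X \<union> Y) v (tw_mult P X Y (tens K (obj P X) (obj P Y) p q))"
  unfolding mult_FA
  by (rule trans[OF bilin_fock_lift(2)[OF V fock_mult_hyps(1-3)] fock_mult_hyps(4)]) (use assms in auto)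

lemma mult_FA_assoc:
  assumes xyz: "x \<in> carrier (FA V)" "y \<in> carrier (FA V)" "z \<in> carrier (FA V)"
  shows "(x \<otimes>\<^bsub>FA V\<^esub> y) \<otimes>\<^bsub>FA V\<^esub> z = x \<otimes>\<^bsub>FA V\<^esub> (y \<otimes>\<^bsub>FA V\<^esub> z)"
proof (rule bilin_FA_eqI[OF _ _ _ xyz(1,2), where f = "\<lambda>x y. (x \<otimes>\<^bsub>FA V\<^esub> y) \<otimes>\<^bsub>FA V\<^esub> z"
      and g = "\<lambda>x y. x \<otimes>\<^bsub>FA V\<^esub> (y \<otimes>\<^bsub>FA V\<^esub> z)"])
  note B = bilin_mult
  show "bilin K (FA V) (FA V) (FA V) (\<lambda>x y. (x \<otimes>\<^bsub>FA V\<^esub> y) \<otimes>\<^bsub>FA V\<^esub> z)"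
    by (rule bilin_comp[OF B lin_id lin_id bilin_left[OF B xyz(3)]]) (rule module_FA)+
  show "bilin K (FA V) (FA V) (FA V) (\<lambda>x y. x \<otimes>\<^bsub>FA V\<^esub> (y \<otimes>\<^bsub>FA V\<^esub> z))"
    by (rule bilin_comp[OF B lin_id bilin_left[OF B xyz(3)] lin_id]) (rule module_FA)+
  fix X Y v p q assume X: "finite X" "finite Y" "X \<inter> Y = {}" "v \<in> X \<union> Y \<rightarrow> carrier V"
      "p \<in> elts X" "q \<in> elts Y"
  have cX: "cls V X v p \<in> carrier (FA V)" "cls V Y v q \<in> carrier (FA V)"
    using X by (auto intro!: cls_closed)
  show "(cls V X v p \<otimes>\<^bsub>FA V\<^esub> cls V Y v q) \<otimes>\<^bsub>FA V\<^esub> z =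
      cls V X v p \<otimes>\<^bsub>FA V\<^esub> (cls V Y v q \<otimes>\<^bsub>FA V\<^esub> z)"
  proof (rule FA_eqI[OF bilin_right[OF B bilin_closed[OF B cX]] lin_comp[OF bilin_right[OF B cX(2)] bilin_right[OF B cX(1)]] _ xyz(3)])
    fix Z' w r' assume Z': "finite Z'" "w \<in> Z' \<rightarrow> carrier V" "r' \<in> elts Z'"
    \<comment> \<open>The third generator is moved away from the first two; then all three share one
      family of letters and associativity of \<open>P\<close> applies.\<close>
    obtain Z u r where Z: "finite Z" "Z \<inter> (X \<union> Y) = {}" "u \<in> ((X \<union> Y) \<union> Z) \<rightarrow> carrier V"
      "\<And>x. x \<in> X \<union> Y ==> u x = v x" "r \<in> elts Z" and e: "cls V Z' w r' = cls V Z u r"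
      using cls_disjoint[OF subset_refl finite_UnI[OF X(1,2)] X(4) Z'] by blast
    have v: "cls V X v p = cls V X u p" "cls V Y v q = cls V Y u q"
      using Z X by (auto intro!: cls_cong)
    have m: "module K (obj P X)" "module K (obj P Y)" "module K (obj P Z)"
      using X Z by (auto intro: module_obj)
    have d: "X \<inter> Z = {}" "Y \<inter> Z = {}" "X \<inter> (Y \<union> Z) = {}" "(X \<union> Y) \<inter> Z = {}" using X Z by auto
    let ?T = "\<lambda>A B. tens K (obj P A) (obj P B)"
    have c: "tw_mult P X Y (?T X Y p q) \<in> elts (X \<union> Y)"
      "tw_mult P Y Z (?T Y Z q r) \<in> elts (Y \<union> Z)"
      using X Z d by (auto intro!: mul_tens_closed)
    have i: "lin K (obj P X) (obj P X) id" "lin K (obj P Z) (obj P Z) id"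
      using m by (auto simp: id_def intro: lin_id)
    have t: "tens K (PP X Y) (obj P Z) (?T X Y p q) r
        \<in> carrier (tensor K (PP X Y) (obj P Z))"
      by (intro tens_closed module_tensor m X Z)
    have "tw_mult P (X \<union> Y) Z (?T (X \<union> Y) Z (tw_mult P X Y (?T X Y p q)) r) =
        tw_mult P X (Y \<union> Z) (?T X (Y \<union> Z) p (tw_mult P Y Z (?T Y Z q r)))"
      using mul_assoc[OF X(1,2) Z(1) X(3) d(1,2) t] X Z m i d
        tmap_tens[OF lin_mul[OF X(1-3) refl] i(2)] tmap_tens[OF i(1) lin_mul[OF X(2) Z(1) d(2) refl]]
      by (simp add: tassoc_tens tens_closed)
    moreover have "u \<in> X \<union> Y \<rightarrow> carrier V" "u \<in> Y \<union> Z \<rightarrow> carrier V" "u \<in> (X \<union> Y) \<union> Z \<rightarrow> carrier V"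
      "u \<in> X \<union> (Y \<union> Z) \<rightarrow> carrier V"
      using Z(3) by auto
    ultimately show "(cls V X v p \<otimes>\<^bsub>FA V\<^esub> cls V Y v q) \<otimes>\<^bsub>FA V\<^esub> cls V Z' w r' =
        cls V X v p \<otimes>\<^bsub>FA V\<^esub> (cls V Y v q \<otimes>\<^bsub>FA V\<^esub> cls V Z' w r')"
      unfolding e v using X Z d c by (simp add: mult_cls Un_assoc)
  qed
qed

text \<open>The unit has no letters, so the family \<open>v\<close> in its expression is arbitrary;
  it is chosen equal to the family of the other factor when \<open>mult_cls\<close> is
  applied.\<close>

lemma one_FA_closed: "\<one>\<^bsub>FA V\<^esub> \<in> carrier (FA V)"
  and one_FA: "\<one>\<^bsub>FA V\<^esub> = cls V {} v (tw_one P)"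
  using cls_closed[of "{}" "\<lambda>_. undefined" "tw_one P"] tw_one_closed
  by (simp_all add: one_fock_alg cls_empty)

lemma one_mult_FA:
  assumes "x \<in> carrier (FA V)"
  shows "\<one>\<^bsub>FA V\<^esub> \<otimes>\<^bsub>FA V\<^esub> x = x" "x \<otimes>\<^bsub>FA V\<^esub> \<one>\<^bsub>FA V\<^esub> = x"
proof -
  note B = bilin_mult
  show "\<one>\<^bsub>FA V\<^esub> \<otimes>\<^bsub>FA V\<^esub> x = x"
  proof (rule FA_eqI[OF bilin_right[OF B one_FA_closed] lin_id[OF module_FA] _ assms])
    fix X v p assume X: "finite X" "v \<in> X \<rightarrow> carrier V" "p \<in> elts X"
    show "\<one>\<^bsub>FA V\<^esub> \<otimes>\<^bsub>FA V\<^esub> cls V X v p = cls V X v p"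
      unfolding one_FA[of v] using X tw_one_closed by (simp add: mult_cls mul_one_left)
  qed
  show "x \<otimes>\<^bsub>FA V\<^esub> \<one>\<^bsub>FA V\<^esub> = x"
  proof (rule FA_eqI[OF bilin_left[OF B one_FA_closed] lin_id[OF module_FA] _ assms])
    fix X v p assume X: "finite X" "v \<in> X \<rightarrow> carrier V" "p \<in> elts X"
    show "cls V X v p \<otimes>\<^bsub>FA V\<^esub> \<one>\<^bsub>FA V\<^esub> = cls V X v p"
      unfolding one_FA[of v] using X tw_one_closed by (simp add: mult_cls mul_one_right)
  qed
qed

end

end

section \<open>Sums and counits on tensor products\<close>

lemma (in abelian_monoid) finsum_single:
  assumes "finite A" "i \<in> A" "f i \<in> carrier G" "\<And>j. j \<in> A ==> j \<noteq> i ==> f j = \<zero>"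
  shows "finsum G f A = f i"
proof -
  have "finsum G f A = finsum G f {i}"
    by (rule add.finprod_mono_neutral_cong_right)
       (use assms in auto, metis assms(3,4) zero_closed)
  then show ?thesis using assms by simp
qed

lemma bilin_finsum:
  assumes b: "bilin K A B U \<beta>" and fin: "finite I" "finite J"
    and f: "\<And>i. i \<in> I ==> f i \<in> carrier A" and g: "\<And>j. j \<in> J ==> g j \<in> carrier B"
  shows "\<beta> (finsum A f I) (finsum B g J) = finsum U (\<lambda>(i, j). \<beta> (f i) (g j)) (I \<times> J)"
proof -
  interpret A: module K A using b by (simp add: bilin_def)
  interpret B: module K B using b by (simp add: bilin_def)
  interpret U: module K U using b by (simp add: bilin_def)
  have "\<beta> (finsum A f I) (finsum B g J) = finsum U (\<lambda>i. \<beta> (f i) (finsum B g J)) I"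
    using f g by (intro lin_finsum[OF bilin_left[OF b]] B.finsum_closed) auto
  also have "\<dots> = finsum U (\<lambda>i. finsum U (\<lambda>j. \<beta> (f i) (g j)) J) I"
    using f g by (intro U.finsum_cong' lin_finsum[OF bilin_right[OF b]] refl)
      (auto intro!: U.finsum_closed bilin_closed[OF b])
  also have "\<dots> = finsum U (\<lambda>(i, j). \<beta> (f i) (g j)) (I \<times> J)"
    using f g fin by (intro U.finsum_Sigma) (auto intro: bilin_closed[OF b])
  finally show ?thesis .
qed

text \<open>One step of an iterated coproduct. If on generators \<open>D\<close> is a sum of
  operations \<open>d i\<close> of the species followed by passages \<open>h i\<close> to classes,
  then so is the effect of \<open>D\<close> on the left factor, with the operations of the species
  collected in the innermost map. The axioms of the species can be applied to that inner
  part.\<close>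

lemma tmap_expand_left:
  assumes \<phi>: "lin K P F \<phi>" and D: "lin K F U D" and g: "lin K M N g" and g': "lin K N N' g'"
    and d: "\<And>i. i \<in> S ==> lin K P (Q i) (d i)" and h: "\<And>i. i \<in> S ==> lin K (Q i) U (h i)"
    and eq: "\<And>p. p \<in> carrier P ==> D (\<phi> p) = finsum U (\<lambda>i. h i (d i p)) S"
    and t: "t \<in> carrier (tensor K P M)"
  shows "tmap K U N' D g' (tmap K F N \<phi> g t) =
    finsum (tensor K U N') (\<lambda>i. tmap K U N' (h i) (\<lambda>x. g' (g x)) (tmap K (Q i) M (d i) (\<lambda>x. x) t)) S"
proof -
  interpret T: module K "tensor K U N'" by (rule module_tensor[OF lin_cod[OF D] lin_cod[OF g']])
  note gg = lin_comp[OF g g'] and hd = lin_comp[OF d h]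
  note i = lin_id[OF lin_dom[OF g]]
  have "tmap K U N' D g' (tmap K F N \<phi> g t) = tmap K U N' (\<lambda>x. D (\<phi> x)) (\<lambda>x. g' (g x)) t"
    by (rule tmap_comp[OF \<phi> g D g' t])
  also have "\<dots> = tmap K U N' (\<lambda>x. finsum U (\<lambda>i. h i (d i x)) S) (\<lambda>x. g' (g x)) t"
    by (rule tmap_cong[OF lin_comp[OF \<phi> D] gg t eq]) auto
  also have "\<dots> = finsum (tensor K U N') (\<lambda>i. tmap K U N' (\<lambda>x. h i (d i x)) (\<lambda>x. g' (g x)) t) S"
    by (rule tmap_sum_left[OF hd lin_dom[OF \<phi>] lin_cod[OF D] gg t])
  also have "\<dots> = finsum (tensor K U N') (\<lambda>i. tmap K U N' (h i) (\<lambda>x. g' (g x)) (tmap K (Q i) M (d i) (\<lambda>x. x) t)) S"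
    by (rule T.finsum_cong') (auto simp: tmap_comp[OF d i h gg t] intro!: lin_closed[OF lin_tmap[OF h gg]]
        lin_closed[OF lin_tmap[OF d i] t])
  finally show ?thesis .
qed

lemma tmap_expand_right:
  assumes \<phi>: "lin K P F \<phi>" and D: "lin K F U D" and g: "lin K M N g" and g': "lin K N N' g'"
    and d: "\<And>i. i \<in> S ==> lin K P (Q i) (d i)" and h: "\<And>i. i \<in> S ==> lin K (Q i) U (h i)"
    and eq: "\<And>p. p \<in> carrier P ==> D (\<phi> p) = finsum U (\<lambda>i. h i (d i p)) S"
    and t: "t \<in> carrier (tensor K M P)"
  shows "tmap K N' U g' D (tmap K N F g \<phi> t) =
    finsum (tensor K N' U) (\<lambda>i. tmap K N' U (\<lambda>x. g' (g x)) (h i) (tmap K M (Q i) (\<lambda>x. x) (d i) t)) S"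
proof -
  interpret T: module K "tensor K N' U" by (rule module_tensor[OF lin_cod[OF g'] lin_cod[OF D]])
  note gg = lin_comp[OF g g'] and hd = lin_comp[OF d h]
  note i = lin_id[OF lin_dom[OF g]]
  have "tmap K N' U g' D (tmap K N F g \<phi> t) = tmap K N' U (\<lambda>x. g' (g x)) (\<lambda>x. D (\<phi> x)) t"
    by (rule tmap_comp[OF g \<phi> g' D t])
  also have "\<dots> = tmap K N' U (\<lambda>x. g' (g x)) (\<lambda>x. finsum U (\<lambda>i. h i (d i x)) S) t"
    by (rule tmap_cong[OF gg lin_comp[OF \<phi> D] t _ eq]) auto
  also have "\<dots> = finsum (tensor K N' U) (\<lambda>i. tmap K N' U (\<lambda>x. g' (g x)) (\<lambda>x. h i (d i x)) t) S"
    by (rule tmap_sum_right[OF hd lin_dom[OF \<phi>] lin_cod[OF D] gg t])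
  also have "\<dots> = finsum (tensor K N' U) (\<lambda>i. tmap K N' U (\<lambda>x. g' (g x)) (h i) (tmap K M (Q i) (\<lambda>x. x) (d i) t)) S"
    by (rule T.finsum_cong') (auto simp: tmap_comp[OF i d gg h t] intro!: lin_closed[OF lin_tmap[OF gg h]]
        lin_closed[OF lin_tmap[OF i d] t])
  finally show ?thesis .
qed

lemma eval_left_cong:
  assumes "lin K A (self_module K) e" "module K M" "t \<in> carrier (tensor K A M)"
    "\<And>a. a \<in> carrier A ==> e a = e' a"
  shows "eval_left K M e t = eval_left K M e' t"
proof -
  have l: "lin K A (self_module K) e'" by (rule lin_cong[OF assms(1,4)])
  show ?thesis
    by (rule tensor_eqI[OF lin_dom[OF assms(1)] assms(2) lin_eval_left[OF assms(2,1)] lin_eval_left[OF assms(2) l] _ assms(3)])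
       (simp add: eval_left_tens[OF assms(2,1)] eval_left_tens[OF assms(2) l] assms(4))
qed

lemma eval_right_cong:
  assumes "lin K A (self_module K) e" "module K M" "t \<in> carrier (tensor K M A)"
    "\<And>a. a \<in> carrier A ==> e a = e' a"
  shows "eval_right K M e t = eval_right K M e' t"
proof -
  have l: "lin K A (self_module K) e'" by (rule lin_cong[OF assms(1,4)])
  show ?thesis
    by (rule tensor_eqI[OF assms(2) lin_dom[OF assms(1)] lin_eval_right[OF assms(2,1)] lin_eval_right[OF assms(2) l] _ assms(3)])
       (simp add: eval_right_tens[OF assms(2,1)] eval_right_tens[OF assms(2) l] assms(4))
qed

lemma eval_scaled:
  assumes e: "lin K A (self_module K) e" and M: "module K M" and c: "c \<in> carrier K"
  shows "t \<in> carrier (tensor K A M) ==>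
      eval_left K M (\<lambda>a. c \<otimes>\<^bsub>K\<^esub> e a) t = c \<odot>\<^bsub>M\<^esub> eval_left K M e t"
    and "t \<in> carrier (tensor K M A) ==>
      eval_right K M (\<lambda>a. c \<otimes>\<^bsub>K\<^esub> e a) t = c \<odot>\<^bsub>M\<^esub> eval_right K M e t"
proof -
  interpret M: module K M by (rule M)
  have l: "lin K A (self_module K) (\<lambda>a. c \<otimes>\<^bsub>K\<^esub> e a)" using lin_scale[OF e c] by simp
  have ec: "e a \<in> carrier K" if "a \<in> carrier A" for a using lin_closed[OF e that] by simp
  show "t \<in> carrier (tensor K A M) ==>
      eval_left K M (\<lambda>a. c \<otimes>\<^bsub>K\<^esub> e a) t = c \<odot>\<^bsub>M\<^esub> eval_left K M e t"
    by (rule tensor_eqI[OF lin_dom[OF e] M lin_eval_left[OF M l] lin_scale[OF lin_eval_left[OF M e] c]])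
       (auto simp: eval_left_tens[OF M l] eval_left_tens[OF M e] M.smult_assoc1 c ec)
  show "t \<in> carrier (tensor K M A) ==>
      eval_right K M (\<lambda>a. c \<otimes>\<^bsub>K\<^esub> e a) t = c \<odot>\<^bsub>M\<^esub> eval_right K M e t"
    by (rule tensor_eqI[OF M lin_dom[OF e] lin_eval_right[OF M l] lin_scale[OF lin_eval_right[OF M e] c]])
       (auto simp: eval_right_tens[OF M l] eval_right_tens[OF M e] M.smult_assoc1 c ec)
qed

lemma eval_zero:
  assumes A: "module K A" and M: "module K M"
  shows "t \<in> carrier (tensor K A M) ==> eval_left K M (\<lambda>a. \<zero>\<^bsub>K\<^esub>) t = \<zero>\<^bsub>M\<^esub>"
    and "t \<in> carrier (tensor K M A) ==> eval_right K M (\<lambda>a. \<zero>\<^bsub>K\<^esub>) t = \<zero>\<^bsub>M\<^esub>"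
proof -
  interpret M: module K M by (rule M)
  have l: "lin K A (self_module K) (\<lambda>a. \<zero>\<^bsub>K\<^esub>)"
    using lin_0[OF A module_self[OF M.R.is_cring]] by simp
  show "t \<in> carrier (tensor K A M) ==> eval_left K M (\<lambda>a. \<zero>\<^bsub>K\<^esub>) t = \<zero>\<^bsub>M\<^esub>"
    by (rule tensor_eqI[OF A M lin_eval_left[OF M l] lin_0[OF module_tensor[OF A M] M]])
       (auto simp: eval_left_tens[OF M l])
  show "t \<in> carrier (tensor K M A) ==> eval_right K M (\<lambda>a. \<zero>\<^bsub>K\<^esub>) t = \<zero>\<^bsub>M\<^esub>"
    by (rule tensor_eqI[OF M A lin_eval_right[OF M l] lin_0[OF module_tensor[OF M A] M]])
       (auto simp: eval_right_tens[OF M l])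
qed

text \<open>\<open>restr\<close> selects positions counted from 0, while \<open>A\<close> consists
  of indices counted from 1, hence the shift by \<open>Suc\<close>. Filtering an increasing list
  leaves the increasing enumeration of \<open>A\<close>, and the word takes the form used in
  \<open>cls\<close>.\<close>

lemma restr_eq:
  assumes "A \<subseteq> {1..length vs}"
  shows "restr vs A = map (\<lambda>i. vs ! (i - 1)) (sorted_list_of_set A)"
proof -
  let ?n = "length vs"
  have "zip vs [0..<?n] = map (\<lambda>i. (vs ! i, i)) [0..<?n]"
    by (rule nth_equalityI) auto
  then have "restr vs A = map (\<lambda>i. vs ! i) (filter (\<lambda>i. Suc i \<in> A) [0..<?n])"
    by (simp add: restr_def nths_def filter_map comp_def)
  also have "\<dots> = map (\<lambda>i. vs ! (i - 1)) (filter (\<lambda>i. i \<in> A) (map Suc [0..<?n]))"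
    by (simp add: filter_map comp_def)
  also have "map Suc [0..<?n] = [1..<Suc ?n]" by (simp add: map_Suc_upt One_nat_def del: upt_Suc)
  also have "filter (\<lambda>i. i \<in> A) [1..<Suc ?n] = sorted_list_of_set A"
  proof -
    have "set (filter (\<lambda>i. i \<in> A) [1..<Suc ?n]) = A" using assms by auto
    then show ?thesis
      using sorted_list_of_set.idem_if_sorted_distinct[of "filter (\<lambda>i. i \<in> A) [1..<Suc ?n]"]
      by (simp add: sorted_wrt_filter del: upt_Suc)
  qed
  finally show ?thesis .
qed

section \<open>Functoriality in the letters\<close>

context twisted_over
begin

text \<open>The formula of \<open>fock_map\<close> for linear maps of letters between arbitrary
  modules. It is applied to \<delta>_V, to the evaluations by a counit and to the reassociation of
  letters, whose sources and targets are in general only modules.\<close>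

definition fock_lin where
  "fock_lin W f = lift K (fock_space K P W) (\<lambda>(vs, p). fock_cls K P W (map f vs) p)"

context
  fixes V :: "('k, 'v, 'm) module_scheme" and W :: "('k, 'w, 'n) module_scheme" and f
  assumes f: "lin K V W f"
begin

lemma fock_lin_hyps:
  shows "fock_compatible V (FA W) (\<lambda>X v. cls W X (\<lambda>i. f (v i)))"
    and "(vs, p) \<in> fock_gens P V ==>
      fock_cls K P W (map f vs) p = cls W {1..length vs} (\<lambda>i. f (vs ! (i - 1))) p"
proof -
  note V = lin_dom[OF f] and W = lin_cod[OF f]
  have c: "f v \<in> carrier W" if "v \<in> carrier V" for v using lin_closed[OF f that] .
  show "fock_compatible V (FA W) (\<lambda>X v. cls W X (\<lambda>i. f (v i)))"
  proof (rule fock_compatibleI[OF V module_FA[OF W]])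
    fix X v p i assume X: "finite X" "v \<in> X \<rightarrow> carrier V" "p \<in> elts X" "i \<in> X"
    have "(\<lambda>j. f ((v(i := a)) j)) = (\<lambda>j. f (v j))(i := f a)" for a by auto
    then show "lin K V (FA W) (\<lambda>a. cls W X (\<lambda>j. f ((v(i := a)) j)) p)"
      using X c by (simp, intro lin_comp[OF f lin_cls_letter[OF W]]) auto
  next
    fix X v v' p and \<sigma> :: "nat \<Rightarrow> nat"
    assume "finite X" "v \<in> X \<rightarrow> carrier V" "p \<in> elts X" "inj_on \<sigma> X"
      "\<And>x. x \<in> X ==> v' (\<sigma> x) = v x"
    then show "cls W (\<sigma> ` X) (\<lambda>i. f (v' i)) (arr P X \<sigma> p) = cls W X (\<lambda>i. f (v i)) p"
      using c by (intro cls_natural[OF W]) auto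
  qed (use c in \<open>auto intro!: lin_cls[OF W]\<close>)
  show "fock_cls K P W (map f vs) p = cls W {1..length vs} (\<lambda>i. f (vs ! (i - 1))) p"
    if g: "(vs, p) \<in> fock_gens P V"
  proof -
    have g': "(map f vs, p) \<in> fock_gens P W" using g c by (auto simp: fock_gens_def)
    show ?thesis
      unfolding cls_upto[OF g', symmetric] length_map by (rule cls_cong) auto
  qed
qed

lemma fock_lin_FA: "fock_lin W f = lift K (FA W) (\<lambda>(vs, p). fock_cls K P W (map f vs) p)"
  unfolding fock_lin_def
  by (rule fun_cong[OF lift_fields_cong]) (simp_all add: fock_alg_fields)

lemma lin_fock_lin: "lin K (FA V) (FA W) (fock_lin W f)"
  unfolding fock_lin_FA
  by (rule lin_FA_dom[OF lin_dom[OF f] lin_fock_space_lift[OF lin_dom[OF f] fock_lin_hyps]])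

lemma fock_lin_gens: "(vs, p) \<in> fock_gens P V ==>
    fock_lin W f (fock_cls K P V vs p) = fock_cls K P W (map f vs) p"
  unfolding fock_lin_FA by (rule fock_lift_gens[OF lin_dom[OF f] fock_lin_hyps])

lemma fock_lin_cls: "finite X ==> v \<in> X \<rightarrow> carrier V ==> p \<in> elts X ==>
    fock_lin W f (cls V X v p) = cls W X (\<lambda>i. f (v i)) p"
  unfolding fock_lin_FA by (rule fock_lift_cls[OF lin_dom[OF f] fock_lin_hyps])

lemma fock_lin_mult:
  assumes "x \<in> carrier (FA V)" "y \<in> carrier (FA V)"
  shows "fock_lin W f (x \<otimes>\<^bsub>FA V\<^esub> y) = fock_lin W f x \<otimes>\<^bsub>FA W\<^esub> fock_lin W f y"
proof -
  note V = lin_dom[OF f] and W = lin_cod[OF f] and l = lin_fock_lin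
  have c: "f v \<in> carrier W" if "v \<in> carrier V" for v using lin_closed[OF f that] .
  show ?thesis
  proof (rule bilin_FA_eqI[OF V _ _ _ assms, where f = "\<lambda>x y. fock_lin W f (x \<otimes>\<^bsub>FA V\<^esub> y)"])
    show "bilin K (FA V) (FA V) (FA W) (\<lambda>x y. fock_lin W f (x \<otimes>\<^bsub>FA V\<^esub> y))"
      by (rule bilin_comp[OF bilin_mult[OF V] lin_id lin_id l]) (rule module_FA[OF V])+
    show "bilin K (FA V) (FA V) (FA W) (\<lambda>x y. fock_lin W f x \<otimes>\<^bsub>FA W\<^esub> fock_lin W f y)"
      by (rule bilin_comp[OF bilin_mult[OF W] l l lin_id]) (rule module_FA[OF W])
    fix X Y v p q assume X: "finite X" "finite Y" "X \<inter> Y = {}" "v \<in> X \<union> Y \<rightarrow> carrier V"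
      "p \<in> elts X" "q \<in> elts Y"
    have fv: "(\<lambda>i. f (v i)) \<in> X \<union> Y \<rightarrow> carrier W" using X c by auto
    show "fock_lin W f (cls V X v p \<otimes>\<^bsub>FA V\<^esub> cls V Y v q) =
        fock_lin W f (cls V X v p) \<otimes>\<^bsub>FA W\<^esub> fock_lin W f (cls V Y v q)"
      using X fv mul_tens_closed[OF X(1-3) refl X(5,6)]
      by (simp add: mult_cls[OF V] mult_cls[OF W] fock_lin_cls)
  qed
qed

lemma fock_lin_one: "fock_lin W f \<one>\<^bsub>FA V\<^esub> = \<one>\<^bsub>FA W\<^esub>"
  using tw_one_closed fock_lin_cls[of "{}" undefined "tw_one P"]
  by (simp add: one_FA[OF lin_dom[OF f], of undefined] one_FA[OF lin_cod[OF f], of "\<lambda>i. f (undefined i)"])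

end

lemma fock_lin_comp:
  assumes "lin K V W f" "lin K W W' g" "x \<in> carrier (FA V)"
  shows "fock_lin W' g (fock_lin W f x) = fock_lin W' (\<lambda>v. g (f v)) x"
proof (rule FA_eqI[OF lin_dom[OF assms(1)] lin_comp[OF lin_fock_lin[OF assms(1)] lin_fock_lin[OF assms(2)]]
      lin_fock_lin[OF lin_comp[OF assms(1,2)]] _ assms(3)])
  fix X v p assume X: "finite X" "v \<in> X \<rightarrow> carrier V" "p \<in> elts X"
  then have "(\<lambda>i. f (v i)) \<in> X \<rightarrow> carrier W" using lin_closed[OF assms(1)] by auto
  then show "fock_lin W' g (fock_lin W f (cls V X v p)) =
      fock_lin W' (\<lambda>v. g (f v)) (cls V X v p)"
    using X by (simp add: fock_lin_cls[OF assms(1)] fock_lin_cls[OF assms(2)]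
        fock_lin_cls[OF lin_comp[OF assms(1,2)]])
qed

lemma fock_lin_cong:
  assumes "lin K V W f" "\<And>v. v \<in> carrier V ==> f v = g v" "x \<in> carrier (FA V)"
  shows "fock_lin W f x = fock_lin W g x"
proof -
  have g: "lin K V W g" by (rule lin_cong[OF assms(1,2)])
  show ?thesis
  proof (rule FA_eqI[OF lin_dom[OF assms(1)] lin_fock_lin[OF assms(1)] lin_fock_lin[OF g] _ assms(3)])
    fix X v p assume X: "finite X" "v \<in> X \<rightarrow> carrier V" "p \<in> elts X"
    show "fock_lin W f (cls V X v p) = fock_lin W g (cls V X v p)"
      unfolding fock_lin_cls[OF assms(1) X] fock_lin_cls[OF g X]
      using X assms(2) by (intro cls_cong) auto
  qed
qed

lemma fock_lin_id:
  assumes "module K V" "x \<in> carrier (FA V)" "\<And>v. v \<in> carrier V ==> f v = v"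
  shows "fock_lin V f x = x"
proof -
  have f: "lin K V V f" by (rule lin_cong[OF lin_id[OF assms(1)]]) (simp add: assms(3))
  show ?thesis
  proof (rule FA_eqI[OF assms(1) lin_fock_lin[OF f] lin_id[OF module_FA[OF assms(1)]] _ assms(2)])
    fix X v p assume X: "finite X" "v \<in> X \<rightarrow> carrier V" "p \<in> elts X"
    show "fock_lin V f (cls V X v p) = cls V X v p"
      unfolding fock_lin_cls[OF f X] using X assms(3) by (intro cls_cong) auto
  qed
qed

end

section \<open>The first coproduct\<close>

context twisted_over
begin

definition fock_delta where
  "fock_delta V = lift K (FF V V) (\<lambda>(vs, p). fock_comult_gen K P V vs p)"

definition fock_eps where
  "fock_eps = lift K (self_module K) (\<lambda>(vs, p). fock_counit_gen K P vs p)"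

lemma cls_cong_fun: "finite X ==> (\<And>x. x \<in> X ==> v x = v' x) ==> cls V X v = cls V X v'"
  by (rule ext) (rule cls_cong)

lemmas tw_coalg = tw[unfolded twisted_bialgebra_def, THEN conjunct2, THEN conjunct1,
  unfolded twisted_coalgebra_def, THEN conjunct2]

lemmas tw_compat = tw[unfolded twisted_bialgebra_def, THEN conjunct2, THEN conjunct2]

lemma lin_comul: "finite X ==> finite Y ==> X \<inter> Y = {} ==> Z = X \<union> Y ==>
    lin K (obj P Z) (PP X Y) (tw_comult P X Y)"
  using tw_coalg[THEN conjunct1] by (simp add: lin_def module_tensor module_obj)

lemma comul_natural: "finite X ==> finite Y ==> X \<inter> Y = {} ==> inj_on \<sigma> (X \<union> Y) ==>
    p \<in> elts (X \<union> Y) ==>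
    tw_comult P (\<sigma> ` X) (\<sigma> ` Y) (arr P (X \<union> Y) \<sigma> p) =
      tmap K (obj P (\<sigma> ` X)) (obj P (\<sigma> ` Y)) (arr P X \<sigma>) (arr P Y \<sigma>) (tw_comult P X Y p)"
  using tw_coalg[THEN conjunct2, THEN conjunct1] by simp

lemma comul_coassoc: "finite X ==> finite Y ==> finite Z ==> X \<inter> Y = {} ==> X \<inter> Z = {} ==> Y \<inter> Z = {} ==>
    p \<in> elts (X \<union> Y \<union> Z) ==>
    tassoc K (obj P X) (obj P Y) (obj P Z)
      (tmap K (PP X Y) (obj P Z) (tw_comult P X Y) id (tw_comult P (X \<union> Y) Z p)) =
    tmap K (obj P X) (PP Y Z) id (tw_comult P Y Z) (tw_comult P X (Y \<union> Z) p)"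
  using tw_coalg[THEN conjunct2, THEN conjunct2, THEN conjunct1] by simp

lemma lin_tw_counit: "lin K (obj P {}) (self_module K) (tw_counit P)"
  using tw_coalg[THEN conjunct2, THEN conjunct2, THEN conjunct2, THEN conjunct1]
  by (simp add: lin_def module_obj module_self K_cring)

lemma tw_counit_left: "finite X ==> p \<in> elts X ==>
    eval_left K (obj P X) (tw_counit P) (tw_comult P {} X p) = p"
  and tw_counit_right: "finite X ==> p \<in> elts X ==>
    eval_right K (obj P X) (tw_counit P) (tw_comult P X {} p) = p"
  using tw_coalg[THEN conjunct2, THEN conjunct2, THEN conjunct2, THEN conjunct2] by simp_all

lemma comul_mul: "finite I ==> finite J ==> finite I' ==> finite J' ==> I \<inter> J = {} ==> I' \<inter> J' = {} ==>
    I \<union> J = I' \<union> J' ==> t \<in> carrier (PP I' J') ==>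
    tw_comult P I J (tw_mult P I' J' t) =
     tmap K (obj P I) (obj P J)
       (tw_mult P (I' \<inter> I) (J' \<inter> I)) (tw_mult P (I' \<inter> J) (J' \<inter> J))
       (tswap K (obj P (I' \<inter> I)) (obj P (I' \<inter> J)) (obj P (J' \<inter> I)) (obj P (J' \<inter> J))
         (tmap K (PP (I' \<inter> I) (I' \<inter> J))
            (PP (J' \<inter> I) (J' \<inter> J))
            (tw_comult P (I' \<inter> I) (I' \<inter> J)) (tw_comult P (J' \<inter> I) (J' \<inter> J)) t))"
  using tw_compat[THEN conjunct1] by simp

lemma comul_one: "tw_comult P {} {} (tw_one P) = tens K (obj P {}) (obj P {}) (tw_one P) (tw_one P)"
  and tw_counit_mul: "p \<in> elts {} ==> q \<in> elts {} ==>
    tw_counit P (tw_mult P {} {} (tens K (obj P {}) (obj P {}) p q)) = tw_counit P p \<otimes>\<^bsub>K\<^esub> tw_counit P q"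
  and tw_counit_one: "tw_counit P (tw_one P) = \<one>\<^bsub>K\<^esub>"
  using tw_compat[THEN conjunct2] by simp_all

lemma module_TA: "module K V ==> module K (FF V V)"
  by (intro module_tensor module_FA)

text \<open>The right-hand side has the shape of the compatibility axioms of the product of
  \<open>P\<close> with \<Delta> and with \<delta>, so that multiplicativity of both coproducts
  reduces to those axioms. The splitting requires different letter spaces \<open>V\<close> and
  \<open>W\<close> in the two factors.\<close>

lemma tmap_cls_mult:
  assumes V: "module K V" and W: "module K W"
    and fin: "finite A" "finite A'" "finite B" "finite B'" and d: "A \<inter> B = {}" "A' \<inter> B' = {}"
    and v: "v \<in> A \<union> B \<rightarrow> carrier V" and w: "w \<in> A' \<union> B' \<rightarrow> carrier W"
    and s: "s \<in> carrier (PP A A')" and t: "t \<in> carrier (PP B B')"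
  shows "Fmap V W (cls V A v) (cls W A' w) s \<otimes>\<^bsub>FF V W\<^esub>
      Fmap V W (cls V B v) (cls W B' w) t =
    Fmap V W (cls V (A \<union> B) v) (cls W (A' \<union> B') w)
      (tmap K (obj P (A \<union> B)) (obj P (A' \<union> B')) (tw_mult P A B) (tw_mult P A' B')
        (tswap K (obj P A) (obj P A') (obj P B) (obj P B')
          (tens K (PP A A') (PP B B') s t)))"
proof -
  have m: "module K (obj P A)" "module K (obj P A')" "module K (obj P B)" "module K (obj P B')"
    using fin by (auto intro: module_obj)
  have l: "lin K (obj P A) (FA V) (cls V A v)" "lin K (obj P A') (FA W) (cls W A' w)"
    "lin K (obj P B) (FA V) (cls V B v)" "lin K (obj P B') (FA W) (cls W B' w)"
    using fin v w by (auto intro!: lin_cls V W)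
  have lu: "lin K (obj P (A \<union> B)) (FA V) (cls V (A \<union> B) v)"
    "lin K (obj P (A' \<union> B')) (FA W) (cls W (A' \<union> B') w)"
    using fin v w by (auto intro!: lin_cls V W)
  have lm: "lin K (PP A B) (obj P (A \<union> B)) (tw_mult P A B)"
    "lin K (PP A' B') (obj P (A' \<union> B')) (tw_mult P A' B')"
    using fin d by (auto intro!: lin_mul)
  note B = bilin_tensor_mult[OF bilin_mult[OF V] bilin_mult[OF W]]
  note mT = module_tensor[OF m(1,2)] module_tensor[OF m(3,4)]
  note l1 = lin_tmap[OF l(1,2)] and l2 = lin_tmap[OF l(3,4)]
    and l3 = lin_comp[OF lin_tswap[OF m] lin_comp[OF lin_tmap[OF lm] lin_tmap[OF lu]]]
  show ?thesis
    by (rule bilin_eqI_tensor[OF m _ _ _ s t, where U = "FF V W"],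
        rule bilin_comp[OF B l1 l2 lin_id], rule module_tensor[OF module_FA[OF V] module_FA[OF W]],
        rule bilin_comp[OF bilin_tens lin_id lin_id l3], (rule mT)+)
       (use fin d v w in \<open>simp add: tmap_tens[OF l(1,2)] tmap_tens[OF l(3,4)] tswap_tens[OF m]
         tmap_tens[OF lm] tmap_tens[OF lu] tensor_mult_tens[OF bilin_mult[OF V] bilin_mult[OF W]]
         lin_closed[OF l(1)] lin_closed[OF l(2)] lin_closed[OF l(3)] lin_closed[OF l(4)]
         lin_closed[OF lm(1)] lin_closed[OF lm(2)] tens_closed m mult_cls V W\<close>)
qed

context
  fixes V :: "('k, 'v, 'm) module_scheme"
  assumes V: "module K V"
begin

lemma delta_hyps:
  defines "\<Theta> \<equiv> \<lambda>X v p. finsum (FF V V) (\<lambda>A. Fmap V V (cls V A v) (cls V (X - A) v)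
    (tw_comult P A (X - A) p)) (Pow X)"
  shows "fock_compatible V (FF V V) \<Theta>"
    and "(vs, p) \<in> fock_gens P V ==> fock_comult_gen K P V vs p = \<Theta> {1..length vs} (\<lambda>i. vs ! (i - 1)) p"
proof -
  interpret T: module K "FF V V" by (rule module_TA[OF V])
  have sub: "finite A" "finite (X - A)" "A \<inter> (X - A) = {}" "X = A \<union> (X - A)" "A \<subseteq> X"
    if "finite X" "A \<in> Pow X" for A X :: "nat set"
    using that finite_subset by auto
  have lt: "lin K (obj P X) (FF V V) (\<lambda>p. Fmap V V (cls V A v) (cls V (X - A) v) (tw_comult P A (X - A) p))"
    if X: "finite X" "v \<in> X \<rightarrow> carrier V" and A: "A \<in> Pow X" for X v A
    using X sub[OF X(1) A] by (intro lin_comp[OF lin_comul lin_tmap] lin_cls V) auto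
  have lp: "lin K (obj P X) (FF V V) (\<Theta> X v)" if X: "finite X" "v \<in> X \<rightarrow> carrier V" for X v
    unfolding \<Theta>_def by (intro lin_sum module_obj T.module_axioms X lt)
  show "fock_compatible V (FF V V) \<Theta>"
  proof (rule fock_compatibleI[OF V T.module_axioms lp])
    fix X v p i assume X: "finite X" "v \<in> X \<rightarrow> carrier V" and p: "p \<in> elts X" and i: "i \<in> X"
    have "lin K V (FF V V) (\<lambda>a. Fmap V V (cls V A (v(i := a))) (cls V (X - A) (v(i := a)))
        (tw_comult P A (X - A) p))" if A: "A \<in> Pow X" for A
    proof -
      note s = sub[OF X(1) A]
      have t: "tw_comult P A (X - A) p \<in> carrier (PP A (X - A))"
        by (rule lin_closed[OF lin_comul[OF s(1-4)] p])
      have v: "v \<in> A \<rightarrow> carrier V" "v \<in> X - A \<rightarrow> carrier V" using X s by auto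
      show ?thesis
      \<comment> \<open>The letter with index \<open>i\<close> occurs in exactly one of the two
        factors; the other factor is constant in it.\<close>
      proof (cases "i \<in> A")
        case True
        then have c: "cls V (X - A) (v(i := a)) = cls V (X - A) v" for a
          by (intro cls_cong_fun s) auto
        show ?thesis unfolding c
        proof (rule lin_tmap_param_left[OF _ _ V module_obj[OF s(1)] module_FA[OF V] lin_cls[OF V s(2) v(2)] t])
          show "lin K (obj P A) (FA V) (cls V A (v(i := m)))" if "m \<in> carrier V" for m
            using v that by (intro lin_cls V s) auto
        qed (rule lin_cls_letter[OF V s(1) v(1) True])
      next
        case False
        then have c: "cls V A (v(i := a)) = cls V A v" for a
          by (intro cls_cong_fun s) auto
        have i': "i \<in> X - A" using False i by simp
        show ?thesis unfolding c
        proof (rule lin_tmap_param_right[OF _ _ V module_obj[OF s(2)] module_FA[OF V] lin_cls[OF V s(1) v(1)] t])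
          show "lin K (obj P (X - A)) (FA V) (cls V (X - A) (v(i := m)))" if "m \<in> carrier V" for m
            using v that by (intro lin_cls V s) auto
        qed (rule lin_cls_letter[OF V s(2) v(2) i'])
      qed
    qed
    then show "lin K V (FF V V) (\<lambda>a. \<Theta> X (v(i := a)) p)"
      unfolding \<Theta>_def by (intro lin_sum V T.module_axioms)
  next
    fix X v v' p and \<sigma> :: "nat \<Rightarrow> nat"
    assume X: "finite X" "v \<in> X \<rightarrow> carrier V" and p: "p \<in> elts X" and \<sigma>: "inj_on \<sigma> X"
      and v': "\<And>x. x \<in> X ==> v' (\<sigma> x) = v x"
    show "\<Theta> (\<sigma> ` X) v' (arr P X \<sigma> p) = \<Theta> X v p"
      unfolding \<Theta>_def
    proof (rule T.finsum_bij[symmetric])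
      show "bij_betw ((`) \<sigma>) (Pow X) (Pow (\<sigma> ` X))"
        using \<sigma> by (intro bij_betw_Pow) (simp add: bij_betw_def)
      have v'V: "v' \<in> \<sigma> ` X \<rightarrow> carrier V" using X v' by auto
      show "(\<lambda>A. Fmap V V (cls V A v') (cls V (\<sigma> ` X - A) v')
          (tw_comult P A (\<sigma> ` X - A) (arr P X \<sigma> p))) \<in> Pow (\<sigma> ` X) \<rightarrow> carrier (FF V V)"
        using X v'V by (intro funcsetI lin_closed[OF lt arr_closed[OF X(1) \<sigma> refl p]]) auto
      fix A assume A: "A \<in> Pow X"
      note s = sub[OF X(1) A]
      have d: "\<sigma> ` X - \<sigma> ` A = \<sigma> ` (X - A)" using \<sigma> s by (simp add: inj_on_image_set_diff)
      have i: "inj_on \<sigma> A" "inj_on \<sigma> (X - A)" using \<sigma> s by (auto intro: inj_on_subset)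
      have t: "tw_comult P A (X - A) p \<in> carrier (PP A (X - A))"
        by (rule lin_closed[OF lin_comul[OF s(1-4)] p])
      have a: "lin K (obj P A) (obj P (\<sigma> ` A)) (arr P A \<sigma>)"
        "lin K (obj P (X - A)) (obj P (\<sigma> ` (X - A))) (arr P (X - A) \<sigma>)"
        using s i by (auto intro!: lin_arr)
      have c: "lin K (obj P (\<sigma> ` A)) (FA V) (cls V (\<sigma> ` A) v')"
        "lin K (obj P (\<sigma> ` (X - A))) (FA V) (cls V (\<sigma> ` (X - A)) v')"
        using s v'V by (auto intro!: lin_cls V)
      have n: "cls V (\<sigma> ` A) v' (arr P A \<sigma> q) = cls V A v q" if "q \<in> elts A" for q
        using s i v' X that by (intro cls_natural V) auto
      have n': "cls V (\<sigma> ` (X - A)) v' (arr P (X - A) \<sigma> q) = cls V (X - A) v q"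
        if "q \<in> elts (X - A)" for q
        using s i v' X that by (intro cls_natural V) auto
      have AX: "A \<union> X = X" using s by auto
      have "tw_comult P (\<sigma> ` A) (\<sigma> ` (X - A)) (arr P X \<sigma> p) =
          tmap K (obj P (\<sigma> ` A)) (obj P (\<sigma> ` (X - A))) (arr P A \<sigma>) (arr P (X - A) \<sigma>) (tw_comult P A (X - A) p)"
        using comul_natural[OF s(1-3), of \<sigma> p] \<sigma> p AX by simp
      then show "Fmap V V (cls V A v) (cls V (X - A) v) (tw_comult P A (X - A) p) =
        Fmap V V (cls V (\<sigma> ` A) v') (cls V (\<sigma> ` X - \<sigma> ` A) v')
          (tw_comult P (\<sigma> ` A) (\<sigma> ` X - \<sigma> ` A) (arr P X \<sigma> p))"
        unfolding d using tmap_comp[OF a c t] tmap_cong[OF lin_comp[OF a(1) c(1)] lin_comp[OF a(2) c(2)] t n n']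
        by simp
    qed
  qed
  show "fock_comult_gen K P V vs p = \<Theta> {1..length vs} (\<lambda>i. vs ! (i - 1)) p" if g: "(vs, p) \<in> fock_gens P V"
  proof -
    \<comment> \<open>\<open>fock_comult_gen\<close> forms its tensors over the record
      \<open>fock_space\<close>. The same tensors arise over \<open>fock_alg\<close>, because only
      the vector space fields enter.\<close>
    have t: "tens K (fock_space K P V) (fock_space K P V) = tens K (FA V) (FA V)"
      and ts: "tensor_space K (fock_space K P V) (fock_space K P V) = tensor_space K (FA V) (FA V)"
      by (rule tensor_space_fields_cong; simp add: fock_alg_fields)+
    have l: "lift K (tensor K (fock_space K P V) (fock_space K P V)) b = lift K (FF V V) b"
      for b :: "'p \<times> 'p \<Rightarrow> _"
      by (rule fun_cong[OF lift_fields_cong]) (simp_all add: tensor_fields ts)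
    have s: "finsum (tensor K (fock_space K P V) (fock_space K P V)) b = finsum (FF V V) b"
      for b :: "nat set \<Rightarrow> _"
      by (rule fun_cong[OF finsum_fields_cong]) (simp_all add: tensor_fields ts)
    have c: "fock_cls K P V (restr vs A) (arr P A (rank_in A) q) = cls V A (\<lambda>i. vs ! (i - 1)) q"
      if "A \<subseteq> {1..length vs}" for A q
      using restr_eq[OF that] by (simp add: cls_def)
    show ?thesis
      unfolding fock_comult_gen_def \<Theta>_def Let_def t l s
      by (rule T.finsum_cong')
         (auto simp: c tmap_def gens_obj[OF g] simp del: Pow_iff
           intro!: lin_closed[OF lt[unfolded tmap_def]] letters_upto[OF g])
  qed
qed

lemma lin_delta: "lin K (FA V) (FF V V) (fock_delta V)"
  unfolding fock_delta_def by (rule lin_FA_dom[OF V lin_fock_space_lift[OF V delta_hyps]])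

lemma delta_gens: "(vs, p) \<in> fock_gens P V ==>
    fock_delta V (fock_cls K P V vs p) = fock_comult_gen K P V vs p"
  unfolding fock_delta_def by (rule fock_lift_gens[OF V delta_hyps])

lemma delta_cls: "finite X ==> v \<in> X \<rightarrow> carrier V ==> p \<in> elts X ==>
    fock_delta V (cls V X v p) =
    finsum (FF V V) (\<lambda>A. Fmap V V (cls V A v) (cls V (X - A) v)
      (tw_comult P A (X - A) p)) (Pow X)"
  unfolding fock_delta_def by (rule fock_lift_cls[OF V delta_hyps])

lemma eps_hyps:
  "fock_compatible V (self_module K) (\<lambda>X v p. if X = {} then tw_counit P p else \<zero>\<^bsub>K\<^esub>)"
  "(vs, p) \<in> fock_gens P V ==> fock_counit_gen K P vs p = (if {1..length vs} = {} then tw_counit P p else \<zero>\<^bsub>K\<^esub>)"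
proof -
  note S = module_self[OF K_cring]
  show "fock_compatible V (self_module K) (\<lambda>X v p. if X = {} then tw_counit P p else \<zero>\<^bsub>K\<^esub>)"
  proof (rule fock_compatibleI[OF V S])
    show "lin K (obj P X) (self_module K) (\<lambda>p. if X = {} then tw_counit P p else \<zero>\<^bsub>K\<^esub>)" if "finite X" for X
      using lin_tw_counit lin_0[OF module_obj[OF that] S] by (cases "X = {}") simp_all
    show "lin K V (self_module K) (\<lambda>a. if X = {} then tw_counit P p else \<zero>\<^bsub>K\<^esub>)" if "i \<in> X" for X i p
      using that lin_0[OF V S] by (auto split: if_splits)
    show "(if \<sigma> ` X = {} then tw_counit P (arr P X \<sigma> p) else \<zero>\<^bsub>K\<^esub>) = (if X = {} then tw_counit P p else \<zero>\<^bsub>K\<^esub>)"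
      if "p \<in> elts X" for X \<sigma> p
      using arr_id[of "{}" \<sigma> p] that by auto
  qed
  show "fock_counit_gen K P vs p = (if {1..length vs} = {} then tw_counit P p else \<zero>\<^bsub>K\<^esub>)"
    by (cases vs) (simp_all add: fock_counit_gen_def)
qed

lemma lin_eps: "lin K (FA V) (self_module K) (fock_eps)"
  unfolding fock_eps_def by (rule lin_FA_dom[OF V lin_fock_space_lift[OF V eps_hyps]])

lemma eps_gens: "(vs, p) \<in> fock_gens P V ==> fock_eps (fock_cls K P V vs p) = fock_counit_gen K P vs p"
  unfolding fock_eps_def by (rule fock_lift_gens[OF V eps_hyps])

lemma eps_cls: "finite X ==> v \<in> X \<rightarrow> carrier V ==> p \<in> elts X ==>
    fock_eps (cls V X v p) = (if X = {} then tw_counit P p else \<zero>\<^bsub>K\<^esub>)"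
  unfolding fock_eps_def by (rule fock_lift_cls[OF V eps_hyps])

end

end

section \<open>Naturality and bialgebra axioms of the first coproduct\<close>

context twisted_over
begin

lemma delta_natural:
  assumes f: "lin K V W f" and x: "x \<in> carrier (FA V)"
  shows "fock_delta W (fock_lin W f x) =
    Fmap W W (fock_lin W f) (fock_lin W f) (fock_delta V x)"
proof -
  note V = lin_dom[OF f] and W = lin_cod[OF f] and l = lin_fock_lin[OF f]
  interpret T: module K "FF W W" by (rule module_TA[OF W])
  show ?thesis
  proof (rule FA_eqI[OF V lin_comp[OF l lin_delta[OF W]] lin_comp[OF lin_delta[OF V] lin_tmap[OF l l]] _ x])
    fix X v p assume X: "finite X" "v \<in> X \<rightarrow> carrier V" "p \<in> elts X"
    have fv: "(\<lambda>i. f (v i)) \<in> X \<rightarrow> carrier W" using X lin_closed[OF f] by auto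
    have A: "finite A" "finite (X - A)" "A \<inter> (X - A) = {}" "X = A \<union> (X - A)" "v \<in> A \<rightarrow> carrier V"
      "v \<in> X - A \<rightarrow> carrier V" "(\<lambda>i. f (v i)) \<in> A \<rightarrow> carrier W" "(\<lambda>i. f (v i)) \<in> X - A \<rightarrow> carrier W"
      if "A \<in> Pow X" for A
      using X(1,2) fv that finite_subset by auto
    have t: "tw_comult P A (X - A) p \<in> carrier (PP A (X - A))" if "A \<in> Pow X" for A
      by (rule lin_closed[OF lin_comul[OF A(1-4)[OF that]] X(3)])
    have ct: "Fmap V V (cls V A v) (cls V (X - A) v) (tw_comult P A (X - A) p) \<in> carrier (FF V V)"
      if "A \<in> Pow X" for A
      by (rule lin_closed[OF lin_tmap[OF lin_cls[OF V A(1,5)[OF that]] lin_cls[OF V A(2,6)[OF that]]] t[OF that]])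
    have "fock_delta W (fock_lin W f (cls V X v p)) =
        finsum (FF W W) (\<lambda>A. Fmap W W (cls W A (\<lambda>i. f (v i))) (cls W (X - A) (\<lambda>i. f (v i)))
          (tw_comult P A (X - A) p)) (Pow X)"
      using X fv by (simp add: fock_lin_cls[OF f] delta_cls[OF W])
    also have "\<dots> = finsum (FF W W) (\<lambda>A. Fmap W W (fock_lin W f) (fock_lin W f)
        (Fmap V V (cls V A v) (cls V (X - A) v) (tw_comult P A (X - A) p))) (Pow X)"
    proof (rule T.finsum_cong')
      fix A assume A': "A \<in> Pow X"
      note A = A[OF A'] and t = t[OF A']
      note c = lin_cls[OF V A(1,5)] lin_cls[OF V A(2,6)]
      note d = lin_cls[OF W A(1,7)] lin_cls[OF W A(2,8)]
      show "Fmap W W (cls W A (\<lambda>i. f (v i))) (cls W (X - A) (\<lambda>i. f (v i)))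
          (tw_comult P A (X - A) p) = Fmap W W (fock_lin W f) (fock_lin W f)
        (Fmap V V (cls V A v) (cls V (X - A) v) (tw_comult P A (X - A) p))"
        unfolding tmap_comp[OF c l l t]
        using A by (intro tmap_cong[OF d t]) (simp_all add: fock_lin_cls[OF f])
    qed (use lin_closed[OF lin_tmap[OF l l] ct] in auto)
    also have "\<dots> = Fmap W W (fock_lin W f) (fock_lin W f)
        (finsum (FF V V) (\<lambda>A. Fmap V V (cls V A v) (cls V (X - A) v)
          (tw_comult P A (X - A) p)) (Pow X))"
      using ct by (intro lin_finsum[OF lin_tmap[OF l l], symmetric]) auto
    finally show "fock_delta W (fock_lin W f (cls V X v p)) =
        Fmap W W (fock_lin W f) (fock_lin W f) (fock_delta V (cls V X v p))"
      using X by (simp add: delta_cls[OF V])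
  qed
qed

lemma eps_natural:
  assumes f: "lin K V W f" and x: "x \<in> carrier (FA V)"
  shows "fock_eps (fock_lin W f x) = fock_eps x"
proof (rule FA_eqI[OF lin_dom[OF f] lin_comp[OF lin_fock_lin[OF f] lin_eps[OF lin_cod[OF f]]] lin_eps[OF lin_dom[OF f]] _ x])
  fix X v p assume X: "finite X" "v \<in> X \<rightarrow> carrier V" "p \<in> elts X"
  then have "(\<lambda>i. f (v i)) \<in> X \<rightarrow> carrier W" using lin_closed[OF f] by auto
  then show "fock_eps (fock_lin W f (cls V X v p)) = fock_eps (cls V X v p)"
    using X by (simp add: fock_lin_cls[OF f] eps_cls[OF lin_cod[OF f]] eps_cls[OF lin_dom[OF f]])
qed

context
  fixes V :: "('k, 'v, 'm) module_scheme"
  assumes V: "module K V"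
begin

interpretation T: module K "FF V V" by (rule module_TA[OF V])
interpretation F: module K "FA V" by (rule module_FA[OF V])

lemma subset_split:
  fixes A X :: "nat set"
  assumes "finite X" "v \<in> X \<rightarrow> carrier V" "A \<in> Pow X"
  shows "finite A" "finite (X - A)" "A \<inter> (X - A) = {}" "X = A \<union> (X - A)" "v \<in> A \<rightarrow> carrier V"
    "v \<in> X - A \<rightarrow> carrier V"
  using assms finite_subset by auto

text \<open>Both sides are sums over the decompositions of \<open>X\<close> into three ordered
  parts, and \<open>term3 B C\<close> is the contribution of \<open>B\<close>, \<open>C\<close> and
  the rest. The right side has this form at once; on the left, coassociativity of \<open>P\<close>
  changes each term into it.\<close>

lemma delta_coassoc:
  assumes x: "x \<in> carrier (FA V)"
  shows "tassoc K (FA V) (FA V) (FA V) (tmap K (FF V V) (FA V) (fock_delta V) id (fock_delta V x)) =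
    tmap K (FA V) (FF V V) id (fock_delta V) (fock_delta V x)"
  unfolding id_def
proof -
  let ?F = "FA V" and ?T = "FF V V" and ?D = "fock_delta V" and ?i = "\<lambda>x. x"
  note D = lin_delta[OF V] and i = lin_id[OF F.module_axioms]
  let ?TF = "tensor K ?T ?F" and ?FT = "tensor K ?F ?T"
  note F = F.module_axioms and as = lin_tassoc[OF F.module_axioms F.module_axioms F.module_axioms]
  interpret FT: module K ?FT by (rule module_tensor[OF F T.module_axioms])
  note Dl = lin_tmap[OF D i] and Dr = lin_tmap[OF i D]
  show "tassoc K ?F ?F ?F (tmap K ?T ?F ?D ?i (?D x)) = tmap K ?F ?T ?i ?D (?D x)"
  proof (rule FA_eqI[OF V lin_comp[OF D lin_comp[OF Dl as]] lin_comp[OF D Dr] _ x])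
    fix X v p assume X: "finite X" "v \<in> X \<rightarrow> carrier V" and p: "p \<in> elts X"
    let ?c = "\<lambda>A. cls V A v" and ?O = "obj P"
    let ?O2 = "\<lambda>A B. PP A B"
    note s = subset_split[OF X]
    have t: "tw_comult P A (X - A) p \<in> carrier (?O2 A (X - A))" if "A \<in> Pow X" for A
      by (rule lin_closed[OF lin_comul[OF s(1-4)[OF that]] p])
    have ct: "tmap K ?F ?F (?c A) (?c (X - A)) (tw_comult P A (X - A) p) \<in> carrier ?T" if "A \<in> Pow X" for A
      by (rule lin_closed[OF lin_tmap[OF lin_cls[OF V s(1,5)[OF that]] lin_cls[OF V s(2,6)[OF that]]] t[OF that]])
    define term3 where "term3 B C = tmap K ?F ?T (?c B) (\<lambda>x. tmap K ?F ?F (?c C) (?c (X - B - C)) x)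
        (tmap K (?O B) (?O2 C (X - B - C)) ?i (tw_comult P C (X - B - C)) (tw_comult P B (X - B) p))" for B C
    have t3: "term3 B C \<in> carrier ?FT" if B: "B \<in> Pow X" and C: "C \<in> Pow (X - B)" for B C
    proof -
      note sB = s[OF B] and sC = subset_split[OF s(2)[OF B] s(6)[OF B] C]
      show ?thesis unfolding term3_def
        by (rule lin_closed[OF lin_tmap[OF lin_cls[OF V sB(1,5)] lin_tmap[OF lin_cls[OF V sC(1,5)] lin_cls[OF V sC(2,6)]]]
            lin_closed[OF lin_tmap[OF lin_id[OF module_obj[OF sB(1)]] lin_comul[OF sC(1-4)]] t[OF B]]])
    qed
    have R: "tmap K ?F ?T ?i ?D (?D (cls V X v p)) =
        finsum ?FT (\<lambda>(B, C). term3 B C) (SIGMA B:Pow X. Pow (X - B))"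
    proof -
      have "tmap K ?F ?T ?i ?D (?D (cls V X v p)) =
          finsum ?FT (\<lambda>B. tmap K ?F ?T ?i ?D (tmap K ?F ?F (?c B) (?c (X - B)) (tw_comult P B (X - B) p))) (Pow X)"
        unfolding delta_cls[OF V X p] by (rule lin_finsum[OF Dr]) (use ct in auto)
      also have "\<dots> = finsum ?FT (\<lambda>B. finsum ?FT (term3 B) (Pow (X - B))) (Pow X)"
      proof (rule FT.finsum_cong')
        fix B assume B: "B \<in> Pow X"
        note sB = s[OF B] and sC = subset_split[OF s(2)[OF B] s(6)[OF B]]
        show "tmap K ?F ?T ?i ?D (tmap K ?F ?F (?c B) (?c (X - B)) (tw_comult P B (X - B) p)) =
            finsum ?FT (term3 B) (Pow (X - B))"
          unfolding term3_def
          by (rule tmap_expand_right[OF lin_cls[OF V sB(2,6)] D lin_cls[OF V sB(1,5)] i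
                lin_comul[OF sC(1-4)] lin_tmap[OF lin_cls[OF V sC(1,5)] lin_cls[OF V sC(2,6)]]
                delta_cls[OF V sB(2,6)] t[OF B]])
      qed (use t3 in \<open>auto intro!: FT.finsum_closed\<close>)
      also have "\<dots> = finsum ?FT (\<lambda>(B, C). term3 B C) (SIGMA B:Pow X. Pow (X - B))"
        using X(1) t3 by (intro FT.finsum_Sigma) auto
      finally show ?thesis .
    qed
    have L: "tassoc K ?F ?F ?F (tmap K ?T ?F ?D ?i (?D (cls V X v p))) =
        finsum ?FT (\<lambda>(A, B). term3 B (A - B)) (SIGMA A:Pow X. Pow A)"
    proof -
      have "tassoc K ?F ?F ?F (tmap K ?T ?F ?D ?i (?D (cls V X v p))) =
          finsum ?FT (\<lambda>A. tassoc K ?F ?F ?F (tmap K ?T ?F ?D ?i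
            (tmap K ?F ?F (?c A) (?c (X - A)) (tw_comult P A (X - A) p)))) (Pow X)"
        unfolding delta_cls[OF V X p] by (rule lin_finsum[OF lin_comp[OF Dl as]]) (use ct in auto)
      also have "\<dots> = finsum ?FT (\<lambda>A. finsum ?FT (\<lambda>B. term3 B (A - B)) (Pow A)) (Pow X)"
      proof (rule FT.finsum_cong')
        fix A assume A: "A \<in> Pow X"
        note sA = s[OF A] and sB = subset_split[OF s(1)[OF A] s(5)[OF A]]
        have B': "B \<in> Pow X" "A - B \<in> Pow (X - B)" "X - B - (A - B) = X - A" "A - B \<union> (X - A) = X - B"
          "B \<inter> (X - A) = {}" "(A - B) \<inter> (X - A) = {}" "B \<union> (A - B) \<union> (X - A) = X"
          if "B \<in> Pow A" for B
          using A that by auto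
        have lT: "lin K (?O2 B (A - B)) ?T (tmap K ?F ?F (?c B) (?c (A - B)))" if "B \<in> Pow A" for B
          by (rule lin_tmap[OF lin_cls[OF V sB(1,5)[OF that]] lin_cls[OF V sB(2,6)[OF that]]])
        have e: "tmap K ?T ?F ?D ?i (tmap K ?F ?F (?c A) (?c (X - A)) (tw_comult P A (X - A) p)) =
            finsum ?TF (\<lambda>B. tmap K ?T ?F (tmap K ?F ?F (?c B) (?c (A - B))) (\<lambda>x. ?c (X - A) x)
              (tmap K (?O2 B (A - B)) (?O (X - A)) (tw_comult P B (A - B)) ?i (tw_comult P A (X - A) p))) (Pow A)"
          by (rule tmap_expand_left[OF lin_cls[OF V sA(1,5)] D lin_cls[OF V sA(2,6)] i
                lin_comul[OF sB(1-4)] lT delta_cls[OF V sA(1,5)] t[OF A]])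
        have u: "tmap K (?O2 B (A - B)) (?O (X - A)) (tw_comult P B (A - B)) ?i (tw_comult P A (X - A) p)
            \<in> carrier (tensor K (?O2 B (A - B)) (?O (X - A)))" if "B \<in> Pow A" for B
          by (rule lin_closed[OF lin_tmap[OF lin_comul[OF sB(1-4)[OF that]] lin_id[OF module_obj[OF sA(2)]]] t[OF A]])
        have "tassoc K ?F ?F ?F (tmap K ?T ?F ?D ?i (tmap K ?F ?F (?c A) (?c (X - A)) (tw_comult P A (X - A) p))) =
          finsum ?FT (\<lambda>B. tassoc K ?F ?F ?F (tmap K ?T ?F (tmap K ?F ?F (?c B) (?c (A - B))) (\<lambda>x. ?c (X - A) x)
              (tmap K (?O2 B (A - B)) (?O (X - A)) (tw_comult P B (A - B)) ?i (tw_comult P A (X - A) p)))) (Pow A)"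
          unfolding e
          by (rule lin_finsum[OF as], intro funcsetI lin_closed[OF lin_tmap[OF lT lin_cls[OF V sA(2,6)]]] u)
        also have "\<dots> = finsum ?FT (\<lambda>B. term3 B (A - B)) (Pow A)"
        proof (rule FT.finsum_cong')
          fix B assume B: "B \<in> Pow A"
          note b = B'[OF B] and sB = sB[OF B]
          have "tassoc K (?O B) (?O (A - B)) (?O (X - A)) (tmap K (?O2 B (A - B)) (?O (X - A)) (tw_comult P B (A - B)) ?i
                (tw_comult P A (X - A) p)) =
              tmap K (?O B) (?O2 (A - B) (X - A)) ?i (tw_comult P (A - B) (X - A)) (tw_comult P B (X - B) p)"
          proof -
            have p': "p \<in> elts (B \<union> (A - B) \<union> (X - A))" unfolding b(7) by (rule p)
            show ?thesis
              using comul_coassoc[OF sB(1,2) sA(2) sB(3) b(5,6) p'] unfolding sB(4)[symmetric] b(4) id_def .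
          qed
          then show "tassoc K ?F ?F ?F (tmap K ?T ?F (tmap K ?F ?F (?c B) (?c (A - B))) (\<lambda>x. ?c (X - A) x)
              (tmap K (?O2 B (A - B)) (?O (X - A)) (tw_comult P B (A - B)) ?i (tw_comult P A (X - A) p))) =
            term3 B (A - B)"
            unfolding tassoc_tmap[OF lin_cls[OF V sB(1,5)] lin_cls[OF V sB(2,6)] lin_cls[OF V sA(2,6)] u[OF B]]
            by (simp add: term3_def b)
        qed (use B' t3 in auto)
        finally show "tassoc K ?F ?F ?F (tmap K ?T ?F ?D ?i
            (tmap K ?F ?F (?c A) (?c (X - A)) (tw_comult P A (X - A) p))) =
          finsum ?FT (\<lambda>B. term3 B (A - B)) (Pow A)" .
      qed (auto intro!: FT.finsum_closed t3)
      also have "\<dots> = finsum ?FT (\<lambda>(A, B). term3 B (A - B)) (SIGMA A:Pow X. Pow A)"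
        using X(1) by (intro FT.finsum_Sigma t3) (auto intro: finite_subset)
      finally show ?thesis .
    qed
    show "tassoc K ?F ?F ?F (tmap K ?T ?F ?D ?i (?D (cls V X v p))) = tmap K ?F ?T ?i ?D (?D (cls V X v p))"
      unfolding L R
    proof (rule FT.finsum_bij)
      \<comment> \<open>The left side first cuts off \<open>A\<close> and then cuts \<open>B\<close>
        out of it, so its middle part is \<open>A - B\<close>.\<close>
      show "bij_betw (\<lambda>(A, B). (B, A - B)) (SIGMA A:Pow X. Pow A) (SIGMA B:Pow X. Pow (X - B))"
        by (rule bij_betw_byWitness[where f' = "\<lambda>(B, C). (B \<union> C, B)"]) auto
    qed (use t3 in auto)
  qed
qed

text \<open>\<open>fock_eps\<close> vanishes on generators that have letters. Hence only the term
  with nothing in the evaluated factor survives, and it is settled by the counit axiom of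
  \<open>P\<close>.\<close>

lemma delta_counit:
  assumes x: "x \<in> carrier (FA V)"
  shows "eval_left K (FA V) (fock_eps) (fock_delta V x) = x"
    and "eval_right K (FA V) (fock_eps) (fock_delta V x) = x"
proof -
  let ?F = "FA V" and ?T = "FF V V" and ?D = "fock_delta V" and ?e = "fock_eps"
  note D = lin_delta[OF V] and e = lin_eps[OF V] and F = F.module_axioms
  note el = lin_eval_left[OF F e] and er = lin_eval_right[OF F e]
  have X': "eval_left K ?F ?e (?D (cls V X v p)) = cls V X v p \<and>
      eval_right K ?F ?e (?D (cls V X v p)) = cls V X v p"
    if X: "finite X" "v \<in> X \<rightarrow> carrier V" and p: "p \<in> elts X" for X v p
  proof -
    let ?c = "\<lambda>A. cls V A v" and ?O = "obj P"
    note s = subset_split[OF X]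
    have t: "tw_comult P A (X - A) p \<in> carrier (PP A (X - A))" if "A \<in> Pow X" for A
      by (rule lin_closed[OF lin_comul[OF s(1-4)[OF that]] p])
    have ct: "tmap K ?F ?F (?c A) (?c (X - A)) (tw_comult P A (X - A) p) \<in> carrier ?T" if "A \<in> Pow X" for A
      by (rule lin_closed[OF lin_tmap[OF lin_cls[OF V s(1,5)[OF that]] lin_cls[OF V s(2,6)[OF that]]] t[OF that]])
    have E: "\<And>A q. A \<in> Pow X ==> q \<in> elts A ==> ?e (?c A q) = (if A = {} then tw_counit P q else \<zero>\<^bsub>K\<^esub>)"
      "\<And>A q. A \<in> Pow X ==> q \<in> elts (X - A) ==> ?e (?c (X - A) q) = (if X - A = {} then tw_counit P q else \<zero>\<^bsub>K\<^esub>)"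
      using eps_cls[OF V] s by auto
    have "eval_left K ?F ?e (?D (cls V X v p)) =
        finsum ?F (\<lambda>A. eval_left K ?F ?e (tmap K ?F ?F (?c A) (?c (X - A)) (tw_comult P A (X - A) p))) (Pow X)"
      unfolding delta_cls[OF V X p] by (rule lin_finsum[OF el]) (use ct in auto)
    also have "\<dots> = eval_left K ?F ?e (tmap K ?F ?F (?c {}) (?c (X - {})) (tw_comult P {} (X - {}) p))"
    proof (rule F.finsum_single)
      fix A assume A: "A \<in> Pow X" "A \<noteq> {}"
      note sA = s[OF A(1)]
      note c = lin_cls[OF V sA(1,5)] lin_cls[OF V sA(2,6)]
      have "eval_left K ?F ?e (tmap K ?F ?F (?c A) (?c (X - A)) (tw_comult P A (X - A) p)) =
          ?c (X - A) (eval_left K (?O (X - A)) (\<lambda>a. \<zero>\<^bsub>K\<^esub>) (tw_comult P A (X - A) p))"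
        using eval_left_cong[OF lin_comp[OF c(1) e] module_obj[OF sA(2)] t[OF A(1)], of "\<lambda>a. \<zero>\<^bsub>K\<^esub>"] E A
        by (simp add: eval_left_tmap[OF e c t[OF A(1)]])
      also have "\<dots> = \<zero>\<^bsub>?F\<^esub>"
        by (simp add: eval_zero(1)[OF module_obj[OF sA(1)] module_obj[OF sA(2)] t[OF A(1)]] lin_zero[OF c(2)])
      finally show "eval_left K ?F ?e (tmap K ?F ?F (?c A) (?c (X - A)) (tw_comult P A (X - A) p)) = \<zero>\<^bsub>?F\<^esub>" .
    qed (use X lin_closed[OF el ct, of "{}"] in auto)
    also have "\<dots> = cls V X v p"
    proof -
      have A: "{} \<in> Pow X" by auto
      note sA = s[OF A] note c = lin_cls[OF V sA(1,5)] lin_cls[OF V sA(2,6)]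
      show ?thesis
        using eval_left_cong[OF lin_comp[OF c(1) e] module_obj[OF sA(2)] t[OF A], of "tw_counit P"] E[OF A]
          tw_counit_left[OF X(1) p]
        by (simp add: eval_left_tmap[OF e c t[OF A], unfolded Diff_empty])
    qed
    finally have 1: "eval_left K ?F ?e (?D (cls V X v p)) = cls V X v p" .
    have "eval_right K ?F ?e (?D (cls V X v p)) =
        finsum ?F (\<lambda>A. eval_right K ?F ?e (tmap K ?F ?F (?c A) (?c (X - A)) (tw_comult P A (X - A) p))) (Pow X)"
      unfolding delta_cls[OF V X p] by (rule lin_finsum[OF er]) (use ct in auto)
    also have "\<dots> = eval_right K ?F ?e (tmap K ?F ?F (?c X) (?c (X - X)) (tw_comult P X (X - X) p))"
    proof (rule F.finsum_single)
      fix A assume A: "A \<in> Pow X" "A \<noteq> X"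
      note sA = s[OF A(1)]
      note c = lin_cls[OF V sA(1,5)] lin_cls[OF V sA(2,6)]
      have "X - A \<noteq> {}" using A by auto
      then have "eval_right K ?F ?e (tmap K ?F ?F (?c A) (?c (X - A)) (tw_comult P A (X - A) p)) =
          ?c A (eval_right K (?O A) (\<lambda>a. \<zero>\<^bsub>K\<^esub>) (tw_comult P A (X - A) p))"
        using eval_right_cong[OF lin_comp[OF c(2) e] module_obj[OF sA(1)] t[OF A(1)], of "\<lambda>a. \<zero>\<^bsub>K\<^esub>"] E(2)[OF A(1)]
        by (simp add: eval_right_tmap[OF e c(2,1) t[OF A(1)]])
      also have "\<dots> = \<zero>\<^bsub>?F\<^esub>"
        by (simp add: eval_zero(2)[OF module_obj[OF sA(2)] module_obj[OF sA(1)] t[OF A(1)]] lin_zero[OF c(1)])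
      finally show "eval_right K ?F ?e (tmap K ?F ?F (?c A) (?c (X - A)) (tw_comult P A (X - A) p)) = \<zero>\<^bsub>?F\<^esub>" .
    qed (use X lin_closed[OF er ct, of X] in auto)
    also have "\<dots> = cls V X v p"
    proof -
      have A: "X \<in> Pow X" by auto
      note sA = s[OF A] note c = lin_cls[OF V sA(1,5)] lin_cls[OF V sA(2,6)]
      show ?thesis
        using eval_right_cong[OF lin_comp[OF c(2) e] module_obj[OF sA(1)] t[OF A], of "tw_counit P"] E(2)[OF A]
          tw_counit_right[OF X(1) p]
        by (simp add: eval_right_tmap[OF e c(2,1) t[OF A], unfolded Diff_cancel])
    qed
    finally show ?thesis using 1 by simp
  qed
  show "eval_left K ?F ?e (?D x) = x"
    by (rule FA_eqI[OF V lin_comp[OF D el] lin_id[OF F] _ x]) (use X' in simp)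
  show "eval_right K ?F ?e (?D x) = x"
    by (rule FA_eqI[OF V lin_comp[OF D er] lin_id[OF F] _ x]) (use X' in simp)
qed

lemma eps_mult:
  assumes "x \<in> carrier (FA V)" "y \<in> carrier (FA V)"
  shows "fock_eps (x \<otimes>\<^bsub>FA V\<^esub> y) = fock_eps x \<otimes>\<^bsub>K\<^esub> fock_eps y"
proof -
  note e = lin_eps[OF V] and F = F.module_axioms
  have mK: "bilin K (self_module K) (self_module K) (self_module K) (mult K)"
    by (rule bilinI; intro module_self linI) (simp_all add: K_cring T.R.l_distr T.R.r_distr T.R.m_assoc T.R.m_lcomm)
  show ?thesis
  proof (rule bilin_FA_eqI[OF V bilin_comp[OF bilin_mult[OF V] lin_id[OF F] lin_id[OF F] e]
        bilin_comp[OF mK e e lin_id[OF module_self[OF K_cring]]] _ assms])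
    fix X Y v p q assume X: "finite X" "finite Y" "X \<inter> Y = {}" "v \<in> X \<union> Y \<rightarrow> carrier V"
      "p \<in> elts X" "q \<in> elts Y"
    have v: "v \<in> X \<rightarrow> carrier V" "v \<in> Y \<rightarrow> carrier V" using X(4) by auto
    have c: "tw_counit P r \<in> carrier K" if "r \<in> elts {}" for r
      using lin_closed[OF lin_tw_counit that] by simp
    show "fock_eps (cls V X v p \<otimes>\<^bsub>FA V\<^esub> cls V Y v q) =
        fock_eps (cls V X v p) \<otimes>\<^bsub>K\<^esub> fock_eps (cls V Y v q)"
      using X v mul_tens_closed[OF X(1-3) refl X(5,6)] c
      by (auto simp: mult_cls[OF V] eps_cls[OF V] tw_counit_mul)
  qed
qed

lemma eps_one: "fock_eps \<one>\<^bsub>FA V\<^esub> = \<one>\<^bsub>K\<^esub>"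
  using tw_one_closed by (simp add: one_FA[OF V, of undefined] eps_cls[OF V] tw_counit_one)

lemma delta_one: "fock_delta V \<one>\<^bsub>FA V\<^esub> = \<one>\<^bsub>FF V V\<^esub>"
proof -
  have l: "lin K (obj P {}) (FA V) (cls V {} undefined)" by (rule lin_cls[OF V]) auto
  have "Fmap V V (cls V {} undefined) (cls V {} undefined) (tw_comult P {} {} (tw_one P))
      = \<one>\<^bsub>FF V V\<^esub>"
    by (simp add: comul_one tmap_tens[OF l l] tw_one_closed one_tensor one_FA[OF V, of undefined])
  moreover have "\<one>\<^bsub>FF V V\<^esub> \<in> carrier (FF V V)"
    by (simp add: one_tensor tens_closed module_FA[OF V] one_FA_closed[OF V])
  ultimately show ?thesis
    using delta_cls[OF V, of "{}" undefined "tw_one P"] tw_one_closed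
    by (simp add: one_FA[OF V, of undefined])
qed

text \<open>For disjoint \<open>X\<close> and \<open>Y\<close> a subset of the union is a pair of
  subsets, so the product of two coproducts has the same index set as the coproduct of the product.
  The terms agree by the compatibility axiom of \<open>P\<close>.\<close>

lemma delta_mult:
  assumes "x \<in> carrier (FA V)" "y \<in> carrier (FA V)"
  shows "fock_delta V (x \<otimes>\<^bsub>FA V\<^esub> y) = fock_delta V x \<otimes>\<^bsub>FF V V\<^esub> fock_delta V y"
proof -
  let ?D = "fock_delta V" and ?F = "FA V" and ?T = "FF V V"
  note D = lin_delta[OF V] and F = F.module_axioms
  note B = bilin_tensor_mult[OF bilin_mult[OF V] bilin_mult[OF V]]
  show ?thesis
  proof (rule bilin_FA_eqI[OF V bilin_comp[OF bilin_mult[OF V] lin_id[OF F] lin_id[OF F] D]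
        bilin_comp[OF B D D lin_id[OF T.module_axioms]] _ assms])
    fix X Y v p q assume X: "finite X" "finite Y" "X \<inter> Y = {}" "v \<in> X \<union> Y \<rightarrow> carrier V"
      and p: "p \<in> elts X" and q: "q \<in> elts Y"
    have v: "v \<in> X \<rightarrow> carrier V" "v \<in> Y \<rightarrow> carrier V" using X(4) by auto
    let ?c = "\<lambda>A. cls V A v" and ?O = "obj P"
    let ?O2 = "\<lambda>A B. PP A B"
    note sX = subset_split[OF X(1) v(1)] and sY = subset_split[OF X(2) v(2)]
    have t: "tw_comult P A (X - A) p \<in> carrier (?O2 A (X - A))" if "A \<in> Pow X" for A
      by (rule lin_closed[OF lin_comul[OF sX(1-4)[OF that]] p])
    have u: "tw_comult P A (Y - A) q \<in> carrier (?O2 A (Y - A))" if "A \<in> Pow Y" for A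
      by (rule lin_closed[OF lin_comul[OF sY(1-4)[OF that]] q])
    have ct: "tmap K ?F ?F (?c A) (?c (X - A)) (tw_comult P A (X - A) p) \<in> carrier ?T" if "A \<in> Pow X" for A
      by (rule lin_closed[OF lin_tmap[OF lin_cls[OF V sX(1,5)[OF that]] lin_cls[OF V sX(2,6)[OF that]]] t[OF that]])
    have cu: "tmap K ?F ?F (?c A) (?c (Y - A)) (tw_comult P A (Y - A) q) \<in> carrier ?T" if "A \<in> Pow Y" for A
      by (rule lin_closed[OF lin_tmap[OF lin_cls[OF V sY(1,5)[OF that]] lin_cls[OF V sY(2,6)[OF that]]] u[OF that]])
    have m: "module K (?O X)" "module K (?O Y)" using X by (auto intro: module_obj)
    let ?pq = "tens K (?O X) (?O Y) p q"
    have pq: "?pq \<in> carrier (?O2 X Y)" using m p q by (intro tens_closed)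
    have mpq: "tw_mult P X Y ?pq \<in> elts (X \<union> Y)" by (rule lin_closed[OF lin_mul[OF X(1-3) refl] pq])
    have fin: "finite (X \<union> Y)" using X by simp
    have "?D (?c X p) \<otimes>\<^bsub>?T\<^esub> ?D (?c Y q) = finsum ?T (\<lambda>(A, B).
        tmap K ?F ?F (?c A) (?c (X - A)) (tw_comult P A (X - A) p) \<otimes>\<^bsub>?T\<^esub>
        tmap K ?F ?F (?c B) (?c (Y - B)) (tw_comult P B (Y - B) q)) (Pow X \<times> Pow Y)"
      unfolding delta_cls[OF V X(1) v(1) p] delta_cls[OF V X(2) v(2) q]
      using X by (intro bilin_finsum[OF B] ct cu) auto
    also have "\<dots> = finsum ?T (\<lambda>I. tmap K ?F ?F (?c I) (?c (X \<union> Y - I)) (tw_comult P I (X \<union> Y - I) (tw_mult P X Y ?pq)))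
        (Pow (X \<union> Y))"
    proof (rule T.finsum_bij)
      show "bij_betw (\<lambda>(A, B). A \<union> B) (Pow X \<times> Pow Y) (Pow (X \<union> Y))"
        by (rule bij_betw_byWitness[where f' = "\<lambda>I. (I \<inter> X, I \<inter> Y)"]) (use X(3) in auto)
      show "(\<lambda>I. tmap K ?F ?F (?c I) (?c (X \<union> Y - I)) (tw_comult P I (X \<union> Y - I) (tw_mult P X Y ?pq)))
          \<in> Pow (X \<union> Y) \<rightarrow> carrier ?T"
      proof
        fix I assume I: "I \<in> Pow (X \<union> Y)"
        note s = subset_split[OF fin X(4) I]
        show "tmap K ?F ?F (?c I) (?c (X \<union> Y - I)) (tw_comult P I (X \<union> Y - I) (tw_mult P X Y ?pq)) \<in> carrier ?T"
          by (rule lin_closed[OF lin_tmap[OF lin_cls[OF V s(1,5)] lin_cls[OF V s(2,6)]] lin_closed[OF lin_comul[OF s(1-4)] mpq]])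
      qed
      fix AB assume "AB \<in> Pow X \<times> Pow Y"
      then obtain A B where AB: "AB = (A, B)" and A: "A \<in> Pow X" and B: "B \<in> Pow Y" by auto
      note sA = sX[OF A] and sB = sY[OF B]
      \<comment> \<open>The four intersections that occur in the compatibility axiom for the part
        \<open>A \<union> B\<close> and its complement.\<close>
      have e: "X \<inter> (A \<union> B) = A" "Y \<inter> (A \<union> B) = B" "X \<inter> (X \<union> Y - (A \<union> B)) = X - A"
        "Y \<inter> (X \<union> Y - (A \<union> B)) = Y - B" and e2: "X \<union> Y - (A \<union> B) = (X - A) \<union> (Y - B)"
        using A B X(3) by auto
      have "tw_comult P (A \<union> B) (X \<union> Y - (A \<union> B)) (tw_mult P X Y ?pq) =
          tmap K (?O (A \<union> B)) (?O (X \<union> Y - (A \<union> B))) (tw_mult P A B) (tw_mult P (X - A) (Y - B))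
            (tswap K (?O A) (?O (X - A)) (?O B) (?O (Y - B))
              (tens K (?O2 A (X - A)) (?O2 B (Y - B)) (tw_comult P A (X - A) p) (tw_comult P B (Y - B) q)))"
      proof -
        have "finite (A \<union> B)" "finite (X \<union> Y - (A \<union> B))" "(A \<union> B) \<inter> (X \<union> Y - (A \<union> B)) = {}"
          "A \<union> B \<union> (X \<union> Y - (A \<union> B)) = X \<union> Y"
          using X(1,2) sA(1) sB(1) A B by auto
        note c = comul_mul[OF this(1,2) X(1,2) this(3) X(3) this(4) pq, unfolded e]
        show ?thesis unfolding c tmap_tens[OF lin_comul[OF sA(1-4)] lin_comul[OF sB(1-4)] p q] ..
      qed
      then show "(case AB of (A, B) \<Rightarrow> tmap K ?F ?F (?c A) (?c (X - A)) (tw_comult P A (X - A) p) \<otimes>\<^bsub>?T\<^esub>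
          tmap K ?F ?F (?c B) (?c (Y - B)) (tw_comult P B (Y - B) q)) =
        tmap K ?F ?F (?c (case AB of (A, B) \<Rightarrow> A \<union> B)) (?c (X \<union> Y - (case AB of (A, B) \<Rightarrow> A \<union> B)))
          (tw_comult P (case AB of (A, B) \<Rightarrow> A \<union> B) (X \<union> Y - (case AB of (A, B) \<Rightarrow> A \<union> B)) (tw_mult P X Y ?pq))"
        unfolding AB prod.case e2
        using sA sB A B X(3) by (subst tmap_cls_mult[OF V V _ _ _ _ _ _ _ _ t[OF A] u[OF B]]) auto
    qed
    also have "\<dots> = ?D (?c X p \<otimes>\<^bsub>?F\<^esub> ?c Y q)"
      unfolding mult_cls[OF V X p q] by (rule delta_cls[OF V fin X(4) mpq, symmetric])
    finally show "?D (?c X p \<otimes>\<^bsub>?F\<^esub> ?c Y q) = ?D (?c X p) \<otimes>\<^bsub>?T\<^esub> ?D (?c Y q)" ..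
  qed
qed

end

end

section \<open>Products over blocks\<close>

text \<open>The increasing order only serves to fix one word; in a commutative algebra any order
  gives the same value. The algebra may lack a unit, so the values of interest are those at nonempty
  \<open>c\<close>.\<close>

definition bprod :: "('v, 'm) monoid_scheme \<Rightarrow> (nat \<Rightarrow> 'v) \<Rightarrow> nat set \<Rightarrow> 'v" where
  "bprod V v c = word_prod V (map v (sorted_list_of_set c))"

lemma bprod_cong: "finite c ==> (\<And>i. i \<in> c ==> v i = v' i) ==> bprod V v c = bprod V v' c"
  unfolding bprod_def by (intro arg_cong[where f = "word_prod V"] map_cong) auto

lemma bprod_singleton: "bprod V v {i} = v i"
  by (simp add: bprod_def word_prod_def)

context
  fixes K :: "('k, 'r) ring_scheme" and V :: "('k, 'v, 'm) module_scheme"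
  assumes V: "comm_alg K V"
begin

lemma bilin_comm_alg: "bilin K V V V (mult V)"
  using V by (simp add: comm_alg_def nonunital_algebra_iff)

lemma module_comm_alg: "module K V"
  using bilin_comm_alg by (simp add: bilin_def)

lemma comm_alg_closed: "x \<in> carrier V ==> y \<in> carrier V ==> x \<otimes>\<^bsub>V\<^esub> y \<in> carrier V"
  by (rule bilin_closed[OF bilin_comm_alg])

lemma comm_alg_comm: "x \<in> carrier V ==> y \<in> carrier V ==> x \<otimes>\<^bsub>V\<^esub> y = y \<otimes>\<^bsub>V\<^esub> x"
  and comm_alg_assoc: "x \<in> carrier V ==> y \<in> carrier V ==> z \<in> carrier V ==>
    (x \<otimes>\<^bsub>V\<^esub> y) \<otimes>\<^bsub>V\<^esub> z = x \<otimes>\<^bsub>V\<^esub> (y \<otimes>\<^bsub>V\<^esub> z)"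
  using V by (auto simp: comm_alg_def nonunital_algebra_iff)

lemma comm_alg_lcomm: "x \<in> carrier V ==> y \<in> carrier V ==> z \<in> carrier V ==>
    x \<otimes>\<^bsub>V\<^esub> (y \<otimes>\<^bsub>V\<^esub> z) = y \<otimes>\<^bsub>V\<^esub> (x \<otimes>\<^bsub>V\<^esub> z)"
  by (metis comm_alg_comm comm_alg_assoc)

lemma foldl_mult_assoc:
  "x \<in> carrier V ==> y \<in> carrier V ==> set l \<subseteq> carrier V ==>
    foldl (mult V) (x \<otimes>\<^bsub>V\<^esub> y) l = x \<otimes>\<^bsub>V\<^esub> foldl (mult V) y l"
  by (induction l arbitrary: y) (auto simp: comm_alg_closed comm_alg_assoc)

lemma word_prod_Cons:
  assumes "x \<in> carrier V" "set l \<subseteq> carrier V" "l \<noteq> []"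
  shows "word_prod V (x # l) = x \<otimes>\<^bsub>V\<^esub> word_prod V l"
  using assms by (cases l) (auto simp: word_prod_def foldl_mult_assoc)

lemma word_prod_closed:
  assumes "set l \<subseteq> carrier V" "l \<noteq> []" shows "word_prod V l \<in> carrier V"
  using assms
proof (induction l)
  case (Cons x l)
  then show ?case by (cases "l = []") (auto simp: word_prod_Cons comm_alg_closed, simp add: word_prod_def)
qed simp

text \<open>Commutativity brings the inserted letter to the front, whatever place the ordering
  assigns to it. From here on products over sets can be handled by insertion of elements.\<close>

lemma word_prod_insort:
  assumes "v i \<in> carrier V" "v ` set l \<subseteq> carrier V" "l \<noteq> []"
  shows "word_prod V (map v (insort i l)) = v i \<otimes>\<^bsub>V\<^esub> word_prod V (map v l)"
  using assms(2,3)
proof (induction l)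
  case (Cons x l)
  show ?case
  proof (cases "l = []")
    case True
    then show ?thesis using assms(1) Cons.prems by (auto simp: word_prod_def comm_alg_comm)
  next
    case False
    have "insort i l \<noteq> []" by (metis insort_not_Nil)
    then have *: "word_prod V (v x # map v (insort i l)) = v x \<otimes>\<^bsub>V\<^esub> (v i \<otimes>\<^bsub>V\<^esub> word_prod V (map v l))"
      using Cons assms(1) False by (subst word_prod_Cons) (auto simp: set_insort_key)
    have c: "word_prod V (map v l) \<in> carrier V" using Cons.prems False by (intro word_prod_closed) auto
    show ?thesis using Cons.prems assms(1) False c
      by (auto simp: * word_prod_Cons comm_alg_lcomm image_subset_iff)
  qed
qed simp

lemma bprod_insert:
  assumes "finite c" "c \<noteq> {}" "i \<notin> c" "v \<in> insert i c \<rightarrow> carrier V"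
  shows "bprod V v (insert i c) = v i \<otimes>\<^bsub>V\<^esub> bprod V v c"
proof -
  have "sorted_list_of_set c \<noteq> []" using assms by simp
  then show ?thesis
    using assms unfolding bprod_def by (simp, intro word_prod_insort) auto
qed

lemma bprod_closed: "finite c ==> c \<noteq> {} ==> v \<in> c \<rightarrow> carrier V ==> bprod V v c \<in> carrier V"
  unfolding bprod_def by (rule word_prod_closed) auto

lemma bprod_Un:
  assumes "finite c" "c \<noteq> {}" "finite d" "d \<noteq> {}" "c \<inter> d = {}" "v \<in> c \<union> d \<rightarrow> carrier V"
  shows "bprod V v (c \<union> d) = bprod V v c \<otimes>\<^bsub>V\<^esub> bprod V v d"
  using assms
proof (induction c rule: finite_ne_induct)
  case (singleton x)
  then show ?case by (simp add: bprod_singleton bprod_insert)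
next
  case (insert x c)
  have "bprod V v (c \<union> d) = bprod V v c \<otimes>\<^bsub>V\<^esub> bprod V v d" using insert by (intro insert.IH) auto
  moreover have "bprod V v c \<in> carrier V" "bprod V v d \<in> carrier V"
    using insert by (auto intro!: bprod_closed)
  ultimately show ?case using insert
    by (simp add: bprod_insert comm_alg_assoc)
qed

lemma bprod_image:
  assumes "finite c" "c \<noteq> {}" "inj_on \<sigma> c" "v \<in> \<sigma> ` c \<rightarrow> carrier V"
  shows "bprod V v (\<sigma> ` c) = bprod V (\<lambda>i. v (\<sigma> i)) c"
  using assms
proof (induction c rule: finite_ne_induct)
  case (singleton x)
  then show ?case by (simp add: bprod_singleton)
next
  case (insert x c)
  then have "bprod V v (\<sigma> ` c) = bprod V (\<lambda>i. v (\<sigma> i)) c" by (intro insert.IH) auto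
  then show ?case using insert by (auto simp: bprod_insert Pi_def)
qed

text \<open>Multiplying first inside the parts and then over the parts. For the parts of a class of
  classes this is the compatibility of block products with iterated quotients.\<close>

lemma bprod_UN:
  assumes "finite D" "D \<noteq> {}" "\<And>d. d \<in> D ==> finite (g d)" "\<And>d. d \<in> D ==> g d \<noteq> {}"
    "\<And>d e. d \<in> D ==> e \<in> D ==> d \<noteq> e ==> g d \<inter> g e = {}" "v \<in> (\<Union>d\<in>D. g d) \<rightarrow> carrier V"
  shows "bprod V v (\<Union>d\<in>D. g d) = bprod V (\<lambda>d. bprod V v (g d)) D"
  using assms
proof (induction D rule: finite_ne_induct)
  case (singleton x)
  then show ?case by (simp add: bprod_singleton)
next
  case (insert x D)
  have IH: "bprod V v (\<Union>d\<in>D. g d) = bprod V (\<lambda>d. bprod V v (g d)) D"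
    using insert.prems by (intro insert.IH) auto
  have c: "bprod V v (g d) \<in> carrier V" if "d \<in> insert x D" for d
    using insert.prems that by (intro bprod_closed) auto
  have "bprod V v (g x \<union> (\<Union>d\<in>D. g d)) = bprod V v (g x) \<otimes>\<^bsub>V\<^esub> bprod V v (\<Union>d\<in>D. g d)"
  proof (rule bprod_Un)
    show "g x \<inter> (\<Union>d\<in>D. g d) = {}" using insert.prems(3) insert.hyps(3) by auto
  qed (use insert in auto)
  also have "\<dots> = bprod V (\<lambda>d. bprod V v (g d)) (insert x D)"
    using insert.hyps c by (subst bprod_insert) (auto simp: IH)
  finally show ?case by simp
qed

lemma lin_bprod:
  assumes "finite c" "i \<in> c" "v \<in> c \<rightarrow> carrier V"
  shows "lin K V V (\<lambda>a. bprod V (v(i := a)) c)"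
\<comment> \<open>A one-element set is treated apart: the product of the remaining letters would be
  empty, and there need not be a unit to stand for it.\<close>
proof (cases "c - {i} = {}")
  case True
  then have "c = {i}" using assms by auto
  then show ?thesis using lin_id[OF module_comm_alg] by (simp add: bprod_singleton)
next
  case False
  have c: "bprod V v (c - {i}) \<in> carrier V"
    using assms False by (intro bprod_closed) auto
  have eq: "a \<otimes>\<^bsub>V\<^esub> bprod V v (c - {i}) = bprod V (v(i := a)) c" if "a \<in> carrier V" for a
  proof -
    have "bprod V (v(i := a)) (insert i (c - {i})) = (v(i := a)) i \<otimes>\<^bsub>V\<^esub> bprod V (v(i := a)) (c - {i})"
    proof (rule bprod_insert[OF _ False])
      show "v(i := a) \<in> insert i (c - {i}) \<rightarrow> carrier V" using assms(3) that by (auto simp: Pi_def)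
    qed (use assms(1) in auto)
    moreover have "bprod V (v(i := a)) (c - {i}) = bprod V v (c - {i})"
      using assms by (intro bprod_cong) auto
    ultimately show ?thesis using assms by (simp add: insert_absorb)
  qed
  show ?thesis by (rule lin_cong[OF bilin_left[OF bilin_comm_alg c] eq])
qed

end

lemma bprod_hom:
  assumes "comm_alg K V" "comm_alg K W" "finite c" "c \<noteq> {}" "v \<in> c \<rightarrow> carrier V"
    and f: "\<And>x. x \<in> carrier V ==> f x \<in> carrier W"
      "\<And>x y. x \<in> carrier V ==> y \<in> carrier V ==> f (x \<otimes>\<^bsub>V\<^esub> y) = f x \<otimes>\<^bsub>W\<^esub> f y"
  shows "f (bprod V v c) = bprod W (\<lambda>i. f (v i)) c"
  using assms(3-5)
proof (induction c rule: finite_ne_induct)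
  case (insert x c)
  then show ?case
    by (auto simp: bprod_insert[OF assms(1)] bprod_insert[OF assms(2)] bprod_closed[OF assms(1)] f Pi_def)
qed (simp add: bprod_singleton)

lemma bprod_tens:
  assumes A: "comm_alg K A" and B: "comm_alg K B" and c: "finite c" "c \<noteq> {}"
    and a: "a \<in> c \<rightarrow> carrier A" and b: "b \<in> c \<rightarrow> carrier B"
  shows "bprod (tensor K A B) (\<lambda>i. tens K A B (a i) (b i)) c = tens K A B (bprod A a c) (bprod B b c)"
  using c a b
proof (induction c rule: finite_ne_induct)
  case (insert x c)
  then show ?case
    by (simp add: bprod_insert[OF A] bprod_insert[OF B] bprod_insert[OF comm_alg_tensor[OF A B]]
        tensor_mult_tens[OF bilin_comm_alg[OF A] bilin_comm_alg[OF B]] bprod_closed[OF A] bprod_closed[OF B]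
        tens_closed module_comm_alg[OF A] module_comm_alg[OF B] Pi_def)
qed (simp add: bprod_singleton)

text \<open>A character carries the product over a class into \<open>K\<close>, where
  \<open>finprod\<close> is available; the products over all classes can then be multiplied together
  by \<open>finprod_quo\<close>.\<close>

lemma bprod_character:
  assumes V: "comm_alg K V" and e: "\<And>x. x \<in> carrier V ==> e x \<in> carrier K"
    "\<And>x y. x \<in> carrier V ==> y \<in> carrier V ==> e (x \<otimes>\<^bsub>V\<^esub> y) = e x \<otimes>\<^bsub>K\<^esub> e y"
    and c: "finite c" "c \<noteq> {}" "v \<in> c \<rightarrow> carrier V"
  shows "e (bprod V v c) = finprod K (\<lambda>i. e (v i)) c"
proof -
  interpret M: module K V by (rule module_comm_alg[OF V])
  show ?thesis
    using c
  proof (induction c rule: finite_ne_induct)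
    case (insert x c)
    have "finprod K (\<lambda>i. e (v i)) (insert x c) = e (v x) \<otimes>\<^bsub>K\<^esub> finprod K (\<lambda>i. e (v i)) c"
      using insert e(1) by (intro M.R.finprod_insert) auto
    then show ?case using insert
      by (simp add: bprod_insert[OF V] bprod_closed[OF V] e Pi_def)
  qed (simp add: bprod_singleton e M.R.finprod_insert)
qed

section \<open>Quotients of finite sets\<close>

text \<open>The quotient map from \<open>X\<close> to \<open>quo X r\<close>, through which classes
  are handled as numbers. It is faithful for finite \<open>X\<close>, since
  \<open>set_encode\<close> codes finite sets.\<close>

definition code :: "(nat \<times> nat) set \<Rightarrow> nat \<Rightarrow> nat" where
  "code r x = set_encode (r `` {x})"

lemma equivs_iff:
  "r \<in> equivs X \<longleftrightarrow> r \<subseteq> X \<times> X \<and> (\<forall>x\<in>X. (x, x) \<in> r) \<and>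
    (\<forall>x y. (x, y) \<in> r \<longrightarrow> (y, x) \<in> r) \<and> (\<forall>x y z. (x, y) \<in> r \<longrightarrow> (y, z) \<in> r \<longrightarrow> (x, z) \<in> r)"
  by (simp add: equivs_def equiv_def refl_on_def sym_def trans_def)

lemma equivsD:
  assumes "r \<in> equivs X"
  shows "(x, y) \<in> r ==> x \<in> X" "(x, y) \<in> r ==> y \<in> X" "x \<in> X ==> (x, x) \<in> r"
    "(x, y) \<in> r ==> (y, x) \<in> r" "(x, y) \<in> r ==> (y, z) \<in> r ==> (x, z) \<in> r"
proof -
  note i = assms[unfolded equivs_iff, THEN conjunct1] assms[unfolded equivs_iff, THEN conjunct2, THEN conjunct1]
    assms[unfolded equivs_iff, THEN conjunct2, THEN conjunct2, THEN conjunct1]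
    assms[unfolded equivs_iff, THEN conjunct2, THEN conjunct2, THEN conjunct2]
  show "(x, y) \<in> r ==> x \<in> X" "(x, y) \<in> r ==> y \<in> X" using i(1) by auto
  show "x \<in> X ==> (x, x) \<in> r" using i(2) by simp
  show "(x, y) \<in> r ==> (y, x) \<in> r" using i(3) by simp
  show "(x, y) \<in> r ==> (y, z) \<in> r ==> (x, z) \<in> r" using i(4) by blast
qed

lemma equivsI:
  assumes "\<And>x y. (x, y) \<in> r ==> x \<in> X \<and> y \<in> X" "\<And>x. x \<in> X ==> (x, x) \<in> r"
    "\<And>x y. (x, y) \<in> r ==> (y, x) \<in> r" "\<And>x y z. (x, y) \<in> r ==> (y, z) \<in> r ==> (x, z) \<in> r"
  shows "r \<in> equivs X"
  unfolding equivs_iff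
proof (intro conjI allI impI ballI subsetI)
  fix p assume "p \<in> r"
  then show "p \<in> X \<times> X" using assms(1) by (cases p) auto
next
  show "(x, x) \<in> r" if "x \<in> X" for x using assms(2)[OF that] .
  show "(y, x) \<in> r" if "(x, y) \<in> r" for x y using assms(3)[OF that] .
  show "(x, z) \<in> r" if "(x, y) \<in> r" "(y, z) \<in> r" for x y z using assms(4)[OF that] .
qed

lemma finite_equivs: "finite X ==> finite (equivs X)"
  by (rule finite_subset[of _ "Pow (X \<times> X)"]) (auto dest: equivsD(1,2))

lemma equivs_empty: "equivs {} = {{}}"
  by (auto simp: equivs_iff)

lemma Id_on_equivs: "Id_on X \<in> equivs X"
  by (auto simp: equivs_iff Id_on_def)

lemma quo_code: "quo X r = code r ` X"
  by (auto simp: quo_def code_def quotient_def)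

lemma finite_quo: "finite X ==> finite (quo X r)"
  by (simp add: quo_code)

lemma quo_empty: "quo {} r = {}"
  by (simp add: quo_code)

context
  fixes X :: "nat set" and r
  assumes X: "finite X" and r: "r \<in> equivs X"
begin

lemma class_subset: "r `` {x} \<subseteq> X"
  using equivsD(2)[OF r] by auto

lemma decode_code: "set_decode (code r x) = r `` {x}"
  using finite_subset[OF class_subset X] by (simp add: code_def)

lemma class_mem: "x \<in> X ==> x \<in> r `` {x}"
  using equivsD(3)[OF r] by auto

lemma code_eq_iff: "x \<in> X ==> y \<in> X ==> code r x = code r y \<longleftrightarrow> (x, y) \<in> r"
proof -
  assume xy: "x \<in> X" "y \<in> X"
  have e: "equiv X r" using r by (simp add: equivs_def)
  have "code r x = code r y \<longleftrightarrow> r `` {x} = r `` {y}"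
    using decode_code by (metis code_def)
  also have "\<dots> \<longleftrightarrow> (x, y) \<in> r"
    by (rule eq_equiv_class_iff[OF e xy])
  finally show ?thesis .
qed

lemma code_mem: "x \<in> X ==> code r x \<in> quo X r"
  by (simp add: quo_code)

lemma code_decode: "c \<in> quo X r ==> i \<in> set_decode c ==> code r i = c"
proof -
  assume "c \<in> quo X r" and i: "i \<in> set_decode c"
  then obtain x where x: "x \<in> X" "c = code r x" by (auto simp: quo_code)
  then have "(x, i) \<in> r" using i by (simp add: decode_code)
  then have "i \<in> X" using equivsD(2)[OF r] by blast
  then show ?thesis using code_eq_iff[of x i] x \<open>(x, i) \<in> r\<close> by simp
qed

lemma decode_subset: "c \<in> quo X r ==> set_decode c \<subseteq> X"
  using equivsD(2)[OF r] by (auto simp: quo_code decode_code)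

lemma decode_nonempty: "c \<in> quo X r ==> set_decode c \<noteq> {}"
  using equivsD(3)[OF r] by (fastforce simp: quo_code decode_code)

lemma decode_disjoint: "c \<in> quo X r ==> d \<in> quo X r ==> c \<noteq> d ==> set_decode c \<inter> set_decode d = {}"
  using code_decode by blast

lemma UN_decode: "(\<Union>c\<in>quo X r. set_decode c) = X"
  by (auto simp: quo_code decode_code dest: equivsD(2)[OF r] intro: equivsD(3)[OF r])

end

lemma transport_iff: "(a, b) \<in> transport \<sigma> r \<longleftrightarrow> (\<exists>x y. (x, y) \<in> r \<and> a = \<sigma> x \<and> b = \<sigma> y)"
  by (force simp: transport_def)

lemma transport_inj_iff:
  assumes "r \<subseteq> X \<times> X" "inj_on \<sigma> X" "x \<in> X" "y \<in> X"
  shows "(\<sigma> x, \<sigma> y) \<in> transport \<sigma> r \<longleftrightarrow> (x, y) \<in> r"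
proof
  assume "(\<sigma> x, \<sigma> y) \<in> transport \<sigma> r"
  then obtain a b where ab: "(a, b) \<in> r" "\<sigma> x = \<sigma> a" "\<sigma> y = \<sigma> b" by (auto simp: transport_iff)
  then have "x = a" "y = b" using assms by (auto dest: inj_onD[OF assms(2)])
  then show "(x, y) \<in> r" using ab by simp
qed (auto simp: transport_iff)

lemma transport_equivs:
  assumes "inj_on \<sigma> X" "r \<in> equivs X"
  shows "transport \<sigma> r \<in> equivs (\<sigma> ` X)"
proof -
  note D = equivsD[OF assms(2)]
  have s: "r \<subseteq> X \<times> X" using D(1,2) by auto
  note iff = transport_inj_iff[OF s assms(1)]
  have sub: "\<exists>a\<in>X. \<exists>b\<in>X. x = \<sigma> a \<and> y = \<sigma> b" if "(x, y) \<in> transport \<sigma> r" for x y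
    using that D(1,2) unfolding transport_iff by blast
  show ?thesis
  proof (rule equivsI)
    show "x \<in> \<sigma> ` X \<and> y \<in> \<sigma> ` X" if "(x, y) \<in> transport \<sigma> r" for x y using sub[OF that] by auto
    show "(x, x) \<in> transport \<sigma> r" if "x \<in> \<sigma> ` X" for x
      using that D(3) by (auto simp: iff)
    show "(y, x) \<in> transport \<sigma> r" if "(x, y) \<in> transport \<sigma> r" for x y
      using sub[OF that] that D(4) by (auto simp: iff)
    show "(x, z) \<in> transport \<sigma> r" if xy: "(x, y) \<in> transport \<sigma> r" and yz: "(y, z) \<in> transport \<sigma> r" for x y z
    proof -
      obtain a b c b' where "x = \<sigma> a" "y = \<sigma> b" "y = \<sigma> b'" "z = \<sigma> c" "a \<in> X" "b \<in> X" "c \<in> X" "b' \<in> X"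
        using sub[OF xy] sub[OF yz] by blast
      then show ?thesis using xy yz D(5)[of a b c] by (simp add: iff)
    qed
  qed
qed

lemma bij_transport:
  assumes "inj_on \<sigma> X"
  shows "bij_betw (transport \<sigma>) (equivs X) (equivs (\<sigma> ` X))"
proof (rule bij_betw_byWitness[where f' = "transport (inv_into X \<sigma>)"])
  have inv: "inj_on (inv_into X \<sigma>) (\<sigma> ` X)" "inv_into X \<sigma> ` \<sigma> ` X = X"
    using assms by (auto simp: inj_on_inv_into image_image)
  have tr: "transport \<tau> (transport \<sigma>' r) = r"
    if "r \<subseteq> Y \<times> Y" "\<And>y. y \<in> Y ==> \<tau> (\<sigma>' y) = y" for \<tau> \<sigma>' r Y
  proof -
    have "(map_prod \<tau> \<tau> \<circ> map_prod \<sigma>' \<sigma>') ` r = id ` r"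
      by (rule image_cong[OF refl]) (use that in auto)
    then show ?thesis by (simp add: transport_def image_comp)
  qed
  show "\<forall>r\<in>equivs X. transport (inv_into X \<sigma>) (transport \<sigma> r) = r"
    using assms by (intro ballI tr[of _ X]) (auto dest: equivsD(1,2))
  show "\<forall>r\<in>equivs (\<sigma> ` X). transport \<sigma> (transport (inv_into X \<sigma>) r) = r"
    by (intro ballI tr[of _ "\<sigma> ` X"]) (auto dest: equivsD(1,2) simp: f_inv_into_f)
  show "transport \<sigma> ` equivs X \<subseteq> equivs (\<sigma> ` X)"
    using transport_equivs[OF assms] by auto
  show "transport (inv_into X \<sigma>) ` equivs (\<sigma> ` X) \<subseteq> equivs X"
    using transport_equivs[OF inv(1)] inv(2) by auto
qed

lemma quo_map_props:
  assumes X: "finite X" and r: "r \<in> equivs X" and \<sigma>: "inj_on \<sigma> X"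
  shows "c \<in> quo X r ==> set_decode (quo_map \<sigma> c) = \<sigma> ` set_decode c"
    and "quo (\<sigma> ` X) (transport \<sigma> r) = quo_map \<sigma> ` quo X r" and "inj_on (quo_map \<sigma>) (quo X r)"
proof -
  have d: "set_decode (quo_map \<sigma> c) = \<sigma> ` set_decode c" for c
    by (simp add: quo_map_def)
  show "set_decode (quo_map \<sigma> c) = \<sigma> ` set_decode c" by (rule d)
  have s: "r \<subseteq> X \<times> X" using equivsD(1,2)[OF r] by auto
  have ct: "code (transport \<sigma> r) (\<sigma> x) = quo_map \<sigma> (code r x)" if x: "x \<in> X" for x
  proof -
    have "transport \<sigma> r `` {\<sigma> x} = \<sigma> ` (r `` {x})"
    proof (intro equalityI subsetI)
      fix b assume "b \<in> transport \<sigma> r `` {\<sigma> x}"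
      then obtain y z where "(y, z) \<in> r" "\<sigma> x = \<sigma> y" "b = \<sigma> z" by (auto simp: transport_iff)
      moreover then have "x = y" using s x inj_onD[OF \<sigma>, of x y] by auto
      ultimately show "b \<in> \<sigma> ` (r `` {x})" by auto
    qed (auto simp: transport_iff)
    then show ?thesis by (simp add: code_def quo_map_def decode_code[OF X r, unfolded code_def])
  qed
  show "quo (\<sigma> ` X) (transport \<sigma> r) = quo_map \<sigma> ` quo X r"
    unfolding quo_code image_image by (rule image_cong[OF refl ct])
  show "inj_on (quo_map \<sigma>) (quo X r)"
  proof (rule inj_onI)
    fix c d' assume c: "c \<in> quo X r" "d' \<in> quo X r" "quo_map \<sigma> c = quo_map \<sigma> d'"
    then have "\<sigma> ` set_decode c = \<sigma> ` set_decode d'" using d by metis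
    then have "set_decode c = set_decode d'"
      using inj_on_image_eq_iff[OF \<sigma>] decode_subset[OF X r] c by blast
    then show "c = d'" by (metis set_decode_inverse)
  qed
qed

lemma equivs_Un:
  assumes "r \<in> equivs X" "s \<in> equivs Y" "X \<inter> Y = {}"
  shows "r \<union> s \<in> equivs (X \<union> Y)" "(r \<union> s) \<inter> X \<times> X = r" "(r \<union> s) \<inter> Y \<times> Y = s"
proof -
  have d: "\<And>x. x \<in> X ==> x \<notin> Y" using assms(3) by blast
  note D = equivsD[OF assms(1)] and E = equivsD[OF assms(2)]
  have rs: "\<And>x y. (x, y) \<in> r ==> x \<in> X \<and> y \<in> X" "\<And>x y. (x, y) \<in> s ==> x \<in> Y \<and> y \<in> Y"
    using D(1,2) E(1,2) by auto
  have "(x, y) \<in> (r \<union> s) \<inter> X \<times> X \<longleftrightarrow> (x, y) \<in> r" "(x, y) \<in> (r \<union> s) \<inter> Y \<times> Y \<longleftrightarrow> (x, y) \<in> s" for x y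
    using rs[of x y] d[of x] by auto
  then show "(r \<union> s) \<inter> X \<times> X = r" "(r \<union> s) \<inter> Y \<times> Y = s" by auto
  show "r \<union> s \<in> equivs (X \<union> Y)"
  proof (rule equivsI)
    show "(x, z) \<in> r \<union> s" if "(x, y) \<in> r \<union> s" "(y, z) \<in> r \<union> s" for x y z
      using that rs[of x y] rs[of y z] d D(5)[of x y z] E(5)[of x y z] by blast
  qed (use rs D(3,4) E(3,4) in auto)
qed

lemma equivs_Int: "r \<in> equivs Z ==> X \<subseteq> Z ==> r \<inter> X \<times> X \<in> equivs X"
  by (rule equivsI) (auto dest: equivsD)

text \<open>The two quotients are disjoint even as sets of numbers: a code determines its class,
  classes are nonempty, and a class of \<open>X\<close> does not meet a class of
  \<open>Y\<close>.\<close>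

lemma quo_Un:
  assumes "finite X" "finite Y" "r \<in> equivs X" "s \<in> equivs Y" "X \<inter> Y = {}"
  shows "quo (X \<union> Y) (r \<union> s) = quo X r \<union> quo Y s" "quo X r \<inter> quo Y s = {}"
proof -
  have "(r \<union> s) `` {x} = r `` {x}" if "x \<in> X" for x
    using assms(5) that equivsD(1)[OF assms(4), of x] by auto
  moreover have "(r \<union> s) `` {x} = s `` {x}" if "x \<in> Y" for x
    using assms(5) that equivsD(1)[OF assms(3), of x] by auto
  ultimately show "quo (X \<union> Y) (r \<union> s) = quo X r \<union> quo Y s"
    by (simp add: quo_code code_def image_Un cong: image_cong)
  show "quo X r \<inter> quo Y s = {}"
    using decode_subset[OF assms(1,3)] decode_subset[OF assms(2,4)] decode_nonempty[OF assms(1,3)] assms(5)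
    by blast
qed

text \<open>The equivalences on the right are those outside of which \<delta> of a product vanishes
  by the compatibility axiom; they index the sum that remains in \<open>split_mult\<close>.\<close>

lemma bij_equivs_Un:
  assumes "X \<inter> Y = {}"
  shows "bij_betw (\<lambda>(r, s). r \<union> s) (equivs X \<times> equivs Y)
    {r \<in> equivs (X \<union> Y). r = r \<inter> X \<times> X \<union> r \<inter> Y \<times> Y}"
proof (rule bij_betw_byWitness[where f' = "\<lambda>r. (r \<inter> X \<times> X, r \<inter> Y \<times> Y)"])
  show "\<forall>a\<in>equivs X \<times> equivs Y. (\<lambda>r. (r \<inter> X \<times> X, r \<inter> Y \<times> Y)) (case a of (r, s) \<Rightarrow> r \<union> s) = a"
    using equivs_Un(2,3)[OF _ _ assms] by auto
  show "(\<lambda>(r, s). r \<union> s) ` (equivs X \<times> equivs Y) \<subseteq> {r \<in> equivs (X \<union> Y). r = r \<inter> X \<times> X \<union> r \<inter> Y \<times> Y}"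
    using equivs_Un[OF _ _ assms] by force
  show "(\<lambda>r. (r \<inter> X \<times> X, r \<inter> Y \<times> Y)) ` {r \<in> equivs (X \<union> Y). r = r \<inter> X \<times> X \<union> r \<inter> Y \<times> Y} \<subseteq> equivs X \<times> equivs Y"
    using equivs_Int[of _ "X \<union> Y"] by auto
qed auto

text \<open>The union \<open>X1\<close> of a set of classes is saturated: related points lie both
  inside or both outside. So \<open>r\<close> relates no point of \<open>X1\<close> to one of the
  complement, and its classes inside \<open>X1\<close> are those that were chosen.\<close>

lemma quo_restrict:
  assumes X: "finite X" and r: "r \<in> equivs X" and Q: "Q \<subseteq> quo X r"
  defines "X1 \<equiv> \<Union>c\<in>Q. set_decode c"
  shows "X1 \<subseteq> X" "r = r \<inter> X1 \<times> X1 \<union> r \<inter> (X - X1) \<times> (X - X1)"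
    "quo X1 (r \<inter> X1 \<times> X1) = Q"
proof -
  have X1: "x \<in> X1 \<longleftrightarrow> x \<in> X \<and> code r x \<in> Q" for x
  proof
    assume "x \<in> X1"
    then obtain c where "c \<in> Q" "x \<in> set_decode c" by (auto simp: X1_def)
    moreover then have "x \<in> X" using decode_subset[OF X r, of c] Q by blast
    ultimately show "x \<in> X \<and> code r x \<in> Q" using code_decode[OF X r, of c x] Q by auto
  next
    assume "x \<in> X \<and> code r x \<in> Q"
    moreover then have "x \<in> set_decode (code r x)"
      using class_mem[OF X r, of x] decode_code[OF X r] by auto
    ultimately show "x \<in> X1" by (auto simp: X1_def)
  qed
  then show "X1 \<subseteq> X" by auto
  have rel: "x \<in> X1 \<longleftrightarrow> y \<in> X1" if "(x, y) \<in> r" for x y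
  proof -
    have "x \<in> X" "y \<in> X" using equivsD(1,2)[OF r that] by auto
    then have "code r x = code r y" using code_eq_iff[OF X r] that by blast
    then show ?thesis using \<open>x \<in> X\<close> \<open>y \<in> X\<close> by (simp add: X1)
  qed
  then show "r = r \<inter> X1 \<times> X1 \<union> r \<inter> (X - X1) \<times> (X - X1)"
    using equivsD(1,2)[OF r] by auto
  have "(r \<inter> X1 \<times> X1) `` {x} = r `` {x}" if "x \<in> X1" for x using rel that by auto
  then have "quo X1 (r \<inter> X1 \<times> X1) = code r ` X1" by (simp add: quo_code code_def cong: image_cong)
  also have "\<dots> = Q"
  proof (intro equalityI subsetI)
    fix c assume c: "c \<in> Q"
    then obtain x where "x \<in> X" "c = code r x" using Q by (auto simp: quo_code)
    then show "c \<in> code r ` X1" using c by (simp add: X1)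
  qed (auto simp: X1)
  finally show "quo X1 (r \<inter> X1 \<times> X1) = Q" .
qed

text \<open>Cutting the set before contracting is matched with contracting before cutting the
  quotient. The inverse takes the union of the chosen classes as \<open>X1\<close> and restricts the
  equivalence to it and to its complement, by \<open>quo_restrict\<close>.\<close>

lemma bij_quo_subsets:
  assumes X: "finite X"
  shows "bij_betw (\<lambda>(X1, r, s). (r \<union> s, quo X1 r)) (SIGMA X1:Pow X. equivs X1 \<times> equivs (X - X1))
    (SIGMA r:equivs X. Pow (quo X r))"
proof (rule bij_betw_byWitness[where f' = "\<lambda>(r, Q). let X1 = \<Union>c\<in>Q. set_decode c in
      (X1, r \<inter> X1 \<times> X1, r \<inter> (X - X1) \<times> (X - X1))"])
  let ?h = "\<lambda>(X1, r, s). (r \<union> s, quo X1 r)"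
  let ?h' = "\<lambda>(r, Q). let X1 = \<Union>c\<in>Q. set_decode c in (X1, r \<inter> X1 \<times> X1, r \<inter> (X - X1) \<times> (X - X1))"
  have 1: "?h' (r \<union> s, quo X1 r) = (X1, r, s) \<and> r \<union> s \<in> equivs X \<and> quo X1 r \<subseteq> quo X (r \<union> s)"
    if "X1 \<subseteq> X" "r \<in> equivs X1" "s \<in> equivs (X - X1)" for X1 r s
  proof -
    have f: "finite X1" "finite (X - X1)" "X1 \<inter> (X - X1) = {}" "X1 \<union> (X - X1) = X"
      using that X finite_subset by auto
    note u = UN_decode[OF f(1) that(2)]
    have e: "r \<union> s \<in> equivs X" using equivs_Un(1)[OF that(2,3) f(3)] unfolding f(4) .
    have q: "quo X (r \<union> s) = quo X1 r \<union> quo (X - X1) s"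
      using quo_Un(1)[OF f(1,2) that(2,3) f(3)] unfolding f(4) .
    show ?thesis
      unfolding Let_def prod.case u equivs_Un(2,3)[OF that(2,3) f(3)] using e q by auto
  qed
  have 2: "?h' (?h a) = a \<and> ?h a \<in> (SIGMA r:equivs X. Pow (quo X r))"
    if a: "a \<in> (SIGMA X1:Pow X. equivs X1 \<times> equivs (X - X1))" for a
  proof -
    obtain X1 r s where "a = (X1, r, s)" "X1 \<subseteq> X" "r \<in> equivs X1" "s \<in> equivs (X - X1)"
      using a by auto
    then show ?thesis using 1[of X1 r s] by (simp only: prod.case mem_Sigma_iff Pow_iff simp_thms)
  qed
  show "\<forall>a\<in>SIGMA X1:Pow X. equivs X1 \<times> equivs (X - X1). ?h' (?h a) = a"
    using 2 by blast
  show "?h ` (SIGMA X1:Pow X. equivs X1 \<times> equivs (X - X1)) \<subseteq> (SIGMA r:equivs X. Pow (quo X r))"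
    using 2 by blast
  show "\<forall>a\<in>SIGMA r:equivs X. Pow (quo X r). ?h (?h' a) = a"
    using quo_restrict[OF X] by (auto simp: Let_def)
  show "?h' ` (SIGMA r:equivs X. Pow (quo X r)) \<subseteq> (SIGMA X1:Pow X. equivs X1 \<times> equivs (X - X1))"
  proof (rule image_subsetI)
    fix a assume "a \<in> (SIGMA r:equivs X. Pow (quo X r))"
    then obtain r Q where a: "a = (r, Q)" and rQ: "r \<in> equivs X" "Q \<subseteq> quo X r" by auto
    note q = quo_restrict[OF X rQ]
    have "r \<inter> (\<Union>c\<in>Q. set_decode c) \<times> (\<Union>c\<in>Q. set_decode c) \<in> equivs (\<Union>c\<in>Q. set_decode c)"
      by (rule equivs_Int[OF rQ(1) q(1)])
    moreover have "r \<inter> (X - (\<Union>c\<in>Q. set_decode c)) \<times> (X - (\<Union>c\<in>Q. set_decode c)) \<in> equivs (X - (\<Union>c\<in>Q. set_decode c))"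
      by (rule equivs_Int[OF rQ(1)]) auto
    ultimately show "?h' a \<in> (SIGMA X1:Pow X. equivs X1 \<times> equivs (X - X1))"
      using q(1) unfolding a Let_def by simp
  qed
qed

context
  fixes X :: "nat set" and r' r
  assumes X: "finite X" and r': "r' \<in> equivs X" and r: "r \<in> equivs X" and sub: "r' \<subseteq> r"
begin

lemma quo_equiv_iff:
  assumes "x \<in> X" "y \<in> X"
  shows "(code r' x, code r' y) \<in> quo_equiv r r' \<longleftrightarrow> (x, y) \<in> r"
proof
  assume "(code r' x, code r' y) \<in> quo_equiv r r'"
  then obtain a b where ab: "(a, b) \<in> r" "code r' x = code r' a" "code r' y = code r' b"
    by (auto simp: quo_equiv_def transport_iff code_def)
  then have "a \<in> X" "b \<in> X" using equivsD(1,2)[OF r ab(1)] by auto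
  then have "(x, a) \<in> r" "(b, y) \<in> r"
    using ab assms code_eq_iff[OF X r'] sub by (metis subsetD)+
  then show "(x, y) \<in> r" using ab(1) equivsD(5)[OF r] by blast
qed (auto simp: quo_equiv_def transport_iff code_def)

lemma quo_equiv_equivs: "quo_equiv r r' \<in> equivs (quo X r')"
proof -
  note D = equivsD[OF r]
  have s: "\<exists>a\<in>X. \<exists>b\<in>X. x = code r' a \<and> y = code r' b" if "(x, y) \<in> quo_equiv r r'" for x y
    using that D(1,2) unfolding quo_equiv_def transport_iff code_def[symmetric] by blast
  show ?thesis
  proof (rule equivsI)
    show "x \<in> quo X r' \<and> y \<in> quo X r'" if "(x, y) \<in> quo_equiv r r'" for x y
      using s[OF that] by (auto simp: quo_code)
    show "(x, x) \<in> quo_equiv r r'" if "x \<in> quo X r'" for x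
      using that D(3) by (auto simp: quo_code quo_equiv_iff)
    show "(y, x) \<in> quo_equiv r r'" if "(x, y) \<in> quo_equiv r r'" for x y
      using s[OF that] that D(4) by (auto simp: quo_equiv_iff)
    show "(x, z) \<in> quo_equiv r r'" if xy: "(x, y) \<in> quo_equiv r r'" and yz: "(y, z) \<in> quo_equiv r r'" for x y z
    proof -
      obtain a b b' c where abc: "x = code r' a" "y = code r' b" "y = code r' b'" "z = code r' c"
        "a \<in> X" "b \<in> X" "b' \<in> X" "c \<in> X"
        using s[OF xy] s[OF yz] by blast
      then have "(a, b) \<in> r" "(b, c) \<in> r" using xy yz quo_equiv_iff by auto
      then show ?thesis using D(5)[of a b c] abc quo_equiv_iff by simp
    qed
  qed
qed

text \<open>The class of \<open>code r' x\<close> in the quotient consists of the codes of all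
  points of the \<open>r\<close>-class of \<open>x\<close>. As \<open>r'\<close> is contained in
  \<open>r\<close>, the \<open>r'\<close>-classes of these points together fill just that
  \<open>r\<close>-class.\<close>

lemma flatten_code: "x \<in> X ==> flatten (code (quo_equiv r r') (code r' x)) = code r x"
proof -
  assume x: "x \<in> X"
  have "quo_equiv r r' `` {code r' x} = code r' ` (r `` {x})"
  proof (intro equalityI subsetI)
    fix d assume d: "d \<in> quo_equiv r r' `` {code r' x}"
    then have "d \<in> quo X r'" using equivsD(2)[OF quo_equiv_equivs] by auto
    then obtain y where "y \<in> X" "d = code r' y" by (auto simp: quo_code)
    then show "d \<in> code r' ` (r `` {x})" using d x quo_equiv_iff by auto
  next
    fix d assume "d \<in> code r' ` (r `` {x})"
    then obtain y where "(x, y) \<in> r" "d = code r' y" by auto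
    moreover then have "y \<in> X" using equivsD(2)[OF r] by auto
    ultimately show "d \<in> quo_equiv r r' `` {code r' x}" using x quo_equiv_iff by auto
  qed
  then have "flatten (code (quo_equiv r r') (code r' x)) = set_encode (\<Union>y\<in>r `` {x}. r' `` {y})"
    using decode_code[OF finite_quo[OF X] quo_equiv_equivs]
    by (simp add: flatten_def decode_code[OF X r'])
  also have "(\<Union>y\<in>r `` {x}. r' `` {y}) = r `` {x}"
    using equivsD(2,5)[OF r] equivsD(3)[OF r'] sub by blast
  finally show ?thesis by (simp add: code_def)
qed

lemma flatten_props:
  shows "quo X r = flatten ` quo (quo X r') (quo_equiv r r')"
    and "inj_on flatten (quo (quo X r') (quo_equiv r r'))"
    and "c \<in> quo (quo X r') (quo_equiv r r') ==> set_decode (flatten c) = (\<Union>d\<in>set_decode c. set_decode d)"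
proof -
  have q: "quo (quo X r') (quo_equiv r r') = (\<lambda>x. code (quo_equiv r r') (code r' x)) ` X"
    by (auto simp: quo_code)
  show "quo X r = flatten ` quo (quo X r') (quo_equiv r r')"
    unfolding q by (auto simp: quo_code flatten_code image_image)
  show "inj_on flatten (quo (quo X r') (quo_equiv r r'))"
    unfolding q
  proof (rule inj_onI, clarify)
    fix x y assume xy: "x \<in> X" "y \<in> X"
      and "flatten (code (quo_equiv r r') (code r' x)) = flatten (code (quo_equiv r r') (code r' y))"
    then have "(x, y) \<in> r" using code_eq_iff[OF X r] by (simp add: flatten_code)
    then show "code (quo_equiv r r') (code r' x) = code (quo_equiv r r') (code r' y)"
      using xy code_eq_iff[OF finite_quo[OF X] quo_equiv_equivs] by (simp add: quo_equiv_iff quo_code)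
  qed
  show "set_decode (flatten c) = (\<Union>d\<in>set_decode c. set_decode d)"
    by (simp add: flatten_def)
qed

end

text \<open>The correspondence between equivalences on a quotient and equivalences above
  \<open>r'\<close>: the inverse pulls an equivalence back along the quotient map
  \<open>code r'\<close>.\<close>

lemma bij_quo_equiv:
  assumes X: "finite X" and r': "r' \<in> equivs X"
  shows "bij_betw (\<lambda>r. quo_equiv r r') {r \<in> equivs X. r' \<subseteq> r} (equivs (quo X r'))"
proof (rule bij_betw_byWitness[where f' = "\<lambda>s. {(x, y). x \<in> X \<and> y \<in> X \<and> (code r' x, code r' y) \<in> s}"])
  show "\<forall>r\<in>{r \<in> equivs X. r' \<subseteq> r}. {(x, y). x \<in> X \<and> y \<in> X \<and> (code r' x, code r' y) \<in> quo_equiv r r'} = r"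
    using quo_equiv_iff[OF X r'] by (auto dest: equivsD(1,2))
  show "\<forall>s\<in>equivs (quo X r'). quo_equiv {(x, y). x \<in> X \<and> y \<in> X \<and> (code r' x, code r' y) \<in> s} r' = s"
  proof
    fix s assume s: "s \<in> equivs (quo X r')"
    have "\<exists>a\<in>X. \<exists>b\<in>X. x = code r' a \<and> y = code r' b" if "(x, y) \<in> s" for x y
      using equivsD(1,2)[OF s that] by (auto simp: quo_code)
    then show "quo_equiv {(x, y). x \<in> X \<and> y \<in> X \<and> (code r' x, code r' y) \<in> s} r' = s"
      by (force simp: quo_equiv_def transport_def code_def[symmetric])
  qed
  show "(\<lambda>r. quo_equiv r r') ` {r \<in> equivs X. r' \<subseteq> r} \<subseteq> equivs (quo X r')"
    using quo_equiv_equivs[OF X r'] by auto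
  show "(\<lambda>s. {(x, y). x \<in> X \<and> y \<in> X \<and> (code r' x, code r' y) \<in> s}) ` equivs (quo X r') \<subseteq> {r \<in> equivs X. r' \<subseteq> r}"
  proof clarify
    fix s assume s: "s \<in> equivs (quo X r')"
    note D = equivsD[OF s]
    note m = D(3)
    have "{(x, y). x \<in> X \<and> y \<in> X \<and> (code r' x, code r' y) \<in> s} \<in> equivs X"
    proof (rule equivsI)
      show "(x, x) \<in> {(x, y). x \<in> X \<and> y \<in> X \<and> (code r' x, code r' y) \<in> s}" if "x \<in> X" for x
        using m[of "code r' x"] that by (simp add: quo_code)
      show "(x, z) \<in> {(x, y). x \<in> X \<and> y \<in> X \<and> (code r' x, code r' y) \<in> s}"
        if "(x, y) \<in> {(x, y). x \<in> X \<and> y \<in> X \<and> (code r' x, code r' y) \<in> s}"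
          "(y, z) \<in> {(x, y). x \<in> X \<and> y \<in> X \<and> (code r' x, code r' y) \<in> s}" for x y z
        using that D(5)[of "code r' x" "code r' y" "code r' z"] by simp
    qed (use D(4) in simp_all)
    moreover have "r' \<subseteq> {(x, y). x \<in> X \<and> y \<in> X \<and> (code r' x, code r' y) \<in> s}"
    proof clarify
      fix x y assume xy: "(x, y) \<in> r'"
      then have "x \<in> X" "y \<in> X" using equivsD(1,2)[OF r'] by auto
      then show "x \<in> X \<and> y \<in> X \<and> (code r' x, code r' y) \<in> s"
      proof -
        have "code r' x = code r' y" using xy code_eq_iff[OF X r'] \<open>x \<in> X\<close> \<open>y \<in> X\<close> by blast
        then show ?thesis using m[of "code r' x"] \<open>x \<in> X\<close> \<open>y \<in> X\<close> by (simp add: quo_code)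
      qed
    qed
    ultimately show "{(x, y). x \<in> X \<and> y \<in> X \<and> (code r' x, code r' y) \<in> s} \<in> equivs X \<and>
      r' \<subseteq> {(x, y). x \<in> X \<and> y \<in> X \<and> (code r' x, code r' y) \<in> s}" by blast
  qed
qed

lemma code_Id: "x \<in> X ==> code (Id_on X) x = set_encode {x}"
proof -
  assume "x \<in> X"
  then have "Id_on X `` {x} = {x}" by auto
  then show ?thesis by (simp add: code_def)
qed

lemma quo_Id: "quo X (Id_on X) = (\<lambda>x. set_encode {x}) ` X"
  by (simp add: quo_code code_Id cong: image_cong)

lemma inj_singleton_code: "inj_on (\<lambda>x. set_encode {x}) X"
  by (rule inj_onI) (metis finite.emptyI finite_insert set_encode_inverse singleton_inject)

lemma finprod_quo:
  assumes K: "cring K" and X: "finite X" and r: "r \<in> equivs X" and f: "f \<in> X \<rightarrow> carrier K"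
  shows "finprod K (\<lambda>c. finprod K f (set_decode c)) (quo X r) = finprod K f X"
proof -
  interpret cring K by (rule K)
  have "finprod K f (\<Union>c\<in>quo X r. set_decode c) = finprod K (\<lambda>c. finprod K f (set_decode c)) (quo X r)"
    using finite_quo[OF X] decode_disjoint[OF X r] decode_subset[OF X r] f
    by (intro finprod_UN_disjoint) (auto simp: pairwise_def disjnt_def, blast)
  then show ?thesis by (simp add: UN_decode[OF X r])
qed

section \<open>Multilinear expansion of words of tensors\<close>

text \<open>Bilinearity in the pair at each position is the condition under which every tensor of a
  list can be expanded by \<open>lift\<close>, the others being held fixed.\<close>

definition mlin2 :: "('k, 'r) ring_scheme \<Rightarrow> ('k, 'a, 'm) module_scheme \<Rightarrow> ('k, 'b, 'n) module_scheme \<Rightarrow>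
    ('k, 'u, 'q) module_scheme \<Rightarrow> nat \<Rightarrow> (('a \<times> 'b) list \<Rightarrow> 'u) \<Rightarrow> bool" where
  "mlin2 K A B U n \<beta> \<longleftrightarrow> (\<forall>xs. length xs = n \<and> set xs \<subseteq> carrier A \<times> carrier B \<longrightarrow>
     \<beta> xs \<in> carrier U \<and> (\<forall>i<n. bilin K A B U (\<lambda>a b. \<beta> (xs[i := (a, b)]))))"

lemma mlin2_closed: "mlin2 K A B U n \<beta> ==> length xs = n ==> set xs \<subseteq> carrier A \<times> carrier B ==> \<beta> xs \<in> carrier U"
  and mlin2_bilin: "mlin2 K A B U n \<beta> ==> length xs = n ==> set xs \<subseteq> carrier A \<times> carrier B ==> i < n ==>
    bilin K A B U (\<lambda>a b. \<beta> (xs[i := (a, b)]))"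
  by (auto simp: mlin2_def)

lemma mlin2_Cons:
  assumes "mlin2 K A B U (Suc n) \<beta>" "x \<in> carrier A \<times> carrier B"
  shows "mlin2 K A B U n (\<lambda>xs. \<beta> (x # xs))"
  unfolding mlin2_def
proof (intro allI impI conjI)
  fix xs assume xs: "length xs = n \<and> set xs \<subseteq> carrier A \<times> carrier B"
  show "\<beta> (x # xs) \<in> carrier U" using xs assms by (intro mlin2_closed[OF assms(1)]) auto
  fix i assume "i < n"
  then show "bilin K A B U (\<lambda>a b. \<beta> (x # xs[i := (a, b)]))"
    using mlin2_bilin[OF assms(1), of "x # xs" "Suc i"] xs assms(2) by simp
qed

text \<open>The claim proved by induction for nested expansions, with \<open>ts\<close> fixed and
  \<beta> arbitrary. Expanding one more tensor requires the remaining expansion to be bilinear in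
  the pair (a, b), which is this same claim with the parameter ranging over \<open>A\<close> and
  over \<open>B\<close>.\<close>

definition param_lin :: "('k, 'r) ring_scheme \<Rightarrow> ('k, 'a, 'x) module_scheme \<Rightarrow> ('k, 'b, 'y) module_scheme \<Rightarrow>
    ('k, 'u, 'z) module_scheme \<Rightarrow> ('k, 'm, 'w) module_scheme \<Rightarrow> ('k, 'a, 'b) tensor list \<Rightarrow> bool" where
  "param_lin K A B U M ts \<longleftrightarrow> (\<forall>\<beta>. (\<forall>m\<in>carrier M. mlin2 K A B U (length ts) (\<beta> m)) \<longrightarrow>
    (\<forall>xs. length xs = length ts \<longrightarrow> set xs \<subseteq> carrier A \<times> carrier B \<longrightarrow> lin K M U (\<lambda>m. \<beta> m xs)) \<longrightarrow>
    lin K M U (\<lambda>m. lift_list K U ts (\<beta> m)))"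

context
  fixes K :: "('k, 'r) ring_scheme" and A :: "('k, 'a, 'm) module_scheme" and B :: "('k, 'b, 'n) module_scheme"
    and U :: "('k, 'u, 'q) module_scheme"
  assumes A: "module K A" and B: "module K B" and U: "module K U"
begin

lemma param_linD:
  assumes "param_lin K A B U M ts" "\<And>m. m \<in> carrier M ==> mlin2 K A B U (length ts) (\<beta> m)"
    "\<And>xs. length xs = length ts ==> set xs \<subseteq> carrier A \<times> carrier B ==> lin K M U (\<lambda>m. \<beta> m xs)"
  shows "lin K M U (\<lambda>m. lift_list K U ts (\<beta> m))"
  using assms unfolding param_lin_def by blast

lemma param_lin_bilin:
  assumes pA: "param_lin K A B U A ts" and pB: "param_lin K A B U B ts" and \<beta>: "mlin2 K A B U (Suc (length ts)) \<beta>"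
  shows "bilin K A B U (\<lambda>a b. lift_list K U ts (\<lambda>xs. \<beta> ((a, b) # xs)))"
proof (rule bilinI[OF A B U])
  interpret A: module K A by (rule A)
  interpret B: module K B by (rule B)
  have b: "bilin K A B U (\<lambda>a b. \<beta> ((a, b) # xs))"
    if "length xs = length ts" "set xs \<subseteq> carrier A \<times> carrier B" for xs
    using mlin2_bilin[OF \<beta>, of "(\<zero>\<^bsub>A\<^esub>, \<zero>\<^bsub>B\<^esub>) # xs" 0] that by simp
  show "lin K B U (\<lambda>b. lift_list K U ts (\<lambda>xs. \<beta> ((a, b) # xs)))" if a: "a \<in> carrier A" for a
    by (rule param_linD[OF pB mlin2_Cons[OF \<beta>] bilin_right[OF b]]) (use a in auto)
  show "lin K A U (\<lambda>a. lift_list K U ts (\<lambda>xs. \<beta> ((a, b) # xs)))" if b': "b \<in> carrier B" for b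
    by (rule param_linD[OF pA mlin2_Cons[OF \<beta>] bilin_left[OF b]]) (use b' in auto)
qed

lemma param_lin_Cons:
  assumes M: "module K M" and p: "param_lin K A B U A ts" "param_lin K A B U B ts" "param_lin K A B U M ts"
    and t: "t \<in> carrier (tensor K A B)"
  shows "param_lin K A B U M (t # ts)"
  unfolding param_lin_def
proof (intro allI impI)
  fix \<beta> assume "\<forall>m\<in>carrier M. mlin2 K A B U (length (t # ts)) (\<beta> m)"
  then have m: "mlin2 K A B U (Suc (length ts)) (\<beta> m)" if "m \<in> carrier M" for m using that by simp
  assume "\<forall>xs. length xs = length (t # ts) \<longrightarrow> set xs \<subseteq> carrier A \<times> carrier B \<longrightarrow> lin K M U (\<lambda>m. \<beta> m xs)"
  then have l: "lin K M U (\<lambda>m. \<beta> m (x # xs))"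
    if "length xs = length ts" "x \<in> carrier A \<times> carrier B" "set xs \<subseteq> carrier A \<times> carrier B" for x xs
    using that by simp
  have "lin K M U (\<lambda>m. lift K U (\<lambda>(a, b). lift_list K U ts (\<lambda>xs. \<beta> m ((a, b) # xs))) t)"
  proof (rule lin_tensor_lift_param[OF A B M param_lin_bilin[OF p(1,2) m] _ t])
    fix a b assume ab: "a \<in> carrier A" "b \<in> carrier B"
    show "lin K M U (\<lambda>m. lift_list K U ts (\<lambda>xs. \<beta> m ((a, b) # xs)))"
      by (rule param_linD[OF p(3) mlin2_Cons[OF m] l]) (use ab in auto)
  qed
  then show "lin K M U (\<lambda>m. lift_list K U (t # ts) (\<beta> m))" by (simp add: split_def)
qed

lemma param_lin_Nil: "param_lin K A B U M []"
  by (simp add: param_lin_def)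

lemma lin_lift_list_param:
  assumes "module K M" "length ts = n" "set ts \<subseteq> carrier (tensor K A B)"
    "\<And>m. m \<in> carrier M ==> mlin2 K A B U n (\<beta> m)"
    "\<And>xs. length xs = n ==> set xs \<subseteq> carrier A \<times> carrier B ==> lin K M U (\<lambda>m. \<beta> m xs)"
  shows "lin K M U (\<lambda>m. lift_list K U ts (\<beta> m))"
proof -
  \<comment> \<open>The two instances on which the induction step relies are proved together; a
    general parameter space \<open>M\<close> then uses them.\<close>
  have AB: "param_lin K A B U A us \<and> param_lin K A B U B us" if "set us \<subseteq> carrier (tensor K A B)" for us
    using that by (induction us) (auto intro: param_lin_Nil param_lin_Cons A B)
  have "param_lin K A B U M us" if "set us \<subseteq> carrier (tensor K A B)" for us
    using that by (induction us) (auto intro: param_lin_Nil param_lin_Cons[OF assms(1)] dest: AB)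
  then show ?thesis using assms by (intro param_linD) auto
qed

lemma lift_list_bilin_Cons:
  assumes \<beta>: "mlin2 K A B U (Suc n) \<beta>" and ts: "length ts = n" "set ts \<subseteq> carrier (tensor K A B)"
  shows "bilin K A B U (\<lambda>a b. lift_list K U ts (\<lambda>xs. \<beta> ((a, b) # xs)))"
proof (rule bilinI[OF A B U])
  interpret A: module K A by (rule A)
  interpret B: module K B by (rule B)
  have b: "bilin K A B U (\<lambda>a b. \<beta> ((a, b) # xs))" if "length xs = n" "set xs \<subseteq> carrier A \<times> carrier B" for xs
    using mlin2_bilin[OF \<beta>, of "(\<zero>\<^bsub>A\<^esub>, \<zero>\<^bsub>B\<^esub>) # xs" 0] that by simp
  show "lin K B U (\<lambda>b. lift_list K U ts (\<lambda>xs. \<beta> ((a, b) # xs)))" if a: "a \<in> carrier A" for a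
    by (rule lin_lift_list_param[OF B ts mlin2_Cons[OF \<beta>] bilin_right[OF b]]) (use a in auto)
  show "lin K A U (\<lambda>a. lift_list K U ts (\<lambda>xs. \<beta> ((a, b) # xs)))" if b': "b \<in> carrier B" for b
    by (rule lin_lift_list_param[OF A ts mlin2_Cons[OF \<beta>] bilin_left[OF b]]) (use b' in auto)
qed

lemma mlin_lift_list:
  assumes "mlin2 K A B U n \<beta>"
  shows "mlin K (tensor K A B) U n (\<lambda>ts. lift_list K U ts \<beta>)"
  using assms
proof (induction n arbitrary: \<beta>)
  case 0
  then show ?case by (auto simp: mlin_def mlin2_def)
next
  case (Suc n)
  have eq: "lift_list K U (t # ts) \<beta> = lift K U (\<lambda>(a, b). lift_list K U ts (\<lambda>xs. \<beta> ((a, b) # xs))) t" for t ts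
    by (simp add: split_def)
  note l = lin_tensor_lift[OF A B lift_list_bilin_Cons[OF Suc.prems]]
  show ?case
    unfolding mlin_def
  proof (intro allI impI)
    fix us assume "length us = Suc n \<and> set us \<subseteq> carrier (tensor K A B)"
    then obtain t ts where us: "us = t # ts" "length ts = n" "set ts \<subseteq> carrier (tensor K A B)"
      "t \<in> carrier (tensor K A B)" by (cases us) auto
    have "lin K (tensor K A B) U (\<lambda>a. lift_list K U (us[i := a]) \<beta>)" if i: "i < Suc n" for i
    proof (cases i)
      case 0
      then show ?thesis using l[OF us(2,3)] by (simp add: us eq del: lift_list.simps)
    next
      case (Suc j)
      have j: "j < n" using Suc i by simp
      \<comment> \<open>A later letter enters the expansion of the first tensor as a
        parameter.\<close>
      have "lin K (tensor K A B) U (\<lambda>a. lift K U (\<lambda>(x, y). lift_list K U (ts[j := a]) (\<lambda>xs. \<beta> ((x, y) # xs))) t)"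
      proof (rule lin_tensor_lift_param[OF A B module_tensor[OF A B] _ _ us(4)])
        show "bilin K A B U (\<lambda>x y. lift_list K U (ts[j := a]) (\<lambda>xs. \<beta> ((x, y) # xs)))"
          if "a \<in> carrier (tensor K A B)" for a
          using us(2,3) that set_update_subset_insert[of ts j a]
          by (intro lift_list_bilin_Cons[OF Suc.prems(1)]) auto
        show "lin K (tensor K A B) U (\<lambda>a. lift_list K U (ts[j := a]) (\<lambda>xs. \<beta> ((x, y) # xs)))"
          if "x \<in> carrier A" "y \<in> carrier B" for x y
          by (rule mlin_lin[OF Suc.IH[OF mlin2_Cons[OF Suc.prems(1)]] us(2,3) j]) (use that in auto)
      qed
      then show ?thesis by (simp add: us Suc eq del: lift_list.simps)
    qed
    then show "lift_list K U us \<beta> \<in> carrier U \<and> (\<forall>i<Suc n. lin K (tensor K A B) U (\<lambda>a. lift_list K U (us[i := a]) \<beta>))"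
      using lin_closed[OF l[OF us(2,3)] us(4)] by (simp add: us(1) eq del: lift_list.simps)
  qed
qed

lemma lift_list_tens:
  assumes "mlin2 K A B U (length xs) \<beta>" "set xs \<subseteq> carrier A \<times> carrier B"
  shows "lift_list K U (map (\<lambda>(a, b). tens K A B a b) xs) \<beta> = \<beta> xs"
  using assms
proof (induction xs arbitrary: \<beta>)
  case (Cons x xs)
  obtain a b where x: "x = (a, b)" "a \<in> carrier A" "b \<in> carrier B" using Cons.prems by (cases x) auto
  have xs: "set xs \<subseteq> carrier A \<times> carrier B" "set (map (\<lambda>(a, b). tens K A B a b) xs) \<subseteq> carrier (tensor K A B)"
    using Cons.prems by (auto intro!: tens_closed A B)
  have eq: "lift_list K U (t # ts) \<beta> = lift K U (\<lambda>(a, b). lift_list K U ts (\<lambda>xs. \<beta> ((a, b) # xs))) t" for t ts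
    by (simp add: split_def)
  have "lift_list K U (map (\<lambda>(a, b). tens K A B a b) (x # xs)) \<beta> =
      lift_list K U (map (\<lambda>(a, b). tens K A B a b) xs) (\<lambda>xs. \<beta> ((a, b) # xs))"
    unfolding list.map eq x(1) prod.case using Cons.prems x(2,3) xs(2)
    by (subst tensor_lift_tens[OF A B lift_list_bilin_Cons]) auto
  also have "\<dots> = \<beta> ((a, b) # xs)"
    using x(2,3) Cons.prems by (intro Cons.IH xs mlin2_Cons) auto
  finally show ?case by (simp add: x)
qed simp

end

section \<open>Splitting letters\<close>

definition blocks :: "('v, 'm) monoid_scheme \<Rightarrow> (nat \<Rightarrow> 'v) \<Rightarrow> nat \<Rightarrow> 'v" where
  "blocks V v c = bprod V v (set_decode c)"

lemma mlin_perm: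
  assumes f: "mlin K A U n f" and \<sigma>: "bij_betw \<sigma> {1..n} {1..n}"
  shows "mlin K A U n (\<lambda>vs. f (map (\<lambda>i. vs ! (\<sigma> i - 1)) [1..<Suc n]))"
  unfolding mlin_def
proof (intro allI impI conjI)
  let ?p = "\<lambda>vs. map (\<lambda>i. vs ! (\<sigma> i - 1)) [1..<Suc n]"
  fix vs assume vs: "length vs = n \<and> set vs \<subseteq> carrier A"
  have \<sigma>n: "\<sigma> i \<in> {1..n}" if "i \<in> {1..n}" for i using \<sigma> that by (auto simp: bij_betw_def)
  have p: "length (?p vs) = n" "set (?p vs) \<subseteq> carrier A"
  proof -
    have "vs ! (\<sigma> i - 1) \<in> carrier A" if "i \<in> {1..n}" for i
    proof -
      have "\<sigma> i - 1 < length vs" using \<sigma>n[OF that] vs by auto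
      then show ?thesis using vs nth_mem by blast
    qed
    then show "set (?p vs) \<subseteq> carrier A" by (auto simp del: upt_Suc)
  qed (simp del: upt_Suc)
  show "f (?p vs) \<in> carrier U" by (rule mlin_closed[OF f p])
  fix i assume i: "i < n"
  \<comment> \<open>Position \<open>i\<close> of the word reappears at position \<open>j - 1\<close>
    of the permuted word, where \<sigma> sends \<open>j\<close> to \<open>Suc i\<close>.\<close>
  then have "Suc i \<in> \<sigma> ` {1..n}" using \<sigma> by (auto simp: bij_betw_def)
  then obtain j where j: "j \<in> {1..n}" "Suc i = \<sigma> j" by auto
  have eq: "?p (vs[i := a]) = (?p vs)[j - 1 := a]" for a
  proof (rule nth_equalityI)
    fix k assume "k < length (?p (vs[i := a]))"
    then have k: "k < n" by (simp del: upt_Suc)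
    then have sk: "\<sigma> (Suc k) \<in> {1..n}" by (intro \<sigma>n) auto
    have "\<sigma> (Suc k) - 1 = i \<longleftrightarrow> Suc k = j"
    proof
      assume "\<sigma> (Suc k) - 1 = i"
      then have e: "\<sigma> (Suc k) = \<sigma> j" using sk j(2) unfolding atLeastAtMost_iff by arith
      have "Suc k \<in> {1..n}" using k by simp
      then show "Suc k = j" by (rule inj_onD[OF bij_betw_imp_inj_on[OF \<sigma>] e _ j(1)])
    qed (use j in auto)
    then show "?p (vs[i := a]) ! k = (?p vs)[j - 1 := a] ! k"
      using k sk vs j by (auto simp: nth_list_update plus_1_eq_Suc simp del: upt_Suc)
  qed (simp del: upt_Suc)
  have "j - 1 < n" using j(1) unfolding atLeastAtMost_iff by arith
  then show "lin K A U (\<lambda>a. f (?p (vs[i := a])))"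
    unfolding eq by (rule mlin_lin[OF f p])
qed

context twisted_over
begin

text \<open>The value of a linear map on a generator is multilinear in the letters, so
  \<open>mlin_eqI\<close> allows the letters to be taken from a determining set.\<close>

lemma FA_eqI_det:
  assumes W: "module K W" and det: "determining K W U S"
    and f: "lin K (FA W) U f" and g: "lin K (FA W) U g"
    and eq: "\<And>X v p. finite X ==> v \<in> X \<rightarrow> S ==> p \<in> elts X ==>
      f (cls W X v p) = g (cls W X v p)"
    and x: "x \<in> carrier (FA W)"
  shows "f x = g x"
proof -
  note S = determiningD(1)[OF det]
  note f' = lin_FA_domD[OF W f] and g' = lin_FA_domD[OF W g]
  have m: "mlin K W U n (\<lambda>vs. h (fock_cls K P W vs p))" if "lin K (fock_space K P W) U h" "p \<in> elts {1..n}" for h n p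
    unfolding mlin_def
  proof (intro allI impI conjI)
    fix vs assume vs: "length vs = n \<and> set vs \<subseteq> carrier W"
    note m = mlin_fock_cls[OF W that(2)]
    show "h (fock_cls K P W vs p) \<in> carrier U"
      using vs by (intro lin_closed[OF that(1)] mlin_closed[OF m]) auto
    show "lin K W U (\<lambda>a. h (fock_cls K P W (vs[i := a]) p))" if "i < n" for i
      using vs that by (intro lin_comp[OF mlin_lin[OF m] \<open>lin K (fock_space K P W) U h\<close>]) auto
  qed
  show ?thesis
  proof (rule fock_eqI_list[OF W f' g'])
    fix vs p assume vp: "(vs, p) \<in> fock_gens P W"
    show "f (fock_cls K P W vs p) = g (fock_cls K P W vs p)"
    proof (rule mlin_eqI[OF m[OF f' gens_obj[OF vp]] m[OF g' gens_obj[OF vp]] det _ refl])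
      fix us assume us: "length us = length vs" "set us \<subseteq> S"
      have u: "(us, p) \<in> fock_gens P W" using us S vp by (auto simp: fock_gens_def)
      have "(\<lambda>i. us ! (i - 1)) \<in> {1..length us} \<rightarrow> S" using us(2) by (auto simp: subset_iff)
      then show "f (fock_cls K P W us p) = g (fock_cls K P W us p)"
        unfolding cls_upto[OF u, symmetric] by (intro eq gens_obj[OF u]) auto
    qed (use vp in \<open>auto simp: fock_gens_def\<close>)
  qed (use x in \<open>simp add: fock_alg_fields\<close>)
qed

lemma bilin_FA_eqI_det:
  assumes W: "module K W" and det: "determining K W U S"
    and f: "bilin K (FA W) (FA W) U f" and g: "bilin K (FA W) (FA W) U g"
    and eq: "\<And>X Y v p q. finite X ==> finite Y ==> X \<inter> Y = {} ==> v \<in> X \<union> Y \<rightarrow> S ==>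
      p \<in> elts X ==> q \<in> elts Y ==>
      f (cls W X v p) (cls W Y v q) = g (cls W X v p) (cls W Y v q)"
    and xy: "x \<in> carrier (FA W)" "y \<in> carrier (FA W)"
  shows "f x y = g x y"
proof (rule FA_eqI_det[OF W det bilin_left[OF f xy(2)] bilin_left[OF g xy(2)] _ xy(1)])
  fix X v p assume X: "finite X" "v \<in> X \<rightarrow> S" "p \<in> elts X"
  then have "v \<in> X \<rightarrow> carrier W" using determiningD(1)[OF det] by auto
  note c = cls_closed[OF W X(1) this X(3)]
  show "f (cls W X v p) y = g (cls W X v p) y"
  proof (rule FA_eqI_det[OF W det bilin_right[OF f c] bilin_right[OF g c] _ xy(2)])
    fix Y w q assume Y: "finite Y" "w \<in> Y \<rightarrow> S" "q \<in> elts Y"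
    obtain Z u r where Z: "finite Z" "Z \<inter> X = {}" "u \<in> (X \<union> Z) \<rightarrow> S" "\<And>x. x \<in> X ==> u x = v x"
      "r \<in> elts Z" and e: "cls W Y w q = cls W Z u r"
      using cls_disjoint[OF W determiningD(1)[OF det] X(1,2) Y] by blast
    have "cls W X v p = cls W X u p" using Z by (intro cls_cong X) auto
    then show "f (cls W X v p) (cls W Y w q) = g (cls W X v p) (cls W Y w q)"
      using eq[OF X(1) Z(1) _ Z(3) X(3) Z(5)] Z(2) by (auto simp: e)
  qed
qed

end

locale contraction_over =
  fixes K :: "('k, 'r) ring_scheme" and P :: "('k, 'p, 'z) double_twisted_scheme"
  assumes cring: "cring K" and tw_bi: "twisted_bialgebra K P"
    and cc: "contraction_coproduct K P" and compat: "contraction_compatible K P"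

sublocale contraction_over \<subseteq> twisted_over K P
  by (rule twisted_over.intro[OF cring tw_bi])

context contraction_over
begin

text \<open>The formula of the second coproduct with arbitrary tensors \<open>ts\<close> in place of
  the coproducts of the letters. The classes themselves serve as indices through \<open>cls\<close>,
  so no numbering of them has to be chosen.\<close>

definition split_gen where
  "split_gen A B ts p = (let n = length ts; T = FF A B in
     finsum T (\<lambda>r. lift K T (\<lambda>(p1, p2). lift_list K T ts (\<lambda>xs.
       tens K (FA A) (FA B)
         (cls A (quo {1..n} r) (blocks A (\<lambda>i. fst (xs ! (i - 1)))) p1)
         (cls B {1..n} (\<lambda>i. snd (xs ! (i - 1))) p2))) (contr P {1..n} r p)) (equivs {1..n}))"

definition fock_split where
  "fock_split A B = lift K (FF A B) (\<lambda>(ts, p). split_gen A B ts p)"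

lemmas cc' = cc[unfolded contraction_coproduct_def]

lemma lin_contr: "finite X ==> r \<in> equivs X ==>
    lin K (obj P X) (PP (quo X r) X) (contr P X r)"
  using cc'[THEN conjunct1] by (simp add: lin_def module_tensor module_obj finite_quo)

lemma contr_natural: "finite X ==> inj_on \<sigma> X ==> r \<in> equivs X ==> p \<in> elts X ==>
    contr P (\<sigma> ` X) (transport \<sigma> r) (arr P X \<sigma> p) =
    tmap K (obj P (quo (\<sigma> ` X) (transport \<sigma> r))) (obj P (\<sigma> ` X))
      (arr P (quo X r) (quo_map \<sigma>)) (arr P X \<sigma>) (contr P X r p)"
  using cc'[THEN conjunct2, THEN conjunct1] by simp

lemma blocks_cong: "finite X ==> r \<in> equivs X ==> (\<And>i. i \<in> X ==> v i = v' i) ==> c \<in> quo X r ==>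
    blocks A v c = blocks A v' c"
  unfolding blocks_def using decode_subset[of X r c] by (intro bprod_cong) auto

context
  fixes A :: "('k, 'a, 'm) module_scheme" and B :: "('k, 'b, 'n) module_scheme"
  assumes A: "comm_alg K A" and B: "module K B"
begin

lemmas mA = module_comm_alg[OF A]

lemma blocks_Pi: "finite X ==> r \<in> equivs X ==> v \<in> X \<rightarrow> carrier A ==>
    blocks A v \<in> quo X r \<rightarrow> carrier A"
  unfolding blocks_def
  by (intro funcsetI bprod_closed[OF A] finite_set_decode decode_nonempty)
     (use decode_subset in fastforce)+

lemma lin_cls_quo: "finite X ==> r \<in> equivs X ==> v \<in> X \<rightarrow> carrier A ==>
    lin K (obj P (quo X r)) (FA A) (cls A (quo X r) (blocks A v))"
  by (intro lin_cls[OF mA] finite_quo blocks_Pi)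

text \<open>The letter \<open>i\<close> enters only the block that contains \<open>i\<close>. There
  the product is linear in it by \<open>lin_bprod\<close>, and the class is linear in that
  block.\<close>

lemma lin_cls_block:
  assumes X: "finite X" and r: "r \<in> equivs X" and v: "v \<in> X \<rightarrow> carrier A" and i: "i \<in> X"
    and q: "q \<in> elts (quo X r)"
  shows "lin K A (FA A) (\<lambda>a. cls A (quo X r) (blocks A (v(i := a))) q)"
proof (rule lin_cong)
  let ?c = "code r i" and ?w = "blocks A v"
  have ic: "i \<in> set_decode ?c" using class_mem[OF X r i] decode_code[OF X r] by simp
  have c: "?c \<in> quo X r" using code_mem[OF X r i] .
  have vc: "v \<in> set_decode ?c \<rightarrow> carrier A" using v decode_subset[OF X r c] by auto
  show "lin K A (FA A) (\<lambda>a. cls A (quo X r) (?w(?c := bprod A (v(i := a)) (set_decode ?c))) q)"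
    by (rule lin_comp[OF lin_bprod[OF A _ ic vc] lin_cls_letter[OF mA finite_quo[OF X] blocks_Pi[OF X r v] c q]]) simp
  fix a
  show "cls A (quo X r) (?w(?c := bprod A (v(i := a)) (set_decode ?c))) q =
      cls A (quo X r) (blocks A (v(i := a))) q"
  proof (rule cls_cong[OF finite_quo[OF X]])
    fix d assume d: "d \<in> quo X r"
    show "(?w(?c := bprod A (v(i := a)) (set_decode ?c))) d = blocks A (v(i := a)) d"
    proof (cases "d = ?c")
      case False
      then have "i \<notin> set_decode d" using code_decode[OF X r d] by auto
      then show ?thesis using False by (auto simp: blocks_def intro!: bprod_cong)
    qed (simp add: blocks_def)
  qed
qed

abbreviation (input) "TAB \<equiv> FF A B"

lemma module_TAB: "module K TAB"
  by (intro module_tensor module_FA mA B)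

text \<open>The splitting at the letters a_i \<otimes> b_i, in a form without expansion of tensors
  and over an arbitrary finite index set.\<close>

definition split_pure where
  "split_pure X a b p = finsum TAB (\<lambda>r. Fmap A B (cls A (quo X r) (blocks A a))
     (cls B X b) (contr P X r p)) (equivs X)"

lemma lin_split_term: "finite X ==> r \<in> equivs X ==> a \<in> X \<rightarrow> carrier A ==> b \<in> X \<rightarrow> carrier B ==>
    lin K (obj P X) TAB (\<lambda>p. Fmap A B (cls A (quo X r) (blocks A a))
     (cls B X b) (contr P X r p))"
  by (intro lin_comp[OF lin_contr lin_tmap] lin_cls_quo lin_cls[OF B])

text \<open>Transport along \<sigma> matches the equivalences on both sides, and axiom (i) of the
  contraction-extraction coproduct matches the terms. The blocks are carried along by
  \<open>quo_map\<close>; their products agree because a product in a commutative algebra does not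
  see the renaming, see \<open>bprod_image\<close>.\<close>

lemma split_pure_natural:
  assumes X: "finite X" and a: "a \<in> X \<rightarrow> carrier A" and b: "b \<in> X \<rightarrow> carrier B"
    and p: "p \<in> elts X" and \<sigma>: "inj_on \<sigma> X"
    and a': "\<And>x. x \<in> X ==> a' (\<sigma> x) = a x" and b': "\<And>x. x \<in> X ==> b' (\<sigma> x) = b x"
  shows "split_pure (\<sigma> ` X) a' b' (arr P X \<sigma> p) = split_pure X a b p"
proof -
  interpret T: module K TAB by (rule module_TAB)
  have a'A: "a' \<in> \<sigma> ` X \<rightarrow> carrier A" "b' \<in> \<sigma> ` X \<rightarrow> carrier B" using a a' b b' by auto
  show ?thesis unfolding split_pure_def
  proof (rule T.finsum_bij[OF bij_transport[OF \<sigma>], symmetric])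
    show "(\<lambda>r. Fmap A B (cls A (quo (\<sigma> ` X) r) (blocks A a')) (cls B (\<sigma> ` X) b')
        (contr P (\<sigma> ` X) r (arr P X \<sigma> p))) \<in> equivs (\<sigma> ` X) \<rightarrow> carrier TAB"
      by (intro funcsetI lin_closed[OF lin_split_term arr_closed[OF X \<sigma> refl p]] finite_imageI X a'A)
    fix r assume r: "r \<in> equivs X"
    note q = quo_map_props[OF X r \<sigma>]
    have t: "contr P X r p \<in> carrier (PP (quo X r) X)"
      by (rule lin_closed[OF lin_contr[OF X r] p])
    have l: "lin K (obj P (quo X r)) (obj P (quo (\<sigma> ` X) (transport \<sigma> r))) (arr P (quo X r) (quo_map \<sigma>))"
      "lin K (obj P X) (obj P (\<sigma> ` X)) (arr P X \<sigma>)"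
      using finite_quo[OF X] q(2,3) X \<sigma> by (auto intro!: lin_arr)
    note c = lin_cls_quo[OF finite_imageI[OF X] transport_equivs[OF \<sigma> r] a'A(1)] lin_cls[OF B finite_imageI[OF X] a'A(2)]
    have n: "cls A (quo (\<sigma> ` X) (transport \<sigma> r)) (blocks A a') (arr P (quo X r) (quo_map \<sigma>) u) =
        cls A (quo X r) (blocks A a) u" if u: "u \<in> elts (quo X r)" for u
      unfolding q(2)
    proof (rule cls_natural[OF mA finite_quo[OF X] q(3) _ blocks_Pi[OF X r a] u])
      fix c assume c: "c \<in> quo X r"
      note s = decode_subset[OF X r c]
      have "bprod A a' (\<sigma> ` set_decode c) = bprod A (\<lambda>i. a' (\<sigma> i)) (set_decode c)"
        using s decode_nonempty[OF X r c] \<sigma> a'A by (intro bprod_image[OF A]) (auto intro: inj_on_subset)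
      also have "\<dots> = bprod A a (set_decode c)" using s a' by (intro bprod_cong) auto
      finally show "blocks A a' (quo_map \<sigma> c) = blocks A a c"
        by (simp add: blocks_def q(1)[OF c])
    qed
    have n': "cls B (\<sigma> ` X) b' (arr P X \<sigma> u) = cls B X b u" if "u \<in> elts X" for u
      by (rule cls_natural[OF B X \<sigma> b' b that])
    show "Fmap A B (cls A (quo X r) (blocks A a)) (cls B X b) (contr P X r p) =
        Fmap A B (cls A (quo (\<sigma> ` X) (transport \<sigma> r)) (blocks A a')) (cls B (\<sigma> ` X) b')
          (contr P (\<sigma> ` X) (transport \<sigma> r) (arr P X \<sigma> p))"
      unfolding contr_natural[OF X \<sigma> r p] tmap_comp[OF l c t]
      by (rule tmap_cong[OF lin_comp[OF l(1) c(1)] lin_comp[OF l(2) c(2)] t n n', symmetric])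
  qed
qed

lemma mlin2_split:
  assumes r: "r \<in> equivs {1..n}" and p1: "p1 \<in> elts (quo {1..n} r)" and p2: "p2 \<in> elts {1..n}"
  shows "mlin2 K A B TAB n (\<lambda>xs. tens K (FA A) (FA B)
    (cls A (quo {1..n} r) (blocks A (\<lambda>i. fst (xs ! (i - 1)))) p1)
    (cls B {1..n} (\<lambda>i. snd (xs ! (i - 1))) p2))"
  unfolding mlin2_def
proof (intro allI impI conjI)
  let ?X = "{1..n}"
  have X: "finite ?X" by simp
  fix xs :: "('a \<times> 'b) list" assume xs: "length xs = n \<and> set xs \<subseteq> carrier A \<times> carrier B"
  let ?a = "\<lambda>i. fst (xs ! (i - 1))" and ?b = "\<lambda>i. snd (xs ! (i - 1))"
  have "xs ! (i - 1) \<in> carrier A \<times> carrier B" if "i \<in> ?X" for i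
  proof -
    have "i - 1 < length xs" using that xs by auto
    then show ?thesis using xs nth_mem by blast
  qed
  then have a: "?a \<in> ?X \<rightarrow> carrier A" and b: "?b \<in> ?X \<rightarrow> carrier B" by (auto simp: mem_Times_iff)
  show "tens K (FA A) (FA B) (cls A (quo ?X r) (blocks A ?a) p1) (cls B ?X ?b p2) \<in> carrier TAB"
    by (intro tens_closed module_FA mA B lin_closed[OF lin_cls_quo] lin_closed[OF lin_cls] X r a b p1 p2)
  fix i assume i: "i < n"
  then have i': "Suc i \<in> ?X" by auto
  have "cls A (quo ?X r) (blocks A (\<lambda>j. fst (xs[i := (x, y)] ! (j - 1)))) p1 =
      cls A (quo ?X r) (blocks A (?a(Suc i := x))) p1" for x y
    using xs i by (intro cls_cong finite_quo blocks_cong[OF X r]) (auto simp: nth_list_update)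
  moreover have "cls B ?X (\<lambda>j. snd (xs[i := (x, y)] ! (j - 1))) p2 =
      cls B ?X (?b(Suc i := y)) p2" for x y
    using xs i by (intro cls_cong) (auto simp: nth_list_update)
  ultimately show "bilin K A B TAB (\<lambda>x y. tens K (FA A) (FA B)
      (cls A (quo ?X r) (blocks A (\<lambda>j. fst (xs[i := (x, y)] ! (j - 1)))) p1)
      (cls B ?X (\<lambda>j. snd (xs[i := (x, y)] ! (j - 1))) p2))"
    by (simp only:) (rule bilin_comp[OF bilin_tens[OF module_FA[OF mA] module_FA[OF B]] lin_cls_block[OF X r a i' p1]
      lin_cls_letter[OF B X b i' p2] lin_id[OF module_TAB]])
qed

lemma bilin_split:
  assumes r: "r \<in> equivs {1..n}" and ts: "length ts = n" "set ts \<subseteq> carrier (tensor K A B)"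
  shows "bilin K (obj P (quo {1..n} r)) (obj P {1..n}) TAB (\<lambda>p1 p2. lift_list K TAB ts (\<lambda>xs.
       tens K (FA A) (FA B)
         (cls A (quo {1..n} r) (blocks A (\<lambda>i. fst (xs ! (i - 1)))) p1)
         (cls B {1..n} (\<lambda>i. snd (xs ! (i - 1))) p2)))"
proof -
  let ?X = "{1..n}"
  have X: "finite ?X" by simp
  have ab: "(\<lambda>i. fst (xs ! (i - 1))) \<in> ?X \<rightarrow> carrier A" "(\<lambda>i. snd (xs ! (i - 1))) \<in> ?X \<rightarrow> carrier B"
    if xs: "length xs = n" "set xs \<subseteq> carrier A \<times> carrier B" for xs :: "('a \<times> 'b) list"
  proof -
    have "xs ! (i - 1) \<in> carrier A \<times> carrier B" if "i \<in> ?X" for i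
    proof -
      have "i - 1 < length xs" using that xs by auto
      then show ?thesis using xs nth_mem by blast
    qed
    then show "(\<lambda>i. fst (xs ! (i - 1))) \<in> ?X \<rightarrow> carrier A" "(\<lambda>i. snd (xs ! (i - 1))) \<in> ?X \<rightarrow> carrier B"
      by (auto simp: mem_Times_iff)
  qed
  have m: "module K (obj P (quo ?X r))" "module K (obj P ?X)" by (auto intro: module_obj finite_quo)
  note mF = module_FA[OF mA] module_FA[OF B]
  show ?thesis
  proof (rule bilinI[OF m module_TAB])
    show "lin K (obj P ?X) TAB (\<lambda>p2. lift_list K TAB ts (\<lambda>xs. tens K (FA A) (FA B)
         (cls A (quo ?X r) (blocks A (\<lambda>i. fst (xs ! (i - 1)))) p1)
         (cls B ?X (\<lambda>i. snd (xs ! (i - 1))) p2)))" if p1: "p1 \<in> elts (quo ?X r)" for p1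
      by (rule lin_lift_list_param[OF mA B module_TAB m(2) ts mlin2_split[OF r p1]], assumption,
          rule lin_comp[OF lin_cls[OF B X ab(2)] lin_tens_right[OF mF lin_closed[OF lin_cls_quo[OF X r ab(1)] p1]]])
    show "lin K (obj P (quo ?X r)) TAB (\<lambda>p1. lift_list K TAB ts (\<lambda>xs. tens K (FA A) (FA B)
         (cls A (quo ?X r) (blocks A (\<lambda>i. fst (xs ! (i - 1)))) p1)
         (cls B ?X (\<lambda>i. snd (xs ! (i - 1))) p2)))" if p2: "p2 \<in> elts ?X" for p2
      by (rule lin_lift_list_param[OF mA B module_TAB m(1) ts mlin2_split[OF r _ p2]], assumption,
          rule lin_comp[OF lin_cls_quo[OF X r ab(1)] lin_tens_left[OF mF lin_closed[OF lin_cls[OF B X ab(2)] p2]]])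
  qed
qed

lemma mlin_split_gen:
  assumes p: "p \<in> elts {1..n}"
  shows "mlin K (tensor K A B) TAB n (\<lambda>ts. split_gen A B ts p)"
  unfolding mlin_def
proof (intro allI impI conjI)
  let ?X = "{1..n}"
  have X: "finite ?X" by simp
  interpret T: module K TAB by (rule module_TAB)
  have m: "module K (obj P (quo ?X r))" "module K (obj P ?X)" for r by (auto intro: module_obj finite_quo)
  have t: "contr P ?X r p \<in> carrier (PP (quo ?X r) ?X)" if "r \<in> equivs ?X" for r
    by (rule lin_closed[OF lin_contr[OF X that] p])
  fix ts :: "('k, 'a, 'b) tensor list" assume ts: "length ts = n \<and> set ts \<subseteq> carrier (tensor K A B)"
  note ts1 = ts[THEN conjunct1] and ts2 = ts[THEN conjunct2]
  show "split_gen A B ts p \<in> carrier TAB"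
    unfolding split_gen_def Let_def ts1
    by (rule T.finsum_closed, rule funcsetI) (rule lin_closed[OF lin_tensor_lift[OF m bilin_split[OF _ ts1 ts2]] t])
  fix i assume i: "i < n"
  have u: "length (ts[i := a]) = n" "set (ts[i := a]) \<subseteq> carrier (tensor K A B)" if "a \<in> carrier (tensor K A B)" for a
    using ts that set_update_subset_insert[of ts i a] by auto
  have l: "length (ts[i := a]) = n" for a using ts by simp
  show "lin K (tensor K A B) TAB (\<lambda>a. split_gen A B (ts[i := a]) p)"
    unfolding split_gen_def Let_def l
    by (intro lin_sum module_tensor[OF mA B] T.module_axioms lin_tensor_lift_param[OF m module_tensor[OF mA B] _ _ t]
        bilin_split u mlin_lin[OF mlin_lift_list[OF mA B T.module_axioms mlin2_split] _ _ i])
       (use ts in auto)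
qed

lemma lin_split_gen:
  assumes "set ts \<subseteq> carrier (tensor K A B)"
  shows "lin K (obj P {1..length ts}) TAB (split_gen A B ts)"
proof -
  have m: "module K (obj P (quo {1..length ts} r))" "module K (obj P {1..length ts})" for r
    by (auto intro: module_obj finite_quo)
  show ?thesis
    unfolding split_gen_def[abs_def] Let_def
    by (intro lin_sum m module_TAB lin_comp[OF lin_contr lin_tensor_lift[OF m bilin_split]])
       (use assms in auto)
qed

text \<open>On pure tensors the nested expansion collapses by \<open>lift_list_tens\<close>, which
  leaves a bilinear expression in the two tensor factors of the structure, that is, a
  \<open>tmap\<close>.\<close>

lemma split_gen_pure:
  assumes p: "p \<in> carrier (obj P {1..length xs})" and xs: "set xs \<subseteq> carrier A \<times> carrier B"
  shows "split_gen A B (map (\<lambda>(a, b). tens K A B a b) xs) p =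
    split_pure {1..length xs} (\<lambda>i. fst (xs ! (i - 1))) (\<lambda>i. snd (xs ! (i - 1))) p"
proof -
  let ?n = "length xs" let ?X = "{1..?n}" let ?ts = "map (\<lambda>(a, b). tens K A B a b) xs"
  have X: "finite ?X" by simp
  interpret T: module K TAB by (rule module_TAB)
  have m: "module K (obj P (quo ?X r))" "module K (obj P ?X)" for r by (auto intro: module_obj finite_quo)
  have ts: "length ?ts = ?n" "set ?ts \<subseteq> carrier (tensor K A B)"
    using xs by (auto intro!: tens_closed mA B)
  have "xs ! (i - 1) \<in> carrier A \<times> carrier B" if "i \<in> ?X" for i
  proof -
    have "i - 1 < length xs" using that by auto
    then show ?thesis using xs nth_mem by blast
  qed
  then have a: "(\<lambda>i. fst (xs ! (i - 1))) \<in> ?X \<rightarrow> carrier A" and b: "(\<lambda>i. snd (xs ! (i - 1))) \<in> ?X \<rightarrow> carrier B"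
    by (auto simp: mem_Times_iff)
  show ?thesis
    unfolding split_gen_def split_pure_def Let_def ts(1)
  proof (rule T.finsum_cong')
    fix r assume r: "r \<in> equivs ?X"
    have t: "contr P ?X r p \<in> carrier (PP (quo ?X r) ?X)"
      by (rule lin_closed[OF lin_contr[OF X r] p])
    note c = lin_cls_quo[OF X r a] lin_cls[OF B X b]
    show "lift K TAB (\<lambda>(p1, p2). lift_list K TAB ?ts (\<lambda>xs. tens K (FA A) (FA B)
         (cls A (quo ?X r) (blocks A (\<lambda>i. fst (xs ! (i - 1)))) p1)
         (cls B ?X (\<lambda>i. snd (xs ! (i - 1))) p2))) (contr P ?X r p) =
      Fmap A B (cls A (quo ?X r) (blocks A (\<lambda>i. fst (xs ! (i - 1)))))
        (cls B ?X (\<lambda>i. snd (xs ! (i - 1)))) (contr P ?X r p)"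
      by (rule tensor_eqI[OF m lin_tensor_lift[OF m bilin_split[OF r ts]] lin_tmap[OF c] _ t])
         (simp add: tensor_lift_tens[OF m bilin_split[OF r ts]] tmap_tens[OF c]
           lift_list_tens[OF mA B T.module_axioms mlin2_split[OF r] xs])
  qed (auto intro!: lin_closed[OF lin_split_term] a b p)
qed

abbreviation (input) "pure_tensors \<equiv> (\<lambda>(a, b). tens K A B a b) ` (carrier A \<times> carrier B)"

lemma determining_pure: "determining K (tensor K A B) U pure_tensors"
  unfolding determining_def
proof (intro conjI allI impI ballI)
  show "pure_tensors \<subseteq> carrier (tensor K A B)" by (auto intro!: tens_closed mA B)
  show "h t = h' t" if "lin K (tensor K A B) U h" "lin K (tensor K A B) U h'" "\<forall>s\<in>pure_tensors. h s = h' s"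
    "t \<in> carrier (tensor K A B)" for h h' t
    by (rule tensor_eqI[OF mA B that(1,2) _ that(4)]) (use that(3) in auto)
qed

text \<open>Both sides are multilinear in the word, so the letters may be taken to be pure tensors,
  where the claim is naturality of \<open>split_pure\<close>. Since \<open>split_gen\<close> is a
  formula on words whose letters are general tensors, the splitting is obtained from
  \<open>fock_lift_list\<close> and not from a compatible family.\<close>

lemma split_gen_perm:
  assumes g: "(ts, p) \<in> fock_gens P (tensor K A B)" and \<sigma>: "bij_betw \<sigma> {1..length ts} {1..length ts}"
  shows "split_gen A B ts (arr P {1..length ts} \<sigma> p) =
    split_gen A B (map (\<lambda>i. ts ! (\<sigma> i - 1)) [1..<Suc (length ts)]) p"
proof -
  let ?n = "length ts" let ?X = "{1..?n}"
  have X: "finite ?X" by simp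
  have im: "\<sigma> ` ?X = ?X" and inj: "inj_on \<sigma> ?X" using \<sigma> by (auto simp: bij_betw_def)
  note p = gens_obj[OF g]
  have \<sigma>p: "arr P ?X \<sigma> p \<in> elts ?X" by (rule arr_closed[OF X inj im[symmetric] p])
  show ?thesis
  proof (rule mlin_eqI[OF mlin_split_gen[OF \<sigma>p] mlin_perm[OF mlin_split_gen[OF p] \<sigma>] determining_pure _ refl])
    fix us assume us: "length us = ?n" "set us \<subseteq> pure_tensors"
    then have "us \<in> lists pure_tensors" by auto
    then obtain xs where xs: "us = map (\<lambda>(a, b). tens K A B a b) xs" "set xs \<subseteq> carrier A \<times> carrier B"
      unfolding lists_image by auto
    have n: "length xs = ?n" using us xs by simp
    let ?ys = "map (\<lambda>i. xs ! (\<sigma> i - 1)) [1..<Suc ?n]"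
    have \<sigma>n: "\<sigma> i - 1 < length xs" "1 \<le> \<sigma> i" if "i \<in> ?X" for i
    proof -
      have "\<sigma> i \<in> ?X" using im that by blast
      then show "\<sigma> i - 1 < length xs" "1 \<le> \<sigma> i" using n by auto
    qed
    have x\<sigma>: "xs ! (\<sigma> i - 1) \<in> carrier A \<times> carrier B" if "i \<in> ?X" for i
      using nth_mem[OF \<sigma>n(1)[OF that]] xs(2) by (rule rev_subsetD)
    have ys: "set ?ys \<subseteq> carrier A \<times> carrier B" "length ?ys = ?n"
    proof -
      show "set ?ys \<subseteq> carrier A \<times> carrier B"
        unfolding set_map by (rule image_subsetI, rule x\<sigma>) (simp del: upt_Suc)
    qed (simp del: upt_Suc)
    have py: "map (\<lambda>i. us ! (\<sigma> i - 1)) [1..<Suc ?n] = map (\<lambda>(a, b). tens K A B a b) ?ys"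
      using \<sigma>n(1) by (auto simp: xs(1) simp del: upt_Suc)
    have yn: "?ys ! (i - 1) = xs ! (\<sigma> i - 1)" if "i \<in> ?X" for i
      using that by (auto simp del: upt_Suc)
    have "?ys ! (i - 1) \<in> carrier A \<times> carrier B" if "i \<in> ?X" for i
      unfolding yn[OF that] by (rule x\<sigma>[OF that])
    then have a: "(\<lambda>i. fst (?ys ! (i - 1))) \<in> ?X \<rightarrow> carrier A" and b: "(\<lambda>i. snd (?ys ! (i - 1))) \<in> ?X \<rightarrow> carrier B"
      by (auto simp: mem_Times_iff simp del: upt_Suc)
    have "split_gen A B us (arr P ?X \<sigma> p) =
        split_pure ?X (\<lambda>i. fst (xs ! (i - 1))) (\<lambda>i. snd (xs ! (i - 1))) (arr P ?X \<sigma> p)"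
      unfolding xs(1) n[symmetric] using \<sigma>p xs(2) by (intro split_gen_pure) (simp_all add: n)
    also have "\<dots> = split_pure ?X (\<lambda>i. fst (?ys ! (i - 1))) (\<lambda>i. snd (?ys ! (i - 1))) p"
      using split_pure_natural[OF X a b p inj, of "\<lambda>i. fst (xs ! (i - 1))" "\<lambda>i. snd (xs ! (i - 1))"] yn
      unfolding im by (simp del: upt_Suc)
    also have "\<dots> = split_gen A B (map (\<lambda>i. us ! (\<sigma> i - 1)) [1..<Suc ?n]) p"
      unfolding py using split_gen_pure[of p ?ys] p ys by (simp only:)
    finally show "split_gen A B us (arr P ?X \<sigma> p) =
      split_gen A B (map (\<lambda>i. us ! (\<sigma> i - 1)) [1..<Suc ?n]) p" .
  qed (use g in \<open>auto simp: fock_gens_def\<close>)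
qed

lemma lin_split: "lin K (FA (tensor K A B)) TAB (fock_split A B)"
  unfolding fock_split_def
  by (rule lin_FA_dom[OF module_tensor[OF mA B] fock_lift_list(1)[where \<beta> = "split_gen A B", OF module_tensor[OF mA B] module_TAB
        mlin_split_gen lin_split_gen split_gen_perm]])

lemma split_gens: "(ts, p) \<in> fock_gens P (tensor K A B) ==>
    fock_split A B (fock_cls K P (tensor K A B) ts p) = split_gen A B ts p"
  unfolding fock_split_def
  by (rule fock_lift_list(2)[where \<beta> = "split_gen A B", OF module_tensor[OF mA B] module_TAB
        mlin_split_gen lin_split_gen split_gen_perm])

lemma split_cls:
  assumes X: "finite X" and a: "a \<in> X \<rightarrow> carrier A" and b: "b \<in> X \<rightarrow> carrier B" and p: "p \<in> elts X"
  shows "fock_split A B (cls (tensor K A B) X (\<lambda>i. tens K A B (a i) (b i)) p) =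
    finsum TAB (\<lambda>r. Fmap A B (cls A (quo X r) (blocks A a))
     (cls B X b) (contr P X r p)) (equivs X)"
proof -
  let ?l = "sorted_list_of_set X" let ?xs = "map (\<lambda>i. (a i, b i)) ?l"
  have w: "(\<lambda>i. tens K A B (a i) (b i)) \<in> X \<rightarrow> carrier (tensor K A B)"
    using a b by (auto intro!: tens_closed mA B)
  have xs: "set ?xs \<subseteq> carrier A \<times> carrier B" "length ?xs = card X" using a b X by auto
  have r: "inj_on (rank_in X) X" "rank_in X ` X = {1..card X}"
    using rank_in_bij[OF X] by (auto simp: bij_betw_def)
  have q: "arr P X (rank_in X) p \<in> carrier (obj P {1..length ?xs})"
    using arr_closed[OF X r(1) r(2)[symmetric] p] xs(2) by simp
  have n: "?xs ! (rank_in X x - 1) = (a x, b x)" if x: "x \<in> X" for x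
  proof -
    have "rank_in X x - 1 < card X" using nth_rank_in(2,3)[OF X x] by simp
    then show ?thesis using nth_rank_in(1)[OF X x] by simp
  qed
  have "fock_split A B (cls (tensor K A B) X (\<lambda>i. tens K A B (a i) (b i)) p) =
      split_gen A B (map (\<lambda>(a, b). tens K A B a b) ?xs) (arr P X (rank_in X) p)"
    unfolding cls_def split_gens[OF cls_gens[OF X w p]] by (simp add: comp_def)
  also have "\<dots> = split_pure (rank_in X ` X) (\<lambda>i. fst (?xs ! (i - 1))) (\<lambda>i. snd (?xs ! (i - 1)))
      (arr P X (rank_in X) p)"
    unfolding split_gen_pure[OF q xs(1)] r(2) xs(2) ..
  also have "\<dots> = split_pure X a b p"
    using n by (intro split_pure_natural X a b p r) simp_all
  finally show ?thesis unfolding split_pure_def .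
qed

end

end

section \<open>Scalars, axioms of the contraction and the second counit\<close>

context twisted_over
begin

text \<open>Scalars are taken out letter by letter; \<open>S\<close> is the set of letters that
  already carry theirs. Evaluating a counit on one half of each letter a_i \<otimes> b_i produces
  such scalars.\<close>

lemma cls_scale:
  assumes V: "module K V" and X: "finite X" and v: "v \<in> X \<rightarrow> carrier V" and p: "p \<in> elts X"
    and c: "c \<in> X \<rightarrow> carrier K"
  shows "cls V X (\<lambda>i. c i \<odot>\<^bsub>V\<^esub> v i) p = finprod K c X \<odot>\<^bsub>FA V\<^esub> cls V X v p"
proof -
  interpret V: module K V by (rule V)
  interpret F: module K "FA V" by (rule module_FA[OF V])
  have cl: "cls V X v p \<in> carrier (FA V)" by (rule cls_closed[OF V X v p])
  have "cls V X (\<lambda>i. if i \<in> S then c i \<odot>\<^bsub>V\<^esub> v i else v i) p = finprod K c S \<odot>\<^bsub>FA V\<^esub> cls V X v p"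
    if "S \<subseteq> X" for S
    using finite_subset[OF that X] that
  proof (induction S rule: finite_induct)
    case empty
    then show ?case using cl by simp
  next
    case (insert s S)
    let ?w = "\<lambda>i. if i \<in> S then c i \<odot>\<^bsub>V\<^esub> v i else v i"
    have w: "?w \<in> X \<rightarrow> carrier V" using v c by (auto simp: Pi_iff)
    have s: "s \<in> X" "c s \<in> carrier K" "v s \<in> carrier V" and cS: "c \<in> S \<rightarrow> carrier K"
      using insert v c by auto
    have "cls V X (\<lambda>i. if i \<in> insert s S then c i \<odot>\<^bsub>V\<^esub> v i else v i) p =
        cls V X (?w(s := c s \<odot>\<^bsub>V\<^esub> v s)) p"
      using insert by (intro cls_cong X) auto
    also have "\<dots> = c s \<odot>\<^bsub>FA V\<^esub> cls V X (?w(s := v s)) p"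
      by (rule lin_smult[OF lin_cls_letter[OF V X w s(1) p] s(2,3)])
    also have "?w(s := v s) = ?w" using insert(2) by (auto simp: fun_eq_iff)
    also have "cls V X ?w p = finprod K c S \<odot>\<^bsub>FA V\<^esub> cls V X v p" using insert by auto
    also have "c s \<odot>\<^bsub>FA V\<^esub> (finprod K c S \<odot>\<^bsub>FA V\<^esub> cls V X v p) =
        finprod K c (insert s S) \<odot>\<^bsub>FA V\<^esub> cls V X v p"
      using insert(1,2) s cS cl by (simp add: F.smult_assoc1)
    finally show ?case .
  qed
  moreover have "cls V X (\<lambda>i. if i \<in> X then c i \<odot>\<^bsub>V\<^esub> v i else v i) p = cls V X (\<lambda>i. c i \<odot>\<^bsub>V\<^esub> v i) p"
    by (rule cls_cong[OF X]) simp
  ultimately show ?thesis by simp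
qed

end

context contraction_over
begin

text \<open>The second counit for an arbitrary linear form \<open>e\<close> on the letters. Keeping
  \<open>e\<close> variable allows it to be composed with maps of letters; the counit of
  \<open>fock\<close> is the case of the counit of \<open>V\<close>.\<close>

definition fock_eps2 where
  "fock_eps2 e = lift K (self_module K)
     (\<lambda>(vs, p). foldr (\<lambda>v c. e v \<otimes>\<^bsub>K\<^esub> c) vs (contr_counit P {1..length vs} p))"

lemma contr_closed: "finite X ==> r \<in> equivs X ==> p \<in> elts X ==>
    contr P X r p \<in> carrier (PP (quo X r) X)"
  by (rule lin_closed[OF lin_contr])

lemma lin_contr_counit: "finite X ==> lin K (obj P X) (self_module K) (contr_counit P X)"
  using cc'[THEN conjunct2, THEN conjunct2, THEN conjunct2, THEN conjunct1]
  by (simp add: lin_def module_obj module_self K_cring)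

lemma contr_counit_natural: "finite X ==> inj_on \<sigma> X ==> p \<in> elts X ==>
    contr_counit P (\<sigma> ` X) (arr P X \<sigma> p) = contr_counit P X p"
  using cc'[THEN conjunct2, THEN conjunct2, THEN conjunct2, THEN conjunct2, THEN conjunct1] by simp

lemma contr_counit_right: "finite X ==> r \<in> equivs X ==> p \<in> elts X ==>
    eval_right K (obj P (quo X r)) (contr_counit P X) (contr P X r p) =
    (if r = Id_on X then arr P X (\<lambda>x. set_encode {x}) p else \<zero>\<^bsub>obj P (quo X r)\<^esub>)"
  using cc'[THEN conjunct2, THEN conjunct2, THEN conjunct2, THEN conjunct2, THEN conjunct2, THEN conjunct1] by simp

lemma contr_counit_left: "finite X ==> p \<in> elts X ==>
    finsum (obj P X) (\<lambda>r. eval_left K (obj P X) (contr_counit P (quo X r)) (contr P X r p)) (equivs X) = p"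
  using cc'[THEN conjunct2, THEN conjunct2, THEN conjunct2, THEN conjunct2, THEN conjunct2, THEN conjunct2] by simp

lemma contr_one: "contr P {} {} (tw_one P) = tens K (obj P {}) (obj P {}) (tw_one P) (tw_one P)"
  and contr_tw_counit: "p \<in> elts {} ==>
    eval_left K (obj P {}) (tw_counit P) (contr P {} {} p) = tw_counit P p \<odot>\<^bsub>obj P {}\<^esub> tw_one P"
  using compat[unfolded contraction_compatible_def, THEN conjunct2] by simp_all

lemma contr_mul:
  assumes "finite X" "finite Y" "X \<inter> Y = {}" "r \<in> equivs X" "s \<in> equivs Y"
    "t \<in> carrier (PP X Y)"
  shows "contr P (X \<union> Y) (r \<union> s) (tw_mult P X Y t) =
    tmap K (obj P (quo (X \<union> Y) (r \<union> s))) (obj P (X \<union> Y))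
      (tw_mult P (quo X r) (quo Y s)) (tw_mult P X Y)
      (tswap K (obj P (quo X r)) (obj P X) (obj P (quo Y s)) (obj P Y)
        (tmap K (PP (quo X r) X) (PP (quo Y s) Y)
          (contr P X r) (contr P Y s) t))"
proof -
  note u = equivs_Un[OF assms(4,5,3)]
  show ?thesis
    using compat[unfolded contraction_compatible_def Let_def, THEN conjunct1, rule_format, OF _ u(1), unfolded u(2,3),
        THEN conjunct1] assms by simp
qed

lemma contr_mul_zero:
  assumes "finite X" "finite Y" "X \<inter> Y = {}" "r \<in> equivs (X \<union> Y)"
    "r \<noteq> r \<inter> X \<times> X \<union> r \<inter> Y \<times> Y" "t \<in> carrier (PP X Y)"
  shows "contr P (X \<union> Y) r (tw_mult P X Y t) = \<zero>\<^bsub>PP (quo (X \<union> Y) r) (X \<union> Y)\<^esub>"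
  using compat[unfolded contraction_compatible_def Let_def, THEN conjunct1, rule_format, OF _ assms(4), THEN conjunct1]
    assms by simp

lemma contr_comul:
  assumes "finite X" "finite Y" "X \<inter> Y = {}" "r \<in> equivs X" "s \<in> equivs Y" "p \<in> elts (X \<union> Y)"
  shows "tmap K (PP (quo X r) (quo Y s)) (obj P (X \<union> Y))
      (tw_comult P (quo X r) (quo Y s)) id (contr P (X \<union> Y) (r \<union> s) p) =
    m1324 K (obj P (quo X r)) (obj P X) (obj P (quo Y s)) (obj P Y) (obj P (X \<union> Y))
      (tw_mult P X Y)
      (tmap K (PP (quo X r) X) (PP (quo Y s) Y)
        (contr P X r) (contr P Y s) (tw_comult P X Y p))"
proof -
  note u = equivs_Un[OF assms(4,5,3)]
  show ?thesis
    using compat[unfolded contraction_compatible_def Let_def, THEN conjunct1, rule_format, OF _ u(1), unfolded u(2,3),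
        THEN conjunct2] assms by simp
qed

context
  fixes V :: "('k, 'v, 'm) module_scheme" and e
  assumes e: "lin K V (self_module K) e"
begin

interpretation K: cring K by (rule K_cring)

text \<open>The definition folds the scalars along the word; as a \<open>finprod\<close> over the
  index set their product is visibly independent of the order of the letters, which is the
  naturality required of a compatible family.\<close>

lemma eps2_hyps:
  "fock_compatible V (self_module K) (\<lambda>X v p. finprod K (\<lambda>i. e (v i)) X \<otimes>\<^bsub>K\<^esub> contr_counit P X p)"
  "(vs, p) \<in> fock_gens P V ==> foldr (\<lambda>v c. e v \<otimes>\<^bsub>K\<^esub> c) vs (contr_counit P {1..length vs} p) =
    finprod K (\<lambda>i. e (vs ! (i - 1))) {1..length vs} \<otimes>\<^bsub>K\<^esub> contr_counit P {1..length vs} p"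
proof -
  note V = lin_dom[OF e] and S = module_self[OF K_cring]
  have ec: "e v \<in> carrier K" if "v \<in> carrier V" for v using lin_closed[OF e that] by simp
  have c: "contr_counit P X p \<in> carrier K" if "finite X" "p \<in> elts X" for X p
    using lin_closed[OF lin_contr_counit[OF that(1)] that(2)] by simp
  have pc: "finprod K (\<lambda>i. e (v i)) X \<in> carrier K" if "v \<in> X \<rightarrow> carrier V" for v X
    using that ec by (intro K.finprod_closed) auto
  show "fock_compatible V (self_module K) (\<lambda>X v p. finprod K (\<lambda>i. e (v i)) X \<otimes>\<^bsub>K\<^esub> contr_counit P X p)"
  proof (rule fock_compatibleI[OF V S])
    show "lin K (obj P X) (self_module K) (\<lambda>p. finprod K (\<lambda>i. e (v i)) X \<otimes>\<^bsub>K\<^esub> contr_counit P X p)"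
      if "finite X" "v \<in> X \<rightarrow> carrier V" for X v
      using lin_scale[OF lin_contr_counit[OF that(1)] pc[OF that(2)]] by simp
    fix X v p assume X: "finite X" "v \<in> X \<rightarrow> carrier V" "p \<in> elts X"
    {
      fix i assume i: "i \<in> X"
      let ?d = "finprod K (\<lambda>j. e (v j)) (X - {i}) \<otimes>\<^bsub>K\<^esub> contr_counit P X p"
      have v': "v \<in> X - {i} \<rightarrow> carrier V" using X by auto
      have "lin K V (self_module K) (\<lambda>a. e a \<otimes>\<^bsub>K\<^esub> ?d)"
        using lin_scale_right[OF e S, of ?d] c[OF X(1,3)] pc[OF v'] by simp
      then show "lin K V (self_module K) (\<lambda>a. finprod K (\<lambda>j. e ((v(i := a)) j)) X \<otimes>\<^bsub>K\<^esub> contr_counit P X p)"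
      proof (rule lin_cong)
        fix a assume a: "a \<in> carrier V"
        have "finprod K (\<lambda>j. e ((v(i := a)) j)) (insert i (X - {i})) =
            e ((v(i := a)) i) \<otimes>\<^bsub>K\<^esub> finprod K (\<lambda>j. e ((v(i := a)) j)) (X - {i})"
          using X v' a ec by (intro K.finprod_insert) (auto simp: Pi_iff)
        also have "finprod K (\<lambda>j. e ((v(i := a)) j)) (X - {i}) = finprod K (\<lambda>j. e (v j)) (X - {i})"
          using X ec by (intro K.finprod_cong') auto
        finally show "e a \<otimes>\<^bsub>K\<^esub> ?d = finprod K (\<lambda>j. e ((v(i := a)) j)) X \<otimes>\<^bsub>K\<^esub> contr_counit P X p"
          using i a ec c[OF X(1,3)] pc[OF v'] by (simp add: insert_absorb K.m_assoc)
      qed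
    next
      fix v' and \<sigma> :: "nat \<Rightarrow> nat" assume \<sigma>: "inj_on \<sigma> X" and v': "\<And>x. x \<in> X ==> v' (\<sigma> x) = v x"
      have "finprod K (\<lambda>i. e (v' i)) (\<sigma> ` X) = finprod K (\<lambda>i. e (v' (\<sigma> i))) X"
        using X ec v' \<sigma> by (intro K.finprod_reindex) (auto simp: Pi_iff)
      also have "\<dots> = finprod K (\<lambda>i. e (v i)) X"
        using X ec v' by (intro K.finprod_cong') (auto simp: Pi_iff)
      finally show "finprod K (\<lambda>i. e (v' i)) (\<sigma> ` X) \<otimes>\<^bsub>K\<^esub> contr_counit P (\<sigma> ` X) (arr P X \<sigma> p) =
          finprod K (\<lambda>i. e (v i)) X \<otimes>\<^bsub>K\<^esub> contr_counit P X p"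
        using contr_counit_natural[OF X(1) \<sigma> X(3)] by simp
    }
  qed
  have "foldr (\<lambda>v c. e v \<otimes>\<^bsub>K\<^esub> c) vs d = finprod K (\<lambda>i. e (vs ! (i - 1))) {1..length vs} \<otimes>\<^bsub>K\<^esub> d"
    if "set vs \<subseteq> carrier V" "d \<in> carrier K" for vs d
    using that
  \<comment> \<open>Adding letters at the right end leaves the indices of the earlier letters
    unchanged, and the index set grows by its last element.\<close>
  proof (induction vs arbitrary: d rule: rev_induct)
    case (snoc x xs)
    have xs: "e (xs ! (i - 1)) \<in> carrier K" if "i \<in> {1..length xs}" for i
    proof -
      have "i - 1 < length xs" using that unfolding atLeastAtMost_iff by arith
      then show ?thesis using snoc.prems(1) nth_mem by (intro ec) auto
    qed
    have ins: "{1..length (xs @ [x])} = insert (Suc (length xs)) {1..length xs}" by auto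
    have "finprod K (\<lambda>i. e ((xs @ [x]) ! (i - 1))) {1..length xs} = finprod K (\<lambda>i. e (xs ! (i - 1))) {1..length xs}"
    proof (rule K.finprod_cong')
      fix i assume "i \<in> {1..length xs}"
      then have "i - 1 < length xs" unfolding atLeastAtMost_iff by arith
      then show "e ((xs @ [x]) ! (i - 1)) = e (xs ! (i - 1))" by (simp add: nth_append)
    qed (use xs in auto)
    moreover have "(\<lambda>i. e ((xs @ [x]) ! (i - 1))) \<in> {1..length xs} \<rightarrow> carrier K"
    proof
      fix i assume i: "i \<in> {1..length xs}"
      then have "i - 1 < length xs" unfolding atLeastAtMost_iff by arith
      then show "e ((xs @ [x]) ! (i - 1)) \<in> carrier K" using xs[OF i] by (simp add: nth_append)
    qed
    ultimately have "finprod K (\<lambda>i. e ((xs @ [x]) ! (i - 1))) {1..length (xs @ [x])} =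
        e x \<otimes>\<^bsub>K\<^esub> finprod K (\<lambda>i. e (xs ! (i - 1))) {1..length xs}"
      unfolding ins using snoc.prems ec by (subst K.finprod_insert) auto
    moreover have "finprod K (\<lambda>i. e (xs ! (i - 1))) {1..length xs} \<in> carrier K"
      using xs by (intro K.finprod_closed) auto
    ultimately show ?case
      using snoc ec by (simp add: K.m_ac)
  qed simp
  then show "(vs, p) \<in> fock_gens P V ==> foldr (\<lambda>v c. e v \<otimes>\<^bsub>K\<^esub> c) vs (contr_counit P {1..length vs} p) =
      finprod K (\<lambda>i. e (vs ! (i - 1))) {1..length vs} \<otimes>\<^bsub>K\<^esub> contr_counit P {1..length vs} p"
    using c by (auto simp: fock_gens_def)
qed

lemma lin_eps2: "lin K (FA V) (self_module K) (fock_eps2 e)"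
  unfolding fock_eps2_def by (rule lin_FA_dom[OF lin_dom[OF e] lin_fock_space_lift[OF lin_dom[OF e] eps2_hyps]])

lemma eps2_gens: "(vs, p) \<in> fock_gens P V ==> fock_eps2 e (fock_cls K P V vs p) =
    foldr (\<lambda>v c. e v \<otimes>\<^bsub>K\<^esub> c) vs (contr_counit P {1..length vs} p)"
  unfolding fock_eps2_def by (rule fock_lift_gens[OF lin_dom[OF e] eps2_hyps])

lemma eps2_cls: "finite X ==> v \<in> X \<rightarrow> carrier V ==> p \<in> elts X ==>
    fock_eps2 e (cls V X v p) = finprod K (\<lambda>i. e (v i)) X \<otimes>\<^bsub>K\<^esub> contr_counit P X p"
  unfolding fock_eps2_def by (rule fock_lift_cls[OF lin_dom[OF e] eps2_hyps])

end

lemma eps2_natural: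
  assumes f: "lin K V W f" and e: "lin K W (self_module K) e" and x: "x \<in> carrier (FA V)"
  shows "fock_eps2 e (fock_lin W f x) = fock_eps2 (\<lambda>v. e (f v)) x"
proof -
  note ef = lin_comp[OF f e]
  show ?thesis
  proof (rule FA_eqI[OF lin_dom[OF f] lin_comp[OF lin_fock_lin[OF f] lin_eps2[OF e]] lin_eps2[OF ef] _ x])
    fix X v p assume X: "finite X" "v \<in> X \<rightarrow> carrier V" "p \<in> elts X"
    then have "(\<lambda>i. f (v i)) \<in> X \<rightarrow> carrier W" using lin_closed[OF f] by auto
    then show "fock_eps2 e (fock_lin W f (cls V X v p)) = fock_eps2 (\<lambda>v. e (f v)) (cls V X v p)"
      using X by (simp add: fock_lin_cls[OF f] eps2_cls[OF e] eps2_cls[OF ef])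
  qed
qed

lemma eps2_cong:
  assumes e: "lin K V (self_module K) e" and "\<And>v. v \<in> carrier V ==> e v = e' v" and x: "x \<in> carrier (FA V)"
  shows "fock_eps2 e x = fock_eps2 e' x"
proof -
  interpret K: cring K by (rule K_cring)
  have e': "lin K V (self_module K) e'" by (rule lin_cong[OF assms(1,2)])
  show ?thesis
  proof (rule FA_eqI[OF lin_dom[OF e] lin_eps2[OF e] lin_eps2[OF e'] _ x])
    fix X v p assume X: "finite X" "v \<in> X \<rightarrow> carrier V" "p \<in> elts X"
    have "finprod K (\<lambda>i. e (v i)) X = finprod K (\<lambda>i. e' (v i)) X"
      using X assms(2) lin_closed[OF e'] by (intro K.finprod_cong') auto
    then show "fock_eps2 e (cls V X v p) = fock_eps2 e' (cls V X v p)"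
      by (simp add: eps2_cls[OF e X] eps2_cls[OF e' X])
  qed
qed

section \<open>Naturality, counits and multiplicativity of the splitting\<close>

context
  fixes A :: "('k, 'a, 'm) module_scheme" and B :: "('k, 'b, 'n) module_scheme"
  assumes A: "comm_alg K A" and B: "module K B"
begin

interpretation T: module K "FF A B" by (rule module_TAB[OF A B])

lemma mA': "module K A" by (rule module_comm_alg[OF A])

lemma pure_letters:
  assumes "v \<in> X \<rightarrow> (\<lambda>(a, b). tens K A B a b) ` (carrier A \<times> carrier B)"
  obtains a b where "a \<in> X \<rightarrow> carrier A" "b \<in> X \<rightarrow> carrier B" "\<And>i. i \<in> X ==> v i = tens K A B (a i) (b i)"
proof -
  have "\<forall>i\<in>X. \<exists>s. s \<in> carrier A \<times> carrier B \<and> v i = tens K A B (fst s) (snd s)"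
    using assms by fastforce
  from bchoice[OF this] obtain g where g: "\<forall>i\<in>X. g i \<in> carrier A \<times> carrier B \<and> v i = tens K A B (fst (g i)) (snd (g i))"
    by blast
  show thesis by (rule that[of "\<lambda>i. fst (g i)" "\<lambda>i. snd (g i)"]) (use g in \<open>auto simp: mem_Times_iff\<close>)
qed

lemma FA_eqI_tens:
  assumes f: "lin K (FA (tensor K A B)) U f" and g: "lin K (FA (tensor K A B)) U g"
    and eq: "\<And>X a b p. finite X ==> a \<in> X \<rightarrow> carrier A ==> b \<in> X \<rightarrow> carrier B ==> p \<in> elts X ==>
      f (cls (tensor K A B) X (\<lambda>i. tens K A B (a i) (b i)) p) =
      g (cls (tensor K A B) X (\<lambda>i. tens K A B (a i) (b i)) p)"
    and x: "x \<in> carrier (FA (tensor K A B))"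
  shows "f x = g x"
proof (rule FA_eqI_det[OF module_tensor[OF mA' B] determining_pure[OF A B] f g _ x])
  fix X v p assume X: "finite X" "v \<in> X \<rightarrow> (\<lambda>(a, b). tens K A B a b) ` (carrier A \<times> carrier B)" "p \<in> elts X"
  obtain a b where ab: "a \<in> X \<rightarrow> carrier A" "b \<in> X \<rightarrow> carrier B" "\<And>i. i \<in> X ==> v i = tens K A B (a i) (b i)"
    using pure_letters[OF X(2)] by blast
  show "f (cls (tensor K A B) X v p) = g (cls (tensor K A B) X v p)"
  proof -
    have "cls (tensor K A B) X v p = cls (tensor K A B) X (\<lambda>i. tens K A B (a i) (b i)) p"
      by (rule cls_cong[OF X(1) ab(3)])
    then show ?thesis using eq[OF X(1) ab(1,2) X(3)] by simp
  qed
qed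

lemma lin_split_apply:
  assumes h: "lin K (FF A B) U h"
    and X: "finite X" "a \<in> X \<rightarrow> carrier A" "b \<in> X \<rightarrow> carrier B" "p \<in> elts X"
  shows "h (fock_split A B (cls (tensor K A B) X (\<lambda>i. tens K A B (a i) (b i)) p)) =
    finsum U (\<lambda>r. h (Fmap A B (cls A (quo X r) (blocks A a))
     (cls B X b) (contr P X r p))) (equivs X)"
  unfolding split_cls[OF A B X]
  by (rule lin_finsum[OF h]) (auto intro!: lin_closed[OF lin_split_term[OF A B]] X)

lemma tens_letters: "a \<in> X \<rightarrow> carrier A ==> b \<in> X \<rightarrow> carrier B ==>
    (\<lambda>i. tens K A B (a i) (b i)) \<in> X \<rightarrow> carrier (tensor K A B)"
  by (auto intro!: tens_closed mA' B)

text \<open>\<open>f\<close> has to be multiplicative because block products are formed in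
  \<open>A\<close> before it is applied, see \<open>bprod_hom\<close>. The letters of the second
  factor are only copied, so \<open>g\<close> may be any linear map.\<close>

lemma split_natural:
  fixes A' :: "('k, 'c, 'o) module_scheme" and B' :: "('k, 'd, 'q) module_scheme"
  assumes A': "comm_alg K A'" and f: "lin K A A' f" and g: "lin K B B' g"
    and mult: "\<And>x y. x \<in> carrier A ==> y \<in> carrier A ==> f (x \<otimes>\<^bsub>A\<^esub> y) = f x \<otimes>\<^bsub>A'\<^esub> f y"
    and x: "x \<in> carrier (FA (tensor K A B))"
  shows "fock_split A' B' (fock_lin (tensor K A' B') (tmap K A' B' f g) x) =
    Fmap A' B' (fock_lin A' f) (fock_lin B' g) (fock_split A B x)"
proof -
  note B' = lin_cod[OF g] and fg = lin_tmap[OF f g] and lf = lin_fock_lin[OF f] and lg = lin_fock_lin[OF g]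
  interpret T': module K "FF A' B'" by (rule module_TAB[OF A' B'])
  note l = lin_tmap[OF lf lg]
  show ?thesis
  proof (rule FA_eqI_tens[OF lin_comp[OF lin_fock_lin[OF fg] lin_split[OF A' B']]
        lin_comp[OF lin_split[OF A B] l] _ x], goal_cases)
    case (1 X a b p)
    note X = 1(1) and a = 1(2) and b = 1(3) and p = 1(4)
    have fa: "(\<lambda>i. f (a i)) \<in> X \<rightarrow> carrier A'" and gb: "(\<lambda>i. g (b i)) \<in> X \<rightarrow> carrier B'"
      using a b lin_closed[OF f] lin_closed[OF g] by auto
    have "fock_lin (tensor K A' B') (tmap K A' B' f g) (cls (tensor K A B) X (\<lambda>i. tens K A B (a i) (b i)) p) =
        cls (tensor K A' B') X (\<lambda>i. tens K A' B' (f (a i)) (g (b i))) p"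
      unfolding fock_lin_cls[OF fg X tens_letters[OF a b] p]
      using a b by (intro cls_cong X tmap_tens[OF f g]) auto
    then have "fock_split A' B' (fock_lin (tensor K A' B') (tmap K A' B' f g)
          (cls (tensor K A B) X (\<lambda>i. tens K A B (a i) (b i)) p)) =
        finsum (FF A' B') (\<lambda>r. Fmap A' B'
          (cls A' (quo X r) (blocks A' (\<lambda>i. f (a i)))) (cls B' X (\<lambda>i. g (b i))) (contr P X r p)) (equivs X)"
      using split_cls[OF A' B' X fa gb p] by simp
    also have "\<dots> = finsum (FF A' B') (\<lambda>r. Fmap A' B' (fock_lin A' f) (fock_lin B' g)
          (Fmap A B (cls A (quo X r) (blocks A a)) (cls B X b) (contr P X r p))) (equivs X)"
    proof (rule T'.finsum_cong')
      fix r assume r: "r \<in> equivs X"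
      note c = lin_cls_quo[OF A B X r a] lin_cls[OF B X b] and t = contr_closed[OF X r p]
      note d = lin_cls_quo[OF A' B' X r fa] lin_cls[OF B' X gb]
      have bl: "blocks A' (\<lambda>i. f (a i)) k = f (blocks A a k)" if k: "k \<in> quo X r" for k
        unfolding blocks_def using decode_nonempty[OF X r k] decode_subset[OF X r k] a
        by (intro bprod_hom[OF A A', symmetric] mult lin_closed[OF f]) auto
      show "Fmap A' B' (cls A' (quo X r) (blocks A' (\<lambda>i. f (a i)))) (cls B' X (\<lambda>i. g (b i))) (contr P X r p) =
        Fmap A' B' (fock_lin A' f) (fock_lin B' g)
          (Fmap A B (cls A (quo X r) (blocks A a)) (cls B X b) (contr P X r p))"
        unfolding tmap_comp[OF c lf lg t]
      proof (rule tmap_cong[OF d t])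
        fix q assume q: "q \<in> elts (quo X r)"
        show "cls A' (quo X r) (blocks A' (\<lambda>i. f (a i))) q = fock_lin A' f (cls A (quo X r) (blocks A a) q)"
          unfolding fock_lin_cls[OF f finite_quo[OF X] blocks_Pi[OF A B X r a] q]
          by (intro cls_cong finite_quo[OF X] bl)
      qed (simp add: fock_lin_cls[OF g X b])
    qed (auto intro!: lin_closed[OF l] lin_closed[OF lin_split_term[OF A B]] X a b p)
    finally show ?case
      unfolding lin_split_apply[OF l X a b p] .
  qed
qed

text \<open>A character turns the blocks of any equivalence into the product of all e(a_i). This
  scalar is common to all terms, and what remains is the left counit axiom of \<open>P\<close>,
  which is a sum over all equivalences. Finally the scalar is returned to the letters by
  \<open>cls_scale\<close>.\<close>

lemma split_counit_left:
  assumes e: "lin K A (self_module K) e"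
    and mult: "\<And>x y. x \<in> carrier A ==> y \<in> carrier A ==> e (x \<otimes>\<^bsub>A\<^esub> y) = e x \<otimes>\<^bsub>K\<^esub> e y"
    and x: "x \<in> carrier (FA (tensor K A B))"
  shows "eval_left K (FA B) (fock_eps2 e) (fock_split A B x) = fock_lin B (eval_left K B e) x"
proof -
  interpret F: module K "FA B" by (rule module_FA[OF B])
  note eb = lin_eval_left[OF B e] and l2 = lin_eps2[OF e]
  note E = lin_eval_left[OF F.module_axioms l2]
  have ec: "e v \<in> carrier K" if "v \<in> carrier A" for v using lin_closed[OF e that] by simp
  show ?thesis
  proof (rule FA_eqI_tens[OF lin_comp[OF lin_split[OF A B] E] lin_fock_lin[OF eb] _ x], goal_cases)
    case (1 X a b p)
    note X = 1(1) and a = 1(2) and b = 1(3) and p = 1(4)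
    let ?c = "finprod K (\<lambda>i. e (a i)) X"
    interpret O: module K "obj P X" by (rule module_obj[OF X])
    have c: "?c \<in> carrier K" using a ec by (intro T.R.finprod_closed) auto
    note lb = lin_cls[OF B X b]
    have ev: "eval_left K (obj P X) (contr_counit P (quo X r)) (contr P X r p) \<in> elts X" if r: "r \<in> equivs X" for r
      by (rule lin_closed[OF lin_eval_left[OF O.module_axioms lin_contr_counit[OF finite_quo[OF X]]] contr_closed[OF X r p]])
    have "eval_left K (FA B) (fock_eps2 e) (fock_split A B (cls (tensor K A B) X (\<lambda>i. tens K A B (a i) (b i)) p)) =
        finsum (FA B) (\<lambda>r. eval_left K (FA B) (fock_eps2 e) (Fmap A B
          (cls A (quo X r) (blocks A a)) (cls B X b) (contr P X r p))) (equivs X)"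
      by (rule lin_split_apply[OF E X a b p])
    also have "\<dots> = finsum (FA B) (\<lambda>r. ?c \<odot>\<^bsub>FA B\<^esub> cls B X b
        (eval_left K (obj P X) (contr_counit P (quo X r)) (contr P X r p))) (equivs X)"
    proof (rule F.finsum_cong')
      fix r assume r: "r \<in> equivs X"
      note la = lin_cls_quo[OF A B X r a] and t = contr_closed[OF X r p] and Q = finite_quo[OF X]
      have "finprod K (\<lambda>k. e (blocks A a k)) (quo X r) = finprod K (\<lambda>k. finprod K (\<lambda>i. e (a i)) (set_decode k)) (quo X r)"
      proof (rule T.R.finprod_cong')
        fix k assume k: "k \<in> quo X r"
        have ak: "a \<in> set_decode k \<rightarrow> carrier A" using a decode_subset[OF X r k] by auto
        show "e (blocks A a k) = finprod K (\<lambda>i. e (a i)) (set_decode k)"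
          unfolding blocks_def
          by (rule bprod_character[OF A ec mult finite_set_decode decode_nonempty[OF X r k] ak])
      next
        show "(\<lambda>k. finprod K (\<lambda>i. e (a i)) (set_decode k)) \<in> quo X r \<rightarrow> carrier K"
        proof
          fix k assume k: "k \<in> quo X r"
          show "finprod K (\<lambda>i. e (a i)) (set_decode k) \<in> carrier K"
            using decode_subset[OF X r k] a ec by (intro T.R.finprod_closed) auto
        qed
      qed simp
      \<comment> \<open>Each index lies in exactly one class, so the product over the classes does
        not depend on the equivalence.\<close>
      also have "\<dots> = ?c"
        by (rule finprod_quo[OF K_cring X r]) (use a ec in auto)
      finally have "fock_eps2 e (cls A (quo X r) (blocks A a) q) = ?c \<otimes>\<^bsub>K\<^esub> contr_counit P (quo X r) q"
        if "q \<in> elts (quo X r)" for q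
        using eps2_cls[OF e Q blocks_Pi[OF A B X r a] that] by simp
      then have "eval_left K (obj P X) (\<lambda>q. fock_eps2 e (cls A (quo X r) (blocks A a) q)) (contr P X r p) =
          eval_left K (obj P X) (\<lambda>q. ?c \<otimes>\<^bsub>K\<^esub> contr_counit P (quo X r) q) (contr P X r p)"
        by (rule eval_left_cong[OF lin_comp[OF la l2] O.module_axioms t])
      also have "\<dots> = ?c \<odot>\<^bsub>obj P X\<^esub> eval_left K (obj P X) (contr_counit P (quo X r)) (contr P X r p)"
        by (rule eval_scaled(1)[OF lin_contr_counit[OF Q] O.module_axioms c t])
      finally show "eval_left K (FA B) (fock_eps2 e) (Fmap A B
          (cls A (quo X r) (blocks A a)) (cls B X b) (contr P X r p)) =
        ?c \<odot>\<^bsub>FA B\<^esub> cls B X b (eval_left K (obj P X) (contr_counit P (quo X r)) (contr P X r p))"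
        unfolding eval_left_tmap[OF l2 la lb t] by (simp add: lin_smult[OF lb] c ev[OF r])
    qed (use c ev in \<open>auto intro!: F.smult_closed lin_closed[OF lb]\<close>)
    \<comment> \<open>Linearity of the class map brings the sum inside, where the left counit axiom
      of \<open>P\<close> evaluates it to \<open>p\<close>.\<close>
    also have "\<dots> = ?c \<odot>\<^bsub>FA B\<^esub> cls B X b p"
      using lin_finsum[OF lin_scale[OF lb c], of "\<lambda>r. eval_left K (obj P X) (contr_counit P (quo X r)) (contr P X r p)" "equivs X"]
        ev contr_counit_left[OF X p] by auto
    also have "\<dots> = cls B X (\<lambda>i. e (a i) \<odot>\<^bsub>B\<^esub> b i) p"
      by (rule cls_scale[OF B X b p, symmetric]) (use a ec in auto)
    also have "\<dots> = fock_lin B (eval_left K B e) (cls (tensor K A B) X (\<lambda>i. tens K A B (a i) (b i)) p)"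
      unfolding fock_lin_cls[OF eb X tens_letters[OF a b] p]
      using a b by (intro cls_cong X eval_left_tens[OF B e, symmetric]) auto
    finally show ?case .
  qed
qed

text \<open>The right counit axiom of \<open>P\<close> kills every equivalence except equality,
  whose blocks are single letters. The scalars e(b_i) are then absorbed into the letters.\<close>

lemma split_counit_right:
  assumes e: "lin K B (self_module K) e" and x: "x \<in> carrier (FA (tensor K A B))"
  shows "eval_right K (FA A) (fock_eps2 e) (fock_split A B x) = fock_lin A (eval_right K A e) x"
proof -
  interpret F: module K "FA A" by (rule module_FA[OF mA'])
  note ea = lin_eval_right[OF mA' e] and l2 = lin_eps2[OF e]
  note E = lin_eval_right[OF F.module_axioms l2]
  have ec: "e v \<in> carrier K" if "v \<in> carrier B" for v using lin_closed[OF e that] by simp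
  show ?thesis
  proof (rule FA_eqI_tens[OF lin_comp[OF lin_split[OF A B] E] lin_fock_lin[OF ea] _ x], goal_cases)
    case (1 X a b p)
    note X = 1(1) and a = 1(2) and b = 1(3) and p = 1(4)
    let ?c = "finprod K (\<lambda>i. e (b i)) X" and ?I = "Id_on X" and ?s = "\<lambda>x. set_encode {x}"
    have c: "?c \<in> carrier K" using b ec by (intro T.R.finprod_closed) auto
    note lb = lin_cls[OF B X b] and I = Id_on_equivs[of X]
    have tm: "eval_right K (FA A) (fock_eps2 e) (Fmap A B
          (cls A (quo X r) (blocks A a)) (cls B X b) (contr P X r p)) =
        ?c \<odot>\<^bsub>FA A\<^esub> cls A (quo X r) (blocks A a)
          (if r = ?I then arr P X ?s p else \<zero>\<^bsub>obj P (quo X r)\<^esub>)" if r: "r \<in> equivs X" for r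
    proof -
      note la = lin_cls_quo[OF A B X r a] and t = contr_closed[OF X r p]
      interpret O: module K "obj P (quo X r)" by (rule module_obj[OF finite_quo[OF X]])
      have "eval_right K (obj P (quo X r)) (\<lambda>q. fock_eps2 e (cls B X b q)) (contr P X r p) =
          eval_right K (obj P (quo X r)) (\<lambda>q. ?c \<otimes>\<^bsub>K\<^esub> contr_counit P X q) (contr P X r p)"
        by (rule eval_right_cong[OF lin_comp[OF lb l2] O.module_axioms t]) (rule eps2_cls[OF e X b])
      also have "\<dots> = ?c \<odot>\<^bsub>obj P (quo X r)\<^esub> eval_right K (obj P (quo X r)) (contr_counit P X) (contr P X r p)"
        by (rule eval_scaled(2)[OF lin_contr_counit[OF X] O.module_axioms c t])
      finally show ?thesis
        unfolding eval_right_tmap[OF l2 lb la t] contr_counit_right[OF X r p, symmetric]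
        using lin_smult[OF la c lin_closed[OF lin_eval_right[OF O.module_axioms lin_contr_counit[OF X]] t]] by simp
    qed
    have arrc: "arr P X ?s p \<in> elts (quo X ?I)"
      by (rule arr_closed[OF X inj_singleton_code quo_Id p])
    \<comment> \<open>The quotient by equality is the set of codes of singletons; naturality along
      the singleton map leads back to \<open>X\<close>.\<close>
    have Ic: "cls A (quo X ?I) (blocks A a) (arr P X ?s p) = cls A X a p"
      unfolding quo_Id
      by (rule cls_natural[OF mA' X inj_singleton_code _ a p]) (simp add: blocks_def bprod_singleton set_encode_inverse del: set_encode_insert)
    have "eval_right K (FA A) (fock_eps2 e) (fock_split A B (cls (tensor K A B) X (\<lambda>i. tens K A B (a i) (b i)) p)) =
        finsum (FA A) (\<lambda>r. eval_right K (FA A) (fock_eps2 e) (Fmap A B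
          (cls A (quo X r) (blocks A a)) (cls B X b) (contr P X r p))) (equivs X)"
      by (rule lin_split_apply[OF E X a b p])
    also have "\<dots> = eval_right K (FA A) (fock_eps2 e) (Fmap A B
          (cls A (quo X ?I) (blocks A a)) (cls B X b) (contr P X ?I p))"
    proof (rule F.finsum_single[OF finite_equivs[OF X] I])
      fix r assume r: "r \<in> equivs X" "r \<noteq> ?I"
      show "eval_right K (FA A) (fock_eps2 e) (Fmap A B
          (cls A (quo X r) (blocks A a)) (cls B X b) (contr P X r p)) = \<zero>\<^bsub>FA A\<^esub>"
        unfolding tm[OF r(1)] using r(2) c by (simp add: lin_zero[OF lin_cls_quo[OF A B X r(1) a]])
    qed (rule lin_closed[OF E lin_closed[OF lin_split_term[OF A B X I a b] p]])
    also have "\<dots> = ?c \<odot>\<^bsub>FA A\<^esub> cls A X a p" unfolding tm[OF I] using Ic by simp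
    also have "\<dots> = cls A X (\<lambda>i. e (b i) \<odot>\<^bsub>A\<^esub> a i) p"
      by (rule cls_scale[OF mA' X a p, symmetric]) (use b ec in auto)
    also have "\<dots> = fock_lin A (eval_right K A e) (cls (tensor K A B) X (\<lambda>i. tens K A B (a i) (b i)) p)"
      unfolding fock_lin_cls[OF ea X tens_letters[OF a b] p]
      using a b by (intro cls_cong X eval_right_tens[OF mA' e, symmetric]) auto
    finally show ?case .
  qed
qed

lemma split_one: "fock_split A B \<one>\<^bsub>FA (tensor K A B)\<^esub> = \<one>\<^bsub>FF A B\<^esub>"
proof -
  let ?a = "undefined :: nat \<Rightarrow> 'a" and ?b = "undefined :: nat \<Rightarrow> 'b"
  have r: "{} \<in> equivs {}" by (simp add: equivs_empty)
  note c = lin_cls_quo[OF A B finite.emptyI r, of ?a, simplified] lin_cls[OF B finite.emptyI, of ?b, simplified]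
  have 1: "Fmap A B (cls A {} (blocks A ?a)) (cls B {} ?b) (contr P {} {} (tw_one P)) =
      \<one>\<^bsub>FF A B\<^esub>"
    using c tw_one_closed unfolding contr_one one_tensor
    by (simp add: quo_empty tmap_tens one_FA[OF mA', of "blocks A ?a"] one_FA[OF B, of ?b])
  have "\<one>\<^bsub>FF A B\<^esub> \<in> carrier (FF A B)"
    unfolding one_tensor by (intro tens_closed module_FA mA' B one_FA_closed)
  then show ?thesis
    using split_cls[OF A B finite.emptyI, of ?a ?b "tw_one P"] tw_one_closed 1
    by (simp add: one_FA[OF module_tensor[OF mA' B], of "\<lambda>i. tens K A B (?a i) (?b i)"] equivs_empty quo_empty)
qed

text \<open>A quotient is empty only if the set is. For nonempty \<open>X\<close> both sides
  therefore vanish, and for empty \<open>X\<close> there is one equivalence, for which the claim is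
  the axiom relating \<delta> with the counit of \<Delta>.\<close>

lemma split_eps:
  assumes x: "x \<in> carrier (FA (tensor K A B))"
  shows "eval_left K (FA B) (fock_eps) (fock_split A B x) = fock_eps x \<odot>\<^bsub>FA B\<^esub> \<one>\<^bsub>FA B\<^esub>"
proof -
  interpret F: module K "FA B" by (rule module_FA[OF B])
  note eps = lin_eps[OF mA'] and E = lin_eval_left[OF F.module_axioms lin_eps[OF mA']]
  note one = one_FA_closed[OF B]
  show ?thesis
  proof (rule FA_eqI_tens[OF lin_comp[OF lin_split[OF A B] E]
        lin_scale_right[OF lin_eps[OF module_tensor[OF mA' B]] F.module_axioms one] _ x], goal_cases)
    case (1 X a b p)
    note X = 1(1) and a = 1(2) and b = 1(3) and p = 1(4)
    note lb = lin_cls[OF B X b]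
    interpret O: module K "obj P X" by (rule module_obj[OF X])
    have tm: "eval_left K (FA B) (fock_eps) (Fmap A B (cls A (quo X r) (blocks A a)) (cls B X b) (contr P X r p)) =
        (if X = {} then tw_counit P p \<odot>\<^bsub>FA B\<^esub> \<one>\<^bsub>FA B\<^esub> else \<zero>\<^bsub>FA B\<^esub>)" if r: "r \<in> equivs X" for r
    proof -
      note la = lin_cls_quo[OF A B X r a] and t = contr_closed[OF X r p]
      have "quo X r = {} \<longleftrightarrow> X = {}" by (simp add: quo_code)
      then have ec: "fock_eps (cls A (quo X r) (blocks A a) q) = (if X = {} then tw_counit P q else \<zero>\<^bsub>K\<^esub>)"
        if "q \<in> elts (quo X r)" for q
        using eps_cls[OF mA' finite_quo[OF X] blocks_Pi[OF A B X r a] that] by simp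
      show ?thesis
      proof (cases "X = {}")
        case False
        then have "eval_left K (obj P X) (\<lambda>q. fock_eps (cls A (quo X r) (blocks A a) q)) (contr P X r p) =
            eval_left K (obj P X) (\<lambda>q. \<zero>\<^bsub>K\<^esub>) (contr P X r p)"
          using ec by (intro eval_left_cong[OF lin_comp[OF la eps] O.module_axioms t]) simp
        also have "\<dots> = \<zero>\<^bsub>obj P X\<^esub>" by (rule eval_zero(1)[OF lin_dom[OF la] O.module_axioms t])
        finally show ?thesis unfolding eval_left_tmap[OF eps la lb t] using False by (simp add: lin_zero[OF lb])
      next
        case True
        have r': "r = {}" using r True by (simp add: equivs_empty)
        have p': "p \<in> elts {}" using p True by simp
        have "eval_left K (obj P X) (\<lambda>q. fock_eps (cls A (quo X r) (blocks A a) q)) (contr P X r p) =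
            eval_left K (obj P X) (tw_counit P) (contr P X r p)"
          using ec True by (intro eval_left_cong[OF lin_comp[OF la eps] O.module_axioms t]) simp
        also have "\<dots> = tw_counit P p \<odot>\<^bsub>obj P X\<^esub> tw_one P"
          using contr_tw_counit[OF p'] True r' by simp
        finally show ?thesis
          unfolding eval_left_tmap[OF eps la lb t]
          using True lin_smult[OF lb, of "tw_counit P p" "tw_one P"] tw_one_closed lin_closed[OF lin_tw_counit p']
          by (simp add: one_FA[OF B, of b])
      qed
    qed
    have "eval_left K (FA B) (fock_eps) (fock_split A B (cls (tensor K A B) X (\<lambda>i. tens K A B (a i) (b i)) p)) =
        finsum (FA B) (\<lambda>r. if X = {} then tw_counit P p \<odot>\<^bsub>FA B\<^esub> \<one>\<^bsub>FA B\<^esub> else \<zero>\<^bsub>FA B\<^esub>) (equivs X)"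
      unfolding lin_split_apply[OF E X a b p]
      by (rule F.finsum_cong')
         (use tm lin_closed[OF E lin_closed[OF lin_split_term[OF A B X _ a b] p]] in auto)
    also have "\<dots> = fock_eps (cls (tensor K A B) X (\<lambda>i. tens K A B (a i) (b i)) p) \<odot>\<^bsub>FA B\<^esub> \<one>\<^bsub>FA B\<^esub>"
      unfolding eps_cls[OF module_tensor[OF mA' B] X tens_letters[OF a b] p]
      using one p lin_closed[OF lin_tw_counit, of p] by (auto simp: equivs_empty F.finsum_insert)
    finally show ?case .
  qed
qed

text \<open>Only equivalences that relate no element of \<open>X\<close> to one of \<open>Y\<close>
  contribute to the splitting of a product. They are pairs of equivalences, and for such a pair the
  compatibility axiom has the form evaluated by \<open>tmap_cls_mult\<close>.\<close>

lemma split_mult: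
  assumes xy: "x \<in> carrier (FA (tensor K A B))" "y \<in> carrier (FA (tensor K A B))"
  shows "fock_split A B (x \<otimes>\<^bsub>FA (tensor K A B)\<^esub> y) =
    fock_split A B x \<otimes>\<^bsub>FF A B\<^esub> fock_split A B y"
proof -
  let ?AB = "tensor K A B" and ?T = "FF A B" and ?S = "fock_split A B" and ?O = "obj P"
  note mAB = module_tensor[OF mA' B] and S = lin_split[OF A B]
  note F = module_FA[OF mAB] and bT = bilin_tensor_mult[OF bilin_mult[OF mA'] bilin_mult[OF B]]
  show ?thesis
  proof (rule bilin_FA_eqI_det[OF mAB determining_pure[OF A B] bilin_comp[OF bilin_mult[OF mAB] lin_id[OF F] lin_id[OF F] S]
        bilin_comp[OF bT S S lin_id[OF T.module_axioms]] _ xy])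
    fix X Y v p q
    assume X: "finite X" and Y: "finite Y" and d: "X \<inter> Y = {}"
      and v: "v \<in> X \<union> Y \<rightarrow> (\<lambda>(a, b). tens K A B a b) ` (carrier A \<times> carrier B)"
      and p: "p \<in> elts X" and q: "q \<in> elts Y"
    obtain a b where a: "a \<in> X \<union> Y \<rightarrow> carrier A" and b: "b \<in> X \<union> Y \<rightarrow> carrier B"
      and vab: "\<And>i. i \<in> X \<union> Y ==> v i = tens K A B (a i) (b i)"
      using pure_letters[OF v] by blast
    let ?w = "\<lambda>i. tens K A B (a i) (b i)"
    have ab: "a \<in> X \<rightarrow> carrier A" "b \<in> X \<rightarrow> carrier B" "a \<in> Y \<rightarrow> carrier A" "b \<in> Y \<rightarrow> carrier B"
      using a b by auto
    have vw: "cls ?AB X v p = cls ?AB X ?w p" "cls ?AB Y v q = cls ?AB Y ?w q"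
      using vab by (auto intro!: cls_cong X Y)
    let ?Z = "X \<union> Y" let ?pq = "tens K (?O X) (?O Y) p q" let ?m = "tw_mult P X Y ?pq"
    let ?term = "\<lambda>X r p. Fmap A B (cls A (quo X r) (blocks A a)) (cls B X b) (contr P X r p)"
    have Z: "finite ?Z" using X Y by simp
    have pq: "?pq \<in> carrier (PP X Y)" by (intro tens_closed module_obj X Y p q)
    have m: "?m \<in> elts ?Z" by (rule lin_closed[OF lin_mul[OF X Y d refl] pq])
    have tc: "?term X r p \<in> carrier ?T" if "r \<in> equivs X" for r
      by (rule lin_closed[OF lin_split_term[OF A B X that ab(1,2)] p])
    have tc': "?term Y r q \<in> carrier ?T" if "r \<in> equivs Y" for r
      by (rule lin_closed[OF lin_split_term[OF A B Y that ab(3,4)] q])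
    have tZ: "?term ?Z r ?m \<in> carrier ?T" if "r \<in> equivs ?Z" for r
      by (rule lin_closed[OF lin_split_term[OF A B Z that a b] m])
    have "?S (cls ?AB X ?w p \<otimes>\<^bsub>FA ?AB\<^esub> cls ?AB Y ?w q) = finsum ?T (\<lambda>r. ?term ?Z r ?m) (equivs ?Z)"
      unfolding mult_cls[OF mAB X Y d tens_letters[OF a b] p q] by (rule split_cls[OF A B Z a b m])
    also have "\<dots> = finsum ?T (\<lambda>r. ?term ?Z r ?m) {r \<in> equivs ?Z. r = r \<inter> X \<times> X \<union> r \<inter> Y \<times> Y}"
    \<comment> \<open>Equivalences that relate \<open>X\<close> with \<open>Y\<close> are dropped:
      there the coproduct of the product is zero.\<close>
    proof (rule T.add.finprod_mono_neutral_cong_right[OF finite_equivs[OF Z]])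
      fix r assume r: "r \<in> equivs ?Z - {r \<in> equivs ?Z. r = r \<inter> X \<times> X \<union> r \<inter> Y \<times> Y}"
      then have r1: "r \<in> equivs ?Z" "r \<noteq> r \<inter> X \<times> X \<union> r \<inter> Y \<times> Y" by auto
      show "?term ?Z r ?m = \<zero>\<^bsub>?T\<^esub>"
        unfolding contr_mul_zero[OF X Y d r1 pq]
        by (rule lin_zero[OF lin_tmap[OF lin_cls_quo[OF A B Z r1(1) a] lin_cls[OF B Z b]]])
    qed (use tZ in auto)
    also have "\<dots> = finsum ?T (\<lambda>(r, s). ?term X r p \<otimes>\<^bsub>?T\<^esub> ?term Y s q) (equivs X \<times> equivs Y)"
    proof (rule T.finsum_bij[OF bij_equivs_Un[OF d], symmetric])
      show "(\<lambda>r. ?term ?Z r ?m) \<in> {r \<in> equivs ?Z. r = r \<inter> X \<times> X \<union> r \<inter> Y \<times> Y} \<rightarrow> carrier ?T"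
        using tZ by auto
      fix rs assume "rs \<in> equivs X \<times> equivs Y"
      then obtain r s where rs: "rs = (r, s)" and r: "r \<in> equivs X" and s: "s \<in> equivs Y" by auto
      note e = equivs_Un[OF r s d] and Q = quo_Un[OF X Y r s d]
      have bl: "blocks A a \<in> quo X r \<union> quo Y s \<rightarrow> carrier A"
        using blocks_Pi[OF A B Z e(1) a] unfolding Q(1) .
      have "tmap K (PP (quo X r) X) (PP (quo Y s) Y) (contr P X r) (contr P Y s) ?pq =
          tens K (PP (quo X r) X) (PP (quo Y s) Y) (contr P X r p) (contr P Y s q)"
        by (rule tmap_tens[OF lin_contr[OF X r] lin_contr[OF Y s] p q])
      then have "contr P ?Z (r \<union> s) ?m = tmap K (?O (quo X r \<union> quo Y s)) (?O ?Z) (tw_mult P (quo X r) (quo Y s)) (tw_mult P X Y)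
          (tswap K (?O (quo X r)) (?O X) (?O (quo Y s)) (?O Y)
            (tens K (PP (quo X r) X) (PP (quo Y s) Y) (contr P X r p) (contr P Y s q)))"
        unfolding contr_mul[OF X Y d r s pq] Q(1) by simp
      then have "?term ?Z (r \<union> s) ?m = ?term X r p \<otimes>\<^bsub>?T\<^esub> ?term Y s q"
        unfolding Q(1)
        by (simp add: tmap_cls_mult[OF mA' B finite_quo[OF X] X finite_quo[OF Y] Y Q(2) d bl b
              contr_closed[OF X r p] contr_closed[OF Y s q]])
      then show "(case rs of (r, s) \<Rightarrow> ?term X r p \<otimes>\<^bsub>?T\<^esub> ?term Y s q) = ?term ?Z (case rs of (r, s) \<Rightarrow> r \<union> s) ?m"
        unfolding rs prod.case ..
    qed
    also have "\<dots> = ?S (cls ?AB X ?w p) \<otimes>\<^bsub>?T\<^esub> ?S (cls ?AB Y ?w q)"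
      unfolding split_cls[OF A B X ab(1,2) p] split_cls[OF A B Y ab(3,4) q]
      by (rule bilin_finsum[OF bT finite_equivs[OF X] finite_equivs[OF Y] tc tc', symmetric])
    finally show "?S (cls ?AB X v p \<otimes>\<^bsub>FA ?AB\<^esub> cls ?AB Y v q) =
        ?S (cls ?AB X v p) \<otimes>\<^bsub>?T\<^esub> ?S (cls ?AB Y v q)"
      unfolding vw .
  qed
qed

end

end

section \<open>Coassociativity of the splitting\<close>

lemma bij_quo_equiv_Sigma:
  assumes X: "finite X"
  shows "bij_betw (\<lambda>(r, r'). (r', quo_equiv r r')) (SIGMA r:equivs X. {r' \<in> equivs X. r' \<subseteq> r})
    (SIGMA r':equivs X. equivs (quo X r'))"
  unfolding bij_betw_def
proof
  note b = bij_quo_equiv[OF X, unfolded bij_betw_def]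
  show "inj_on (\<lambda>(r, r'). (r', quo_equiv r r')) (SIGMA r:equivs X. {r' \<in> equivs X. r' \<subseteq> r})"
  proof (rule inj_onI, clarify)
    fix r r' s assume 1: "r \<in> equivs X" "r' \<in> equivs X" "r' \<subseteq> r" "s \<in> equivs X" "r' \<subseteq> s"
      and "quo_equiv r r' = quo_equiv s r'"
    then show "r = s \<and> r' = r'" using inj_onD[OF conjunct1[OF b[OF 1(2)]], of r s] by simp
  qed
  show "(\<lambda>(r, r'). (r', quo_equiv r r')) ` (SIGMA r:equivs X. {r' \<in> equivs X. r' \<subseteq> r}) =
      (SIGMA r':equivs X. equivs (quo X r'))"
  proof (intro equalityI subsetI)
    fix z assume "z \<in> (\<lambda>(r, r'). (r', quo_equiv r r')) ` (SIGMA r:equivs X. {r' \<in> equivs X. r' \<subseteq> r})"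
    then obtain r r' where "z = (r', quo_equiv r r')" "r \<in> equivs X" "r' \<in> equivs X" "r' \<subseteq> r" by auto
    then show "z \<in> (SIGMA r':equivs X. equivs (quo X r'))" using quo_equiv_equivs[OF X] by simp
  next
    fix z assume "z \<in> (SIGMA r':equivs X. equivs (quo X r'))"
    then obtain r' s where z: "z = (r', s)" "r' \<in> equivs X" "s \<in> equivs (quo X r')" by blast
    then obtain r where r: "r \<in> equivs X" "r' \<subseteq> r" "s = quo_equiv r r'"
      using conjunct2[OF b[OF z(2)], symmetric] by blast
    show "z \<in> (\<lambda>(r, r'). (r', quo_equiv r r')) ` (SIGMA r:equivs X. {r' \<in> equivs X. r' \<subseteq> r})"
      by (rule image_eqI[of _ _ "(r, r')"]) (use r z in simp_all)
  qed
qed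

context contraction_over
begin

lemma contr_contr:
  assumes "finite X" "r \<in> equivs X" "r' \<in> equivs X" "p \<in> elts X"
  shows "tmap K (obj P (quo X r)) (PP (quo X r') X) id (contr P X r') (contr P X r p) =
    (if r' \<subseteq> r then
       tassoc K (obj P (quo X r)) (obj P (quo X r')) (obj P X)
         (tmap K (PP (quo X r) (quo X r')) (obj P X)
           (\<lambda>q. tmap K (obj P (quo X r)) (obj P (quo X r'))
                  (arr P (quo (quo X r') (quo_equiv r r')) flatten) id
                  (contr P (quo X r') (quo_equiv r r') q))
           id (contr P X r' p))
     else \<zero>\<^bsub>tensor K (obj P (quo X r)) (PP (quo X r') X)\<^esub>)"
  using cc'[THEN conjunct2, THEN conjunct2, THEN conjunct1] assms by blast

text \<open>A class of the iterated quotient flattens to the union of the classes it contains, and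
  these are disjoint and nonempty, so that \<open>bprod_UN\<close> applies.\<close>

lemma blocks_flatten:
  assumes A: "comm_alg K A" and X: "finite X" and r: "r \<in> equivs X" "r' \<in> equivs X" "r' \<subseteq> r"
    and a: "a \<in> X \<rightarrow> carrier A" and c: "c \<in> quo (quo X r') (quo_equiv r r')"
  shows "blocks A a (flatten c) = blocks A (blocks A a) c"
proof -
  note q = quo_equiv_equivs[OF X r(2,1,3)] and Q = finite_quo[OF X]
  note sub = decode_subset[OF Q q c]
  show ?thesis
    unfolding blocks_def flatten_props(3)[OF X r(2,1,3) c]
  proof (rule bprod_UN[OF A finite_set_decode decode_nonempty[OF Q q c] finite_set_decode])
    show "a \<in> (\<Union>d\<in>set_decode c. set_decode d) \<rightarrow> carrier A"
      using a sub decode_subset[OF X r(2)] by fastforce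
  qed (use sub decode_nonempty[OF X r(2)] decode_disjoint[OF X r(2)] in \<open>auto simp: subset_iff\<close>)
qed

text \<open>On the left, an equivalence \<open>r'\<close> on \<open>X\<close> is followed by an
  equivalence on its quotient. On the right, \<open>r\<close> and \<open>r'\<close> are both
  equivalences on \<open>X\<close>, applied one after the other; by axiom (ii) of \<delta> the pairs
  with \<open>r'\<close> not contained in \<open>r\<close> vanish and the others give the terms of
  the left side.\<close>

lemma split_coassoc:
  assumes A: "comm_alg K A" and B: "comm_alg K B" and C: "module K C"
    and x: "x \<in> carrier (FA (tensor K (tensor K A B) C))"
  shows "tassoc K (FA A) (FA B) (FA C) (tmap K (FF A B) (FA C) (fock_split A B) id
      (fock_split (tensor K A B) C x)) =
    tmap K (FA A) (FF B C) id (fock_split B C)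
      (fock_split A (tensor K B C) (fock_lin (tensor K A (tensor K B C)) (tassoc K A B C) x))"
  unfolding id_def
proof -
  let ?AB = "tensor K A B" and ?BC = "tensor K B C" and ?O = "obj P" and ?i = "\<lambda>x. x"
  let ?TAB = "FF A B" and ?TBC = "FF B C"
  let ?FT = "tensor K (FA A) ?TBC" and ?TF = "tensor K ?TAB (FA C)"
  let ?W = "tensor K ?AB C" and ?W' = "tensor K A ?BC"
  note mA = module_comm_alg[OF A] and mB = module_comm_alg[OF B] and AB = comm_alg_tensor[OF A B]
  note mBC = module_tensor[OF mB C] and mAB = module_tensor[OF mA mB]
  note FA = module_FA[OF mA] and FB = module_FA[OF mB] and FC = module_FA[OF C]
  note S1 = lin_split[OF AB C] and S2 = lin_split[OF A mB] and S3 = lin_split[OF A mBC] and S4 = lin_split[OF B C]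
  note l1 = lin_comp[OF lin_tmap[OF S2 lin_id[OF FC]] lin_tassoc[OF FA FB FC]] and l2 = lin_tmap[OF lin_id[OF FA] S4]
  note as = lin_tassoc[OF mA mB C]
  interpret FT: module K ?FT by (rule module_tensor[OF FA module_tensor[OF FB FC]])
  \<comment> \<open>Pure tensors with three factors, so that all letters can be written with
    components a_i, b_i and c_i.\<close>
  let ?S = "(\<lambda>(a, b, c). tens K ?AB C (tens K A B a b) c) ` (carrier A \<times> carrier B \<times> carrier C)"
  have det: "determining K ?W ?FT ?S"
    unfolding determining_def
  proof (intro conjI allI impI ballI)
    show "?S \<subseteq> carrier ?W" by (auto intro!: tens_closed mA mB C mAB)
    show "h t = h' t" if "lin K ?W ?FT h" "lin K ?W ?FT h'" "\<forall>s\<in>?S. h s = h' s" "t \<in> carrier ?W" for h h' t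
      by (rule tensor_eqI3_left[OF mA mB C that(1,2) _ that(4)]) (use that(3) in auto)
  qed
  let ?G = "\<lambda>y. tassoc K (FA A) (FA B) (FA C) (tmap K ?TAB (FA C) (fock_split A B) ?i y)"
  let ?H = "\<lambda>y. tmap K (FA A) ?TBC ?i (fock_split B C) (fock_split A ?BC (fock_lin ?W' (tassoc K A B C) y))"
  show "?G (fock_split ?AB C x) =
      ?H x"
  proof (rule FA_eqI_det[OF module_tensor[OF mAB C] det lin_comp[OF S1 l1]
        lin_comp[OF lin_comp[OF lin_fock_lin[OF as] S3] l2] _ x])
    fix X v p assume X: "finite X" and v: "v \<in> X \<rightarrow> ?S" and p: "p \<in> elts X"
    have "\<forall>i\<in>X. \<exists>s. s \<in> carrier A \<times> carrier B \<times> carrier C \<and>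
        v i = tens K ?AB C (tens K A B (fst s) (fst (snd s))) (snd (snd s))"
      using v by fastforce
    from bchoice[OF this] obtain g where g: "\<forall>i\<in>X. g i \<in> carrier A \<times> carrier B \<times> carrier C \<and>
        v i = tens K ?AB C (tens K A B (fst (g i)) (fst (snd (g i)))) (snd (snd (g i)))"
      by blast
    define a b c where "a i = fst (g i)" and "b i = fst (snd (g i))" and "c i = snd (snd (g i))" for i
    have a: "a \<in> X \<rightarrow> carrier A" and b: "b \<in> X \<rightarrow> carrier B" and c: "c \<in> X \<rightarrow> carrier C"
      using g by (auto simp: a_def b_def c_def mem_Times_iff)
    let ?ab = "\<lambda>i. tens K A B (a i) (b i)" and ?bc = "\<lambda>i. tens K B C (b i) (c i)"
    have ab: "?ab \<in> X \<rightarrow> carrier ?AB" by (rule tens_letters[OF A mB a b])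
    have bc: "?bc \<in> X \<rightarrow> carrier ?BC" by (rule tens_letters[OF B C b c])
    have v: "cls ?W X v p = cls ?W X (\<lambda>i. tens K ?AB C (?ab i) (c i)) p"
      by (rule cls_cong[OF X]) (use g in \<open>simp add: a_def b_def c_def\<close>)
    have bcc: "cls C X c = (\<lambda>x. cls C X c x)" ..
    let ?\<Phi> = "\<lambda>r' s. cls A (quo (quo X r') s) (blocks A (blocks A a))"
    let ?\<Psi> = "\<lambda>r'. Fmap B C (cls B (quo X r') (blocks B b)) (cls C X c)"
    let ?OT = "\<lambda>r'. PP (quo X r') X"
    let ?T3 = "\<lambda>r' s. tensor K (PP (quo (quo X r') s) (quo X r')) (?O X)"
    let ?E = "\<lambda>r'. Fmap ?AB C (cls ?AB (quo X r') (blocks ?AB ?ab)) (cls C X c) (contr P X r' p)"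
    define u where "u r' s = tmap K (PP (quo (quo X r') s) (quo X r')) (?O X)
        (contr P (quo X r') s) ?i (contr P X r' p)" for r' s
    \<comment> \<open>The term of the left side for \<open>r'\<close> followed by \<open>s\<close>
      on the quotient. Reassociation has been moved inside, to the structure in \<open>P\<close>,
      where axiom (ii) can meet it.\<close>
    define tm where "tm r' s = tmap K (FA A) ?TBC (?\<Phi> r' s) (?\<Psi> r')
      (tassoc K (?O (quo (quo X r') s)) (?O (quo X r')) (?O X) (u r' s))" for r' s
    note lC = lin_cls[OF C X c] and mX = module_obj[OF X] and t = contr_closed[OF X _ p]
    have Q: "finite (quo X r')" for r' by (rule finite_quo[OF X])
    have lB: "lin K (?O (quo X r')) (FA B) (cls B (quo X r') (blocks B b))" if "r' \<in> equivs X" for r'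
      by (rule lin_cls_quo[OF B C X that b])
    have bA: "blocks A a \<in> quo X r' \<rightarrow> carrier A" "blocks B b \<in> quo X r' \<rightarrow> carrier B" if "r' \<in> equivs X" for r'
      using blocks_Pi[OF A mB X that a] blocks_Pi[OF B C X that b] by auto
    have l\<Phi>: "lin K (?O (quo (quo X r') s)) (FA A) (?\<Phi> r' s)" if "r' \<in> equivs X" "s \<in> equivs (quo X r')" for r' s
      by (rule lin_cls_quo[OF A mB Q that(2) bA(1)[OF that(1)]])
    have l\<Psi>: "lin K (?OT r') ?TBC (?\<Psi> r')" if "r' \<in> equivs X" for r'
      by (rule lin_tmap[OF lB[OF that] lC])
    have u: "u r' s \<in> carrier (?T3 r' s)" if "r' \<in> equivs X" "s \<in> equivs (quo X r')" for r' s
      unfolding u_def by (rule lin_closed[OF lin_tmap[OF lin_contr[OF Q that(2)] lin_id[OF mX]] t[OF that(1)]])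
    have aso: "lin K (?T3 r' s) (tensor K (?O (quo (quo X r') s)) (?OT r'))
        (tassoc K (?O (quo (quo X r') s)) (?O (quo X r')) (?O X))" for r' s
      by (rule lin_tassoc[OF module_obj[OF finite_quo[OF Q]] module_obj[OF Q] mX])
    have tmc: "tm r' s \<in> carrier ?FT" if "r' \<in> equivs X" "s \<in> equivs (quo X r')" for r' s
      unfolding tm_def
      by (rule lin_closed[OF lin_tmap[OF l\<Phi>[OF that] l\<Psi>[OF that(1)]] lin_closed[OF aso u[OF that]]])
    have L: "?G (fock_split ?AB C (cls ?W X v p)) =
        finsum ?FT (\<lambda>(r', s). tm r' s) (SIGMA r':equivs X. equivs (quo X r'))"
    proof -
      have "?G (fock_split ?AB C (cls ?W X v p)) =
          finsum ?FT (\<lambda>r'. ?G (?E r')) (equivs X)"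
        unfolding v by (rule lin_split_apply[OF AB C l1 X ab c p])
      also have "\<dots> = finsum ?FT (\<lambda>r'. finsum ?FT (tm r') (equivs (quo X r'))) (equivs X)"
      proof (rule FT.finsum_cong')
        fix r' assume r': "r' \<in> equivs X"
        let ?Q = "quo X r'"
        have bl: "cls ?AB ?Q (blocks ?AB ?ab) q =
            cls ?AB ?Q (\<lambda>i. tens K A B (blocks A a i) (blocks B b i)) q" for q
        proof (rule cls_cong[OF Q])
          fix k assume k: "k \<in> ?Q"
          have "a \<in> set_decode k \<rightarrow> carrier A" "b \<in> set_decode k \<rightarrow> carrier B"
            using decode_subset[OF X r' k] a b by auto
          then show "blocks ?AB ?ab k = tens K A B (blocks A a k) (blocks B b k)"
            unfolding blocks_def
            by (rule bprod_tens[OF A B finite_set_decode decode_nonempty[OF X r' k]])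
        qed
        have lh: "lin K (PP (quo ?Q s) ?Q) ?TAB
            (Fmap A B (?\<Phi> r' s) (cls B ?Q (blocks B b)))" if "s \<in> equivs ?Q" for s
          by (rule lin_tmap[OF l\<Phi>[OF r' that] lB[OF r']])
        have e: "tmap K ?TAB (FA C) (fock_split A B) ?i
            (?E r') =
          finsum ?TF (\<lambda>s. tmap K ?TAB (FA C) (Fmap A B (?\<Phi> r' s) (cls B ?Q (blocks B b)))
            (\<lambda>x. cls C X c x) (u r' s)) (equivs ?Q)"
          unfolding u_def
        proof (rule tmap_expand_left[OF lin_cls_quo[OF AB C X r' ab] S2 lC lin_id[OF FC] lin_contr[OF Q] lh _ t[OF r']])
          fix q assume q: "q \<in> elts ?Q"
          show "fock_split A B (cls ?AB ?Q (blocks ?AB ?ab) q) =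
              finsum ?TAB (\<lambda>s. Fmap A B (?\<Phi> r' s) (cls B ?Q (blocks B b)) (contr P ?Q s q)) (equivs ?Q)"
            unfolding bl by (rule split_cls[OF A mB Q bA[OF r'] q])
        qed
        have "?G (?E r') =
          finsum ?FT (\<lambda>s. tassoc K (FA A) (FA B) (FA C) (tmap K ?TAB (FA C)
            (Fmap A B (?\<Phi> r' s) (cls B ?Q (blocks B b))) (\<lambda>x. cls C X c x) (u r' s))) (equivs ?Q)"
          unfolding e
          by (rule lin_finsum[OF lin_tassoc[OF FA FB FC]], intro funcsetI lin_closed[OF lin_tmap[OF lh lC]] u r')
        also have "\<dots> = finsum ?FT (tm r') (equivs ?Q)"
        proof (rule FT.finsum_cong')
          fix s assume s: "s \<in> equivs ?Q"
          show "tassoc K (FA A) (FA B) (FA C) (tmap K ?TAB (FA C)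
            (Fmap A B (?\<Phi> r' s) (cls B ?Q (blocks B b))) (\<lambda>x. cls C X c x) (u r' s)) = tm r' s"
            unfolding tm_def by (rule tassoc_tmap[OF l\<Phi>[OF r' s] lB[OF r'] lC u[OF r' s]])
        qed (use tmc r' in auto)
        finally show "?G (?E r') =
          finsum ?FT (tm r') (equivs ?Q)" .
      qed (use tmc in \<open>auto intro!: FT.finsum_closed\<close>)
      also have "\<dots> = finsum ?FT (\<lambda>(r', s). tm r' s) (SIGMA r':equivs X. equivs (quo X r'))"
        by (intro FT.finsum_Sigma finite_equivs X Q tmc)
      finally show ?thesis .
    qed
    \<comment> \<open>The term of the right side: contraction by \<open>r\<close>, and then by
      \<open>r'\<close> in the extracted factor, which still lives on \<open>X\<close>.\<close>
    define tR where "tR r r' = tmap K (FA A) ?TBC (\<lambda>x. cls A (quo X r) (blocks A a) x) (?\<Psi> r')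
        (tmap K (?O (quo X r)) (?OT r') ?i (contr P X r') (contr P X r p))" for r r'
    note lA = lin_cls_quo[OF A mB X _ a]
    have tRc: "tR r r' \<in> carrier ?FT" if "r \<in> equivs X" "r' \<in> equivs X" for r r'
      unfolding tR_def
      by (rule lin_closed[OF lin_tmap[OF lA[OF that(1)] l\<Psi>[OF that(2)]]
            lin_closed[OF lin_tmap[OF lin_id[OF module_obj[OF Q]] lin_contr[OF X that(2)]] t[OF that(1)]]])
    have tR0: "tR r r' = \<zero>\<^bsub>?FT\<^esub>" if "r \<in> equivs X" "r' \<in> equivs X" "\<not> r' \<subseteq> r" for r r'
      unfolding tR_def using contr_contr[OF X that(1,2) p] that(3)
      by (simp add: id_def lin_zero[OF lin_tmap[OF lA[OF that(1)] l\<Psi>[OF that(2)]]])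
    \<comment> \<open>Axiom (ii) produces the iterated quotient together with the identification
      \<open>flatten\<close> onto the quotient by \<open>r\<close>. Naturality of \<open>cls\<close>
      absorbs this identification, with \<open>blocks_flatten\<close> accounting for the
      letters.\<close>
    have tR: "tR r r' = tm r' (quo_equiv r r')" if r: "r \<in> equivs X" "r' \<in> equivs X" "r' \<subseteq> r" for r r'
    proof -
      let ?s = "quo_equiv r r'" and ?Q = "quo X r'"
      note s = quo_equiv_equivs[OF X r(2,1,3)] and fl = flatten_props[OF X r(2,1,3)]
      let ?OQ = "?O (quo ?Q ?s)" and ?f = "arr P (quo ?Q ?s) flatten"
      note QQ = finite_quo[OF Q]
      note lf = lin_arr[OF QQ fl(2), unfolded fl(1)[symmetric]]
      have lf: "lin K ?OQ (?O (quo X r)) ?f" by (rule lin_arr[OF QQ fl(2) fl(1)])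
      note iQ = lin_id[OF module_obj[OF Q[of r']]] and iX = lin_id[OF mX]
      note lff = lin_tmap[OF lf iQ] and uc = u[OF r(2) s]
      have "tmap K (PP (quo X r) ?Q) (?O X) (\<lambda>q. tmap K (?O (quo X r)) (?O ?Q) ?f ?i (contr P ?Q ?s q)) ?i (contr P X r' p)
          = tmap K (PP (quo X r) ?Q) (?O X) (tmap K (?O (quo X r)) (?O ?Q) ?f ?i) ?i (u r' ?s)"
        unfolding u_def by (rule tmap_comp[OF lin_contr[OF Q s] iX lff iX t[OF r(2)], symmetric])
      then have "tmap K (?O (quo X r)) (?OT r') ?i (contr P X r') (contr P X r p) =
          tassoc K (?O (quo X r)) (?O ?Q) (?O X) (tmap K (PP (quo X r) ?Q) (?O X)
            (tmap K (?O (quo X r)) (?O ?Q) ?f ?i) ?i (u r' ?s))"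
        using contr_contr[OF X r(1,2) p] r(3) by (simp add: id_def)
      also have "\<dots> = tmap K (?O (quo X r)) (?OT r') ?f (tmap K (?O ?Q) (?O X) ?i ?i) (tassoc K ?OQ (?O ?Q) (?O X) (u r' ?s))"
        by (rule tassoc_tmap[OF lf iQ iX uc])
      finally have e: "tmap K (?O (quo X r)) (?OT r') ?i (contr P X r') (contr P X r p) = \<dots>" .
      note uc' = lin_closed[OF aso uc]
      note lcf = lin_comp[OF lf lA[OF r(1)]] and lti = lin_tmap[OF iQ iX]
      show ?thesis
        unfolding tR_def tm_def e tmap_comp[OF lf lti lA[OF r(1)] l\<Psi>[OF r(2)] uc']
      proof (rule tmap_cong[OF lcf lin_comp[OF lti l\<Psi>[OF r(2)]] uc'])
        fix q assume q: "q \<in> carrier ?OQ"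
        show "cls A (quo X r) (blocks A a) (?f q) = ?\<Phi> r' ?s q"
          unfolding fl(1)
          by (rule cls_natural[OF mA QQ fl(2) blocks_flatten[OF A X r a] blocks_Pi[OF A mB Q s bA(1)[OF r(2)]] q])
      next
        fix y assume y: "y \<in> carrier (?OT r')"
        show "?\<Psi> r' (tmap K (?O ?Q) (?O X) ?i ?i y) = ?\<Psi> r' y"
          using tmap_id[OF module_obj[OF Q] mX y] by simp
      qed
    qed
    have R: "?H (cls ?W X v p) =
        finsum ?FT (\<lambda>(r, r'). tR r r') (SIGMA r:equivs X. equivs X)"
    proof -
      have "fock_lin ?W' (tassoc K A B C) (cls ?W X v p) = cls ?W' X (\<lambda>i. tens K A ?BC (a i) (?bc i)) p"
        unfolding v fock_lin_cls[OF as X tens_letters[OF AB C ab c] p]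
        using a b c by (intro cls_cong X tassoc_tens[OF mA mB C]) auto
      then have "?H (cls ?W X v p) =
          finsum ?FT (\<lambda>r. tmap K (FA A) ?TBC ?i (fock_split B C) (Fmap A ?BC
            (cls A (quo X r) (blocks A a)) (cls ?BC X ?bc) (contr P X r p))) (equivs X)"
        using lin_split_apply[OF A mBC l2 X a bc p] by simp
      also have "\<dots> = finsum ?FT (\<lambda>r. finsum ?FT (tR r) (equivs X)) (equivs X)"
      proof (rule FT.finsum_cong')
        fix r assume r: "r \<in> equivs X"
        show "tmap K (FA A) ?TBC ?i (fock_split B C) (Fmap A ?BC
            (cls A (quo X r) (blocks A a)) (cls ?BC X ?bc) (contr P X r p)) = finsum ?FT (tR r) (equivs X)"
          unfolding tR_def
          by (rule tmap_expand_right[OF lin_cls[OF mBC X bc] S4 lA[OF r] lin_id[OF FA] lin_contr[OF X] l\<Psi>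
                split_cls[OF B C X b c] t[OF r]])
      qed (use tRc in \<open>auto intro!: FT.finsum_closed\<close>)
      also have "\<dots> = finsum ?FT (\<lambda>(r, r'). tR r r') (SIGMA r:equivs X. equivs X)"
        by (intro FT.finsum_Sigma finite_equivs X tRc)
      finally show ?thesis .
    qed
    have "finsum ?FT (\<lambda>(r, r'). tR r r') (SIGMA r:equivs X. equivs X) =
        finsum ?FT (\<lambda>(r, r'). tR r r') (SIGMA r:equivs X. {r' \<in> equivs X. r' \<subseteq> r})"
    proof (rule FT.add.finprod_mono_neutral_cong_right)
      show "finite (SIGMA r:equivs X. equivs X)" using finite_equivs[OF X] by auto
      fix z assume z: "z \<in> (SIGMA r:equivs X. equivs X) - (SIGMA r:equivs X. {r' \<in> equivs X. r' \<subseteq> r})"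
      obtain r r' where zr: "z = (r, r')" by (cases z)
      show "(case z of (r, r') \<Rightarrow> tR r r') = \<zero>\<^bsub>?FT\<^esub>"
        unfolding zr prod.case by (rule tR0) (use z in \<open>simp_all add: zr\<close>)
    qed (auto intro!: tRc)
    also have "\<dots> = finsum ?FT (\<lambda>(r', s). tm r' s) (SIGMA r':equivs X. equivs (quo X r'))"
    proof (rule FT.finsum_bij[OF bij_quo_equiv_Sigma[OF X]])
      fix z assume z: "z \<in> (SIGMA r:equivs X. {r' \<in> equivs X. r' \<subseteq> r})"
      obtain r r' where zr: "z = (r, r')" by (cases z)
      show "(case z of (r, r') \<Rightarrow> tR r r') = (case case z of (r, r') \<Rightarrow> (r', quo_equiv r r') of (r', s) \<Rightarrow> tm r' s)"
        unfolding zr prod.case by (rule tR) (use z in \<open>simp_all add: zr\<close>)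
    qed (auto intro!: tmc)
    finally show "?G (fock_split ?AB C (cls ?W X v p)) =
      ?H (cls ?W X v p)"
      unfolding L R by simp
  qed
qed

section \<open>Cointeraction of the splitting with the first coproduct\<close>

lemma m1324_cls:
  assumes A: "module K A" and B: "module K B" and f: "finite Y" "finite X" "finite Y'" "finite X'"
    and d: "X \<inter> X' = {}" and a: "a \<in> Y \<rightarrow> carrier A" "a' \<in> Y' \<rightarrow> carrier A" and b: "b \<in> X \<union> X' \<rightarrow> carrier B"
    and u: "u \<in> carrier (tensor K (PP Y X) (PP Y' X'))"
  shows "m1324 K (FA A) (FA B) (FA A) (FA B) (FA B) (lift K (FA B) (\<lambda>(a, b). a \<otimes>\<^bsub>FA B\<^esub> b))
      (tmap K (FF A B) (FF A B)
        (Fmap A B (cls A Y a) (cls B X b)) (Fmap A B (cls A Y' a') (cls B X' b)) u) =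
    tmap K (FF A A) (FA B) (Fmap A A (cls A Y a) (cls A Y' a')) (cls B (X \<union> X') b)
      (m1324 K (obj P Y) (obj P X) (obj P Y') (obj P X') (obj P (X \<union> X')) (tw_mult P X X') u)"
proof -
  note m = f[THEN module_obj] and FA = module_FA[OF A] and FB = module_FA[OF B]
  have b': "b \<in> X \<rightarrow> carrier B" "b \<in> X' \<rightarrow> carrier B" using b by auto
  note l = lin_cls[OF A f(1) a(1)] lin_cls[OF B f(2) b'(1)] lin_cls[OF A f(3) a(2)] lin_cls[OF B f(4) b'(2)]
  note lX = lin_cls[OF B finite_UnI[OF f(2,4)] b]
  note lm = lin_mul[OF f(2,4) d refl]
  note bm = bilin_mult[OF B]
  note M = lin_m1324[OF FA FB FA FB lin_tensor_lift[OF FB FB bm]] and MO = lin_m1324[OF m lm]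
  note l12 = lin_tmap[OF l(1,2)] and l34 = lin_tmap[OF l(3,4)] and l13 = lin_tmap[OF l(1,3)]
  note lc = lin_closed[OF l(1)] lin_closed[OF l(2)] lin_closed[OF l(3)] lin_closed[OF l(4)]
  show ?thesis
  proof (rule tensor_eqI4[OF m lin_comp[OF lin_tmap[OF l12 l34] M] lin_comp[OF MO lin_tmap[OF l13 lX]] _ u], goal_cases)
    case (1 p q p' q')
    note h = 1
    note t = tens_closed[OF m(1,2) h(1,2)] tens_closed[OF m(3,4) h(3,4)] tens_closed[OF m(1,3) h(1,3)] tens_closed[OF m(2,4) h(2,4)]
    show ?case
      unfolding tmap_tens[OF l12 l34 t(1,2)] tmap_tens[OF l(1,2) h(1,2)] tmap_tens[OF l(3,4) h(3,4)]
        m1324_tens[OF FA FB FA FB lin_tensor_lift[OF FB FB bm] lc(1)[OF h(1)] lc(2)[OF h(2)] lc(3)[OF h(3)] lc(4)[OF h(4)]]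
        m1324_tens[OF m lm h] tmap_tens[OF l13 lX t(3) lin_closed[OF lm t(4)]] tmap_tens[OF l(1,3) h(1,3)]
        tensor_lift_tens[OF FB FB bm lc(2)[OF h(2)] lc(4)[OF h(4)]] mult_cls[OF B f(2,4) d b h(2,4)] ..
  qed
qed

text \<open>Contracting by an equivalence and then cutting the quotient yields the same terms as
  cutting \<open>X\<close> and contracting both parts: for the union of equivalences on two
  complementary parts this is the compatibility of \<delta> with \<Delta> in \<open>P\<close>.
  \<open>m1324_cls\<close> moves the final product of the extracted factors from the Fock space into
  \<open>P\<close>, where that axiom contains it.\<close>

lemma split_delta:
  assumes A: "comm_alg K A" and B: "module K B" and x: "x \<in> carrier (FA (tensor K A B))"
  shows "tmap K (FF A A) (FA B) (fock_delta A) id (fock_split A B x) =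
    m1324 K (FA A) (FA B) (FA A) (FA B) (FA B) (lift K (FA B) (\<lambda>(a, b). a \<otimes>\<^bsub>FA B\<^esub> b))
      (tmap K (FF A B) (FF A B) (fock_split A B) (fock_split A B)
        (fock_delta (tensor K A B) x))"
  unfolding id_def
proof -
  let ?AB = "tensor K A B" and ?O = "obj P" and ?i = "\<lambda>x. x" and ?S = "fock_split A B"
  let ?T = "FF A B" and ?TA = "FF A A"
  let ?TT = "tensor K ?T ?T" and ?U = "tensor K ?TA (FA B)"
  let ?M = "m1324 K (FA A) (FA B) (FA A) (FA B) (FA B) (lift K (FA B) (\<lambda>(a, b). a \<otimes>\<^bsub>FA B\<^esub> b))"
  note mA = module_comm_alg[OF A]
  note mAB = module_tensor[OF mA B] and FA = module_FA[OF mA] and FB = module_FA[OF B]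
  note S = lin_split[OF A B] and D = lin_delta[OF mA] and DD = lin_delta[OF mAB]
  note M = lin_m1324[OF FA FB FA FB lin_tensor_lift[OF FB FB bilin_mult[OF B]]]
  note Dl = lin_tmap[OF D lin_id[OF FB]] and SS = lin_tmap[OF S S]
  interpret U: module K ?U by (rule lin_cod[OF Dl])
  interpret TT: module K ?TT by (rule lin_cod[OF SS])
  interpret FF: module K "FF ?AB ?AB" by (rule lin_dom[OF SS])
  show "tmap K ?TA (FA B) (fock_delta A) ?i (?S x) = ?M (tmap K ?T ?T ?S ?S (fock_delta ?AB x))"
  proof (rule FA_eqI_tens[OF A B lin_comp[OF S Dl] lin_comp[OF DD lin_comp[OF SS M]] _ x], goal_cases)
    case (1 X a b p)
    note X = 1(1) and a = 1(2) and b = 1(3) and p = 1(4)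
    let ?ab = "\<lambda>i. tens K A B (a i) (b i)" and ?bl = "blocks A a"
    note ab = tens_letters[OF A B a b] and lB = lin_cls[OF B X b] and mX = module_obj[OF X] and t = contr_closed[OF X _ p]
    let ?c = "\<lambda>Y. cls A Y ?bl"
    have Q: "finite (quo X r)" for r by (rule finite_quo[OF X])
    note s = subset_split[OF mAB X ab]
    \<comment> \<open>The term for contraction by \<open>r\<close> followed by cutting the quotient
      into \<open>Y\<close> and the remaining classes.\<close>
    define tL where "tL r Y = tmap K ?TA (FA B) (Fmap A A (?c Y) (?c (quo X r - Y))) (\<lambda>x. cls B X b x)
      (tmap K (PP Y (quo X r - Y)) (?O X) (tw_comult P Y (quo X r - Y)) ?i (contr P X r p))" for r Y
    have bl: "?bl \<in> quo X r \<rightarrow> carrier A" if "r \<in> equivs X" for r by (rule blocks_Pi[OF A B X that a])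
    have lh: "lin K (PP Y (quo X r - Y)) ?TA (Fmap A A (?c Y) (?c (quo X r - Y)))"
      if "r \<in> equivs X" "Y \<in> Pow (quo X r)" for r Y
    proof -
      note s = subset_split[OF mA Q bl[OF that(1)] that(2)]
      show ?thesis by (rule lin_tmap[OF lin_cls[OF mA s(1,5)] lin_cls[OF mA s(2,6)]])
    qed
    have lc: "lin K (?O (quo X r)) (PP Y (quo X r - Y)) (tw_comult P Y (quo X r - Y))"
      if "r \<in> equivs X" "Y \<in> Pow (quo X r)" for r Y
      using subset_split[OF mA Q bl[OF that(1)] that(2)] by (intro lin_comul)
    have tLc: "tL r Y \<in> carrier ?U" if "r \<in> equivs X" "Y \<in> Pow (quo X r)" for r Y
      unfolding tL_def by (rule lin_closed[OF lin_tmap[OF lh[OF that] lB] lin_closed[OF lin_tmap[OF lc[OF that] lin_id[OF mX]] t[OF that(1)]]])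
    have L: "tmap K ?TA (FA B) (fock_delta A) ?i (?S (cls ?AB X ?ab p)) =
        finsum ?U (\<lambda>(r, Y). tL r Y) (SIGMA r:equivs X. Pow (quo X r))"
    proof -
      have "tmap K ?TA (FA B) (fock_delta A) ?i (?S (cls ?AB X ?ab p)) =
          finsum ?U (\<lambda>r. tmap K ?TA (FA B) (fock_delta A) ?i
            (Fmap A B (?c (quo X r)) (cls B X b) (contr P X r p))) (equivs X)"
        by (rule lin_split_apply[OF A B Dl X a b p])
      also have "\<dots> = finsum ?U (\<lambda>r. finsum ?U (tL r) (Pow (quo X r))) (equivs X)"
      proof (rule U.finsum_cong')
        fix r assume r: "r \<in> equivs X"
        show "tmap K ?TA (FA B) (fock_delta A) ?i (Fmap A B (?c (quo X r)) (cls B X b) (contr P X r p)) =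
            finsum ?U (tL r) (Pow (quo X r))"
          unfolding tL_def
          by (rule tmap_expand_left[OF lin_cls[OF mA Q bl[OF r]] D lB lin_id[OF FB] lc[OF r] lh[OF r]
                delta_cls[OF mA Q bl[OF r]] t[OF r]])
      qed (use tLc in \<open>auto intro!: U.finsum_closed\<close>)
      also have "\<dots> = finsum ?U (\<lambda>(r, Y). tL r Y) (SIGMA r:equivs X. Pow (quo X r))"
        using Q by (intro U.finsum_Sigma finite_equivs X tLc) auto
      finally show ?thesis .
    qed
    define h where "h Y r = Fmap A B (?c (quo Y r)) (cls B Y b)" for Y r
    define u where "u Y r s = tmap K (PP (quo Y r) Y) (PP (quo (X - Y) s) (X - Y))
      (contr P Y r) (contr P (X - Y) s) (tw_comult P Y (X - Y) p)" for Y r s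
    \<comment> \<open>The term for cutting \<open>X\<close> into \<open>Y\<close> and its
      complement, contracting these by \<open>r\<close> and \<open>s\<close>, and multiplying the
      extracted factors.\<close>
    define tR where "tR Y r s = ?M (tmap K ?T ?T (h Y r) (h (X - Y) s) (u Y r s))" for Y r s
    have aY: "a \<in> Y \<rightarrow> carrier A" "b \<in> Y \<rightarrow> carrier B" if "Y \<subseteq> X" for Y using a b that by auto
    have lH: "lin K (PP (quo Y r) Y) ?T (h Y r)" if "Y \<subseteq> X" "r \<in> equivs Y" for Y r
      unfolding h_def
      by (rule lin_tmap[OF lin_cls_quo[OF A B finite_subset[OF that(1) X] that(2) aY(1)[OF that(1)]]
            lin_cls[OF B finite_subset[OF that(1) X] aY(2)[OF that(1)]]])
    have cY: "tw_comult P Y (X - Y) p \<in> carrier (PP Y (X - Y))" if "Y \<in> Pow X" for Y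
      using s[OF that] p by (intro lin_closed[OF lin_comul]) auto
    have uc: "u Y r s \<in> carrier (tensor K (PP (quo Y r) Y) (PP (quo (X - Y) s) (X - Y)))"
      if "Y \<in> Pow X" "r \<in> equivs Y" "s \<in> equivs (X - Y)" for Y r s
      unfolding u_def
      by (rule lin_closed[OF lin_tmap[OF lin_contr[OF s(1)[OF that(1)] that(2)] lin_contr[OF s(2)[OF that(1)] that(3)]] cY[OF that(1)]])
    have huc: "tmap K ?T ?T (h Y r) (h (X - Y) s) (u Y r s) \<in> carrier ?TT"
      if "Y \<in> Pow X" "r \<in> equivs Y" "s \<in> equivs (X - Y)" for Y r s
      using that by (intro lin_closed[OF lin_tmap[OF lH lH] uc]) auto
    have tRc: "tR Y r s \<in> carrier ?U" if "Y \<in> Pow X" "r \<in> equivs Y" "s \<in> equivs (X - Y)" for Y r s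
      unfolding tR_def by (rule lin_closed[OF M huc[OF that]])
    have ct: "Fmap ?AB ?AB (cls ?AB Y ?ab) (cls ?AB (X - Y) ?ab) (tw_comult P Y (X - Y) p)
        \<in> carrier (FF ?AB ?AB)" if "Y \<in> Pow X" for Y
      by (rule lin_closed[OF lin_tmap[OF lin_cls[OF mAB s(1,5)[OF that]] lin_cls[OF mAB s(2,6)[OF that]]] cY[OF that]])
    let ?E = "\<lambda>Y. equivs Y \<times> equivs (X - Y)"
    have R: "?M (tmap K ?T ?T ?S ?S (fock_delta ?AB (cls ?AB X ?ab p))) =
        finsum ?U (\<lambda>(Y, r, s). tR Y r s) (SIGMA Y:Pow X. ?E Y)"
    proof -
      have "?M (tmap K ?T ?T ?S ?S (fock_delta ?AB (cls ?AB X ?ab p))) = finsum ?U (\<lambda>Y. ?M (tmap K ?T ?T ?S ?S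
          (Fmap ?AB ?AB (cls ?AB Y ?ab) (cls ?AB (X - Y) ?ab) (tw_comult P Y (X - Y) p)))) (Pow X)"
        unfolding delta_cls[OF mAB X ab p] by (rule lin_finsum[OF lin_comp[OF SS M]]) (use ct in auto)
      also have "\<dots> = finsum ?U (\<lambda>Y. finsum ?U (\<lambda>(r, s). tR Y r s) (?E Y)) (Pow X)"
      proof (rule U.finsum_cong')
        fix Y assume Y: "Y \<in> Pow X"
        let ?Y = "X - Y"
        note sY = s[OF Y] and c = cY[OF Y]
        have sub: "Y \<subseteq> X" "?Y \<subseteq> X" using Y by auto
        note cl = lin_cls[OF mAB sY(1,5)] lin_cls[OF mAB sY(2,6)]
        have hc1: "lin K (?O Y) ?T (\<lambda>q. h Y r (contr P Y r q))" if "r \<in> equivs Y" for r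
          by (rule lin_comp[OF lin_contr[OF sY(1) that] lH[OF sub(1) that]])
        have hc2: "lin K (?O ?Y) ?T (\<lambda>q. h ?Y r (contr P ?Y r q))" if "r \<in> equivs ?Y" for r
          by (rule lin_comp[OF lin_contr[OF sY(2) that] lH[OF sub(2) that]])
        note T = lin_cod[OF S] and m1 = module_obj[OF sY(1)] and m2 = module_obj[OF sY(2)]
        have e1: "?S (cls ?AB Y ?ab q) = finsum ?T (\<lambda>r. h Y r (contr P Y r q)) (equivs Y)" if "q \<in> elts Y" for q
          unfolding h_def by (rule split_cls[OF A B sY(1) aY[OF sub(1)] that])
        have e2: "?S (cls ?AB ?Y ?ab q) = finsum ?T (\<lambda>r. h ?Y r (contr P ?Y r q)) (equivs ?Y)" if "q \<in> elts ?Y" for q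
          unfolding h_def by (rule split_cls[OF A B sY(2) aY[OF sub(2)] that])
        note ls1 = lin_comp[OF cl(1) S] and ls2 = lin_comp[OF cl(2) S]
        \<comment> \<open>The splitting in the left factor is expanded over the equivalences on
          \<open>Y\<close>, then the one in the right factor over those on the complement.\<close>
        have "tmap K ?T ?T ?S ?S (Fmap ?AB ?AB (cls ?AB Y ?ab) (cls ?AB ?Y ?ab) (tw_comult P Y ?Y p)) =
            tmap K ?T ?T (\<lambda>q. ?S (cls ?AB Y ?ab q)) (\<lambda>q. ?S (cls ?AB ?Y ?ab q)) (tw_comult P Y ?Y p)"
          by (rule tmap_comp[OF cl S S c])
        also have "\<dots> = tmap K ?T ?T (\<lambda>q. finsum ?T (\<lambda>r. h Y r (contr P Y r q)) (equivs Y)) (\<lambda>q. ?S (cls ?AB ?Y ?ab q)) (tw_comult P Y ?Y p)"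
          by (rule tmap_cong[OF ls1 ls2 c e1 refl])
        also have "\<dots> = finsum ?TT (\<lambda>r. tmap K ?T ?T (\<lambda>q. h Y r (contr P Y r q)) (\<lambda>q. ?S (cls ?AB ?Y ?ab q)) (tw_comult P Y ?Y p)) (equivs Y)"
          by (rule tmap_sum_left[OF hc1 m1 T ls2 c])
        also have "\<dots> = finsum ?TT (\<lambda>r. finsum ?TT (\<lambda>s. tmap K ?T ?T (h Y r) (h ?Y s) (u Y r s)) (equivs ?Y)) (equivs Y)"
        proof (rule TT.finsum_cong')
          fix r assume r: "r \<in> equivs Y"
          have "tmap K ?T ?T (\<lambda>q. h Y r (contr P Y r q)) (\<lambda>q. ?S (cls ?AB ?Y ?ab q)) (tw_comult P Y ?Y p) =
              tmap K ?T ?T (\<lambda>q. h Y r (contr P Y r q)) (\<lambda>q. finsum ?T (\<lambda>s. h ?Y s (contr P ?Y s q)) (equivs ?Y)) (tw_comult P Y ?Y p)"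
            by (rule tmap_cong[OF hc1[OF r] ls2 c refl e2])
          also have "\<dots> = finsum ?TT (\<lambda>s. tmap K ?T ?T (\<lambda>q. h Y r (contr P Y r q)) (\<lambda>q. h ?Y s (contr P ?Y s q)) (tw_comult P Y ?Y p)) (equivs ?Y)"
            by (rule tmap_sum_right[OF hc2 m2 T hc1[OF r] c])
          also have "\<dots> = finsum ?TT (\<lambda>s. tmap K ?T ?T (h Y r) (h ?Y s) (u Y r s)) (equivs ?Y)"
          proof (rule TT.finsum_cong')
            fix s assume s: "s \<in> equivs ?Y"
            show "tmap K ?T ?T (\<lambda>q. h Y r (contr P Y r q)) (\<lambda>q. h ?Y s (contr P ?Y s q)) (tw_comult P Y ?Y p) =
                tmap K ?T ?T (h Y r) (h ?Y s) (u Y r s)"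
              unfolding u_def
              by (rule tmap_comp[OF lin_contr[OF sY(1) r] lin_contr[OF sY(2) s] lH[OF sub(1) r] lH[OF sub(2) s] c, symmetric])
          qed (use huc[OF Y r] in auto)
          finally show "tmap K ?T ?T (\<lambda>q. h Y r (contr P Y r q)) (\<lambda>q. ?S (cls ?AB ?Y ?ab q)) (tw_comult P Y ?Y p) =
              finsum ?TT (\<lambda>s. tmap K ?T ?T (h Y r) (h ?Y s) (u Y r s)) (equivs ?Y)" .
        qed (use huc[OF Y] in \<open>auto intro!: TT.finsum_closed\<close>)
        also have "\<dots> = finsum ?TT (\<lambda>(r, s). tmap K ?T ?T (h Y r) (h ?Y s) (u Y r s)) (?E Y)"
          by (intro TT.finsum_Sigma finite_equivs sY(1,2) huc[OF Y])
        finally have e: "tmap K ?T ?T ?S ?S (Fmap ?AB ?AB (cls ?AB Y ?ab) (cls ?AB ?Y ?ab) (tw_comult P Y ?Y p)) =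
            finsum ?TT (\<lambda>(r, s). tmap K ?T ?T (h Y r) (h ?Y s) (u Y r s)) (?E Y)" .
        have "?M (finsum ?TT (\<lambda>(r, s). tmap K ?T ?T (h Y r) (h ?Y s) (u Y r s)) (?E Y)) =
            finsum ?U (\<lambda>z. ?M (case z of (r, s) \<Rightarrow> tmap K ?T ?T (h Y r) (h ?Y s) (u Y r s))) (?E Y)"
          by (rule lin_finsum[OF M]) (use huc[OF Y] in auto)
        also have "\<dots> = finsum ?U (\<lambda>(r, s). tR Y r s) (?E Y)"
          unfolding tR_def by (rule arg_cong[where f = "\<lambda>f. finsum ?U f (?E Y)"]) (rule ext, simp split: prod.split)
        finally show "?M (tmap K ?T ?T ?S ?S (Fmap ?AB ?AB (cls ?AB Y ?ab) (cls ?AB ?Y ?ab) (tw_comult P Y ?Y p))) =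
            finsum ?U (\<lambda>(r, s). tR Y r s) (?E Y)"
          unfolding e .
      qed (use tRc in \<open>auto intro!: U.finsum_closed\<close>)
      also have "\<dots> = finsum ?U (\<lambda>(Y, rs). case rs of (r, s) \<Rightarrow> tR Y r s) (SIGMA Y:Pow X. ?E Y)"
        using X finite_subset by (intro U.finsum_Sigma finite_cartesian_product finite_equivs) (auto intro!: tRc)
      finally show ?thesis .
    qed
    show ?case
      unfolding L R
    proof (rule U.finsum_bij[OF bij_quo_subsets[OF X], symmetric])
      show "(\<lambda>(r, Y). tL r Y) \<in> (SIGMA r:equivs X. Pow (quo X r)) \<rightarrow> carrier ?U" using tLc by auto
      fix z assume z: "z \<in> (SIGMA Y:Pow X. ?E Y)"
      obtain Y r s where zz: "z = (Y, r, s)" by (cases z)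
      have Y: "Y \<in> Pow X" and r: "r \<in> equivs Y" and s': "s \<in> equivs (X - Y)" using z by (auto simp: zz)
      note sY = s[OF Y]
      have d: "Y \<inter> (X - Y) = {}" and XY: "Y \<union> (X - Y) = X" using Y by auto
      note rs = equivs_Un[OF r s' d, unfolded XY] and qU = quo_Un[OF sY(1,2) r s' d, unfolded XY]
      have q: "quo X (r \<union> s) - quo Y r = quo (X - Y) s" using qU by blast
      have blp: "?bl \<in> quo Y r \<rightarrow> carrier A" "?bl \<in> quo (X - Y) s \<rightarrow> carrier A"
        using blocks_Pi[OF A B sY(1) r, of a] blocks_Pi[OF A B sY(2) s', of a] a Y by auto
      have bX: "b \<in> Y \<union> (X - Y) \<rightarrow> carrier B" unfolding XY by (rule b)
      have pX: "p \<in> elts (Y \<union> (X - Y))" unfolding XY by (rule p)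
      \<comment> \<open>The chosen part of the quotient is the quotient of \<open>Y\<close>, so
        cutting it is the quotient-level cut that appears in the compatibility axiom.\<close>
      have "tL (r \<union> s) (quo Y r) = tR Y r s"
        unfolding tL_def tR_def q u_def h_def
          m1324_cls[OF mA B finite_quo[OF sY(1)] sY(1) finite_quo[OF sY(2)] sY(2) d blp bX uc[OF Y r s', unfolded u_def], unfolded XY]
        using contr_comul[OF sY(1,2) d r s' pX, unfolded XY] by (simp add: id_def)
      then show "(case z of (Y, rs) \<Rightarrow> case rs of (r, s) \<Rightarrow> tR Y r s) =
          (case case z of (X1, r, s) \<Rightarrow> (r \<union> s, quo X1 r) of (r, Y) \<Rightarrow> tL r Y)"
        unfolding zz by simp
    qed
  qed
qed

end

text \<open>If the values \<beta> on generators come from a linear map \<open>h\<close> that is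
  already known, they respect the relations automatically. This spares a separate proof that the
  prescribed formula for the second coproduct is well defined.\<close>

lemma presented_lift_eq:
  assumes K: "cring K" and R: "R \<subseteq> carrier (free_module K G)"
    and h: "lin K (presented K G R) U h" and \<beta>: "\<And>g. g \<in> G ==> \<beta> g = h (presented_gen K G R g)"
    and x: "x \<in> carrier (presented K G R)"
  shows "lift K U \<beta> x = h x"
proof -
  let ?p = "\<lambda>x. relation_span K G R +>\<^bsub>free_module K G\<^esub> x"
  have cl: "\<beta> g \<in> carrier U" if "g \<in> G" for g
    unfolding \<beta>[OF that] by (rule lin_closed[OF h presented_gen_closed[OF K R that]])
  note l = lin_comp[OF lin_presented_proj[OF K R] h]
  have fl: "lin K (free_module K G) U (free_lift K U \<beta>)"
    by (rule lin_free_lift[OF lin_cod[OF h]]) (use cl in auto)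
  have eq: "free_lift K U \<beta> y = h (?p y)" if "y \<in> carrier (free_module K G)" for y
    using K that
  proof (induction rule: free_module_induct)
    case (gen g)
    then show ?case using \<beta> cl by (simp add: free_lift_gen[OF lin_cod[OF h]] presented_gen_def)
  next
    case zero
    show ?case using lin_zero[OF l] lin_zero[OF fl] by simp
  next
    case (add x y)
    then show ?case using lin_add[OF l] lin_add[OF fl] by simp
  next
    case (smult c x)
    then show ?case using lin_smult[OF l] lin_smult[OF fl] by simp
  qed
  have rel: "free_lift K U \<beta> r = \<zero>\<^bsub>U\<^esub>" if "r \<in> R" for r
  proof -
    have "r \<in> carrier (free_module K G)" using that R by (rule subsetD[rotated])
    from eq[OF this] show ?thesis using presented_rel[OF K R that] lin_zero[OF h] by simp
  qed
  note L = lin_presented_lift[OF K R lin_cod[OF h] cl rel]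
  show ?thesis
  proof (rule presented_eqI[OF K R L h _ x])
    fix g assume g: "g \<in> G"
    show "lift K U \<beta> (presented_gen K G R g) = h (presented_gen K G R g)"
      using presented_lift_gen[OF K R lin_cod[OF h] cl rel g] \<beta>[OF g] by simp
  qed
qed

lemma tensor_lift_cong:
  assumes A: "module K A" and B: "module K B" and \<beta>: "bilin K A B U \<beta>"
    and eq: "\<And>a b. a \<in> carrier A ==> b \<in> carrier B ==> \<beta> a b = \<beta>' a b" and t: "t \<in> carrier (tensor K A B)"
  shows "lift K U (\<lambda>(a, b). \<beta> a b) t = lift K U (\<lambda>(a, b). \<beta>' a b) t"
proof -
  have U: "module K U" using \<beta> by (simp add: bilin_def)
  have \<beta>': "bilin K A B U \<beta>'"
    by (rule bilinI[OF A B U])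
       (rule lin_cong[OF bilin_right[OF \<beta>] eq] lin_cong[OF bilin_left[OF \<beta>] eq]; assumption)+
  show ?thesis
    by (rule tensor_eqI[OF A B lin_tensor_lift[OF A B \<beta>] lin_tensor_lift[OF A B \<beta>'] _ t])
       (simp only: tensor_lift_tens[OF A B \<beta>] tensor_lift_tens[OF A B \<beta>'] eq)
qed

text \<open>Two expressions that agree only for components in the carriers have the same expansion.
  It serves to compare the prescribed formula for the second coproduct with \<open>split_gen\<close>
  letter by letter.\<close>

lemma lift_list_cong:
  assumes A: "module K A" and B: "module K B" and U: "module K U"
    and "mlin2 K A B U (length ts) \<beta>" "set ts \<subseteq> carrier (tensor K A B)"
    and "\<And>xs. length xs = length ts ==> set xs \<subseteq> carrier A \<times> carrier B ==> \<beta> xs = \<beta>' xs"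
  shows "lift_list K U ts \<beta> = lift_list K U ts \<beta>'"
  using assms(4-)
proof (induction ts arbitrary: \<beta> \<beta>')
  case (Cons t ts)
  have eq: "lift_list K U (t # ts) \<gamma> = lift K U (\<lambda>(a, b). lift_list K U ts (\<lambda>xs. \<gamma> ((a, b) # xs))) t" for \<gamma>
    by (simp add: split_def)
  have m: "mlin2 K A B U (Suc (length ts)) \<beta>" and ts: "set ts \<subseteq> carrier (tensor K A B)" "t \<in> carrier (tensor K A B)"
    using Cons.prems by auto
  show ?case
    unfolding eq
  proof (rule tensor_lift_cong[OF A B lift_list_bilin_Cons[OF A B U m refl ts(1)] _ ts(2)])
    fix a b assume ab: "a \<in> carrier A" "b \<in> carrier B"
    then have "(a, b) \<in> carrier A \<times> carrier B" by simp
    then show "lift_list K U ts (\<lambda>xs. \<beta> ((a, b) # xs)) = lift_list K U ts (\<lambda>xs. \<beta>' ((a, b) # xs))"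
      using ab by (intro Cons.IH mlin2_Cons[OF m] ts(1) Cons.prems(3)) auto
  qed
qed simp

text \<open>A numbering receives the equivalence alone; the underlying set is recovered from it as
  its domain, because an equivalence is reflexive.\<close>

lemma block_numbering_exists: "block_numbering (\<lambda>r. rank_in (quo (Domain r) r))"
  unfolding block_numbering_def
proof (intro allI ballI)
  fix n r assume r: "r \<in> equivs {1..n}"
  have "Domain r = {1..n}" using equivsD(1)[OF r] equivsD(3)[OF r] by blast
  then show "bij_betw (rank_in (quo (Domain r) r)) (quo {1..n} r) {1..card (quo {1..n} r)}"
    using rank_in_bij[OF finite_quo[of "{1..n}" r]] by simp
qed

lemma comm_bialgebraD:
  assumes "comm_nonunital_bialgebra K V"
  shows "comm_alg K V" and "lin K V (tensor K V V) (comult V)" and "lin K V (self_module K) (counit V)"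
    and "\<And>x. x \<in> carrier V ==> tassoc K V V V (tmap K (tensor K V V) V (comult V) id (comult V x)) =
      tmap K V (tensor K V V) id (comult V) (comult V x)"
    and "\<And>x. x \<in> carrier V ==> eval_left K V (counit V) (comult V x) = x"
    and "\<And>x. x \<in> carrier V ==> eval_right K V (counit V) (comult V x) = x"
    and "\<And>x y. x \<in> carrier V ==> y \<in> carrier V ==> comult V (x \<otimes>\<^bsub>V\<^esub> y) = comult V x \<otimes>\<^bsub>tensor K V V\<^esub> comult V y"
    and "\<And>x y. x \<in> carrier V ==> y \<in> carrier V ==> counit V (x \<otimes>\<^bsub>V\<^esub> y) = counit V x \<otimes>\<^bsub>K\<^esub> counit V y"
proof -
  note d = assms[unfolded comm_nonunital_bialgebra_def nonunital_bialgebra_def coalgebra_def]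
  have m: "module K V" using d by blast
  interpret V: module K V by (rule m)
  show "comm_alg K V" using d by (simp add: comm_alg_def)
  show "lin K V (tensor K V V) (comult V)" "lin K V (self_module K) (counit V)"
    using d m by (simp_all add: lin_def module_tensor module_self V.R.is_cring)
qed (use assms in \<open>simp_all add: comm_nonunital_bialgebra_def nonunital_bialgebra_def coalgebra_def\<close>)

section \<open>The second coproduct and its axioms\<close>

context contraction_over
begin

definition fock_delta2 where
  "fock_delta2 V x = fock_split V V (fock_lin (tensor K V V) (comult V) x)"

context
  fixes V :: "('k, 'v, 'm) bialgebra_scheme"
  assumes V: "comm_nonunital_bialgebra K V"
begin

lemmas bV = comm_bialgebraD[OF V]
lemmas mV = module_comm_alg[OF bV(1)]
lemmas lD = lin_fock_lin[OF bV(2)] and lS = lin_split[OF bV(1) mV]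

lemma lin_delta2: "lin K (FA V) (FF V V) (fock_delta2 V)"
  unfolding fock_delta2_def[abs_def] by (rule lin_comp[OF lD lS])

text \<open>By naturality of the splitting the second application of \<delta>_V, on either factor,
  can be carried out on the letters before any splitting. The two iterated splittings are related by
  \<open>split_coassoc\<close>, and the letters by coassociativity of \<delta>_V.\<close>

lemma delta2_coassoc:
  assumes x: "x \<in> carrier (FA V)"
  shows "tassoc K (FA V) (FA V) (FA V) (tmap K (FF V V) (FA V) (fock_delta2 V) id (fock_delta2 V x)) =
    tmap K (FA V) (FF V V) id (fock_delta2 V) (fock_delta2 V x)"
proof -
  let ?F = "FA V" and ?VV = "tensor K V V" and ?S = "fock_split V V" and ?d = "comult V"
  let ?T = "tensor K ?F ?F" and ?L = "fock_lin ?VV ?d"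
  let ?y = "?L x"
  note i = lin_id[OF mV, unfolded id_def[symmetric]] and iF = lin_id[OF module_FA[OF mV], unfolded id_def[symmetric]]
  note VV = comm_alg_tensor[OF bV(1) bV(1)]
  have y: "?y \<in> carrier (FA ?VV)" by (rule lin_closed[OF lD x])
  have Sy: "?S ?y \<in> carrier ?T" by (rule lin_closed[OF lS y])
  \<comment> \<open>The untouched factor is written as an induced map as well, to match the form of
    \<open>split_natural\<close>.\<close>
  have idF: "fock_lin V id z = id z" if "z \<in> carrier ?F" for z
    using fock_lin_id[OF mV that, of id] by simp
  note lid = lin_fock_lin[OF i]
  note ll = lin_tmap[OF bV(2) i] and lr = lin_tmap[OF i bV(2)]
  have "tmap K ?T ?F (fock_delta2 V) id (?S ?y) = tmap K ?T ?F (\<lambda>z. ?S (?L z)) (\<lambda>z. id (fock_lin V id z)) (?S ?y)"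
    by (rule tmap_cong[OF lin_delta2 iF Sy]) (simp_all add: fock_delta2_def idF)
  also have "\<dots> = tmap K ?T ?F ?S id (tmap K (FA ?VV) ?F ?L (fock_lin V id) (?S ?y))"
    by (rule tmap_comp[OF lD lid lS iF Sy, symmetric])
  \<comment> \<open>Multiplicativity of \<delta>_V is used here: it acts on the factor whose letters
    have been multiplied over blocks.\<close>
  also have "tmap K (FA ?VV) ?F ?L (fock_lin V id) (?S ?y) =
      fock_split ?VV V (fock_lin (tensor K ?VV V) (tmap K ?VV V ?d id) ?y)"
    by (rule split_natural[OF bV(1) mV VV bV(2) i bV(7) y, symmetric])
  finally have e: "tmap K ?T ?F (fock_delta2 V) id (?S ?y) = tmap K ?T ?F ?S id
      (fock_split ?VV V (fock_lin (tensor K ?VV V) (tmap K ?VV V ?d id) ?y))" .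
  have "tassoc K ?F ?F ?F (tmap K ?T ?F (fock_delta2 V) id (?S ?y)) =
      tmap K ?F ?T id ?S (fock_split V ?VV (fock_lin (tensor K V ?VV) (tassoc K V V V)
        (fock_lin (tensor K ?VV V) (tmap K ?VV V ?d id) ?y)))"
    unfolding e by (rule split_coassoc[OF bV(1) bV(1) mV lin_closed[OF lin_fock_lin[OF ll] y]])
  also have "fock_lin (tensor K V ?VV) (tassoc K V V V) (fock_lin (tensor K ?VV V) (tmap K ?VV V ?d id) ?y) =
      fock_lin (tensor K V ?VV) (\<lambda>v. tassoc K V V V (tmap K ?VV V ?d id v)) ?y"
    by (rule fock_lin_comp[OF ll lin_tassoc[OF mV mV mV] y])
  also have "\<dots> = fock_lin (tensor K V ?VV) (\<lambda>v. tassoc K V V V (tmap K ?VV V ?d id (?d v))) x"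
    by (rule fock_lin_comp[OF bV(2) lin_comp[OF ll lin_tassoc[OF mV mV mV]] x])
  \<comment> \<open>Coassociativity of \<delta>_V, applied to each letter.\<close>
  also have "\<dots> = fock_lin (tensor K V ?VV) (\<lambda>v. tmap K V ?VV id ?d (?d v)) x"
    by (rule fock_lin_cong[OF lin_comp[OF bV(2) lin_comp[OF ll lin_tassoc[OF mV mV mV]]] bV(4) x])
  also have "\<dots> = fock_lin (tensor K V ?VV) (tmap K V ?VV id ?d) ?y"
    by (rule fock_lin_comp[OF bV(2) lr x, symmetric])
  also have "fock_split V ?VV \<dots> = tmap K ?F (FA ?VV) (fock_lin V id) ?L (?S ?y)"
    by (rule split_natural[OF bV(1) mV bV(1) i bV(2) _ y]) simp
  also have "tmap K ?F ?T id ?S \<dots> = tmap K ?F ?T (\<lambda>z. id (fock_lin V id z)) (\<lambda>z. ?S (?L z)) (?S ?y)"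
    by (rule tmap_comp[OF lid lD iF lS Sy])
  also have "\<dots> = tmap K ?F ?T id (fock_delta2 V) (?S ?y)"
    by (rule tmap_cong[OF lin_comp[OF lid iF] lin_comp[OF lD lS] Sy]) (simp_all add: fock_delta2_def idF)
  finally show ?thesis unfolding fock_delta2_def[of V x] .
qed

text \<open>The counit identities of the splitting turn the evaluations into maps induced by an
  evaluation of letters, which after \<delta>_V is the identity on letters. For the left one the
  counit of \<open>V\<close> has to be a character.\<close>

lemma delta2_counit:
  assumes x: "x \<in> carrier (FA V)"
  shows "eval_left K (FA V) (fock_eps2 (counit V)) (fock_delta2 V x) = x"
    and "eval_right K (FA V) (fock_eps2 (counit V)) (fock_delta2 V x) = x"
proof -
  note y = lin_closed[OF lD x]
  show "eval_left K (FA V) (fock_eps2 (counit V)) (fock_delta2 V x) = x"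
    using split_counit_left[OF bV(1) mV bV(3,8) y] fock_lin_comp[OF bV(2) lin_eval_left[OF mV bV(3)] x]
      fock_lin_id[OF mV x bV(5)] unfolding fock_delta2_def by simp
  show "eval_right K (FA V) (fock_eps2 (counit V)) (fock_delta2 V x) = x"
    using split_counit_right[OF bV(1) mV bV(3) y] fock_lin_comp[OF bV(2) lin_eval_right[OF mV bV(3)] x]
      fock_lin_id[OF mV x bV(6)] unfolding fock_delta2_def by simp
qed

lemma delta2_mult:
  assumes "x \<in> carrier (FA V)" "y \<in> carrier (FA V)"
  shows "fock_delta2 V (x \<otimes>\<^bsub>FA V\<^esub> y) =
    fock_delta2 V x \<otimes>\<^bsub>FF V V\<^esub> fock_delta2 V y"
  unfolding fock_delta2_def fock_lin_mult[OF bV(2) assms]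
  by (rule split_mult[OF bV(1) mV lin_closed[OF lD assms(1)] lin_closed[OF lD assms(2)]])

lemma delta2_one: "fock_delta2 V \<one>\<^bsub>FA V\<^esub> = \<one>\<^bsub>FF V V\<^esub>"
  unfolding fock_delta2_def fock_lin_one[OF bV(2)] by (rule split_one[OF bV(1) mV])

lemma delta2_eps:
  assumes x: "x \<in> carrier (FA V)"
  shows "eval_left K (FA V) (fock_eps) (fock_delta2 V x) = fock_eps x \<odot>\<^bsub>FA V\<^esub> \<one>\<^bsub>FA V\<^esub>"
  unfolding fock_delta2_def split_eps[OF bV(1) mV lin_closed[OF lD x]] eps_natural[OF bV(2) x] ..

lemma delta2_delta:
  assumes x: "x \<in> carrier (FA V)"
  shows "tmap K (FF V V) (FA V) (fock_delta V) id (fock_delta2 V x) =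
    m1324 K (FA V) (FA V) (FA V) (FA V) (FA V) (lift K (FA V) (\<lambda>(a, b). a \<otimes>\<^bsub>FA V\<^esub> b))
      (tmap K (FF V V) (FF V V) (fock_delta2 V) (fock_delta2 V) (fock_delta V x))"
  unfolding fock_delta2_def split_delta[OF bV(1) mV lin_closed[OF lD x]] delta_natural[OF bV(2) x]
    tmap_comp[OF lD lD lS lS lin_closed[OF lin_delta[OF mV] x]] ..

text \<open>Compatibility of \<open>f\<close> with the coproducts of \<open>V\<close> and
  \<open>W\<close> is used on the letters, compatibility with the products when \<open>f\<close> is
  moved through the splitting.\<close>

lemma delta2_natural:
  assumes W: "comm_nonunital_bialgebra K W" and f: "nonunital_bialgebra_hom K V W f" and x: "x \<in> carrier (FA V)"
  shows "fock_delta2 W (fock_lin W f x) =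
    Fmap W W (fock_lin W f) (fock_lin W f) (fock_delta2 V x)"
proof -
  note bW = comm_bialgebraD[OF W] note mW = module_comm_alg[OF bW(1)]
  have lf: "lin K V W f" using f mV mW by (simp add: nonunital_bialgebra_hom_def lin_def)
  have m: "f (a \<otimes>\<^bsub>V\<^esub> b) = f a \<otimes>\<^bsub>W\<^esub> f b" if "a \<in> carrier V" "b \<in> carrier V" for a b
    using f that by (simp add: nonunital_bialgebra_hom_def)
  have c: "comult W (f a) = tmap K W W f f (comult V a)" if "a \<in> carrier V" for a
    using f that by (simp add: nonunital_bialgebra_hom_def)
  have "fock_lin (tensor K W W) (comult W) (fock_lin W f x) =
      fock_lin (tensor K W W) (\<lambda>v. comult W (f v)) x"
    by (rule fock_lin_comp[OF lf bW(2) x])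
  also have "\<dots> = fock_lin (tensor K W W) (\<lambda>v. tmap K W W f f (comult V v)) x"
    by (rule fock_lin_cong[OF lin_comp[OF lf bW(2)] c x])
  also have "\<dots> = fock_lin (tensor K W W) (tmap K W W f f) (fock_lin (tensor K V V) (comult V) x)"
    by (rule fock_lin_comp[OF bV(2) lin_tmap[OF lf lf] x, symmetric])
  finally show ?thesis
    unfolding fock_delta2_def
    using split_natural[OF bV(1) mV bW(1) lf lf m lin_closed[OF lD x]] by simp
qed

text \<open>The prescribed formula numbers the classes by \<sigma>, whereas \<open>split_gen\<close>
  uses them as indices directly; \<open>cls_numbered\<close> shows that both give the same class. As
  \<sigma> is arbitrary, the formula holds for every choice of numbering.\<close>

lemma delta2_gens:
  assumes \<sigma>: "block_numbering \<sigma>" and g: "(vs, p) \<in> fock_gens P V"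
  shows "fock_delta2 V (fock_cls K P V vs p) = fock_comult2_gen K P V \<sigma> vs p"
proof -
  let ?n = "length vs" and ?F = "fock_space K P V" and ?T = "FF V V"
  let ?X = "{1..?n}" and ?ts = "map (comult V) vs"
  have X: "finite ?X" by simp
  note p = gens_obj[OF g]
  interpret T: module K ?T by (rule lin_cod[OF lS])
  have ts: "length ?ts = ?n" "set ?ts \<subseteq> carrier (tensor K V V)"
    using g lin_closed[OF bV(2)] by (auto simp: fock_gens_def)
  have tg: "(?ts, p) \<in> fock_gens P (tensor K V V)" using ts p by (simp add: fock_gens_def)
  have e: "tens K ?F ?F = tens K (FA V) (FA V)" "tensor_space K ?F ?F = tensor_space K (FA V) (FA V)"
    by (rule tensor_space_fields_cong[symmetric]; simp add: fock_alg_fields)+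
  have e': "finsum (tensor K ?F ?F) = finsum ?T" "lift K (tensor K ?F ?F) = lift K ?T"
    by (rule finsum_fields_cong lift_fields_cong; simp only: tensor_fields e)+
  have e3: "lift_list K (tensor K ?F ?F) ts \<beta> = lift_list K ?T ts \<beta>" for ts :: "('k, 'v, 'v) tensor list" and \<beta>
    by (induction ts arbitrary: \<beta>) (simp_all add: e')
  have m: "module K (obj P (quo ?X r))" "module K (obj P ?X)" for r by (auto intro: module_obj finite_quo)
  have "fock_delta2 V (fock_cls K P V vs p) = split_gen V V ?ts p"
    unfolding fock_delta2_def fock_lin_gens[OF bV(2) g] by (rule split_gens[OF bV(1) mV tg])
  also have "\<dots> = fock_comult2_gen K P V \<sigma> vs p"
    unfolding split_gen_def fock_comult2_gen_def Let_def ts(1) e e' e3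
  proof (rule sym, rule T.finsum_cong'[OF refl])
    show "(\<lambda>r. lift K ?T (\<lambda>(p1, p2). lift_list K ?T ?ts (\<lambda>xs. tens K (FA V) (FA V)
        (cls V (quo ?X r) (blocks V (\<lambda>i. fst (xs ! (i - 1)))) p1) (cls V ?X (\<lambda>i. snd (xs ! (i - 1))) p2)))
        (contr P ?X r p)) \<in> equivs ?X \<rightarrow> carrier ?T"
      by (intro funcsetI lin_closed[OF lin_tensor_lift[OF m bilin_split[OF bV(1) mV _ ts]] contr_closed[OF X _ p]])
    fix r assume r: "r \<in> equivs ?X"
    let ?Q = "quo ?X r"
    note t = contr_closed[OF X r p]
    have \<sigma>r: "bij_betw (\<sigma> r) ?Q {1..card ?Q}" using \<sigma> r unfolding block_numbering_def by blast
    show "lift K ?T (\<lambda>(p1, p2). lift_list K ?T ?ts (\<lambda>xs. tens K (FA V) (FA V)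
        (fock_cls K P V (block_word V \<sigma> r (map fst xs)) (arr P ?Q (\<sigma> r) p1)) (fock_cls K P V (map snd xs) p2)))
        (contr P ?X r p) =
      lift K ?T (\<lambda>(p1, p2). lift_list K ?T ?ts (\<lambda>xs. tens K (FA V) (FA V)
        (cls V ?Q (blocks V (\<lambda>i. fst (xs ! (i - 1)))) p1) (cls V ?X (\<lambda>i. snd (xs ! (i - 1))) p2)))
        (contr P ?X r p)"
    proof (rule sym, rule tensor_lift_cong[OF m bilin_split[OF bV(1) mV r ts] _ t],
        rule lift_list_cong[OF mV mV T.module_axioms _ ts(2)])
      show "mlin2 K V V ?T (length ?ts) (\<lambda>xs. tens K (FA V) (FA V)
          (cls V ?Q (blocks V (\<lambda>i. fst (xs ! (i - 1)))) p1) (cls V ?X (\<lambda>i. snd (xs ! (i - 1))) p2))"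
        if "p1 \<in> elts ?Q" "p2 \<in> elts ?X" for p1 p2
        unfolding ts(1) by (rule mlin2_split[OF bV(1) mV r that])
    next
      fix p1 p2 and xs :: "('v \<times> 'v) list"
      assume p1: "p1 \<in> elts ?Q" and p2: "p2 \<in> elts ?X"
        and xs: "length xs = length ?ts" "set xs \<subseteq> carrier V \<times> carrier V"
      let ?a = "map fst xs" and ?b = "map snd xs"
      have n: "length xs = ?n" using xs by simp
      have a: "(?a, p) \<in> fock_gens P V" and b: "(?b, p2) \<in> fock_gens P V"
        using n xs(2) p p2 by (auto simp: fock_gens_def)
      have aX: "(\<lambda>i. ?a ! (i - 1)) \<in> ?X \<rightarrow> carrier V" using letters_upto[OF a] n by simp
      have ix: "i - 1 < length xs" if "i \<in> ?X" for i using that n unfolding atLeastAtMost_iff by arith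
      have "cls V ?X (\<lambda>i. snd (xs ! (i - 1))) p2 = cls V ?X (\<lambda>i. ?b ! (i - 1)) p2"
        by (rule cls_cong[OF X]) (simp add: nth_map[OF ix])
      also have "\<dots> = fock_cls K P V ?b p2" using cls_upto[OF b] n by simp
      finally have 2: "cls V ?X (\<lambda>i. snd (xs ! (i - 1))) p2 = fock_cls K P V ?b p2" .
      \<comment> \<open>Both sides multiply the letters of a class in increasing order of index, so
        that the words agree literally.\<close>
      have bw: "block_word V \<sigma> r ?a = map (\<lambda>j. blocks V (\<lambda>i. ?a ! (i - 1)) (inv_into ?Q (\<sigma> r) j)) [1..<Suc (card ?Q)]"
        unfolding block_word_def Let_def length_map n
      proof (rule map_cong[OF refl])
        fix j assume "j \<in> set [1..<Suc (card ?Q)]"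
        then have "j \<in> \<sigma> r ` ?Q" using \<sigma>r by (auto simp: bij_betw_def)
        then have "inv_into ?Q (\<sigma> r) j \<in> ?Q" by (rule inv_into_into)
        then have "set_decode (inv_into ?Q (\<sigma> r) j) \<subseteq> {1..length ?a}"
          using decode_subset[OF X r] n by simp
        then show "word_prod V (restr ?a (set_decode (inv_into ?Q (\<sigma> r) j))) =
            blocks V (\<lambda>i. ?a ! (i - 1)) (inv_into ?Q (\<sigma> r) j)"
          by (simp add: restr_eq blocks_def bprod_def)
      qed
      have "cls V ?Q (blocks V (\<lambda>i. fst (xs ! (i - 1)))) p1 = cls V ?Q (blocks V (\<lambda>i. ?a ! (i - 1))) p1"
        by (intro cls_cong finite_quo X blocks_cong[OF X r]) (simp_all add: nth_map[OF ix])
      also have "\<dots> = fock_cls K P V (block_word V \<sigma> r ?a) (arr P ?Q (\<sigma> r) p1)"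
        unfolding bw
        by (rule cls_numbered[OF mV finite_quo[OF X] \<sigma>r blocks_Pi[OF bV(1) mV X r aX] p1, symmetric])
      finally show "tens K (FA V) (FA V) (cls V ?Q (blocks V (\<lambda>i. fst (xs ! (i - 1)))) p1)
          (cls V ?X (\<lambda>i. snd (xs ! (i - 1))) p2) =
        tens K (FA V) (FA V) (fock_cls K P V (block_word V \<sigma> r ?a) (arr P ?Q (\<sigma> r) p1)) (fock_cls K P V ?b p2)"
        unfolding 2 by simp
    qed
  qed
  finally show ?thesis .
qed

end

end

text \<open>\<open>fock\<close> extends the fields of \<open>fock_alg\<close> by coproducts and
  counits. Tensor products and the maps between them read only the fields compared here, so the
  axioms proved over one record hold over the other.\<close>

definition same_alg :: "('k, 'a, 'm) module_scheme \<Rightarrow> ('k, 'a, 'n) module_scheme \<Rightarrow> bool" where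
  "same_alg A B \<longleftrightarrow> carrier A = carrier B \<and> zero A = zero B \<and> add A = add B \<and> smult A = smult B \<and>
     mult A = mult B \<and> one A = one B"

lemma same_algD:
  assumes "same_alg A B"
  shows "carrier A = carrier B" "zero A = zero B" "add A = add B" "smult A = smult B" "mult A = mult B" "one A = one B"
  using assms by (auto simp: same_alg_def)

lemma same_alg_refl: "same_alg A A"
  by (simp add: same_alg_def)

lemma same_alg_tensor:
  assumes "same_alg A' A" "same_alg B' B"
  shows "tensor K A' B' = tensor K A B" and "tens K A' B' = tens K A B" and "tmap K A' B' = tmap K A B"
proof -
  note d = same_algD[OF assms(1)] same_algD[OF assms(2)]
  have e: "tensor_space K A' B' = tensor_space K A B" "tens K A' B' = tens K A B"
    by (rule tensor_space_fields_cong; simp add: d)+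
  show t: "tensor K A' B' = tensor K A B" by (simp add: tensor_def e d)
  show "tens K A' B' = tens K A B" by (rule e)
  show "tmap K A' B' = tmap K A B" by (intro ext) (simp add: tmap_def t e)
qed

lemma same_alg_lift:
  assumes "same_alg A' A"
  shows "lift K A' = lift K A" "eval_left K A' = eval_left K A" "eval_right K A' = eval_right K A"
proof -
  show l: "lift K A' = lift K A" by (rule lift_fields_cong) (simp_all add: same_algD[OF assms])
  show "eval_left K A' = eval_left K A" "eval_right K A' = eval_right K A"
    by (simp_all add: fun_eq_iff eval_left_def eval_right_def l same_algD[OF assms])
qed

lemma same_alg_maps:
  assumes "same_alg A' A"
  shows "tassoc K A' A' A' = tassoc K A A A" and "m1324 K A' A' A' A' A' = m1324 K A A A A A"
proof -
  note s = assms same_alg_refl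
  note t = same_alg_tensor[OF assms assms] same_alg_tensor[OF assms same_alg_refl] same_alg_tensor[OF same_alg_refl assms]
  show "tassoc K A' A' A' = tassoc K A A A"
    by (intro ext) (simp only: tassoc_def Let_def t)
  show "m1324 K A' A' A' A' A' = m1324 K A A A A A"
    by (intro ext) (simp only: m1324_def tswap_def Let_def t)
qed

text \<open>Agreement of the two coproducts is assumed on the carrier only: the second coproduct of
  \<open>fock\<close> is a lift of the prescribed formula, and off the carrier it need not coincide
  with the composite defining \<open>fock_delta2\<close>.\<close>

lemma coalgebra_transfer:
  assumes s: "same_alg C' C" and lin: "lin K C (tensor K C C) \<Delta>" "lin K C (self_module K) \<epsilon>"
    and eq: "\<And>x. x \<in> carrier C ==> \<Delta>' x = \<Delta> x"
    and coassoc: "\<And>x. x \<in> carrier C ==> tassoc K C C C (tmap K (tensor K C C) C \<Delta> id (\<Delta> x)) =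
      tmap K C (tensor K C C) id \<Delta> (\<Delta> x)"
    and counit: "\<And>x. x \<in> carrier C ==> eval_left K C \<epsilon> (\<Delta> x) = x" "\<And>x. x \<in> carrier C ==> eval_right K C \<epsilon> (\<Delta> x) = x"
  shows "coalgebra K C' \<Delta>' \<epsilon>"
proof -
  note C = lin_dom[OF lin(1)] and d = same_algD[OF s]
  note t = same_alg_tensor[OF s s] same_alg_tensor[OF s same_alg_refl] same_alg_tensor[OF same_alg_refl s]
    same_alg_maps[OF s] same_alg_lift[OF s]
  note i = lin_id[OF C, unfolded id_def[symmetric]]
  have l': "lin K C' (tensor K C C) \<Delta>'" "lin K C' (self_module K) \<epsilon>"
    using lin_fields_cong[OF lin_cong[OF lin(1) eq[symmetric]] refl refl refl refl d(1-4)]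
      lin_fields_cong[OF lin(2) refl refl refl refl d(1-4)] by simp_all
  have e: "tmap K (tensor K C C) C \<Delta>' id t = tmap K (tensor K C C) C \<Delta> id t"
    "tmap K C (tensor K C C) id \<Delta>' t = tmap K C (tensor K C C) id \<Delta> t" if "t \<in> carrier (tensor K C C)" for t
    by (rule tmap_cong[OF lin(1) i that eq[symmetric] refl, symmetric]
        tmap_cong[OF i lin(1) that refl eq[symmetric], symmetric]; assumption)+
  show ?thesis
    unfolding coalgebra_def t d
    using l' coassoc counit e[OF lin_closed[OF lin(1)]] by (simp add: lin_def eq)
qed

section \<open>The double bialgebra \<open>fock\<close> and its morphisms\<close>

context contraction_over
begin

lemma fock_same: "same_alg (fock K P V) (FA V)"
  by (simp add: same_alg_def fock_def fock_alg_def Let_def)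

lemma fock_maps:
  shows "comult (fock K P V) = fock_delta V" and "counit (fock K P V) = fock_eps"
    and "counit2 (fock K P V) = fock_eps2 (counit V)"
proof -
  let ?F = "fock_space K P V"
  have e: "tensor_space K ?F ?F = tensor_space K (FA V) (FA V)"
    by (rule tensor_space_fields_cong[symmetric]; simp add: fock_alg_fields)
  have l: "lift K (tensor K ?F ?F) = lift K (FF V V)"
    by (rule lift_fields_cong; simp only: tensor_fields e)
  show "comult (fock K P V) = fock_delta V"
    by (simp add: fock_def Let_def fock_delta_def l)
  show "counit (fock K P V) = fock_eps"
    by (simp add: fock_def Let_def fock_eps_def)
  show "counit2 (fock K P V) = fock_eps2 (counit V)"
    by (simp add: fock_def Let_def fock_eps2_def fock_counit2_gen_def[abs_def])
qed

lemma fock_map_eq: "fock_map K P W f = fock_lin W f"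
  by (simp add: fock_map_def fock_lin_def)

text \<open>The formula agrees with \<open>fock_delta2\<close> on generators for the numbering
  selected by \<open>SOME\<close>, which exists by \<open>block_numbering_exists\<close>;
  \<open>presented_lift_eq\<close> then identifies the two maps.\<close>

lemma fock_comult2:
  assumes V: "comm_nonunital_bialgebra K V" and x: "x \<in> carrier (FA V)"
  shows "comult2 (fock K P V) x = fock_delta2 V x"
proof -
  let ?F = "fock_space K P V" and ?\<sigma> = "SOME \<sigma>. block_numbering \<sigma>"
  have \<sigma>: "block_numbering ?\<sigma>" by (rule someI[of block_numbering]) (rule block_numbering_exists)
  have e: "tensor_space K ?F ?F = tensor_space K (FA V) (FA V)"
    by (rule tensor_space_fields_cong[symmetric]; simp add: fock_alg_fields)
  have l: "lift K (tensor K ?F ?F) = lift K (FF V V)"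
    by (rule lift_fields_cong; simp only: tensor_fields e)
  have "lift K (FF V V) (\<lambda>(vs, p). fock_comult2_gen K P V ?\<sigma> vs p) x = fock_delta2 V x"
  proof (rule presented_lift_eq[OF K fock_rels_closed])
    show "lin K (presented K (fock_gens P V) (fock_rels K P V)) (FF V V) (fock_delta2 V)"
      using lin_FA_domD[OF module_comm_alg[OF comm_bialgebraD(1)[OF V]] lin_delta2[OF V]] by (simp add: fock_space_def)
    show "(\<lambda>(vs, p). fock_comult2_gen K P V ?\<sigma> vs p) g = fock_delta2 V (presented_gen K (fock_gens P V) (fock_rels K P V) g)"
      if "g \<in> fock_gens P V" for g
      using delta2_gens[OF V \<sigma>, of "fst g" "snd g"] that by (simp add: fock_cls_def split_def)
    show "x \<in> carrier (presented K (fock_gens P V) (fock_rels K P V))"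
      using x by (simp add: fock_alg_fields fock_space_def)
  qed (rule module_comm_alg[OF comm_bialgebraD(1)[OF V]])
  then show ?thesis by (simp add: fock_def Let_def l)
qed

lemma fock_double_bialgebra:
  assumes V: "comm_nonunital_bialgebra K V"
  shows "is_double_bialgebra K (fock K P V)"
proof -
  let ?F = "FA V" and ?A = "fock K P V" and ?T = "FF V V"
  note mV = module_comm_alg[OF comm_bialgebraD(1)[OF V]] and s = fock_same[of V]
  note d = same_algD[OF s] and D = lin_delta[OF mV] and D2 = lin_delta2[OF V]
  note t = same_alg_tensor[OF s s] same_alg_tensor[OF s same_alg_refl] same_alg_tensor[OF same_alg_refl s]
    same_alg_maps[OF s] same_alg_lift[OF s] fock_maps
  have m: "module K ?A" by (rule module_fields_cong[OF module_FA[OF mV] d(1-4)])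
  have alg: "nonunital_algebra K ?F"
    using bilin_mult[OF mV] mult_FA_assoc[OF mV] by (simp add: nonunital_algebra_iff)
  have alg': "nonunital_algebra K ?A"
    using alg m unfolding nonunital_algebra_def linear_map_def d by simp
  have mon: "monoid ?A"
    using bilin_closed[OF bilin_mult[OF mV]] mult_FA_assoc[OF mV] one_FA_closed[OF mV] one_mult_FA[OF mV]
    unfolding monoid_def d by blast
  have co1: "coalgebra K ?A (comult ?A) (counit ?A)"
    unfolding fock_maps
    by (rule coalgebra_transfer[OF s D lin_eps[OF mV] refl delta_coassoc[OF mV] delta_counit[OF mV]])
  have co2: "coalgebra K ?A (comult2 ?A) (counit2 ?A)"
    unfolding fock_maps
    by (rule coalgebra_transfer[OF s D2 lin_eps2[OF comm_bialgebraD(3)[OF V]] fock_comult2[OF V]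
          delta2_coassoc[OF V] delta2_counit[OF V]])
  have T2: "tmap K ?T ?T (comult2 ?A) (comult2 ?A) u = tmap K ?T ?T (fock_delta2 V) (fock_delta2 V) u"
    if "u \<in> carrier ?T" for u
    by (rule tmap_cong[OF D2 D2 that fock_comult2[OF V, symmetric] fock_comult2[OF V, symmetric], symmetric])
  have mc: "x \<otimes>\<^bsub>?F\<^esub> y \<in> carrier ?F" if "x \<in> carrier ?F" "y \<in> carrier ?F" for x y
    by (rule bilin_closed[OF bilin_mult[OF mV] that])
  note oc = one_FA_closed[OF mV]
  have bi: "unital_bialgebra K ?A"
    unfolding unital_bialgebra_def nonunital_bialgebra_def
    using alg' mon co1 delta_mult[OF mV] eps_mult[OF mV] delta_one[OF mV] eps_one[OF mV]
    unfolding t d by blast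
  show ?thesis
    unfolding is_double_bialgebra_def
  proof (intro conjI ballI bi co2)
    fix x assume "x \<in> carrier ?A"
    then have x: "x \<in> carrier ?F" unfolding d .
    note Dx = T2[OF lin_closed[OF D x]]
    show "tmap K (tensor K ?A ?A) ?A (comult ?A) id (comult2 ?A x) =
        m1324 K ?A ?A ?A ?A ?A (lift K ?A (\<lambda>(a, b). a \<otimes>\<^bsub>?A\<^esub> b))
          (tmap K (tensor K ?A ?A) (tensor K ?A ?A) (comult2 ?A) (comult2 ?A) (comult ?A x))"
      unfolding t d fock_comult2[OF V x] Dx by (rule delta2_delta[OF V x])
    show "eval_left K ?A (counit ?A) (comult2 ?A x) = counit ?A x \<odot>\<^bsub>?A\<^esub> \<one>\<^bsub>?A\<^esub>"
      unfolding t d fock_comult2[OF V x] by (rule delta2_eps[OF V x])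
    fix y assume "y \<in> carrier ?A"
    then have y: "y \<in> carrier ?F" unfolding d .
    show "comult2 ?A (x \<otimes>\<^bsub>?A\<^esub> y) = comult2 ?A x \<otimes>\<^bsub>tensor K ?A ?A\<^esub> comult2 ?A y"
      unfolding t d fock_comult2[OF V x] fock_comult2[OF V y] fock_comult2[OF V mc[OF x y]]
      by (rule delta2_mult[OF V x y])
  next
    show "comult2 ?A \<one>\<^bsub>?A\<^esub> = \<one>\<^bsub>tensor K ?A ?A\<^esub>"
      unfolding t d fock_comult2[OF V oc] by (rule delta2_one[OF V])
  qed
qed

text \<open>A lift of ill-defined values would be meaningless. These equations confirm that the
  structure maps do take the prescribed values on generators.\<close>

lemma fock_gens_formulas:
  assumes V: "comm_nonunital_bialgebra K V" and g: "(vs, p) \<in> fock_gens P V"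
  shows "(ws, q) \<in> fock_gens P V ==>
      fock_cls K P V vs p \<otimes>\<^bsub>fock K P V\<^esub> fock_cls K P V ws q = fock_mult_gen K P V vs p ws q"
    and "comult (fock K P V) (fock_cls K P V vs p) = fock_comult_gen K P V vs p"
    and "counit (fock K P V) (fock_cls K P V vs p) = fock_counit_gen K P vs p"
    and "block_numbering \<sigma> ==> comult2 (fock K P V) (fock_cls K P V vs p) = fock_comult2_gen K P V \<sigma> vs p"
    and "counit2 (fock K P V) (fock_cls K P V vs p) = fock_counit2_gen K P V vs p"
proof -
  note mV = module_comm_alg[OF comm_bialgebraD(1)[OF V]]
  have c: "fock_cls K P V vs p \<in> carrier (FA V)"
    using cls_closed[OF mV _ letters_upto[OF g] gens_obj[OF g]] cls_upto[OF g] by simp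
  show "fock_cls K P V vs p \<otimes>\<^bsub>fock K P V\<^esub> fock_cls K P V ws q = fock_mult_gen K P V vs p ws q"
    if "(ws, q) \<in> fock_gens P V"
    unfolding same_algD[OF fock_same] by (rule mult_gens[OF mV g that])
  show "comult (fock K P V) (fock_cls K P V vs p) = fock_comult_gen K P V vs p"
    unfolding fock_maps by (rule delta_gens[OF mV g])
  show "counit (fock K P V) (fock_cls K P V vs p) = fock_counit_gen K P vs p"
    unfolding fock_maps by (rule eps_gens[OF mV g])
  show "comult2 (fock K P V) (fock_cls K P V vs p) = fock_comult2_gen K P V \<sigma> vs p" if "block_numbering \<sigma>"
    unfolding fock_comult2[OF V c] by (rule delta2_gens[OF V that g])
  show "counit2 (fock K P V) (fock_cls K P V vs p) = fock_counit2_gen K P V vs p"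
    unfolding fock_maps fock_counit2_gen_def by (rule eps2_gens[OF comm_bialgebraD(3)[OF V] g])
qed

lemma bialgebra_hom_lin:
  assumes "comm_nonunital_bialgebra K V" "comm_nonunital_bialgebra K W" "nonunital_bialgebra_hom K V W f"
  shows "lin K V W f"
  using assms module_comm_alg[OF comm_bialgebraD(1)[OF assms(1)]] module_comm_alg[OF comm_bialgebraD(1)[OF assms(2)]]
  by (simp add: nonunital_bialgebra_hom_def lin_def)

lemma fock_map_hom:
  assumes V: "comm_nonunital_bialgebra K V" and W: "comm_nonunital_bialgebra K W" and f: "nonunital_bialgebra_hom K V W f"
  shows "double_bialgebra_hom K (fock K P V) (fock K P W) (fock_map K P W f)"
proof -
  note lf = bialgebra_hom_lin[OF V W f] and sV = fock_same[of V] and sW = fock_same[of W]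
  note L = lin_fock_lin[OF lf] and dV = same_algD[OF sV] and dW = same_algD[OF sW]
  have e: "counit V v = counit W (f v)" if "v \<in> carrier V" for v
    using f that by (simp add: nonunital_bialgebra_hom_def)
  show ?thesis
    unfolding double_bialgebra_hom_def fock_map_eq
  proof (intro conjI ballI)
    show "linear_map K (fock K P V) (fock K P W) (fock_lin W f)"
      using L unfolding lin_def linear_map_def dV dW by blast
    show "fock_lin W f \<one>\<^bsub>fock K P V\<^esub> = \<one>\<^bsub>fock K P W\<^esub>"
      unfolding dV dW by (rule fock_lin_one[OF lf])
    fix x assume "x \<in> carrier (fock K P V)"
    then have x: "x \<in> carrier (FA V)" unfolding dV .
    show "comult (fock K P W) (fock_lin W f x) =
        tmap K (fock K P W) (fock K P W) (fock_lin W f) (fock_lin W f) (comult (fock K P V) x)"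
      unfolding fock_maps same_alg_tensor[OF sW sW] by (rule delta_natural[OF lf x])
    show "counit (fock K P W) (fock_lin W f x) = counit (fock K P V) x"
      unfolding fock_maps by (rule eps_natural[OF lf x])
    show "comult2 (fock K P W) (fock_lin W f x) =
        tmap K (fock K P W) (fock K P W) (fock_lin W f) (fock_lin W f) (comult2 (fock K P V) x)"
      unfolding fock_comult2[OF V x] fock_comult2[OF W lin_closed[OF L x]] same_alg_tensor[OF sW sW]
      by (rule delta2_natural[OF V W f x])
    show "counit2 (fock K P W) (fock_lin W f x) = counit2 (fock K P V) x"
      unfolding fock_maps eps2_natural[OF lf comm_bialgebraD(3)[OF W] x]
      by (rule eps2_cong[OF comm_bialgebraD(3)[OF V] e x, symmetric])
    fix y assume "y \<in> carrier (fock K P V)"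
    then have y: "y \<in> carrier (FA V)" unfolding dV .
    show "fock_lin W f (x \<otimes>\<^bsub>fock K P V\<^esub> y) = fock_lin W f x \<otimes>\<^bsub>fock K P W\<^esub> fock_lin W f y"
      unfolding dV dW by (rule fock_lin_mult[OF lf x y])
  qed
qed

end

theorem corollary3p8:
  fixes K :: "'k ring"
    and P :: "('k, 'p) double_twisted"
  assumes "field K"
    and "twisted_bialgebra K P"
    and "contraction_coproduct K P"
    and "contraction_compatible K P"
  shows
    "(\<forall>V :: ('k, 'v) bialgebra. comm_nonunital_bialgebra K V \<longrightarrow>
        is_double_bialgebra K (fock K P V) \<and>
        (\<forall>(vs, p)\<in>fock_gens P V.
           (\<forall>(ws, q)\<in>fock_gens P V.
              fock_cls K P V vs p \<otimes>\<^bsub>fock K P V\<^esub> fock_cls K P V ws q = fock_mult_gen K P V vs p ws q) \<and>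
           comult (fock K P V) (fock_cls K P V vs p) = fock_comult_gen K P V vs p \<and>
           counit (fock K P V) (fock_cls K P V vs p) = fock_counit_gen K P vs p \<and>
           (\<forall>\<sigma>. block_numbering \<sigma> \<longrightarrow>
              comult2 (fock K P V) (fock_cls K P V vs p) = fock_comult2_gen K P V \<sigma> vs p) \<and>
           counit2 (fock K P V) (fock_cls K P V vs p) = fock_counit2_gen K P V vs p)) \<and>
     (\<forall>(V :: ('k, 'v) bialgebra) (W :: ('k, 'w) bialgebra) f.
        comm_nonunital_bialgebra K V \<and> comm_nonunital_bialgebra K W \<and>
        nonunital_bialgebra_hom K V W f \<longrightarrow>
        double_bialgebra_hom K (fock K P V) (fock K P W) (fock_map K P W f) \<and>
        (\<forall>(vs, p)\<in>fock_gens P V.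
           fock_map K P W f (fock_cls K P V vs p) = fock_cls K P W (map f vs) p)) \<and>
     (\<forall>V :: ('k, 'v) bialgebra. comm_nonunital_bialgebra K V \<longrightarrow>
        (\<forall>x\<in>carrier (fock K P V). fock_map K P V id x = x)) \<and>
     (\<forall>(U :: ('k, 'u) bialgebra) (V :: ('k, 'v) bialgebra) (W :: ('k, 'w) bialgebra) f g.
        comm_nonunital_bialgebra K U \<and> comm_nonunital_bialgebra K V \<and>
        comm_nonunital_bialgebra K W \<and>
        nonunital_bialgebra_hom K U V f \<and> nonunital_bialgebra_hom K V W g \<longrightarrow>
        (\<forall>x\<in>carrier (fock K P U).
           fock_map K P W (g \<circ> f) x = fock_map K P W g (fock_map K P V f x)))"
proof -
  interpret contraction_over K P
    using assms by (intro contraction_over.intro fieldE(1))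
  show ?thesis
  proof (intro conjI allI impI, goal_cases)
    case (1 V)
    then show ?case by (rule fock_double_bialgebra)
  next
    case (2 V)
    show ?case using fock_gens_formulas[OF 2] by blast
  next
    case (3 V W f)
    then show ?case using fock_map_hom by blast
  next
    case (4 V W f)
    then show ?case using bialgebra_hom_lin fock_lin_gens unfolding fock_map_eq by blast
  next
    case (5 V)
    have "fock_lin V id x = x" if "x \<in> carrier (FA V)" for x
      by (rule fock_lin_id[OF module_comm_alg[OF comm_bialgebraD(1)[OF 5]] that]) simp
    then show ?case unfolding fock_map_eq same_algD[OF fock_same] by blast
  next
    case (6 U V W f g)
    then have "lin K U V f" "lin K V W g" using bialgebra_hom_lin by blast+
    from fock_lin_comp[OF this] show ?case
      unfolding fock_map_eq comp_def same_algD[OF fock_same] by simp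
  qed
qed

end
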